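(* Let $0<\rho<1$ and suppose $n/N\to\rho$ as $n,m\to\infty$, where $N=n+m$. Let $(k^{(p)})_{p\ge1}$ be a sequence of kernels ($k=k^{(p)}$ on $\mathbb{R}^p$) with $\mathbb{E}[k^4(Z_1,Z_2)]<\infty$ for each $p$. Under the null hypothesis $X=^dY$, for any $n,m,p$ and any $0<\tau\le1$, $$\sup_{x\in\mathbb{R}}\big|\mathbb{P}(T_{n,m,p}^k\le x)-\Phi(x)\big|\le C(\rho,\tau)\left\{\frac{\mathbb{E}\big[|\tilde k(Z_1,Z_2)|^{2+2\tau}\big]}{N^\tau(\mathcal{V}_k^2(Z))^{1+\tau}}+\frac{\big(\mathbb{E}[g^k(Z_1,Z_2,Z_3,Z_4)]\big)^{\frac{1+\tau}{2}}}{(\mathcal{V}_k^2(Z))^{1+\tau}}\right\}^{\frac{1}{3+2\tau}},$$ where $C(\rho,\tau)$ is a positive finite constant depending only on $\rho$ and $\tau$, and $\Phi$ is the standard normal distribution function.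
   Context: Kernel: a kernel on $\mathbb{R}^p$ is a symmetric function $k:\mathbb{R}^p\times\mathbb{R}^p\to\mathbb{R}$ satisfying either (a) $k\ge0$, $k(x,y)=0$ iff $x=y$, and for all Borel probability measures $P\ne Q$ with $\int k(z,z_0)\,dP(z)<\infty$ and $\int k(z,z_0)\,dQ(z)<\infty$ for some $z_0$, one has $\int k\,d([P-Q]\times[P-Q])<0$; or (b) $-k$ is the reproducing kernel of an RKHS on $\mathbb{R}^p$ and is characteristic (the mean embedding map on Borel probability measures is injective). It is assumed that $k(x,x)=a_0^k$ is a finite constant not depending on $x$. Sampling: for each $p$, $X,Y$ are random vectors in $\mathbb{R}^p$; $X_1,\dots,X_n$ are i.i.d. copies of $X$, $Y_1,\dots,Y_m$ are i.i.d. copies of $Y$, the two samples are independent. $Z$ is the mixture equal to $X$ with probability $\rho$ and to $Y$ with probability $1-\rho$; $Z_1,Z_2,\dots$ are i.i.d. copies of $Z$. Notation: $\tilde k(Z_1,Z_2)=k(Z_1,Z_2)-\mathbb{E}[k(Z_1,Z_2)]$; $\mathcal{V}_k^2(Z)=\mathbb{E}[k^2(Z_1,Z_2)]-2\mathbb{E}[k(Z_1,Z_2)k(Z_1,Z_3)]+(\mathbb{E}[k(Z_1,Z_2)])^2$; $d^k(z_1,z_2)=k(z_1,z_2)-\mathbb{E}[k(Z,z_2)]-\mathbb{E}[k(z_1,Z)]+\mathbb{E}[k(Z_1,Z_2)]$; $g^k(z_1,z_2,z_3,z_4)=d^k(z_1,z_2)d^k(z_1,z_3)d^k(z_2,z_4)d^k(z_3,z_4)$.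 Test statistic: $\mathcal{E}_{n,m}^k(X,Y)=\frac{2}{nm}\sum_{i=1}^n\sum_{j=1}^m k(X_i,Y_j)-\binom n2^{-1}\sum_{1\le i<j\le n}k(X_i,X_j)-\binom m2^{-1}\sum_{1\le i<j\le m}k(Y_i,Y_j)$; $c_{n,m}=\frac{2}{n(n-1)}+\frac{4}{nm}+\frac{2}{m(m-1)}$. Let $W_1,\dots,W_N$ be the pooled sample ($W_s=X_s$ for $s\le n$, $W_s=Y_{s-n}$ for $s>n$), $a_{s,t}=k(W_s,W_t)$ for $1\le s,t\le N$, $\tilde a_{\cdot t}=\frac{1}{N-2}\sum_{i=1}^N a_{i,t}$, $\tilde a_{s\cdot}=\frac1{N-2}\sum_{j=1}^Na_{s,j}$, $\tilde a_{\cdot\cdot}=\frac{1}{(N-1)(N-2)}\sum_{i,j=1}^Na_{i,j}$, $A^*_{s,t}=a_{s,t}-\tilde a_{\cdot t}-\tilde a_{s\cdot}+\tilde a_{\cdot\cdot}$, and $\mathcal{V}_{n,m}^{k*}(X,Y)=\frac{1}{N(N-3)}\sum_{s\ne t}(A^*_{s,t})^2-\frac{(a_0^k)^2}{(N-1)(N-3)}$. Finally $T_{n,m,p}^k=\mathcal{E}_{n,m}^k(X,Y)\big/\sqrt{c_{n,m}\mathcal{V}_{n,m}^{k*}(X,Y)}$.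
   Formalization: For given sequences n, m with n/N→ρ, the constant C(ρ,τ) serves all sufficiently late terms; the finitely many earlier ones get a constant that may also depend on the sequences, since no C(ρ,τ) works for literally all n, m. Also n,m≥2 and V_k²(Z)≠0 are assumed. *)

theory Defs
  imports "HOL-Probability.Probability"
begin

section \<open>Borel probability measures on the coordinate spaces\<close>

text \<open>
  The dimension \<open>p\<close> has to be a number, since one constant must serve all
  dimensions. Points of \<open>p\<close>-dimensional space are therefore the elements of
  \<open>{..<p} \<rightarrow>\<^sub>E UNIV\<close>, which is the space of the product measure below; its sigma algebra is
  the Borel sigma algebra.
\<close>

definition euclid :: "nat \<Rightarrow> (nat \<Rightarrow> real) measure" where
  "euclid p = (\<Pi>\<^sub>M i\<in>{..<p}. borel)"

definition borel_prob :: "nat \<Rightarrow> (nat \<Rightarrow> real) measure \<Rightarrow> bool" where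
  "borel_prob p P \<longleftrightarrow> prob_space P \<and> sets P = sets (euclid p)"

type_synonym kern = "(nat \<Rightarrow> real) \<Rightarrow> (nat \<Rightarrow> real) \<Rightarrow> real"

section \<open>Reproducing kernel Hilbert spaces\<close>

text \<open>
  A real Hilbert space of functions on \<open>S\<close>, given by its set \<open>H\<close> of elements and its inner product
  \<open>ip\<close>. Functions on \<open>S\<close> are represented by their extensions by zero outside \<open>S\<close>.
\<close>

definition hilbert_function_space ::
  "'x set \<Rightarrow> ('x \<Rightarrow> real) set \<Rightarrow> (('x \<Rightarrow> real) \<Rightarrow> ('x \<Rightarrow> real) \<Rightarrow> real) \<Rightarrow> bool" where
  "hilbert_function_space S H ip \<longleftrightarrow>
     (\<forall>f\<in>H. \<forall>x. x \<notin> S \<longrightarrow> f x = 0) \<and>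
     (\<lambda>x. 0) \<in> H \<and>
     (\<forall>f\<in>H. \<forall>g\<in>H. (\<lambda>x. f x + g x) \<in> H) \<and>
     (\<forall>c. \<forall>f\<in>H. (\<lambda>x. c * f x) \<in> H) \<and>
     (\<forall>f\<in>H. \<forall>g\<in>H. ip f g = ip g f) \<and>
     (\<forall>f\<in>H. \<forall>g\<in>H. \<forall>h\<in>H. ip (\<lambda>x. f x + g x) h = ip f h + ip g h) \<and>
     (\<forall>c. \<forall>f\<in>H. \<forall>g\<in>H. ip (\<lambda>x. c * f x) g = c * ip f g) \<and>
     (\<forall>f\<in>H. 0 \<le> ip f f) \<and>
     (\<forall>f\<in>H. ip f f = 0 \<longrightarrow> f = (\<lambda>x. 0)) \<and>
     (\<forall>F :: nat \<Rightarrow> 'x \<Rightarrow> real.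
        (\<forall>i. F i \<in> H) \<and>
        (\<forall>e>0. \<exists>M. \<forall>i\<ge>M. \<forall>j\<ge>M. sqrt (ip (\<lambda>x. F i x - F j x) (\<lambda>x. F i x - F j x)) < e) \<longrightarrow>
        (\<exists>f\<in>H. (\<lambda>i. sqrt (ip (\<lambda>x. F i x - f x) (\<lambda>x. F i x - f x))) \<longlonglongrightarrow> 0))"

definition kernel_section :: "'x set \<Rightarrow> ('x \<Rightarrow> 'x \<Rightarrow> real) \<Rightarrow> 'x \<Rightarrow> 'x \<Rightarrow> real" where
  "kernel_section S K x = (\<lambda>y. if y \<in> S then K y x else 0)"

definition reproducing_kernel :: "'x set \<Rightarrow> ('x \<Rightarrow> 'x \<Rightarrow> real) \<Rightarrow> bool" where
  "reproducing_kernel S K \<longleftrightarrow>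
     (\<exists>H ip. hilbert_function_space S H ip \<and>
        (\<forall>x\<in>S. kernel_section S K x \<in> H \<and> (\<forall>f\<in>H. f x = ip f (kernel_section S K x))))"

text \<open>
  The mean embedding as a function on \<open>p\<close>-dimensional space, again extended by zero. It is used only
  for kernels that are constant on the diagonal; a reproducing kernel of this kind is bounded, so all
  the integrals exist.
\<close>

definition mean_embedding :: "nat \<Rightarrow> kern \<Rightarrow> (nat \<Rightarrow> real) measure \<Rightarrow> (nat \<Rightarrow> real) \<Rightarrow> real" where
  "mean_embedding p K P = (\<lambda>y. if y \<in> space (euclid p) then (\<integral>x. K y x \<partial>P) else 0)"

definition characteristic :: "nat \<Rightarrow> kern \<Rightarrow> bool" where
  "characteristic p K \<longleftrightarrow> inj_on (mean_embedding p K) {P. borel_prob p P}"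

section \<open>Kernels\<close>

text \<open>
  The integral of \<open>k\<close> with respect to the product of the signed measure \<open>P - Q\<close> with itself.
\<close>

definition diff_integral :: "kern \<Rightarrow> (nat \<Rightarrow> real) measure \<Rightarrow> (nat \<Rightarrow> real) measure \<Rightarrow> real" where
  "diff_integral k P Q =
     (\<integral>(x, y). k x y \<partial>(P \<Otimes>\<^sub>M P)) - (\<integral>(x, y). k x y \<partial>(P \<Otimes>\<^sub>M Q))
     - (\<integral>(x, y). k x y \<partial>(Q \<Otimes>\<^sub>M P)) + (\<integral>(x, y). k x y \<partial>(Q \<Otimes>\<^sub>M Q))"

definition strong_negative_type :: "nat \<Rightarrow> kern \<Rightarrow> bool" where
  "strong_negative_type p k \<longleftrightarrow>
     (\<forall>x\<in>space (euclid p). \<forall>y\<in>space (euclid p). 0 \<le> k x y \<and> (k x y = 0 \<longleftrightarrow> x = y)) \<and>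
     (\<forall>P Q. borel_prob p P \<and> borel_prob p Q \<and> P \<noteq> Q \<and>
        (\<exists>z0\<in>space (euclid p). integrable P (\<lambda>z. k z z0) \<and> integrable Q (\<lambda>z. k z z0)) \<longrightarrow>
        diff_integral k P Q < 0)"

definition mmd_kernel :: "nat \<Rightarrow> kern \<Rightarrow> bool" where
  "mmd_kernel p k \<longleftrightarrow>
     (\<lambda>(x, y). k x y) \<in> borel_measurable (euclid p \<Otimes>\<^sub>M euclid p) \<and>
     (\<forall>x\<in>space (euclid p). \<forall>y\<in>space (euclid p). k x y = k y x) \<and>
     (strong_negative_type p k \<or>
      reproducing_kernel (space (euclid p)) (\<lambda>x y. - k x y) \<and> characteristic p (\<lambda>x y. - k x y))"

section \<open>Population quantities\<close>

definition mixture ::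
  "real \<Rightarrow> (nat \<Rightarrow> real) measure \<Rightarrow> (nat \<Rightarrow> real) measure \<Rightarrow> (nat \<Rightarrow> real) measure" where
  "mixture \<rho> P Q = measure_pmf (bernoulli_pmf \<rho>) \<bind> (\<lambda>b. if b then P else Q)"

text \<open>
  Below \<open>Z\<close> is a distribution; independent copies of a random vector with this distribution are the
  coordinates of a product of copies of \<open>Z\<close>.
\<close>

definition Ek :: "kern \<Rightarrow> (nat \<Rightarrow> real) measure \<Rightarrow> real" where
  "Ek k Z = (\<integral>(z1, z2). k z1 z2 \<partial>(Z \<Otimes>\<^sub>M Z))"

definition k_tilde :: "kern \<Rightarrow> (nat \<Rightarrow> real) measure \<Rightarrow> kern" where
  "k_tilde k Z z1 z2 = k z1 z2 - Ek k Z"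

definition V2 :: "kern \<Rightarrow> (nat \<Rightarrow> real) measure \<Rightarrow> real" where
  "V2 k Z =
     (\<integral>(z1, z2). (k z1 z2)\<^sup>2 \<partial>(Z \<Otimes>\<^sub>M Z))
     - 2 * (\<integral>(z1, z2, z3). k z1 z2 * k z1 z3 \<partial>(Z \<Otimes>\<^sub>M Z \<Otimes>\<^sub>M Z))
     + (Ek k Z)\<^sup>2"

definition dk :: "kern \<Rightarrow> (nat \<Rightarrow> real) measure \<Rightarrow> kern" where
  "dk k Z z1 z2 = k z1 z2 - (\<integral>z. k z z2 \<partial>Z) - (\<integral>z. k z1 z \<partial>Z) + Ek k Z"

definition gk :: "kern \<Rightarrow> (nat \<Rightarrow> real) measure \<Rightarrow>
    (nat \<Rightarrow> real) \<Rightarrow> (nat \<Rightarrow> real) \<Rightarrow> (nat \<Rightarrow> real) \<Rightarrow> (nat \<Rightarrow> real) \<Rightarrow> real" where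
  "gk k Z z1 z2 z3 z4 = dk k Z z1 z2 * dk k Z z1 z3 * dk k Z z2 z4 * dk k Z z3 z4"

definition Eg :: "kern \<Rightarrow> (nat \<Rightarrow> real) measure \<Rightarrow> real" where
  "Eg k Z = (\<integral>(z1, z2, z3, z4). gk k Z z1 z2 z3 z4 \<partial>(Z \<Otimes>\<^sub>M Z \<Otimes>\<^sub>M Z \<Otimes>\<^sub>M Z))"

definition Ektilde_powr :: "kern \<Rightarrow> (nat \<Rightarrow> real) measure \<Rightarrow> real \<Rightarrow> real" where
  "Ektilde_powr k Z r = (\<integral>(z1, z2). \<bar>k_tilde k Z z1 z2\<bar> powr r \<partial>(Z \<Otimes>\<^sub>M Z))"

section \<open>The test statistic\<close>

text \<open>Samples are indexed from 1.\<close>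

definition E_stat :: "nat \<Rightarrow> nat \<Rightarrow> kern \<Rightarrow> (nat \<Rightarrow> nat \<Rightarrow> real) \<Rightarrow> (nat \<Rightarrow> nat \<Rightarrow> real) \<Rightarrow> real" where
  "E_stat n m k X Y =
     2 / (real n * real m) * (\<Sum>i=1..n. \<Sum>j=1..m. k (X i) (Y j))
     - 1 / real (n choose 2) * (\<Sum>j=1..n. \<Sum>i=1..<j. k (X i) (X j))
     - 1 / real (m choose 2) * (\<Sum>j=1..m. \<Sum>i=1..<j. k (Y i) (Y j))"

definition c_coef :: "nat \<Rightarrow> nat \<Rightarrow> real" where
  "c_coef n m = 2 / (real n * (real n - 1)) + 4 / (real n * real m) + 2 / (real m * (real m - 1))"

definition pooled :: "nat \<Rightarrow> (nat \<Rightarrow> 'x) \<Rightarrow> (nat \<Rightarrow> 'x) \<Rightarrow> nat \<Rightarrow> 'x" where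
  "pooled n X Y s = (if s \<le> n then X s else Y (s - n))"

definition A_star :: "nat \<Rightarrow> (nat \<Rightarrow> nat \<Rightarrow> real) \<Rightarrow> nat \<Rightarrow> nat \<Rightarrow> real" where
  "A_star N a s t =
     a s t - (\<Sum>i=1..N. a i t) / (real N - 2) - (\<Sum>j=1..N. a s j) / (real N - 2)
     + (\<Sum>i=1..N. \<Sum>j=1..N. a i j) / ((real N - 1) * (real N - 2))"

text \<open>
  The argument \<open>a0\<close> is the value of the kernel on the diagonal. With that value \<open>V_star\<close> is never
  negative, so the square root in \<open>T_stat\<close> is a genuine one; where \<open>V_star\<close> vanishes, \<open>T_stat\<close>
  is zero by the convention for division.
\<close>

definition V_star ::
  "nat \<Rightarrow> nat \<Rightarrow> kern \<Rightarrow> real \<Rightarrow> (nat \<Rightarrow> nat \<Rightarrow> real) \<Rightarrow> (nat \<Rightarrow> nat \<Rightarrow> real) \<Rightarrow> real" where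
  "V_star n m k a0 X Y =
     (let N = n + m; W = pooled n X Y; a = (\<lambda>s t. k (W s) (W t))
      in 1 / (real N * (real N - 3)) * (\<Sum>s=1..N. \<Sum>t\<in>{1..N} - {s}. (A_star N a s t)\<^sup>2)
         - a0\<^sup>2 / ((real N - 1) * (real N - 3)))"

definition T_stat ::
  "nat \<Rightarrow> nat \<Rightarrow> kern \<Rightarrow> real \<Rightarrow> (nat \<Rightarrow> nat \<Rightarrow> real) \<Rightarrow> (nat \<Rightarrow> nat \<Rightarrow> real) \<Rightarrow> real" where
  "T_stat n m k a0 X Y = E_stat n m k X Y / sqrt (c_coef n m * V_star n m k a0 X Y)"

text \<open>
  The joint law of \<open>n\<close> independent vectors with law \<open>P\<close> and, independently of them, \<open>m\<close>
  independent vectors with law \<open>Q\<close>.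
\<close>

definition sample_law :: "nat \<Rightarrow> nat \<Rightarrow> (nat \<Rightarrow> real) measure \<Rightarrow> (nat \<Rightarrow> real) measure \<Rightarrow>
    ((nat \<Rightarrow> nat \<Rightarrow> real) \<times> (nat \<Rightarrow> nat \<Rightarrow> real)) measure" where
  "sample_law n m P Q = (\<Pi>\<^sub>M i\<in>{1..n}. P) \<Otimes>\<^sub>M (\<Pi>\<^sub>M j\<in>{1..m}. Q)"

end

theory Submission
  imports Defs
begin

text \<open>
  Under the null hypothesis the pooled observations are i.i.d., and after division by \<open>sqrt c\<close> the
  numerator is a quadratic form with weights of order \<open>1 / N\<close>, whose row sums vanish. The variance estimator
  is the squared norm of the centered kernel matrix. Both are unchanged when \<open>k\<close> is replaced by its
  degenerate projection \<open>dk\<close>, whose second moment is \<open>V2\<close>.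

  With \<open>B\<close> the bracket of the theorem and \<open>\<delta> = B powr (1 / (3 + 2 * \<tau>))\<close>, truncate the normalized
  kernel at \<open>\<delta> * sqrt N\<close>. For the bounded degenerate quadratic form \<open>S = (\<Sum>i. L i) / 2\<close> that remains,
  \<open>S - L i\<close> does not involve the \<open>i\<close>-th observation, so \<open>L i\<close> has mean zero against
  \<open>iexp (t * (S - L i))\<close>. Expanding around \<open>S\<close> gives an approximate differential equation for the
  characteristic function of \<open>S\<close>, with errors governed by the variance of \<open>(\<Sum>i. (L i)\<^sup>2) / 2\<close> and by
  third moments; Gaussian smoothing at scale \<open>\<delta>\<close> and Levy inversion turn this into a Kolmogorov bound.
  The truncation error and the variance estimator are controlled in \<open>L\<^sup>2\<close>.
\<close>

text \<open>The exponent \<open>1 / (3 + 2 * \<tau>)\<close> makes the error sources meet. If the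
  bracket is \<open>\<delta> powr (3 + 2 * \<tau>)\<close>, the normalized kernel has absolute
  moment of order \<open>2 + 2 * \<tau>\<close> at most
  \<open>N powr \<tau> * \<delta> powr (3 + 2 * \<tau>)\<close>. The cut then leaves squared norm at
  most \<open>\<delta> powr 3\<close> in the tail and fourth moment at most
  \<open>N * \<delta> powr 5\<close> in the bulk, with \<open>\<tau>\<close> gone. Chebyshev at
  level \<open>\<delta>\<close> turns the tail into probability of order \<open>\<delta>\<close>.
  Truncation also moves the second moment of the kernel by order
  \<open>\<delta> powr (3 / 2)\<close>, so the differential equation holds only up to that order,
  and smoothing loses a factor \<open>\<delta> powr (- 1 / 2)\<close>. For this reason the estimates
  are written in \<open>\<epsilon> = sqrt \<delta>\<close>. The obstacle is that truncation destroys
  degeneracy. The clipped kernel and the tail have to be projected again, and the two projections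
  add up to the original one only almost everywhere, since conditional means exist only almost
  everywhere. The ratio of the sample sizes enters only through the bound
  \<open>\<kappa> / N\<close> on the weights.\<close>

section \<open>Characteristic functions close to the Gaussian one\<close>

lemma norm_integral_le:
  fixes f :: "'a \<Rightarrow> 'b::{banach,second_countable_topology}"
  assumes "integrable M f" "integrable M g" "\<And>x. x \<in> space M \<Longrightarrow> norm (f x) \<le> g x"
  shows "norm (\<integral>x. f x \<partial>M) \<le> (\<integral>x. g x \<partial>M)"
  by (rule order_trans[OF integral_norm_bound integral_mono]) (use assms in auto)

text \<open>The second-order bound for \<open>iexp\<close> makes the pointwise remainder at most
  \<open>(u - t)\<^sup>2 * (S x)\<^sup>2 / 2\<close>, so after integration it is quadratic in
  \<open>u - t\<close>, with half the second moment as constant.\<close>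

lemma (in prob_space) char_has_vector_derivative:
  fixes S :: "'a \<Rightarrow> real"
  assumes S[measurable]: "random_variable borel S" and S2: "integrable M (\<lambda>x. (S x)\<^sup>2)"
  shows "((\<lambda>t. char (distr M borel S) t) has_vector_derivative
      \<i> * (\<integral>x. S x * iexp (t * S x) \<partial>M)) (at t)"
proof -
  have S1: "integrable M S"
    using square_integrable_imp_integrable[OF S S2] .
  have char_eq: "char (distr M borel S) u = (\<integral>x. iexp (u * S x) \<partial>M)" for u
    unfolding char_def by (subst integral_distr) auto
  have i1: "integrable M (\<lambda>x. iexp (u * S x))" for u
    by (rule integrable_const_bound[where B=1]) auto
  have i2: "integrable M (\<lambda>x. S x * iexp (u * S x))" for u
    by (rule Bochner_Integration.integrable_bound[OF S1]) (auto simp: norm_mult)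
  define K where "K = (\<integral>x. (S x)\<^sup>2 \<partial>M)"
  have bound: "cmod (char (distr M borel S) u - char (distr M borel S) t
      - (u - t) *\<^sub>R (\<i> * (\<integral>x. S x * iexp (t * S x) \<partial>M))) \<le> (u - t)\<^sup>2 * (K / 2)" for u
  proof -
    have eq: "char (distr M borel S) u - char (distr M borel S) t
        - (u - t) *\<^sub>R (\<i> * (\<integral>x. S x * iexp (t * S x) \<partial>M))
        = (\<integral>x. iexp (u * S x) - iexp (t * S x) - (u - t) *\<^sub>R (\<i> * (S x * iexp (t * S x))) \<partial>M)"
      unfolding char_eq using i1 i2 by (simp del: scaleR_conv_of_real)
    have "cmod (\<integral>x. iexp (u * S x) - iexp (t * S x) - (u - t) *\<^sub>R (\<i> * (S x * iexp (t * S x))) \<partial>M)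
      \<le> (\<integral>x. (u - t)\<^sup>2 * ((S x)\<^sup>2 / 2) \<partial>M)"
    proof (rule norm_integral_le)
      fix x
      \<comment> \<open>Factoring out the unimodular \<open>iexp (t * S x)\<close> leaves the Taylor
        remainder of order one at \<open>(u - t) * S x\<close>.\<close>
      have "iexp (u * S x) - iexp (t * S x) - (u - t) *\<^sub>R (\<i> * (S x * iexp (t * S x)))
        = iexp (t * S x) * (iexp ((u - t) * S x) - (\<Sum>k\<le>1. (\<i> * ((u - t) * S x))^k / fact k))"
        by (simp add: algebra_simps exp_add[symmetric] scaleR_conv_of_real) 
      then have "cmod (iexp (u * S x) - iexp (t * S x) - (u - t) *\<^sub>R (\<i> * (S x * iexp (t * S x))))
        = cmod (iexp ((u - t) * S x) - (\<Sum>k\<le>1. (\<i> * ((u - t) * S x))^k / fact k))"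
        by (simp add: norm_mult)
      also have "\<dots> \<le> \<bar>(u - t) * S x\<bar>^(Suc 1) / fact (Suc 1)"
        by (rule iexp_approx1)
      also have "\<dots> = (u - t)\<^sup>2 * ((S x)\<^sup>2 / 2)"
        by (simp add: abs_mult power2_eq_square[symmetric] power_mult_distrib)
      finally show "cmod (iexp (u * S x) - iexp (t * S x) - (u - t) *\<^sub>R (\<i> * (S x * iexp (t * S x))))
          \<le> (u - t)\<^sup>2 * ((S x)\<^sup>2 / 2)" .
    qed (use i1 i2 S2 in auto)
    also have "\<dots> = (u - t)\<^sup>2 * (K / 2)" unfolding K_def by simp
    finally show ?thesis using eq by simp
  qed
  have K: "0 \<le> K" unfolding K_def by simp
  show ?thesis
    unfolding has_vector_derivative_def has_derivative_within_alt2
  proof (intro conjI allI impI)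
    fix e :: real assume "0 < e"
    have "eventually (\<lambda>u. dist u t < e / (K + 1)) (at t)"
      using \<open>0 < e\<close> K by (auto simp: eventually_at intro!: exI[of _ "e / (K + 1)"])
    then show "\<forall>\<^sub>F y in at t. norm (char (distr M borel S) y - char (distr M borel S) t
        - (y - t) *\<^sub>R (\<i> * (CLINT x|M. (complex_of_real (S x)) * iexp (t * S x)))) \<le> e * norm (y - t)"
    proof eventually_elim
      case (elim u)
      have "\<bar>u - t\<bar> * (K + 1) \<le> e"
        using elim K by (simp add: dist_real_def field_simps)
      moreover have "\<bar>u - t\<bar> * (K / 2) \<le> \<bar>u - t\<bar> * (K + 1)"
        using K by (intro mult_left_mono) auto
      ultimately have "\<bar>u - t\<bar> * (K / 2) * \<bar>u - t\<bar> \<le> e * \<bar>u - t\<bar>"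
        by (intro mult_right_mono) auto
      moreover have "(u - t)\<^sup>2 * (K / 2) = \<bar>u - t\<bar> * (K / 2) * \<bar>u - t\<bar>"
        by (simp add: power2_eq_square)
      ultimately have "(u - t)\<^sup>2 * (K / 2) \<le> e * norm (u - t)"
        unfolding real_norm_def by linarith
      with bound[of u] show ?case by (rule order_trans)
    qed
  qed (rule bounded_linear_scaleR_left)
qed

text \<open>The derivative of the characteristic function is \<open>\<i>\<close> times the first
  integral in \<open>stein\<close>, so \<open>stein\<close> is the Gaussian equation c' = - t c up
  to an error. The integrating factor \<open>exp (t\<^sup>2 / 2)\<close> turns it into a derivative
  bound, which is integrated from 0. The factor \<open>1 - exp (- t\<^sup>2 / 2)\<close> is kept
  because it vanishes at 0, where inversion divides by \<open>t\<close>.\<close>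

lemma (in prob_space) char_near_gaussian:
  fixes S :: "'a \<Rightarrow> real"
  assumes S[measurable]: "random_variable borel S" and S2: "integrable M (\<lambda>x. (S x)\<^sup>2)"
    and a: "0 \<le> a" and b: "0 \<le> b"
    and stein: "\<And>t. cmod ((\<integral>x. S x * iexp (t * S x) \<partial>M) - \<i> * t * (\<integral>x. iexp (t * S x) \<partial>M))
        \<le> \<bar>t\<bar> * a + t\<^sup>2 * b"
  shows "cmod (char (distr M borel S) t - of_real (exp (- t\<^sup>2 / 2))) \<le> (a + \<bar>t\<bar> * b) * (1 - exp (- t\<^sup>2 / 2))"
proof -
  let ?c = "char (distr M borel S)"
  have char_eq: "?c u = (\<integral>x. iexp (u * S x) \<partial>M)" for u
    unfolding char_def by (subst integral_distr) auto
  define D where "D u = (\<integral>x. S x * iexp (u * S x) \<partial>M)" for u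
  define g where "g u = exp (u\<^sup>2 / 2) *\<^sub>R ?c u" for u
  define g' where "g' u = exp (u\<^sup>2 / 2) *\<^sub>R (\<i> * (D u - \<i> * u * ?c u))" for u
  have g: "(g has_vector_derivative g' u) (at u)" for u
  proof -
    have 1: "((\<lambda>u::real. exp (u\<^sup>2 / 2)) has_real_derivative (u * exp (u\<^sup>2/2))) (at u)"
      by (auto intro!: derivative_eq_intros)
    show ?thesis
      unfolding g_def
      by (rule has_vector_derivative_eq_rhs[OF has_vector_derivative_scaleR[OF 1
            char_has_vector_derivative[OF S S2]]])
        (simp add: g'_def D_def scaleR_conv_of_real algebra_simps)
  qed
  \<comment> \<open>The mean value inequality runs to the right from 0; negative \<open>t\<close> is
    handled by reflection.\<close>
  have gn: "((\<lambda>s. g (- s)) has_vector_derivative - g' (- s)) (at s)" for s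
  proof -
    have "(uminus has_vector_derivative (-1::real)) (at s)" by (auto intro!: derivative_eq_intros)
    from vector_diff_chain_at[OF this g[of "- s"]] show ?thesis by (simp add: o_def)
  qed
  have g'b: "cmod (g' u) \<le> exp (u\<^sup>2/2) * (\<bar>u\<bar> * a + u\<^sup>2 * b)" for u
    using stein[of u] unfolding g'_def D_def char_eq by (simp add: norm_mult)
  \<comment> \<open>The coefficient is frozen at the endpoint \<open>T\<close>, so that the majorant
    has an elementary primitive.\<close>
  have phi': "((\<lambda>s. (a + T * b) * exp (s\<^sup>2/2)) has_vector_derivative (a + T * b) * (s * exp (s\<^sup>2/2))) (at s)"
    for T s :: real
    unfolding has_real_derivative_iff_has_vector_derivative[symmetric]
    by (auto intro!: derivative_eq_intros)
  have bd: "exp (s\<^sup>2/2) * (\<bar>s\<bar> * a + s\<^sup>2 * b) \<le> (a + T * b) * (s * exp (s\<^sup>2/2))"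
    if "0 < s" "s < T" for s T :: real
  proof -
    have "s * s * b \<le> s * T * b" using that b by (intro mult_right_mono mult_left_mono) auto
    then have "s * a + s * s * b \<le> (a + T * b) * s" by (simp add: algebra_simps)
    then have "exp (s\<^sup>2/2) * (s * a + s * s * b) \<le> exp (s\<^sup>2/2) * ((a + T * b) * s)"
      by (intro mult_left_mono) auto
    then show ?thesis using that by (simp add: power2_eq_square mult_ac)
  qed
  have g0: "g 0 = 1" unfolding g_def char_eq by (simp add: prob_space)
  have cont: "continuous_on A g" "continuous_on A (\<lambda>s. g (- s))" for A
    using g gn by (auto intro!: continuous_at_imp_continuous_on intro: has_vector_derivative_continuous)
  have main: "cmod (g t - 1) \<le> (a + \<bar>t\<bar> * b) * (exp (t\<^sup>2/2) - 1)"
  proof -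
    consider "t = 0" | "t > 0" | "t < 0" by linarith
    then show ?thesis
    proof cases
      case 1 then show ?thesis by (simp add: g0)
    next
      case 2
      have "norm (g t - g 0) \<le> (a + t * b) * exp (t\<^sup>2/2) - (a + t * b) * exp (0\<^sup>2/2)"
      proof (rule differentiable_bound_general[OF 2 cont(1)])
        show "continuous_on {0..t} (\<lambda>s. (a + t * b) * exp (s\<^sup>2 / 2))"
          by (intro continuous_intros) auto
        show "norm (g' x) \<le> (a + t * b) * (x * exp (x\<^sup>2/2))" if "0 < x" "x < t" for x
          using g'b[of x] bd[OF that] by (rule order_trans)
      qed (use g phi' in auto)
      then show ?thesis using 2 g0 by (simp add: algebra_simps)
    next
      case 3
      then have 30: "0 < - t" by simp
      have "norm (g (- (- t)) - g (- 0)) \<le> (a + (- t) * b) * exp ((- t)\<^sup>2/2) - (a + (- t) * b) * exp (0\<^sup>2/2)"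
      proof (rule differentiable_bound_general[OF 30 cont(2)])
        show "continuous_on {0..-t} (\<lambda>s. (a + (- t) * b) * exp (s\<^sup>2 / 2))"
          by (intro continuous_intros) auto
        show "((\<lambda>s. (a + (- t) * b) * exp (s\<^sup>2/2)) has_vector_derivative
            (a + (- t) * b) * (x * exp (x\<^sup>2/2))) (at x)" for x by (rule phi')
        show "norm (- g' (- x)) \<le> (a + (- t) * b) * (x * exp (x\<^sup>2/2))" if "0 < x" "x < - t" for x
          using order_trans[OF g'b[of "- x"], of "(a + (- t) * b) * (x * exp (x\<^sup>2/2))"] bd[OF that]
          by (metis abs_minus_cancel norm_minus_cancel power2_minus)
      qed (use gn phi' in auto)
      then show ?thesis using 3 g0 by (simp add: algebra_simps)
    qed
  qed
  have "?c t - of_real (exp (- t\<^sup>2/2)) = exp (- t\<^sup>2/2) *\<^sub>R (g t - 1)"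
    unfolding g_def by (simp add: scaleR_conv_of_real algebra_simps exp_minus flip: exp_of_real)
  then have "cmod (?c t - of_real (exp (- t\<^sup>2/2))) = exp (- t\<^sup>2/2) * cmod (g t - 1)" by simp
  also have "\<dots> \<le> exp (- t\<^sup>2/2) * ((a + \<bar>t\<bar> * b) * (exp (t\<^sup>2/2) - 1))"
    using main by (intro mult_left_mono) auto
  also have "\<dots> = (a + \<bar>t\<bar> * b) * (1 - exp (- t\<^sup>2 / 2))"
    by (simp add: algebra_simps exp_minus)
  finally show ?thesis .
qed

section \<open>Inversion of characteristic functions\<close>

text \<open>Levy inversion on \<open>{a<..b}\<close> is applied to both measures and subtracted. The
  inversion kernel times \<open>\<bar>t\<bar>\<close> is at most 2, uniformly in \<open>a\<close>;
  this turns \<open>1 / (2 * pi)\<close> into \<open>1 / pi\<close> and lets \<open>a\<close> tend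
  to minus infinity.\<close>

lemma cdf_diff_le_integral_char:
  fixes \<mu> \<nu> :: "real measure"
  assumes \<mu>: "real_distribution \<mu>" and \<nu>: "real_distribution \<nu>"
    and atoms: "\<And>x. measure \<mu> {x} = 0" "\<And>x. measure \<nu> {x} = 0"
    and g: "integrable lborel g" and bound: "\<And>t. cmod (char \<mu> t - char \<nu> t) \<le> \<bar>t\<bar> * g t"
    and g0: "\<And>t. 0 \<le> g t"
  shows "\<bar>cdf \<mu> x - cdf \<nu> x\<bar> \<le> (\<integral>t. g t \<partial>lborel) / pi"
proof -
  interpret \<mu>: real_distribution \<mu> by fact
  interpret \<nu>: real_distribution \<nu> by fact
  define F where "F a b t = (iexp (-(t * a)) - iexp (-(t * b))) / (\<i> * complex_of_real t)" for a b t :: real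
  have meas[measurable]: "F a b \<in> borel_measurable borel" for a b unfolding F_def by measurable
  have F2: "cmod (F a b t) * \<bar>t\<bar> \<le> 2" for a b t
  proof (cases "t = 0")
    case False
    have "cmod (F a b t) * \<bar>t\<bar> = cmod (iexp (-(t * a)) - iexp (-(t * b)))"
      using False by (simp add: F_def norm_divide norm_mult)
    also have "\<dots> \<le> cmod (iexp (-(t * a))) + cmod (iexp (-(t * b)))" by (rule norm_triangle_ineq4)
    finally show ?thesis unfolding norm_exp_i_times by simp
  qed simp
  have int: "complex_interval_lebesgue_integrable lborel (ereal u) (ereal v) (\<lambda>t. F a b t * char M t)"
    if "real_distribution M" "a \<le> b" for M :: "real measure" and u v a b :: real
  proof -
    interpret M: real_distribution M by fact
    \<comment> \<open>Off the null set \<open>{0}\<close> the kernel is bounded by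
      \<open>b - a\<close>. Hence each truncated integral exists and the two can be subtracted under
      one integral sign.\<close>
    have "cmod (F a b t * char M t) \<le> b - a" if "t \<noteq> 0" for t
    proof -
      have "cmod (F a b t) \<le> b - a"
        using Levy_Inversion_aux2[of "-b" "-a" t] \<open>a \<le> b\<close> that unfolding F_def by simp
      then show ?thesis using M.cmod_char_le_1[of t] 
        by (simp add: norm_mult) (metis \<open>a \<le> b\<close> diff_ge_0_iff_ge mult_mono mult.right_neutral norm_ge_zero)
    qed
    then show ?thesis
      apply (simp add: interval_lebesgue_integrable_def set_integrable_def del: times_divide_eq_left)
      apply (intro integrableI_bounded_set_indicator[where B="b - a"] conjI impI)
      apply (auto intro!: AE_I [of _ _ "{0}"] )
      done
  qed
  have ab: "\<bar>measure \<mu> {a<..b} - measure \<nu> {a<..b}\<bar> \<le> (\<integral>t. g t \<partial>lborel) / pi" if "a \<le> b" for a b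
  proof -
    let ?I = "\<lambda>M T. 1 / (2 * pi) * (CLBINT t=-real T..real T. F a b t * char M t)"
    have "(\<lambda>T::nat. ?I \<mu> T) \<longlonglongrightarrow> complex_of_real (measure \<mu> {a<..b})" 
      using \<mu>.Levy_Inversion[OF that atoms(1) atoms(1)] unfolding F_def by simp
    moreover have "(\<lambda>T::nat. ?I \<nu> T) \<longlonglongrightarrow> complex_of_real (measure \<nu> {a<..b})" 
      using \<nu>.Levy_Inversion[OF that atoms(2) atoms(2)] unfolding F_def by simp
    ultimately have lim: "(\<lambda>T::nat. cmod (?I \<mu> T - ?I \<nu> T)) \<longlonglongrightarrow>
        cmod (complex_of_real (measure \<mu> {a<..b}) - complex_of_real (measure \<nu> {a<..b}))"
      by (intro tendsto_intros)
    have "cmod (?I \<mu> T - ?I \<nu> T) \<le> (\<integral>t. g t \<partial>lborel) / pi" for T :: nat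
    proof -
      have "?I \<mu> T - ?I \<nu> T = 1 / (2 * pi) *
          (CLBINT t=-real T..real T. F a b t * char \<mu> t - F a b t * char \<nu> t)"
        unfolding interval_lebesgue_integral_diff(2)[OF int[OF \<mu> that] int[OF \<nu> that], of "-real T" "real T"]
        by (simp only: right_diff_distrib)
      also have "\<dots> = 1 / (2 * pi) *
          (CLINT t|lborel. indicator {-real T<..<real T} t *\<^sub>R (F a b t * (char \<mu> t - char \<nu> t)))"
        by (simp add: interval_lebesgue_integral_def set_lebesgue_integral_def algebra_simps einterval_eq)
      finally have "cmod (?I \<mu> T - ?I \<nu> T) = 1 / (2 * pi) *
          cmod (CLINT t|lborel. indicator {-real T<..<real T} t *\<^sub>R (F a b t * (char \<mu> t - char \<nu> t)))"
        by (simp add: norm_mult norm_divide)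
      also have "\<dots> \<le> 1 / (2 * pi) * (\<integral>t. 2 * g t \<partial>lborel)"
      proof (intro mult_left_mono norm_integral_le)
        show pw: "norm (indicator {-real T<..<real T} t *\<^sub>R (F a b t * (char \<mu> t - char \<nu> t))) \<le> 2 * g t" for t
        proof -
          have "cmod (F a b t) * cmod (char \<mu> t - char \<nu> t) \<le> cmod (F a b t) * (\<bar>t\<bar> * g t)"
            by (intro mult_left_mono bound) auto
          also have "\<dots> = (cmod (F a b t) * \<bar>t\<bar>) * g t" by simp
          also have "\<dots> \<le> 2 * g t" by (intro mult_right_mono F2 g0)
          finally show ?thesis using g0[of t] by (auto simp: indicator_def norm_mult)
        qed
        have gi: "integrable lborel (\<lambda>t. 2 * g t)" using g by simp
        show "integrable lborel (\<lambda>t. indicator {-real T<..<real T} t *\<^sub>R (F a b t * (char \<mu> t - char \<nu> t)))"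
          by (rule Bochner_Integration.integrable_bound[OF gi]) (auto intro!: order_trans[OF pw] simp del: norm_scaleR)
      qed (use g in auto)
      finally show ?thesis by (simp add: field_simps)
    qed
    then have "cmod (complex_of_real (measure \<mu> {a<..b}) - complex_of_real (measure \<nu> {a<..b}))
        \<le> (\<integral>t. g t \<partial>lborel) / pi"
      by (intro LIMSEQ_le_const2[OF lim]) auto
    then show ?thesis by (simp flip: of_real_diff)
  qed
  have "(\<lambda>i. \<bar>(cdf \<mu> x - cdf \<mu> (- real i)) - (cdf \<nu> x - cdf \<nu> (- real i))\<bar>)
      \<longlonglongrightarrow> \<bar>(cdf \<mu> x - 0) - (cdf \<nu> x - 0)\<bar>"
    by (intro tendsto_intros \<mu>.cdf_lim_neg_infty \<nu>.cdf_lim_neg_infty)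
  moreover have "\<bar>(cdf \<mu> x - cdf \<mu> (- real i)) - (cdf \<nu> x - cdf \<nu> (- real i))\<bar> \<le> (\<integral>t. g t \<partial>lborel) / pi"
    if "i \<ge> nat \<lceil>\<bar>x\<bar>\<rceil> + 1" for i :: nat
  proof -
    have "- real i < x" using that by linarith
    then show ?thesis using ab[of "- real i" x] \<mu>.cdf_diff_eq \<nu>.cdf_diff_eq by simp
  qed
  ultimately have "\<bar>(cdf \<mu> x - 0) - (cdf \<nu> x - 0)\<bar> \<le> (\<integral>t. g t \<partial>lborel) / pi"
    by (intro LIMSEQ_le_const2) auto
  then show ?thesis by simp
qed

section \<open>Regularity of the normal distribution function\<close>

lemma cdf_std_normal_diff_le:
  assumes "x \<le> y" and c: "\<And>u. x < u \<Longrightarrow> u \<le> y \<Longrightarrow> std_normal_density u \<le> c"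
  shows "cdf std_normal_distribution y - cdf std_normal_distribution x \<le> c * (y - x)"
proof (cases "x = y")
  case False
  then have xy: "x < y" using assms by simp
  interpret N: real_distribution std_normal_distribution by (rule real_dist_normal_dist)
  have c0: "0 \<le> c" using c[of y] xy normal_density_nonneg[of 0 1 y] by linarith
  have "emeasure std_normal_distribution {x<..y} = (\<integral>\<^sup>+u. ennreal (std_normal_density u) * indicator {x<..y} u \<partial>lborel)"
    by (subst emeasure_density) auto
  also have "\<dots> \<le> (\<integral>\<^sup>+u. ennreal c * indicator {x<..y} u \<partial>lborel)"
    by (intro nn_integral_mono) (auto simp: indicator_def intro!: ennreal_leI c)
  also have "\<dots> = ennreal (c * (y - x))"
    using xy c0 by (simp add: nn_integral_cmult_indicator ennreal_mult'')
  finally have "measure std_normal_distribution {x<..y} \<le> c * (y - x)"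
    using c0 xy by (simp add: N.emeasure_eq_measure)
  then show ?thesis using N.cdf_diff_eq[OF xy] by simp
qed simp

lemma std_normal_density_le_1: "std_normal_density u \<le> 1"
proof -
  have "1 \<le> sqrt (2 * pi)" using pi_ge_two by (intro real_le_rsqrt) auto
  then have "1 / sqrt (2 * pi) \<le> 1" by (simp add: divide_le_eq_1)
  moreover have "exp (- u\<^sup>2 / 2) \<le> 1" by simp
  ultimately have "1 / sqrt (2 * pi) * exp (- u\<^sup>2 / 2) \<le> 1 * 1" by (intro mult_mono) auto
  then show ?thesis by (simp add: std_normal_density_def)
qed

lemma cdf_std_normal_lipschitz:
  "x \<le> y \<Longrightarrow> cdf std_normal_distribution y - cdf std_normal_distribution x \<le> y - x"
  using cdf_std_normal_diff_le[of x y 1] std_normal_density_le_1 by simp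

lemma abs_mult_std_normal_density_le: "\<bar>u\<bar> * std_normal_density u \<le> 1"
proof -
  have "1 \<le> sqrt (2 * pi)" using pi_ge_two by (intro real_le_rsqrt) auto
  then have 1: "1 / sqrt (2 * pi) \<le> 1" by (simp add: divide_le_eq_1)
  have "\<bar>u\<bar> \<le> 1 + u\<^sup>2 / 2" using zero_le_power2[of "\<bar>u\<bar> - 1"] by (simp add: power2_diff)
  also have "\<dots> \<le> exp (u\<^sup>2 / 2)" by (rule exp_ge_add_one_self)
  finally have "\<bar>u\<bar> * exp (- u\<^sup>2 / 2) \<le> 1" by (simp add: exp_minus field_simps)
  then have "1 / sqrt (2 * pi) * (\<bar>u\<bar> * exp (- u\<^sup>2 / 2)) \<le> 1 * 1"
    using 1 by (intro mult_mono) auto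
  then show ?thesis by (simp add: std_normal_density_def)
qed

lemma std_normal_density_antimono: "\<bar>u\<bar> \<le> \<bar>v\<bar> \<Longrightarrow> std_normal_density v \<le> std_normal_density u"
  using power_mono[of "\<bar>u\<bar>" "\<bar>v\<bar>" 2]
  by (simp add: std_normal_density_def divide_right_mono)

text \<open>The mean value bound gives \<open>\<bar>x\<bar> * \<bar>s - 1\<bar>\<close> times a
  density value between \<open>x\<close> and \<open>x * s\<close>. As \<open>s\<close> is at least 1
  / 2, that point is no closer to 0 than \<open>x / 2\<close>, and \<open>\<bar>x / 2\<bar>\<close>
  times the density at \<open>x / 2\<close> is at most 1. Studentization therefore costs an error
  uniform in \<open>x\<close>.\<close>

lemma cdf_std_normal_scale:
  fixes s x :: real
  assumes s: "1 / 2 \<le> s"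
  shows "\<bar>cdf std_normal_distribution (x * s) - cdf std_normal_distribution x\<bar> \<le> 2 * \<bar>s - 1\<bar>"
proof -
  interpret N: real_distribution std_normal_distribution by (rule real_dist_normal_dist)
  let ?c = "std_normal_density (x / 2)"
  have "\<bar>x / 2\<bar> * ?c \<le> 1" by (rule abs_mult_std_normal_density_le)
  then have "\<bar>x\<bar> * ?c \<le> 2" by simp
  then have xc: "\<bar>x\<bar> * ?c * \<bar>s - 1\<bar> \<le> 2 * \<bar>s - 1\<bar>" by (intro mult_right_mono) auto
  have len: "?c * \<bar>x * s - x\<bar> = \<bar>x\<bar> * ?c * \<bar>s - 1\<bar>"
    by (simp add: right_diff_distrib[of x s 1, simplified, symmetric] abs_mult)
  have half: "\<bar>x / 2\<bar> \<le> \<bar>u\<bar>" if "min x (x * s) \<le> u" "u \<le> max x (x * s)" for u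
  proof -
    have "x / 2 \<le> x * s" if "0 \<le> x" using mult_left_mono[OF s that] by simp
    moreover have "x * s \<le> x / 2" if "x \<le> 0" using mult_left_mono_neg[OF s that] by simp
    ultimately show ?thesis using that unfolding min_def max_def by (smt (verit) field_sum_of_halves)
  qed
  show ?thesis
  proof (cases "x \<le> x * s")
    case True
    have "cdf std_normal_distribution (x * s) - cdf std_normal_distribution x \<le> ?c * (x * s - x)"
      using True by (intro cdf_std_normal_diff_le std_normal_density_antimono half) auto
    then have "cdf std_normal_distribution (x * s) - cdf std_normal_distribution x \<le> ?c * \<bar>x * s - x\<bar>"
      using True by simp
    then show ?thesis using xc len N.cdf_nondecreasing[OF True] by linarith
  next
    case False
    then have F: "x * s \<le> x" by simp
    have "cdf std_normal_distribution x - cdf std_normal_distribution (x * s) \<le> ?c * (x - x * s)"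
      using F by (intro cdf_std_normal_diff_le std_normal_density_antimono half) auto
    then have "cdf std_normal_distribution x - cdf std_normal_distribution (x * s) \<le> ?c * \<bar>x * s - x\<bar>"
      using F by simp
    then show ?thesis using xc len N.cdf_nondecreasing[OF F] by linarith
  qed
qed

section \<open>Gaussian smoothing and its removal\<close>

lemma integral_inverse_1_plus_square_scaled:
  fixes \<delta> :: real
  assumes "0 < \<delta>"
  shows "integrable lborel (\<lambda>t. 1 / (1 + (\<delta> * t)\<^sup>2))"
    and "(\<integral>t. 1 / (1 + (\<delta> * t)\<^sup>2) \<partial>lborel) = pi / \<delta>"
proof -
  have i: "integrable lborel (\<lambda>t::real. inverse (1 + t\<^sup>2))"
    using integrable_inverse_1_plus_square by (simp add: set_integrable_def)
  have v: "(\<integral>t. inverse (1 + (t::real)\<^sup>2) \<partial>lborel) = pi"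
    using LBINT_inverse_1_plus_square by (simp add: interval_lebesgue_integral_def set_lebesgue_integral_def)
  show "integrable lborel (\<lambda>t. 1 / (1 + (\<delta> * t)\<^sup>2))"
    using lborel_integrable_real_affine[OF i, of \<delta> 0] assms by (simp add: inverse_eq_divide)
  show "(\<integral>t. 1 / (1 + (\<delta> * t)\<^sup>2) \<partial>lborel) = pi / \<delta>"
    using lborel_integral_real_affine[of \<delta> "\<lambda>t. inverse (1 + t\<^sup>2)" 0] assms v
    by (simp add: inverse_eq_divide field_simps)
qed

text \<open>For \<open>\<bar>t\<bar> > 1\<close> this is the inequality \<open>2 * \<epsilon> *
  \<bar>t\<bar> \<le> (\<epsilon> * \<bar>t\<bar>)\<^sup>2 + 1\<close>. After division by
  \<open>\<bar>t\<bar>\<close> the constant summand is cut off by smoothing at scale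
  \<open>\<epsilon>\<^sup>2\<close>, the other one is integrable, and both integrals are of order
  \<open>1 / \<epsilon>\<close>.\<close>

lemma one_minus_exp_le:
  fixes t \<epsilon> :: real
  assumes \<epsilon>: "0 < \<epsilon>" "\<epsilon> \<le> 1"
  shows "1 - exp (- t\<^sup>2 / 2) \<le> \<bar>t\<bar> * (\<epsilon> / 2 + 1 / (\<epsilon> * (1 + t\<^sup>2)))"
proof (cases "\<bar>t\<bar> \<le> 1")
  case True
  have "1 - exp (- t\<^sup>2 / 2) \<le> t\<^sup>2 / 2" using exp_ge_add_one_self[of "- t\<^sup>2 / 2"] by simp
  also have "\<dots> = \<bar>t\<bar> * (\<bar>t\<bar> / 2)" by (simp add: power2_eq_square)
  also have "\<dots> \<le> \<bar>t\<bar> * (1 / 2)" using True by (intro mult_left_mono) auto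
  also have "1 / 2 \<le> 1 / (\<epsilon> * (1 + t\<^sup>2))"
  proof (rule divide_left_mono)
    have "t\<^sup>2 \<le> 1" using True by (simp add: abs_square_le_1)
    then have "\<epsilon> * (1 + t\<^sup>2) \<le> 1 * 2" using \<epsilon> by (intro mult_mono) auto
    then show "\<epsilon> * (1 + t\<^sup>2) \<le> 2" by simp
    show "0 < 2 * (\<epsilon> * (1 + t\<^sup>2))" using \<epsilon> by (simp add: add_pos_nonneg)
  qed simp
  then have "\<bar>t\<bar> * (1 / 2) \<le> \<bar>t\<bar> * (\<epsilon> / 2 + 1 / (\<epsilon> * (1 + t\<^sup>2)))"
    using \<epsilon> by (intro mult_left_mono) auto
  finally show ?thesis .
next
  case False
  then have t: "1 < \<bar>t\<bar>" by simp
  then have "1 < t\<^sup>2" using power_strict_mono[of 1 "\<bar>t\<bar>" 2] by simp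
  then have "1 / (\<epsilon> * (2 * t\<^sup>2)) \<le> 1 / (\<epsilon> * (1 + t\<^sup>2))"
    using \<epsilon> by (intro divide_left_mono mult_left_mono mult_pos_pos) auto
  then have "\<bar>t\<bar> * (\<epsilon> / 2 + 1 / (\<epsilon> * (2 * t\<^sup>2))) \<le> \<bar>t\<bar> * (\<epsilon> / 2 + 1 / (\<epsilon> * (1 + t\<^sup>2)))"
    by (intro mult_left_mono) auto
  moreover have "1 \<le> \<bar>t\<bar> * (\<epsilon> / 2 + 1 / (\<epsilon> * (2 * t\<^sup>2)))"
  proof -
    have "0 \<le> (\<epsilon> * \<bar>t\<bar> - 1)\<^sup>2" by simp
    then have "2 * (\<epsilon> * \<bar>t\<bar>) \<le> (\<epsilon> * \<bar>t\<bar>)\<^sup>2 + 1" by (simp add: power2_diff)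
    moreover have "\<bar>t\<bar> * (\<epsilon> / 2 + 1 / (\<epsilon> * (2 * t\<^sup>2))) = ((\<epsilon> * \<bar>t\<bar>)\<^sup>2 + 1) / (2 * (\<epsilon> * \<bar>t\<bar>))"
      using \<epsilon> t by (cases "t > 0") (auto simp: field_simps power2_eq_square)
    moreover have "0 < \<epsilon> * \<bar>t\<bar>" using \<epsilon> t by simp
    ultimately show ?thesis by (simp add: field_simps)
  qed
  moreover have "1 - exp (- t\<^sup>2 / 2) \<le> 1" by simp
  ultimately show ?thesis by linarith
qed

definition gauss_smooth :: "real \<Rightarrow> real measure \<Rightarrow> real measure" where
  "gauss_smooth \<delta> \<mu> = distr (\<mu> \<Otimes>\<^sub>M std_normal_distribution) borel (\<lambda>(s, g). s + \<delta> * g)"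

text \<open>Smoothing removes the atoms, as inversion requires, and multiplies the characteristic
  function by a factor that makes the inversion integral converge. The formula for the distribution
  function as an average of shifts is what permits undoing the smoothing.\<close>

lemma gauss_smooth:
  assumes \<mu>: "real_distribution \<mu>" and \<delta>: "0 < \<delta>"
  shows "real_distribution (gauss_smooth \<delta> \<mu>)"
    and "measure (gauss_smooth \<delta> \<mu>) {x} = 0"
    and "char (gauss_smooth \<delta> \<mu>) t = char \<mu> t * of_real (exp (- (\<delta> * t)\<^sup>2 / 2))"
    and "cdf (gauss_smooth \<delta> \<mu>) x = (\<integral>g. cdf \<mu> (x - \<delta> * g) \<partial>std_normal_distribution)"
    and "integrable std_normal_distribution (\<lambda>g. cdf \<mu> (x - \<delta> * g))"
proof -
  let ?N = std_normal_distribution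
  interpret \<mu>: real_distribution \<mu> by fact
  interpret N: real_distribution ?N by (rule real_dist_normal_dist)
  interpret P: pair_prob_space \<mu> ?N ..
  have m[measurable]: "(\<lambda>(s, g). s + \<delta> * g) \<in> borel_measurable (\<mu> \<Otimes>\<^sub>M ?N)"
    by (simp add: measurable_cong_sets[OF sets_pair_measure_cong[OF \<mu>.M_is_borel N.M_is_borel] refl])
  show "real_distribution (gauss_smooth \<delta> \<mu>)"
    unfolding gauss_smooth_def by (rule P.real_distribution_distr[OF m])
  have sets_pre: "(\<lambda>(s, g). s + \<delta> * g) -` A \<inter> space (\<mu> \<Otimes>\<^sub>M ?N) \<in> sets (\<mu> \<Otimes>\<^sub>M ?N)"
    if "A \<in> sets borel" for A using that by measurable
  have em: "emeasure (gauss_smooth \<delta> \<mu>) A = (\<integral>\<^sup>+s. emeasure ?N {g. s + \<delta> * g \<in> A} \<partial>\<mu>)"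
    if A: "A \<in> sets borel" for A
    unfolding gauss_smooth_def emeasure_distr[OF m A]
    by (subst N.emeasure_pair_measure_alt[OF sets_pre[OF A]])
       (auto intro!: nn_integral_cong arg_cong[where f="emeasure ?N"] simp: space_pair_measure)
  have em2: "emeasure (gauss_smooth \<delta> \<mu>) A = (\<integral>\<^sup>+g. emeasure \<mu> {s. s + \<delta> * g \<in> A} \<partial>?N)"
    if A: "A \<in> sets borel" for A
    unfolding gauss_smooth_def emeasure_distr[OF m A]
    by (subst P.emeasure_pair_measure_alt2[OF sets_pre[OF A]])
       (auto intro!: nn_integral_cong arg_cong[where f="emeasure \<mu>"] simp: space_pair_measure)
  have "emeasure ?N {g. s + \<delta> * g \<in> {x}} = 0" for s
  proof -
    have "{g. s + \<delta> * g \<in> {x}} = {(x - s) / \<delta>}" using \<delta> by (auto simp: field_simps)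
    moreover have "emeasure ?N {(x - s) / \<delta>} = 0"
      by (subst emeasure_density) (auto intro!: nn_integral_null_set)
    ultimately show ?thesis by simp
  qed
  then have "emeasure (gauss_smooth \<delta> \<mu>) {x} = 0" by (simp add: em)
  then show "measure (gauss_smooth \<delta> \<mu>) {x} = 0" by (simp add: measure_def)
  have intc: "integrable ?N (\<lambda>g. cdf \<mu> (x - \<delta> * g))"
  proof (rule N.integrable_const_bound[where B=1])
    have mc: "mono (cdf \<mu>)" by (rule monoI) (rule \<mu>.cdf_nondecreasing)
    have "cdf \<mu> \<in> borel_measurable borel" by (rule borel_measurable_mono[OF mc])
    then show "(\<lambda>g. cdf \<mu> (x - \<delta> * g)) \<in> borel_measurable ?N" by measurable
  qed (use \<mu>.cdf_bounded_prob \<mu>.cdf_nonneg in auto)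
  then show "integrable ?N (\<lambda>g. cdf \<mu> (x - \<delta> * g))" .
  have "emeasure (gauss_smooth \<delta> \<mu>) {..x} = (\<integral>\<^sup>+g. ennreal (cdf \<mu> (x - \<delta> * g)) \<partial>?N)"
    unfolding em2[OF atMost_borel] cdf_def \<mu>.emeasure_eq_measure[symmetric]
    by (intro nn_integral_cong arg_cong[where f="emeasure \<mu>"]) auto
  also have "\<dots> = ennreal (\<integral>g. cdf \<mu> (x - \<delta> * g) \<partial>?N)"
    by (rule nn_integral_eq_integral[OF intc]) (use \<mu>.cdf_nonneg in auto)
  finally show "cdf (gauss_smooth \<delta> \<mu>) x = (\<integral>g. cdf \<mu> (x - \<delta> * g) \<partial>?N)"
    unfolding cdf_def[of "gauss_smooth \<delta> \<mu>"]
    by (simp add: measure_def \<mu>.cdf_nonneg integral_nonneg_AE)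
  have i: "integrable (\<mu> \<Otimes>\<^sub>M ?N) (\<lambda>(s, g). iexp (t * s) * iexp ((\<delta> * t) * g))"
  proof (rule P.integrable_const_bound[where B=1])
    show "(\<lambda>(s, g). iexp (t * s) * iexp (\<delta> * t * g)) \<in> borel_measurable (\<mu> \<Otimes>\<^sub>M ?N)"
      by (simp add: measurable_cong_sets[OF sets_pair_measure_cong[OF \<mu>.M_is_borel N.M_is_borel] refl])
  qed (auto simp: norm_mult)
  have "char (gauss_smooth \<delta> \<mu>) t = (\<integral>(s, g). iexp (t * s) * iexp ((\<delta> * t) * g) \<partial>(\<mu> \<Otimes>\<^sub>M ?N))"
    unfolding char_def gauss_smooth_def
    by (subst integral_distr[OF m]) (auto simp: split_beta exp_add[symmetric] algebra_simps intro!: Bochner_Integration.integral_cong)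
  also have "\<dots> = (\<integral>s. (\<integral>g. iexp (t * s) * iexp ((\<delta> * t) * g) \<partial>?N) \<partial>\<mu>)"
    using P.integral_fst'[OF i] by simp
  also have "\<dots> = char \<mu> t * char ?N (\<delta> * t)"
    by (simp add: char_def)
  finally show "char (gauss_smooth \<delta> \<mu>) t = char \<mu> t * of_real (exp (- (\<delta> * t)\<^sup>2 / 2))"
    by (simp add: char_std_normal_distribution)
qed

text \<open>Esseen's argument. Inversion bounds the distance of the smoothed laws by
  \<open>\<Delta>\<close>. A discrepancy of the original laws persists on a window next to it, since
  one distribution function is monotone and the other Lipschitz; averaging over the window transfers
  it to the smoothed laws.\<close>

lemma kolmogorov_smoothing:
  assumes \<mu>: "real_distribution \<mu>" and \<epsilon>: "0 < \<epsilon>" "\<epsilon> \<le> 1" and a: "0 \<le> a" and b: "0 \<le> b"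
    and char: "\<And>t. cmod (char \<mu> t - of_real (exp (- t\<^sup>2 / 2))) \<le> (a + \<bar>t\<bar> * b) * (1 - exp (- t\<^sup>2 / 2))"
  shows "\<bar>cdf \<mu> x - cdf std_normal_distribution x\<bar> \<le> 6 * \<epsilon>\<^sup>2 + 4 * a / \<epsilon> + 4 * b / \<epsilon>\<^sup>2"
proof -
  let ?N = std_normal_distribution
  interpret \<mu>: real_distribution \<mu> by fact
  interpret N: real_distribution ?N by (rule real_dist_normal_dist)
  define \<delta> where "\<delta> = \<epsilon>\<^sup>2"
  have \<delta>: "0 < \<delta>" using \<epsilon> by (simp add: \<delta>_def)
  define g where "g t = a * (\<epsilon> * (1 / (1 + (\<delta> * t)\<^sup>2)) + 1 / \<epsilon> * (1 / (1 + (1 * t)\<^sup>2)))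
      + 2 * b * (1 / (1 + (\<delta> * t)\<^sup>2))" for t
  note I\<delta> = integral_inverse_1_plus_square_scaled[OF \<delta>]
  note I1 = integral_inverse_1_plus_square_scaled[OF zero_less_one]
  have gi: "integrable lborel g" unfolding g_def
    by (intro Bochner_Integration.integrable_add integrable_mult_right I\<delta>(1) I1(1))
  have "(\<integral>t. g t \<partial>lborel) = a * (\<epsilon> * (pi / \<delta>) + 1 / \<epsilon> * (pi / 1)) + 2 * b * (pi / \<delta>)"
    unfolding g_def
    by (subst Bochner_Integration.integral_add)
       (intro Bochner_Integration.integrable_add integrable_mult_right I\<delta>(1) I1(1),
        intro Bochner_Integration.integrable_add integrable_mult_right I\<delta>(1) I1(1),
        simp only: integral_mult_right_zero Bochner_Integration.integral_add[OF
          integrable_mult_right[OF I\<delta>(1)] integrable_mult_right[OF I1(1)]] I\<delta>(2) I1(2))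
  then have g_int: "(\<integral>t. g t \<partial>lborel) / pi = 2 * a / \<epsilon> + 2 * b / \<epsilon>\<^sup>2"
    using \<epsilon> by (simp add: \<delta>_def field_simps power2_eq_square)
  have g0: "0 \<le> g t" for t using a b \<epsilon> by (simp add: g_def)
  have gb: "cmod (char (gauss_smooth \<delta> \<mu>) t - char (gauss_smooth \<delta> ?N) t) \<le> \<bar>t\<bar> * g t" for t
  proof -
    define e where "e = exp (- (\<delta> * t)\<^sup>2 / 2)"
    have e0: "0 \<le> e" "e \<le> 1" by (auto simp: e_def)
    \<comment> \<open>The Gaussian factor is traded for a Cauchy density shape, whose integral is
      explicit.\<close>
    have e2: "e \<le> 2 * (1 / (1 + (\<delta> * t)\<^sup>2))"
    proof -
      have "1 + (\<delta> * t)\<^sup>2 \<le> 2 * (1 + (\<delta> * t)\<^sup>2 / 2)" by simp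
      also have "\<dots> \<le> 2 * exp ((\<delta> * t)\<^sup>2 / 2)"
        using exp_ge_add_one_self[of "(\<delta> * t)\<^sup>2 / 2"] by (intro mult_left_mono) auto
      finally have "(1 + (\<delta> * t)\<^sup>2) * e \<le> 2" by (simp add: e_def exp_minus field_simps)
      moreover have "0 < 1 + (\<delta> * t)\<^sup>2" by (simp add: add_pos_nonneg)
      ultimately show ?thesis by (simp add: field_simps)
    qed
    let ?q = "1 - exp (- t\<^sup>2 / 2)"
    have q: "?q \<le> \<bar>t\<bar> * (\<epsilon> / 2 + 1 / \<epsilon> * (1 / (1 + t\<^sup>2)))" "?q \<le> 1"
      using one_minus_exp_le[OF \<epsilon>, of t] by auto
    have q0: "0 \<le> ?q" by simp
    have c: "char (gauss_smooth \<delta> \<mu>) t - char (gauss_smooth \<delta> ?N) t = (char \<mu> t - of_real (exp (- t\<^sup>2 / 2))) * of_real e"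
      unfolding gauss_smooth(3)[OF \<mu> \<delta>] gauss_smooth(3)[OF real_dist_normal_dist \<delta>] e_def
        char_std_normal_distribution by (simp add: algebra_simps)
    have "cmod (char (gauss_smooth \<delta> \<mu>) t - char (gauss_smooth \<delta> ?N) t) \<le> (a + \<bar>t\<bar> * b) * ?q * e"
      unfolding c norm_mult norm_of_real abs_of_nonneg[OF e0(1)] by (intro mult_right_mono char e0)
    also have "\<dots> = a * (?q * e) + \<bar>t\<bar> * b * (?q * e)" by (simp add: algebra_simps)
    also have "\<dots> \<le> a * (\<bar>t\<bar> * (\<epsilon> * (1 / (1 + (\<delta> * t)\<^sup>2)) + 1 / \<epsilon> * (1 / (1 + t\<^sup>2))))
        + \<bar>t\<bar> * b * (2 * (1 / (1 + (\<delta> * t)\<^sup>2)))"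
    proof (intro add_mono mult_left_mono)
      have "?q * e \<le> \<bar>t\<bar> * (\<epsilon> / 2 + 1 / \<epsilon> * (1 / (1 + t\<^sup>2))) * e"
        by (intro mult_right_mono q e0)
      also have "\<dots> = \<bar>t\<bar> * (\<epsilon> / 2 * e + 1 / \<epsilon> * (1 / (1 + t\<^sup>2)) * e)" by (simp add: algebra_simps)
      also have "\<dots> \<le> \<bar>t\<bar> * (\<epsilon> / 2 * (2 * (1 / (1 + (\<delta> * t)\<^sup>2))) + 1 / \<epsilon> * (1 / (1 + t\<^sup>2)) * 1)"
        using e0 e2 \<epsilon> by (intro mult_left_mono add_mono) auto
      finally show "?q * e \<le> \<bar>t\<bar> * (\<epsilon> * (1 / (1 + (\<delta> * t)\<^sup>2)) + 1 / \<epsilon> * (1 / (1 + t\<^sup>2)))" by simp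
      have "?q * e \<le> 1 * e" by (intro mult_right_mono q e0)
      then show "?q * e \<le> 2 * (1 / (1 + (\<delta> * t)\<^sup>2))" using e2 by simp
    qed (use a b in auto)
    also have "\<dots> = \<bar>t\<bar> * g t" by (simp add: g_def algebra_simps)
    finally show ?thesis .
  qed
  define \<Delta> where "\<Delta> = 2 * a / \<epsilon> + 2 * b / \<epsilon>\<^sup>2"
  have \<Delta>0: "0 \<le> \<Delta>" using a b \<epsilon> by (simp add: \<Delta>_def)
  have smooth: "\<bar>cdf (gauss_smooth \<delta> \<mu>) y - cdf (gauss_smooth \<delta> ?N) y\<bar> \<le> \<Delta>" for y
    unfolding \<Delta>_def g_int[symmetric]
    by (intro cdf_diff_le_integral_char gauss_smooth \<mu> \<delta> real_dist_normal_dist gi gb g0)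
  let ?d = "\<lambda>y. cdf \<mu> y - cdf ?N y"
  have diff: "cdf (gauss_smooth \<delta> \<mu>) y - cdf (gauss_smooth \<delta> ?N) y = (\<integral>h. ?d (y - \<delta> * h) \<partial>?N)"
    and diff_i: "integrable ?N (\<lambda>h. ?d (y - \<delta> * h))" for y
    using gauss_smooth(4,5)[OF \<mu> \<delta>] gauss_smooth(4,5)[OF real_dist_normal_dist \<delta>]
    by simp_all
  have d_le: "\<bar>?d y\<bar> \<le> 1" for y
    using \<mu>.cdf_bounded_prob[of y] N.cdf_bounded_prob[of y] \<mu>.cdf_nonneg[of y] N.cdf_nonneg[of y] by linarith
  \<comment> \<open>The supremum is finite, so the final inequality, with \<open>D / 3\<close> on
    its right-hand side, can be solved for \<open>D\<close>.\<close>
  define D where "D = (SUP y. \<bar>?d y\<bar>)"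
  have bdd: "bdd_above (range (\<lambda>y. \<bar>?d y\<bar>))" using d_le by (intro bdd_aboveI2)
  have D: "\<bar>?d y\<bar> \<le> D" for y unfolding D_def by (rule cSUP_upper[OF _ bdd]) simp
  have D0: "0 \<le> D" using D[of 0] by linarith
  have tail: "measure ?N {h. 2 \<le> \<bar>h\<bar>} \<le> 1 / 4"
  proof -
    have "integrable ?N (\<lambda>h. h ^ 2)" "(\<integral>h. h\<^sup>2 \<partial>?N) = 1" "(\<integral>h. h \<partial>?N) = 0"
      using std_normal_distribution_even_moments[of 1] integral_std_normal_distribution_moment_odd[of 1]
      by (auto simp: fact_numeral)
    then show ?thesis using N.Chebyshev_inequality[of "\<lambda>h. h" 2] by simp
  qed
  have point: "s * ?d y \<le> 4 * \<delta> + 4 / 3 * (\<Delta> + D / 4)" if s: "s = 1 \<or> s = -1" for s y :: real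
  proof -
    define u where "u = s * ?d y - 4 * \<delta>"
    show ?thesis
    proof (cases "0 \<le> u")
      case True
      \<comment> \<open>The shift by \<open>2 * \<delta>\<close> in the direction of the sign
        \<open>s\<close> puts \<open>?z - \<delta> * h\<close> on the favourable side of
        \<open>y\<close>, within \<open>4 * \<delta>\<close>, as long as
        \<open>\<bar>h\<bar> < 2\<close>.\<close>
      let ?z = "y + s * (2 * \<delta>)"
      have low: "u - (u + D) * indicator {h. 2 \<le> \<bar>h\<bar>} h \<le> s * ?d (?z - \<delta> * h)" for h
      proof (cases "2 \<le> \<bar>h\<bar>")
        case True
        then show ?thesis using D[of "?z - \<delta> * h"] s by (auto simp: abs_le_iff)
      next
        case False
        then have h: "- (2 * \<delta>) \<le> \<delta> * h" "\<delta> * h \<le> 2 * \<delta>"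
          using mult_left_mono[of "-2" h \<delta>] mult_left_mono[of h 2 \<delta>] \<delta> by (auto simp: abs_if split: if_splits)
        from s show ?thesis
        proof
          assume s1: "s = 1"
          have "cdf \<mu> y \<le> cdf \<mu> (?z - \<delta> * h)" using h s1 by (intro \<mu>.cdf_nondecreasing) auto
          moreover have "cdf ?N (?z - \<delta> * h) - cdf ?N y \<le> (?z - \<delta> * h) - y"
            using h s1 by (intro cdf_std_normal_lipschitz) auto
          ultimately show ?thesis using h s1 False by (simp add: u_def)
        next
          assume s1: "s = -1"
          have "cdf \<mu> (?z - \<delta> * h) \<le> cdf \<mu> y" using h s1 by (intro \<mu>.cdf_nondecreasing) auto
          moreover have "cdf ?N y - cdf ?N (?z - \<delta> * h) \<le> y - (?z - \<delta> * h)"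
            using h s1 by (intro cdf_std_normal_lipschitz) auto
          ultimately show ?thesis using h s1 False by (simp add: u_def)
        qed
      qed
      \<comment> \<open>The window is missed with probability at most 1 / 4, where only the bound
        \<open>- D\<close> is available. This gives
        \<open>u - (u + D) / 4 \<le> \<Delta>\<close>.\<close>
      have "u - (u + D) * (1 / 4) \<le> u - (u + D) * measure ?N {h. 2 \<le> \<bar>h\<bar>}"
        using tail True D0 by (intro diff_left_mono mult_left_mono) auto
      also have "\<dots> = (\<integral>h. u - (u + D) * indicator {h. 2 \<le> \<bar>h\<bar>} h \<partial>?N)"
      proof -
        have "integrable ?N (\<lambda>h. indicator {h. 2 \<le> \<bar>h\<bar>} h :: real)"
          by (rule N.integrable_const_bound[where B=1]) auto
        then show ?thesis using N.prob_space by simp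
      qed
      also have "\<dots> \<le> (\<integral>h. s * ?d (?z - \<delta> * h) \<partial>?N)"
        by (intro integral_mono low integrable_mult_right diff_i Bochner_Integration.integrable_diff
            N.integrable_const) (rule N.integrable_const_bound[where B=1]; auto)
      also have "\<dots> = s * (cdf (gauss_smooth \<delta> \<mu>) ?z - cdf (gauss_smooth \<delta> ?N) ?z)"
        unfolding diff by simp
      also have "\<dots> \<le> \<Delta>" using smooth[of ?z] s by (auto simp: abs_le_iff)
      finally have "u \<le> 4 / 3 * (\<Delta> + D / 4)" by (simp add: field_simps)
      then show ?thesis unfolding u_def by linarith
    next
      case False
      have "0 \<le> 4 / 3 * (\<Delta> + D / 4)" using \<Delta>0 D0 by simp
      with False show ?thesis unfolding u_def by linarith
    qed
  qed
  have "\<bar>?d y\<bar> \<le> 4 * \<delta> + 4 / 3 * (\<Delta> + D / 4)" for y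
    using point[of 1 y] point[of "-1" y] by (auto simp: abs_le_iff)
  then have "D \<le> 4 * \<delta> + 4 / 3 * (\<Delta> + D / 4)" unfolding D_def by (intro cSUP_least) auto
  then have "D \<le> 6 * \<delta> + 2 * \<Delta>" by (simp add: field_simps)
  with D[of x] have "\<bar>?d x\<bar> \<le> 6 * \<delta> + 2 * \<Delta>" by linarith
  then show ?thesis by (simp add: \<delta>_def \<Delta>_def algebra_simps)
qed

subsection \<open>Resampling one coordinate\<close>

text \<open>On a rectangle the old coordinate \<open>i\<close> is unconstrained and contributes a
  factor 1, while the new one contributes the factor of \<open>A i\<close>. Through this invariance
  any single coordinate can be integrated out while the others stay fixed.\<close>

lemma (in prob_space) distr_PiM_resample:
  assumes I: "finite I" and i: "i \<in> I"
  shows "distr (PiM I (\<lambda>_. M) \<Otimes>\<^sub>M M) (PiM I (\<lambda>_. M)) (\<lambda>(z, x). z(i := x)) = PiM I (\<lambda>_. M)"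
proof -
  interpret P: product_prob_space "\<lambda>_. M" I ..
  interpret Q: product_sigma_finite "\<lambda>_. M" ..
  let ?\<Omega> = "PiM I (\<lambda>_. M)"
  have m[measurable]: "(\<lambda>(z, x). z(i := x)) \<in> ?\<Omega> \<Otimes>\<^sub>M M \<rightarrow>\<^sub>M ?\<Omega>"
    using measurable_add_dim[of i I "\<lambda>_. M"] i by (simp add: insert_absorb)
  show ?thesis
  proof (rule Q.PiM_eqI[OF I])
    fix A assume A: "\<And>j. j \<in> I \<Longrightarrow> A j \<in> sets M"
    let ?A' = "\<lambda>j. if j = i then space M else A j"
    have pre: "(\<lambda>(z, x). z(i := x)) -` (Pi\<^sub>E I A) \<inter> space (?\<Omega> \<Otimes>\<^sub>M M) = (Pi\<^sub>E I ?A') \<times> A i"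
      using sets.sets_into_space[OF A] i
      by (auto simp: space_pair_measure space_PiM PiE_iff extensional_def split: if_splits; metis subsetD)
    have "emeasure (distr (?\<Omega> \<Otimes>\<^sub>M M) ?\<Omega> (\<lambda>(z, x). z(i := x))) (Pi\<^sub>E I A)
        = emeasure (?\<Omega> \<Otimes>\<^sub>M M) ((Pi\<^sub>E I ?A') \<times> A i)"
      using A I by (subst emeasure_distr) (auto simp: pre[symmetric] intro!: sets_PiM_I_finite)
    also have "\<dots> = emeasure ?\<Omega> (Pi\<^sub>E I ?A') * emeasure M (A i)"
      using A I i by (intro emeasure_pair_measure_Times) (auto intro!: sets_PiM_I_finite)
    also have "emeasure ?\<Omega> (Pi\<^sub>E I ?A') = (\<Prod>j\<in>I. emeasure M (?A' j))"
      using A I by (intro Q.emeasure_PiM) auto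
    also have "\<dots> = (\<Prod>j\<in>I - {i}. emeasure M (A j))"
      using I i by (subst prod.remove[OF I i]) (auto simp: emeasure_space_1 intro!: prod.cong)
    also have "\<dots> * emeasure M (A i) = (\<Prod>j\<in>I. emeasure M (A j))"
      by (subst prod.remove[OF I i]) (simp add: mult.commute)
    finally show "emeasure (distr (?\<Omega> \<Otimes>\<^sub>M M) ?\<Omega> (\<lambda>(z, x). z(i := x))) (Pi\<^sub>E I A)
        = (\<Prod>j\<in>I. emeasure M (A j))" .
  qed simp
qed

locale sample = prob_space Z for Z :: "'a measure" +
  fixes I :: "nat set"
  assumes finite_I: "finite I"
begin

abbreviation \<Omega> :: "(nat \<Rightarrow> 'a) measure" where "\<Omega> \<equiv> PiM I (\<lambda>_. Z)"

sublocale \<Omega>: prob_space \<Omega>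
  by (intro prob_space_PiM) unfold_locales

sublocale ZZ: pair_prob_space Z Z ..

sublocale \<Omega>Z: pair_prob_space \<Omega> Z ..

lemma measurable_upd: "i \<in> I \<Longrightarrow> (\<lambda>(z, x). z(i := x)) \<in> \<Omega> \<Otimes>\<^sub>M Z \<rightarrow>\<^sub>M \<Omega>"
  using measurable_add_dim[of i I "\<lambda>_. Z"] by (simp add: insert_absorb)

lemma space_\<Omega>_upd: "i \<in> I \<Longrightarrow> z \<in> space \<Omega> \<Longrightarrow> x \<in> space Z \<Longrightarrow> z(i := x) \<in> space \<Omega>"
  by (auto simp: space_PiM PiE_iff extensional_def)

lemma space_\<Omega>: "z \<in> space \<Omega> \<Longrightarrow> i \<in> I \<Longrightarrow> z i \<in> space Z"
  by (auto simp: space_PiM PiE_iff)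

lemma integral_resample:
  fixes F :: "(nat \<Rightarrow> 'a) \<Rightarrow> 'b::{banach,second_countable_topology}"
  assumes i: "i \<in> I" and F: "integrable \<Omega> F"
  shows "(\<integral>z. F z \<partial>\<Omega>) = (\<integral>z. (\<integral>x. F (z(i := x)) \<partial>Z) \<partial>\<Omega>)"
proof -
  let ?u = "\<lambda>(z, x). z(i := x)"
  have d: "distr (\<Omega> \<Otimes>\<^sub>M Z) \<Omega> ?u = \<Omega>" by (rule distr_PiM_resample[OF finite_I i])
  have Fm: "F \<in> borel_measurable \<Omega>" using F by auto
  have Fi: "integrable (\<Omega> \<Otimes>\<^sub>M Z) (\<lambda>p. F (?u p))"
    using integrable_distr_eq[OF measurable_upd[OF i] Fm] F d by simp
  have "(\<integral>z. F z \<partial>\<Omega>) = (\<integral>z. F z \<partial>(distr (\<Omega> \<Otimes>\<^sub>M Z) \<Omega> ?u))" by (simp only: d)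
  also have "\<dots> = (\<integral>p. F (?u p) \<partial>(\<Omega> \<Otimes>\<^sub>M Z))"
    by (rule integral_distr[OF measurable_upd[OF i] Fm])
  also have "\<dots> = (\<integral>z. (\<integral>x. F (z(i := x)) \<partial>Z) \<partial>\<Omega>)"
    using \<Omega>Z.integral_fst'[OF Fi] by simp
  finally show ?thesis .
qed

lemma distr_pair:
  assumes "i \<in> I" "j \<in> I" "i \<noteq> j"
  shows "distr \<Omega> (Z \<Otimes>\<^sub>M Z) (\<lambda>z. (z i, z j)) = Z \<Otimes>\<^sub>M Z"
proof (rule pair_measure_eqI[symmetric])
  fix A B assume AB: "A \<in> sets Z" "B \<in> sets Z"
  interpret Q: product_sigma_finite "\<lambda>_. Z" ..
  let ?A = "\<lambda>k. if k = i then A else if k = j then B else space Z"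
  have pre: "(\<lambda>z. (z i, z j)) -` (A \<times> B) \<inter> space \<Omega> = Pi\<^sub>E I ?A"
    using assms sets.sets_into_space[OF AB(1)] sets.sets_into_space[OF AB(2)]
    by (auto simp: space_PiM PiE_iff split: if_splits; metis subsetD)
  have "emeasure (distr \<Omega> (Z \<Otimes>\<^sub>M Z) (\<lambda>z. (z i, z j))) (A \<times> B) = emeasure \<Omega> (Pi\<^sub>E I ?A)"
    using AB assms by (subst emeasure_distr) (auto simp: pre)
  also have "\<dots> = (\<Prod>k\<in>I. emeasure Z (?A k))"
    using finite_I AB by (intro Q.emeasure_PiM) auto
  also have "\<dots> = emeasure Z A * emeasure Z B * (\<Prod>k\<in>I - {i} - {j}. emeasure Z (?A k))"
    using finite_I assms by (subst prod.remove[of I i]) (auto simp: prod.remove[of "I - {i}" j] mult.assoc)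
  also have "(\<Prod>k\<in>I - {i} - {j}. emeasure Z (?A k)) = 1"
    by (intro prod.neutral) (auto simp: emeasure_space_1)
  finally show "emeasure Z A * emeasure Z B
      = emeasure (distr \<Omega> (Z \<Otimes>\<^sub>M Z) (\<lambda>z. (z i, z j))) (A \<times> B)" by simp
qed (unfold_locales, simp)

lemma measurable_pair_coord[measurable]:
  "i \<in> I \<Longrightarrow> j \<in> I \<Longrightarrow> (\<lambda>z. (z i, z j)) \<in> \<Omega> \<rightarrow>\<^sub>M Z \<Otimes>\<^sub>M Z"
  by measurable

lemma integral_pair:
  fixes f :: "'a \<Rightarrow> 'a \<Rightarrow> real"
  assumes "i \<in> I" "j \<in> I" "i \<noteq> j" and f: "(\<lambda>(x, y). f x y) \<in> borel_measurable (Z \<Otimes>\<^sub>M Z)"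
  shows "(\<integral>z. f (z i) (z j) \<partial>\<Omega>) = (\<integral>(x, y). f x y \<partial>(Z \<Otimes>\<^sub>M Z))"
    and "integrable \<Omega> (\<lambda>z. f (z i) (z j)) \<longleftrightarrow> integrable (Z \<Otimes>\<^sub>M Z) (\<lambda>(x, y). f x y)"
  using integral_distr[OF measurable_pair_coord[OF assms(1,2)] f] distr_pair[OF assms(1-3)]
    integrable_distr_eq[OF measurable_pair_coord[OF assms(1,2)] f]
  by simp_all

lemma AE_coord:
  assumes "i \<in> I" and P: "AE x in Z. P x"
  shows "AE z in \<Omega>. P (z i)"
  using AE_PiM_component[of I "\<lambda>_. Z" i P] assms prob_space_axioms by auto

text \<open>A class of integrable functions closed under sums and products, so that integrability of
  products of several kernels follows from introduction rules.\<close>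

definition bounded_measurable :: "((nat \<Rightarrow> 'a) \<Rightarrow> 'b::real_normed_vector) \<Rightarrow> bool" where
  "bounded_measurable F \<longleftrightarrow> F \<in> borel_measurable \<Omega> \<and> (\<exists>c. \<forall>z\<in>space \<Omega>. norm (F z) \<le> c)"

lemma bounded_measurableI: "F \<in> borel_measurable \<Omega> \<Longrightarrow> (\<And>z. z \<in> space \<Omega> \<Longrightarrow> norm (F z) \<le> c) \<Longrightarrow> bounded_measurable F"
  by (auto simp: bounded_measurable_def)

lemma bounded_measurable_integrable: "bounded_measurable (F :: _ \<Rightarrow> 'b::{banach,second_countable_topology}) \<Longrightarrow> integrable \<Omega> F"
  by (auto simp: bounded_measurable_def intro!: \<Omega>.integrable_const_bound)

lemma bounded_measurable_const: "bounded_measurable (\<lambda>z. c)"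
  by (auto simp: bounded_measurable_def)

lemma bounded_measurable_add: "bounded_measurable F \<Longrightarrow> bounded_measurable G \<Longrightarrow> bounded_measurable (\<lambda>z. F z + G z :: 'b::{banach,second_countable_topology})"
  unfolding bounded_measurable_def by (auto intro!: exI norm_triangle_le add_mono) 

lemma bounded_measurable_diff: "bounded_measurable F \<Longrightarrow> bounded_measurable G \<Longrightarrow> bounded_measurable (\<lambda>z. F z - G z :: 'b::{banach,second_countable_topology})"
  unfolding bounded_measurable_def by (auto intro!: exI order_trans[OF norm_triangle_ineq4] add_mono) 

lemma bounded_measurable_mult:
  assumes "bounded_measurable F" "bounded_measurable G"
  shows "bounded_measurable (\<lambda>z. F z * G z :: 'b::{real_normed_field,second_countable_topology})"
proof -
  obtain c d where "\<And>z. z \<in> space \<Omega> \<Longrightarrow> norm (F z) \<le> c" "\<And>z. z \<in> space \<Omega> \<Longrightarrow> norm (G z) \<le> d"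
    using assms by (auto simp: bounded_measurable_def)
  then have "norm (F z * G z) \<le> c * d" if "z \<in> space \<Omega>" for z
    using that unfolding norm_mult by (meson mult_mono norm_ge_zero order_trans)
  then show ?thesis using assms by (auto simp: bounded_measurable_def)
qed

lemma bounded_measurable_power: "bounded_measurable F \<Longrightarrow> bounded_measurable (\<lambda>z. F z ^ n :: 'b::{real_normed_field,second_countable_topology})"
  by (induction n) (auto intro: bounded_measurable_const bounded_measurable_mult)

lemma bounded_measurable_of_real: "bounded_measurable F \<Longrightarrow> bounded_measurable (\<lambda>z. complex_of_real (F z))"
  by (auto simp: bounded_measurable_def)

lemma bounded_measurable_sum: "(\<And>i. i \<in> A \<Longrightarrow> bounded_measurable (F i)) \<Longrightarrow>
    bounded_measurable (\<lambda>z. \<Sum>i\<in>A. F i z :: 'b::{banach,second_countable_topology})"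
  by (induction A rule: infinite_finite_induct) (auto intro: bounded_measurable_const bounded_measurable_add)

lemma bounded_measurable_abs: "bounded_measurable F \<Longrightarrow> bounded_measurable (\<lambda>z. \<bar>F z\<bar> :: real)"
  by (auto simp: bounded_measurable_def)

lemma bounded_measurable_norm: "bounded_measurable F \<Longrightarrow> bounded_measurable (\<lambda>z. norm (F z :: 'b::{banach,second_countable_topology}))"
  by (auto simp: bounded_measurable_def)

lemma bounded_measurable_divide: "bounded_measurable F \<Longrightarrow> bounded_measurable (\<lambda>z. F z / c :: 'b::{real_normed_field,second_countable_topology})"
  using bounded_measurable_mult[OF _ bounded_measurable_const[of "1 / c"], of F] by simp

lemma bounded_measurable_iexp: "bounded_measurable F \<Longrightarrow> bounded_measurable (\<lambda>z. iexp (F z))"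
  by (auto simp: bounded_measurable_def intro!: exI[of _ 1])

lemmas bounded_measurable_intros = bounded_measurable_const bounded_measurable_add bounded_measurable_diff bounded_measurable_mult bounded_measurable_power bounded_measurable_of_real bounded_measurable_sum bounded_measurable_abs bounded_measurable_norm bounded_measurable_divide

end

subsection \<open>Moments of degenerate quadratic forms\<close>

lemma abs_mult4_le: "\<bar>a * b * c * d\<bar> \<le> (a^4 + b^4 + c^4 + d^4) / 4" for a b c d :: real
proof -
  have "2 * (\<bar>a * b\<bar> * \<bar>c * d\<bar>) \<le> \<bar>a * b\<bar>\<^sup>2 + \<bar>c * d\<bar>\<^sup>2"
    using sum_squares_bound[of "\<bar>a * b\<bar>" "\<bar>c * d\<bar>"] by simp
  moreover have "2 * (a\<^sup>2 * b\<^sup>2) \<le> a^4 + b^4" "2 * (c\<^sup>2 * d\<^sup>2) \<le> c^4 + d^4"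
    using sum_squares_bound[of "a\<^sup>2" "b\<^sup>2"] sum_squares_bound[of "c\<^sup>2" "d\<^sup>2"] by simp_all
  ultimately show ?thesis by (simp add: abs_mult power_mult_distrib)
qed

lemma sum_Times: "(\<Sum>p\<in>A \<times> B. f p) = (\<Sum>i\<in>A. \<Sum>j\<in>B. f (i, j))"
  by (simp add: sum.cartesian_product)

lemma sum_of_bool:
  assumes "finite A" "x \<in> A"
  shows "(\<Sum>k\<in>A. of_bool (k = x)) = (1::real)" "(\<Sum>k\<in>A. of_bool (x = k)) = (1::real)"
  using assms by (simp_all add: of_bool_def sum.delta sum.delta')

lemma sum_sum_of_bool:
  assumes "finite A"
  shows "(\<Sum>j\<in>A. \<Sum>k\<in>A. of_bool (j = k)) = real (card A)"
proof -
  have "(\<Sum>j\<in>A. \<Sum>k\<in>A. of_bool (j = k)) = (\<Sum>j\<in>A. 1 :: real)"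
    by (intro sum.cong refl sum_of_bool(2)[OF assms])
  then show ?thesis by simp
qed

lemma (in prob_space) integral_abs_le_sqrt:
  fixes f :: "'a \<Rightarrow> real"
  assumes "f \<in> borel_measurable M" "integrable M (\<lambda>x. (f x)\<^sup>2)" "(\<integral>x. (f x)\<^sup>2 \<partial>M) \<le> c"
  shows "(\<integral>x. \<bar>f x\<bar> \<partial>M) \<le> sqrt c"
proof -
  have "integrable M f" using square_integrable_imp_integrable[OF assms(1,2)] .
  then have "(\<integral>x. \<bar>f x\<bar> \<partial>M)\<^sup>2 \<le> (\<integral>x. \<bar>f x\<bar>\<^sup>2 \<partial>M)"
    using variance_positive[of "\<lambda>x. \<bar>f x\<bar>"] variance_eq[of "\<lambda>x. \<bar>f x\<bar>"] assms by simp
  then show ?thesis using assms(3) by (intro real_le_rsqrt) simp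
qed

context sample begin

text \<open>The majorant \<open>K\<close> is meant to be supported on the index patterns with
  nonzero expectation; summing it is then a counting problem.\<close>

lemma integral_square_sum_le:
  fixes F :: "'i \<Rightarrow> (nat \<Rightarrow> 'a) \<Rightarrow> real"
  assumes F: "\<And>p. p \<in> A \<Longrightarrow> bounded_measurable (F p)"
    and K: "\<And>p q. p \<in> A \<Longrightarrow> q \<in> A \<Longrightarrow> (\<integral>z. F p z * F q z \<partial>\<Omega>) \<le> K p q"
  shows "(\<integral>z. (\<Sum>p\<in>A. F p z)\<^sup>2 \<partial>\<Omega>) \<le> (\<Sum>p\<in>A. \<Sum>q\<in>A. K p q)"
proof -
  have "(\<integral>z. (\<Sum>p\<in>A. F p z)\<^sup>2 \<partial>\<Omega>) = (\<integral>z. (\<Sum>p\<in>A. \<Sum>q\<in>A. F p z * F q z) \<partial>\<Omega>)"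
    by (simp add: power2_eq_square sum_product)
  also have "\<dots> = (\<Sum>p\<in>A. \<Sum>q\<in>A. (\<integral>z. F p z * F q z \<partial>\<Omega>))"
    using F by (subst Bochner_Integration.integral_sum)
      (auto intro!: sum.cong Bochner_Integration.integral_sum bounded_measurable_integrable bounded_measurable_intros)
  also have "\<dots> \<le> (\<Sum>p\<in>A. \<Sum>q\<in>A. K p q)" by (intro sum_mono K)
  finally show ?thesis .
qed

end

text \<open>The intended \<open>h\<close> is the projection of a clipped kernel. Being built from
  bounded sections it is degenerate at every point of the space and not only almost everywhere,
  which allows conditioning on arbitrary values.\<close>

locale degenerate_kernel = sample +
  fixes h :: "'a \<Rightarrow> 'a \<Rightarrow> real" and c :: real
  assumes h_meas: "(\<lambda>(x, y). h x y) \<in> borel_measurable (Z \<Otimes>\<^sub>M Z)"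
    and h_bound: "\<And>x y. \<bar>h x y\<bar> \<le> c"
    and h_sym: "\<And>x y. x \<in> space Z \<Longrightarrow> y \<in> space Z \<Longrightarrow> h x y = h y x"
    and h_degen: "\<And>x. x \<in> space Z \<Longrightarrow> (\<integral>y. h x y \<partial>Z) = 0"
begin

abbreviation N :: nat where "N \<equiv> card I"

definition m2 :: real where "m2 = (\<integral>(x, y). (h x y)\<^sup>2 \<partial>(Z \<Otimes>\<^sub>M Z))"
definition m4 :: real where "m4 = (\<integral>(x, y). h x y ^ 4 \<partial>(Z \<Otimes>\<^sub>M Z))"
text \<open>As \<open>h\<close> is symmetric, \<open>H\<close> is the kernel of the square of its
  integral operator, and \<open>G\<close> is the squared Hilbert-Schmidt norm of that square, that
  is, the trace of the fourth power.\<close>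

definition H :: "'a \<Rightarrow> 'a \<Rightarrow> real" where "H x y = (\<integral>z. h z x * h z y \<partial>Z)"
definition G :: real where "G = (\<integral>(x, y). (H x y)\<^sup>2 \<partial>(Z \<Otimes>\<^sub>M Z))"

lemma h_meas'[measurable (raw)]:
  assumes "f \<in> M \<rightarrow>\<^sub>M Z" "g \<in> M \<rightarrow>\<^sub>M Z"
  shows "(\<lambda>u. h (f u) (g u)) \<in> borel_measurable M"
  using measurable_compose[OF measurable_Pair[OF assms] h_meas] by simp

lemma c0: "0 \<le> c" using h_bound[of undefined undefined] by linarith

lemma h_sq: "(h x y)\<^sup>2 \<le> c\<^sup>2"
  using h_bound[of x y] c0 by (metis abs_le_square_iff abs_of_nonneg)

lemma bounded_measurable_h: "i \<in> I \<Longrightarrow> j \<in> I \<Longrightarrow> bounded_measurable (\<lambda>z. h (z i) (z j))"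
  by (rule bounded_measurableI[where c=c]) (auto simp: h_bound)

lemmas bounded_measurable_rules = bounded_measurable_intros bounded_measurable_h

text \<open>A sample point occurring in a single factor is integrated out first.\<close>

lemma integral_kernel_eq_0_right:
  fixes F :: "(nat \<Rightarrow> 'a) \<Rightarrow> 'b::{banach,second_countable_topology}"
  assumes "i \<in> I" "l \<in> I" "i \<noteq> l" and F: "bounded_measurable F"
    and inv: "\<And>z x. z \<in> space \<Omega> \<Longrightarrow> x \<in> space Z \<Longrightarrow> F (z(l := x)) = F z"
  shows "(\<integral>z. h (z i) (z l) *\<^sub>R F z \<partial>\<Omega>) = 0"
proof -
  have "integrable \<Omega> (\<lambda>z. h (z i) (z l) *\<^sub>R F z)"
  proof (rule bounded_measurable_integrable)
    obtain d where d: "\<And>z. z \<in> space \<Omega> \<Longrightarrow> norm (F z) \<le> d" using F by (auto simp: bounded_measurable_def)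
    show "bounded_measurable (\<lambda>z. h (z i) (z l) *\<^sub>R F z)"
      using assms(1,2) F unfolding bounded_measurable_def
      by (auto intro!: exI[of _ "c * d"] mult_mono h_bound d c0)
  qed
  then have "(\<integral>z. h (z i) (z l) *\<^sub>R F z \<partial>\<Omega>)
      = (\<integral>z. (\<integral>x. h ((z(l := x)) i) ((z(l := x)) l) *\<^sub>R F (z(l := x)) \<partial>Z) \<partial>\<Omega>)"
    by (rule integral_resample[OF \<open>l \<in> I\<close>])
  also have "\<dots> = (\<integral>z. 0 \<partial>\<Omega>)"
  proof (rule Bochner_Integration.integral_cong)
    fix z assume z: "z \<in> space \<Omega>"
    have zi: "z i \<in> space Z" using space_\<Omega>[OF z \<open>i \<in> I\<close>] .
    have hi: "integrable Z (\<lambda>x. h (z i) x)"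
      by (rule integrable_const_bound[where B=c]) (use zi in \<open>auto simp: h_bound\<close>)
    have "(\<integral>x. h ((z(l := x)) i) ((z(l := x)) l) *\<^sub>R F (z(l := x)) \<partial>Z) = (\<integral>x. h (z i) x *\<^sub>R F z \<partial>Z)"
      using z \<open>i \<noteq> l\<close> by (intro Bochner_Integration.integral_cong) (auto simp: inv)
    also have "\<dots> = 0" using hi h_degen[OF zi] by simp
    finally show "(\<integral>x. h ((z(l := x)) i) ((z(l := x)) l) *\<^sub>R F (z(l := x)) \<partial>Z) = 0" .
  qed simp
  finally show ?thesis by simp
qed

lemma integral_kernel_eq_0_left:
  fixes F :: "(nat \<Rightarrow> 'a) \<Rightarrow> 'b::{banach,second_countable_topology}"
  assumes "i \<in> I" "l \<in> I" "i \<noteq> l" and F: "bounded_measurable F"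
    and inv: "\<And>z x. z \<in> space \<Omega> \<Longrightarrow> x \<in> space Z \<Longrightarrow> F (z(l := x)) = F z"
  shows "(\<integral>z. h (z l) (z i) *\<^sub>R F z \<partial>\<Omega>) = 0"
proof -
  have "(\<integral>z. h (z l) (z i) *\<^sub>R F z \<partial>\<Omega>) = (\<integral>z. h (z i) (z l) *\<^sub>R F z \<partial>\<Omega>)"
    using assms(1,2) by (intro Bochner_Integration.integral_cong) (auto simp: h_sym[OF space_\<Omega> space_\<Omega>])
  then show ?thesis using integral_kernel_eq_0_right[OF assms] by simp
qed

lemma moment:
  assumes "i \<in> I" "j \<in> I" "i \<noteq> j"
  shows "(\<integral>z. (h (z i) (z j))\<^sup>2 \<partial>\<Omega>) = m2" "(\<integral>z. h (z i) (z j) ^ 4 \<partial>\<Omega>) = m4"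
  unfolding m2_def m4_def by (rule integral_pair[OF assms]; measurable)+

lemma m4_nonneg: "0 \<le> m4" and m2_nonneg: "0 \<le> m2" and G_nonneg: "0 \<le> G"
  unfolding m4_def m2_def G_def by (auto intro!: integral_nonneg_AE)

text \<open>The inequality of arithmetic and geometric means bounds any mixed moment by
  \<open>m4\<close>, however the four index pairs overlap.\<close>

lemma integral_mult4_le:
  assumes "i1 \<in> I" "j1 \<in> I" "i1 \<noteq> j1" "i2 \<in> I" "j2 \<in> I" "i2 \<noteq> j2"
    "i3 \<in> I" "j3 \<in> I" "i3 \<noteq> j3" "i4 \<in> I" "j4 \<in> I" "i4 \<noteq> j4"
  shows "\<bar>\<integral>z. h (z i1) (z j1) * h (z i2) (z j2) * h (z i3) (z j3) * h (z i4) (z j4) \<partial>\<Omega>\<bar> \<le> m4"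
proof -
  let ?F = "\<lambda>z. (h (z i1) (z j1)^4 + h (z i2) (z j2)^4 + h (z i3) (z j3)^4 + h (z i4) (z j4)^4) / 4"
  have i: "integrable \<Omega> (\<lambda>z. h (z i) (z j)^4)" if "i \<in> I" "j \<in> I" for i j
    by (intro bounded_measurable_integrable bounded_measurable_rules that)
  have "\<bar>\<integral>z. h (z i1) (z j1) * h (z i2) (z j2) * h (z i3) (z j3) * h (z i4) (z j4) \<partial>\<Omega>\<bar> \<le> (\<integral>z. ?F z \<partial>\<Omega>)"
    unfolding real_norm_def[symmetric]
    by (rule norm_integral_le) (use abs_mult4_le in \<open>auto intro!: bounded_measurable_integrable bounded_measurable_rules assms\<close>)
  also have "\<dots> = m4" using assms by (simp add: i moment)
  finally show ?thesis .
qed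

text \<open>Given the observation \<open>i\<close>, the summands are independent and centered, so a
  product of four survives only if its indices pair up. There are three pairings with at most
  \<open>N\<^sup>2\<close> index choices each. The condition \<open>w i = 0\<close> removes the
  diagonal value of \<open>h\<close>.\<close>

lemma integral_quartic_linear_le:
  assumes i: "i \<in> I" and w: "\<And>j. j \<in> I \<Longrightarrow> \<bar>w j\<bar> \<le> \<beta>" and wi: "w i = 0"
  shows "(\<integral>z. (\<Sum>j\<in>I. w j * h (z i) (z j))^4 \<partial>\<Omega>) \<le> 3 * \<beta>^4 * real N ^ 2 * m4"
proof -
  have \<beta>0: "0 \<le> \<beta>" using w[OF i] by linarith
  define X where "X j z = w j * h (z i) (z j)" for j :: nat and z
  have bmX: "bounded_measurable (X j)" if "j \<in> I" for j unfolding X_def[abs_def] by (intro bounded_measurable_rules that i)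
  define K :: "nat \<times> nat \<Rightarrow> nat \<times> nat \<Rightarrow> real" where "K = (\<lambda>(j, k) (l, m). \<beta>^4 * m4 * (of_bool (j = k \<and> l = m)
      + of_bool (j = l \<and> k = m) + of_bool (j = m \<and> k = l)) :: real)"
  have "(\<integral>z. (\<Sum>j\<in>I. X j z)^4 \<partial>\<Omega>) = (\<integral>z. (\<Sum>p\<in>I \<times> I. X (fst p) z * X (snd p) z)\<^sup>2 \<partial>\<Omega>)"
  proof -
    have "(\<Sum>p\<in>I \<times> I. X (fst p) z * X (snd p) z) = (\<Sum>j\<in>I. X j z)\<^sup>2" for z
      by (simp add: sum_product sum.cartesian_product power2_eq_square split_beta)
    then show ?thesis by simp
  qed
  also have "\<dots> \<le> (\<Sum>p\<in>I \<times> I. \<Sum>q\<in>I \<times> I. K p q)"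
  proof (rule integral_square_sum_le)
    fix p assume p: "p \<in> I \<times> I"
    show "bounded_measurable (\<lambda>z. X (fst p) z * X (snd p) z)" using p by (auto intro!: bounded_measurable_intros bmX)
    fix q assume q: "q \<in> I \<times> I"
    obtain j k where jk: "p = (j, k)" "j \<in> I" "k \<in> I" using p by auto
    obtain l m where lm: "q = (l, m)" "l \<in> I" "m \<in> I" using q by auto
    let ?E = "\<integral>z. X (fst p) z * X (snd p) z * (X (fst q) z * X (snd q) z) \<partial>\<Omega>"
    let ?E' = "\<integral>z. h (z i) (z j) * h (z i) (z k) * h (z i) (z l) * h (z i) (z m) \<partial>\<Omega>"
    have "?E = (\<integral>z. (w j * w k * w l * w m) *
        (h (z i) (z j) * h (z i) (z k) * h (z i) (z l) * h (z i) (z m)) \<partial>\<Omega>)"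
      unfolding jk lm X_def by (intro Bochner_Integration.integral_cong refl) (simp add: mult_ac)
    then have E: "?E = w j * w k * w l * w m * ?E'"
      by (simp only: integral_mult_right_zero)
    have K0: "0 \<le> K p q"
      unfolding K_def jk(1) lm(1) prod.case
      by (intro mult_nonneg_nonneg add_nonneg_nonneg m4_nonneg zero_le_power \<beta>0) simp_all
    show "?E \<le> K p q"
    proof (cases "j = i \<or> k = i \<or> l = i \<or> m = i")
      case True then show ?thesis using K0 wi unfolding E by auto
    next
      case ne: False
      have z0: "(\<integral>z. h (z i) (z u) *\<^sub>R (h (z i) (z v1) * h (z i) (z v2) * h (z i) (z v3)) \<partial>\<Omega>) = 0"
        if "u \<in> I" "v1 \<in> I" "v2 \<in> I" "v3 \<in> I" "u \<noteq> i" "u \<notin> {v1, v2, v3}" for u v1 v2 v3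
        using that i by (intro integral_kernel_eq_0_right bounded_measurable_rules) auto
      consider "j \<notin> {k,l,m}" | "k \<notin> {j,l,m}" | "l \<notin> {j,k,m}" | "m \<notin> {j,k,l}"
        | "(j = k \<and> l = m) \<or> (j = l \<and> k = m) \<or> (j = m \<and> k = l)" by auto
      then show ?thesis
      proof cases
        case 1
        then have "?E' = 0" using z0[of j k l m] jk lm ne by (simp add: mult_ac)
        then show ?thesis using K0 unfolding E by simp
      next
        case 2
        then have "?E' = 0" using z0[of k j l m] jk lm ne by (simp add: mult_ac)
        then show ?thesis using K0 unfolding E by simp
      next
        case 3
        then have "?E' = 0" using z0[of l j k m] jk lm ne by (simp add: mult_ac)
        then show ?thesis using K0 unfolding E by simp
      next
        case 4
        then have "?E' = 0" using z0[of m j k l] jk lm ne by (simp add: mult_ac)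
        then show ?thesis using K0 unfolding E by simp
      next
        case 5
        have "\<bar>?E\<bar> = \<bar>w j\<bar> * \<bar>w k\<bar> * \<bar>w l\<bar> * \<bar>w m\<bar> * \<bar>?E'\<bar>" unfolding E by (simp add: abs_mult)
        also have "\<dots> \<le> \<beta> * \<beta> * \<beta> * \<beta> * m4"
          using ne jk lm i by (intro mult_mono w integral_mult4_le) (auto simp: \<beta>0)
        also have "\<dots> = \<beta>^4 * m4 * 1" by (simp add: eval_nat_numeral)
        also have "\<dots> \<le> K p q" unfolding K_def jk(1) lm(1) prod.case
          using 5 m4_nonneg by (intro mult_left_mono) auto
        finally show ?thesis by linarith
      qed
    qed
  qed
  also have "\<dots> = 3 * \<beta>^4 * real N ^ 2 * m4"
  proof -
    have "(\<Sum>p\<in>I \<times> I. \<Sum>q\<in>I \<times> I. K p q) = (\<Sum>j\<in>I. \<Sum>k\<in>I. \<Sum>l\<in>I. \<Sum>m\<in>I. K (j,k) (l,m))"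
      by (simp only: sum_Times)
    also have "\<dots> = \<beta>^4 * m4 * (\<Sum>j\<in>I. \<Sum>k\<in>I. \<Sum>l\<in>I. \<Sum>m\<in>I. of_bool (j = k) * of_bool (l = m)
      + of_bool (j = l) * of_bool (k = m) + of_bool (j = m) * of_bool (k = l))"
      by (simp add: K_def sum_distrib_left of_bool_conj mult_ac)
    also have "(\<Sum>j\<in>I. \<Sum>k\<in>I. \<Sum>l\<in>I. \<Sum>m\<in>I. of_bool (j = k) * of_bool (l = m)
      + of_bool (j = l) * of_bool (k = m) + of_bool (j = m) * of_bool (k = l)) = (3 * real N ^ 2 :: real)"
    proof -
      have "(\<Sum>l\<in>I. \<Sum>m\<in>I. of_bool (j = k) * of_bool (l = m) + of_bool (j = l) * of_bool (k = m)
          + of_bool (j = m) * of_bool (k = l)) = (of_bool (j = k) * real N + 1 + 1 :: real)"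
        if "j \<in> I" "k \<in> I" for j k
        by (simp only: sum.distrib sum_distrib_left[symmetric] sum_distrib_right[symmetric] sum_of_bool[OF finite_I that(1)]
            sum_of_bool[OF finite_I that(2)] sum_sum_of_bool[OF finite_I])
      then have "(\<Sum>j\<in>I. \<Sum>k\<in>I. \<Sum>l\<in>I. \<Sum>m\<in>I. of_bool (j = k) * of_bool (l = m) + of_bool (j = l) * of_bool (k = m)
          + of_bool (j = m) * of_bool (k = l)) = (\<Sum>j\<in>I. \<Sum>k\<in>I. of_bool (j = k) * real N + 1 + 1 :: real)"
        by (intro sum.cong refl)
      then show ?thesis
        by (simp only: sum.distrib sum_distrib_right[symmetric] sum_sum_of_bool[OF finite_I])
          (simp add: power2_eq_square)
    qed
    finally show ?thesis by simp
  qed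
  finally show ?thesis unfolding X_def .
qed

lemma integral_square_linear_le:
  assumes i: "i \<in> I" and w: "\<And>j. j \<in> I \<Longrightarrow> \<bar>w j\<bar> \<le> \<beta>" and wi: "w i = 0"
  shows "(\<integral>z. (\<Sum>j\<in>I. w j * h (z i) (z j))\<^sup>2 \<partial>\<Omega>) \<le> \<beta>\<^sup>2 * real N * m2"
proof -
  have \<beta>0: "0 \<le> \<beta>" using w[OF i] by linarith
  have "(\<integral>z. (\<Sum>j\<in>I. w j * h (z i) (z j))\<^sup>2 \<partial>\<Omega>) \<le> (\<Sum>j\<in>I. \<Sum>k\<in>I. \<beta>\<^sup>2 * m2 * of_bool (j = k))"
  proof (rule integral_square_sum_le)
    fix j assume j: "j \<in> I"
    show "bounded_measurable (\<lambda>z. w j * h (z i) (z j))" by (intro bounded_measurable_rules i j)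
    fix k assume k: "k \<in> I"
    have "(\<integral>z. w j * h (z i) (z j) * (w k * h (z i) (z k)) \<partial>\<Omega>)
        = (\<integral>z. (w j * w k) * (h (z i) (z j) * h (z i) (z k)) \<partial>\<Omega>)"
      by (intro Bochner_Integration.integral_cong refl) (simp add: mult_ac)
    then have E: "(\<integral>z. w j * h (z i) (z j) * (w k * h (z i) (z k)) \<partial>\<Omega>)
        = w j * w k * (\<integral>z. h (z i) (z j) * h (z i) (z k) \<partial>\<Omega>)"
      by (simp only: integral_mult_right_zero)
    show "(\<integral>z. w j * h (z i) (z j) * (w k * h (z i) (z k)) \<partial>\<Omega>) \<le> \<beta>\<^sup>2 * m2 * of_bool (j = k)"
    proof (cases "j = i \<or> k = i")
      case True
      then show ?thesis using wi m2_nonneg unfolding E by auto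
    next
      case ne: False
      show ?thesis
      proof (cases "j = k")
        case True
        have "w j * w j \<le> \<bar>w j\<bar> * \<bar>w j\<bar>" by (simp add: abs_mult_self_eq)
        also have "\<dots> \<le> \<beta> * \<beta>" by (intro mult_mono w j \<beta>0) auto
        finally show ?thesis using True ne moment(1)[OF i j] m2_nonneg unfolding E
          by (auto simp: power2_eq_square intro!: mult_right_mono)
      next
        case False
        have "(\<integral>z. h (z i) (z j) *\<^sub>R h (z i) (z k) \<partial>\<Omega>) = 0"
          using ne False by (intro integral_kernel_eq_0_right bounded_measurable_rules i j k) auto
        then show ?thesis using False unfolding E by simp
      qed
    qed
  qed
  also have "\<dots> = \<beta>\<^sup>2 * real N * m2"
    using finite_I by (simp add: sum_distrib_left[symmetric] of_bool_def if_distrib sum.delta cong: if_cong)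
  finally show ?thesis .
qed

text \<open>The squares are centered but not degenerate, so two of them are uncorrelated only when
  their index pairs are disjoint. Each pair meets at most \<open>4 * N\<close> others, which gives
  \<open>4 * N^3\<close> covariances.\<close>

lemma integral_square_diagonal_le:
  assumes a: "\<And>i j. i \<in> I \<Longrightarrow> j \<in> I \<Longrightarrow> \<bar>a i j\<bar> \<le> \<alpha>" and a0: "\<And>i. a i i = 0"
  shows "(\<integral>z. (\<Sum>i\<in>I. \<Sum>j\<in>I. a i j * ((h (z i) (z j))\<^sup>2 - m2))\<^sup>2 \<partial>\<Omega>) \<le> 4 * \<alpha>\<^sup>2 * real N ^ 3 * m4"
proof -
  define X where "X i j z = (h (z i) (z j))\<^sup>2 - m2" for i j :: nat and z
  have bmX: "bounded_measurable (X i j)" if "i \<in> I" "j \<in> I" for i j unfolding X_def[abs_def] by (intro bounded_measurable_rules that)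
  have XX: "\<bar>\<integral>z. X i j z * X k l z \<partial>\<Omega>\<bar> \<le> m4"
    if ij: "i \<in> I" "j \<in> I" "i \<noteq> j" and kl: "k \<in> I" "l \<in> I" "k \<noteq> l" for i j k l
  proof -
    \<comment> \<open>The variance of the squared kernel is \<open>m4 - m2\<^sup>2\<close>.\<close>
    have var: "(\<integral>z. (X u v z)\<^sup>2 \<partial>\<Omega>) \<le> m4" if uv: "u \<in> I" "v \<in> I" "u \<noteq> v" for u v
    proof -
      have eq: "(\<lambda>z. (X u v z)\<^sup>2) = (\<lambda>z. h (z u) (z v)^4 - 2 * m2 * (h (z u) (z v))\<^sup>2 + m2\<^sup>2)"
        by (auto simp: X_def power2_diff fun_eq_iff simp flip: power_mult)
      have "(\<integral>z. (X u v z)\<^sup>2 \<partial>\<Omega>) = m4 - 2 * m2 * m2 + m2\<^sup>2"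
        unfolding eq using uv
        by (simp add: moment \<Omega>.prob_space bounded_measurable_integrable bounded_measurable_rules)
      then show ?thesis by (simp add: power2_eq_square)
    qed
    have "\<bar>\<integral>z. X i j z * X k l z \<partial>\<Omega>\<bar> \<le> (\<integral>z. ((X i j z)\<^sup>2 + (X k l z)\<^sup>2) / 2 \<partial>\<Omega>)"
      unfolding real_norm_def[symmetric]
    proof (rule norm_integral_le)
      fix z
      show "norm (X i j z * X k l z) \<le> ((X i j z)\<^sup>2 + (X k l z)\<^sup>2) / 2"
        using sum_squares_bound[of "\<bar>X i j z\<bar>" "\<bar>X k l z\<bar>"] by (simp add: abs_mult)
    qed (intro bounded_measurable_integrable bounded_measurable_rules bmX ij kl)+
    also have "\<dots> = ((\<integral>z. (X i j z)\<^sup>2 \<partial>\<Omega>) + (\<integral>z. (X k l z)\<^sup>2 \<partial>\<Omega>)) / 2"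
      by (simp add: bounded_measurable_integrable bounded_measurable_rules bmX ij kl)
    also have "\<dots> \<le> m4" using var[OF ij] var[OF kl] by simp
    finally show ?thesis .
  qed
  have indep: "(\<integral>z. X i j z * X k l z \<partial>\<Omega>) = 0"
    if ij: "i \<in> I" "j \<in> I" "i \<noteq> j" and kl: "k \<in> I" "l \<in> I" and d: "k \<noteq> i" "k \<noteq> j" "l \<noteq> i" "l \<noteq> j" for i j k l
  proof -
    \<comment> \<open>\<open>r\<close> is the conditional mean of the centered square given its
      first point. Integrating out \<open>j\<close> and then \<open>i\<close> leaves the mean of
      \<open>r\<close>, which is zero.\<close>
    define r where "r x = (\<integral>y. (h x y)\<^sup>2 \<partial>Z) - m2" for x
    have r_meas[measurable]: "r \<in> borel_measurable Z" unfolding r_def by measurable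
    have r_b: "\<bar>r x\<bar> \<le> c\<^sup>2 + m2" for x
    proof -
      have "(\<integral>y. (h x y)\<^sup>2 \<partial>Z) \<le> c\<^sup>2"
        by (cases "integrable Z (\<lambda>y. (h x y)\<^sup>2)")
          (auto simp: not_integrable_integral_eq h_sq intro!: integral_le_const)
      moreover have "0 \<le> (\<integral>y. (h x y)\<^sup>2 \<partial>Z)" by simp
      ultimately show ?thesis using m2_nonneg unfolding r_def by linarith
    qed
    have bmr: "bounded_measurable (\<lambda>z. r (z i))" using ij r_b by (intro bounded_measurableI[where c="c\<^sup>2 + m2"]) auto
    have inth: "integrable Z (\<lambda>y. (h x y)\<^sup>2)" if "x \<in> space Z" for x
      using that by (intro integrable_const_bound[where B="c\<^sup>2"]) (auto simp: h_sq)
    have "(\<integral>z. X i j z * X k l z \<partial>\<Omega>) = (\<integral>z. (\<integral>x. X i j (z(j := x)) * X k l (z(j := x)) \<partial>Z) \<partial>\<Omega>)"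
      by (intro integral_resample bounded_measurable_integrable bounded_measurable_rules bmX ij kl)
    also have "\<dots> = (\<integral>z. r (z i) * X k l z \<partial>\<Omega>)"
    proof (rule Bochner_Integration.integral_cong)
      fix z assume z: "z \<in> space \<Omega>"
      have "(\<integral>x. X i j (z(j := x)) * X k l (z(j := x)) \<partial>Z) = (\<integral>x. ((h (z i) x)\<^sup>2 - m2) * X k l z \<partial>Z)"
        using d ij by (auto simp: X_def)
      also have "\<dots> = r (z i) * X k l z"
        using inth[OF space_\<Omega>[OF z ij(1)]] by (simp add: r_def prob_space)
      finally show "(\<integral>x. X i j (z(j := x)) * X k l (z(j := x)) \<partial>Z) = r (z i) * X k l z" .
    qed simp
    also have "\<dots> = (\<integral>z. (\<integral>x. r ((z(i := x)) i) * X k l (z(i := x)) \<partial>Z) \<partial>\<Omega>)"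
      by (intro integral_resample bounded_measurable_integrable bounded_measurable_intros bmr bmX ij kl)
    also have "\<dots> = (\<integral>z. (\<integral>x. r x \<partial>Z) * X k l z \<partial>\<Omega>)"
      using d by (intro Bochner_Integration.integral_cong) (auto simp: X_def)
    also have "(\<integral>x. r x \<partial>Z) = 0"
    proof -
      have hh: "integrable (Z \<Otimes>\<^sub>M Z) (\<lambda>(x, y). (h x y)\<^sup>2)"
        by (rule ZZ.integrable_const_bound[where B="c\<^sup>2"]) (auto simp: h_sq split_beta)
      have "m2 = (\<integral>x. (\<integral>y. (h x y)\<^sup>2 \<partial>Z) \<partial>Z)"
        unfolding m2_def using ZZ.integral_fst'[OF hh] by simp
      moreover have "integrable Z (\<lambda>x. \<integral>y. (h x y)\<^sup>2 \<partial>Z)"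
        using ZZ.integrable_fst'[OF hh] by simp
      ultimately show ?thesis by (simp add: r_def prob_space)
    qed
    finally show ?thesis by simp
  qed
  define K :: "nat \<times> nat \<Rightarrow> nat \<times> nat \<Rightarrow> real" where "K = (\<lambda>(i, j) (k, l). \<alpha>\<^sup>2 * m4 * (of_bool (k = i) + of_bool (k = j) + of_bool (l = i) + of_bool (l = j)) :: real)"
  have "(\<integral>z. (\<Sum>i\<in>I. \<Sum>j\<in>I. a i j * X i j z)\<^sup>2 \<partial>\<Omega>) = (\<integral>z. (\<Sum>p\<in>I \<times> I. a (fst p) (snd p) * X (fst p) (snd p) z)\<^sup>2 \<partial>\<Omega>)"
    by (simp add: sum.cartesian_product split_beta)
  also have "\<dots> \<le> (\<Sum>p\<in>I \<times> I. \<Sum>q\<in>I \<times> I. K p q)"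
  proof (rule integral_square_sum_le)
    fix p assume p: "p \<in> I \<times> I"
    show "bounded_measurable (\<lambda>z. a (fst p) (snd p) * X (fst p) (snd p) z)" using p by (auto intro!: bounded_measurable_intros bmX)
    fix q assume q: "q \<in> I \<times> I"
    obtain i j where ij: "p = (i, j)" "i \<in> I" "j \<in> I" using p by auto
    obtain k l where kl: "q = (k, l)" "k \<in> I" "l \<in> I" using q by auto
    have \<alpha>0: "0 \<le> \<alpha>" using a[OF ij(2,3)] by linarith
    let ?E = "\<integral>z. a (fst p) (snd p) * X (fst p) (snd p) z * (a (fst q) (snd q) * X (fst q) (snd q) z) \<partial>\<Omega>"
    let ?E' = "\<integral>z. X i j z * X k l z \<partial>\<Omega>"
    have "?E = (\<integral>z. (a i j * a k l) * (X i j z * X k l z) \<partial>\<Omega>)"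
      unfolding ij kl by (intro Bochner_Integration.integral_cong refl) (simp add: mult_ac)
    then have E: "?E = a i j * a k l * ?E'"
      by (simp only: integral_mult_right_zero)
    have K0: "0 \<le> K p q"
      unfolding K_def ij(1) kl(1) prod.case
      by (intro mult_nonneg_nonneg add_nonneg_nonneg m4_nonneg) simp_all
    show "?E \<le> K p q"
    proof (cases "i = j \<or> k = l")
      case True then show ?thesis using K0 a0 unfolding E by auto
    next
      case ne: False
      show ?thesis
      proof (cases "k = i \<or> k = j \<or> l = i \<or> l = j")
        case True
        have "?E \<le> \<bar>a i j\<bar> * \<bar>a k l\<bar> * \<bar>?E'\<bar>" unfolding E by (simp add: abs_mult[symmetric])
        also have "\<dots> \<le> \<alpha> * \<alpha> * m4" using ne ij kl by (intro mult_mono a XX) (auto simp: \<alpha>0)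
        also have "\<dots> = \<alpha>\<^sup>2 * m4 * 1" by (simp add: power2_eq_square)
        also have "\<dots> \<le> K p q" unfolding K_def ij(1) kl(1) prod.case
          using True m4_nonneg by (intro mult_left_mono) auto
        finally show ?thesis .
      next
        case False
        then show ?thesis using indep[OF ij(2,3) _ kl(2,3)] ne K0 unfolding E by simp
      qed
    qed
  qed
  also have "\<dots> = 4 * \<alpha>\<^sup>2 * real N ^ 3 * m4"
  proof -
    have "(\<Sum>p\<in>I \<times> I. \<Sum>q\<in>I \<times> I. K p q) = (\<Sum>i\<in>I. \<Sum>j\<in>I. \<Sum>k\<in>I. \<Sum>l\<in>I. K (i,j) (k,l))"
      by (simp only: sum_Times)
    also have "\<dots> = (\<Sum>i\<in>I. \<Sum>j\<in>I. \<alpha>\<^sup>2 * m4 * (\<Sum>k\<in>I. \<Sum>l\<in>I. 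
        of_bool (k = i) + of_bool (k = j) + of_bool (l = i) + of_bool (l = j)))"
      by (simp add: K_def sum_distrib_left)
    also have "\<dots> = (\<Sum>i\<in>I. \<Sum>j\<in>I. \<alpha>\<^sup>2 * m4 * (4 * real N))"
    proof (intro sum.cong refl arg_cong[where f="(*) (\<alpha>\<^sup>2 * m4)"])
      fix i j assume "i \<in> I" "j \<in> I"
      then show "(\<Sum>k\<in>I. \<Sum>l\<in>I. of_bool (k = i) + of_bool (k = j) + of_bool (l = i) + of_bool (l = j)) = 4 * real N"
        by (simp only: sum.distrib sum_constant sum_distrib_left[symmetric] sum_of_bool[OF finite_I])
    qed
    finally show ?thesis by (simp add: power2_eq_square eval_nat_numeral)
  qed
  finally show ?thesis unfolding X_def .
qed

end

context degenerate_kernel begin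

text \<open>The factors are the edges of the cycle i - j - l - k. Integrating out the opposite
  vertices \<open>l\<close> and \<open>i\<close> yields \<open>H (z j) (z k)\<close> twice.\<close>

lemma integral_4_cycle:
  assumes "i \<in> I" "l \<in> I" "j \<in> I" "k \<in> I" "i \<noteq> l" "j \<noteq> k" "i \<noteq> j" "i \<noteq> k" "l \<noteq> j" "l \<noteq> k"
  shows "(\<integral>z. (h (z i) (z j) * h (z i) (z k)) * (h (z l) (z j) * h (z l) (z k)) \<partial>\<Omega>) = G"
proof -
  have hz: "h u v = h u v * 1" for u v by simp
  have H_meas: "(\<lambda>(x, y). H x y) \<in> borel_measurable (Z \<Otimes>\<^sub>M Z)"
    unfolding H_def by measurable
  have H_meas': "(\<lambda>u. H (f u) (g u)) \<in> borel_measurable M" if "f \<in> M \<rightarrow>\<^sub>M Z" "g \<in> M \<rightarrow>\<^sub>M Z" for f g and M :: "'m measure"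
    using measurable_compose[OF measurable_Pair[OF that] H_meas] by simp
  have H_b: "\<bar>H x y\<bar> \<le> c\<^sup>2" if "x \<in> space Z" "y \<in> space Z" for x y
  proof -
    have i: "integrable Z (\<lambda>z. h z x * h z y)"
      using that by (intro integrable_const_bound[where B="c * c"])
        (auto simp: abs_mult intro!: mult_mono h_bound c0)
    have "norm (H x y) \<le> (\<integral>z. c * c \<partial>Z)" unfolding H_def
      by (rule norm_integral_le[OF i]) (auto simp: abs_mult intro!: mult_mono h_bound c0)
    then show ?thesis by (simp add: prob_space power2_eq_square)
  qed
  have bmH: "bounded_measurable (\<lambda>z. H (z j) (z k))"
    using assms by (intro bounded_measurableI[where c="c\<^sup>2"] H_meas') (auto intro!: H_b space_\<Omega>)
  have "(\<integral>z. (h (z i) (z j) * h (z i) (z k)) * (h (z l) (z j) * h (z l) (z k)) \<partial>\<Omega>)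
    = (\<integral>z. (\<integral>x. (h ((z(l := x)) i) ((z(l := x)) j) * h ((z(l := x)) i) ((z(l := x)) k))
        * (h ((z(l := x)) l) ((z(l := x)) j) * h ((z(l := x)) l) ((z(l := x)) k)) \<partial>Z) \<partial>\<Omega>)"
    by (intro integral_resample bounded_measurable_integrable bounded_measurable_rules assms)
  also have "\<dots> = (\<integral>z. (h (z i) (z j) * h (z i) (z k)) * H (z j) (z k) \<partial>\<Omega>)"
    using assms by (simp add: H_def)
  also have "\<dots> = (\<integral>z. (\<integral>x. (h ((z(i := x)) i) ((z(i := x)) j) * h ((z(i := x)) i) ((z(i := x)) k))
        * H ((z(i := x)) j) ((z(i := x)) k) \<partial>Z) \<partial>\<Omega>)"
    by (intro integral_resample bounded_measurable_integrable bounded_measurable_rules bmH assms)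
  also have "\<dots> = (\<integral>z. (H (z j) (z k))\<^sup>2 \<partial>\<Omega>)"
    using assms by (simp add: H_def power2_eq_square)
  also have "\<dots> = G"
    unfolding G_def by (rule integral_pair[OF assms(3,4,6)]) (use H_meas in measurable)
  finally show ?thesis .
qed

text \<open>Each summand is a path j - i - k with distinct ends. By degeneracy, two paths are
  correlated only if every end occurs again in the other path. Then either the second centre is a
  vertex of the first path, leaving at most 27 second paths per first path, or the two close up to a
  4-cycle, in at most \<open>2 * N\<close> ways. Hence \<open>G\<close> comes with
  \<open>N^4\<close>, but \<open>m4\<close> only with \<open>N^3\<close>.\<close>

lemma integral_square_offdiagonal_le:
  assumes w: "\<And>i j. i \<in> I \<Longrightarrow> j \<in> I \<Longrightarrow> \<bar>w i j\<bar> \<le> \<beta>" and w0: "\<And>i. w i i = 0"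
  shows "(\<integral>z. (\<Sum>i\<in>I. \<Sum>j\<in>I. \<Sum>k\<in>I. of_bool (j \<noteq> k) * (w i j * w i k) * (h (z i) (z j) * h (z i) (z k)))\<^sup>2 \<partial>\<Omega>)
    \<le> \<beta>^4 * (27 * real N ^ 3 * m4 + 2 * real N ^ 4 * G)"
proof -
  define F :: "nat \<times> nat \<times> nat \<Rightarrow> (nat \<Rightarrow> 'a) \<Rightarrow> real" where
    "F = (\<lambda>(i, j, k) z. of_bool (j \<noteq> k) * (w i j * w i k) * (h (z i) (z j) * h (z i) (z k)))"
  define K :: "nat \<times> nat \<times> nat \<Rightarrow> nat \<times> nat \<times> nat \<Rightarrow> real" where
    "K = (\<lambda>(i, j, k) (l, u, v). \<beta>^4 * (m4 * (of_bool (l \<in> {i,j,k}) * (of_bool (u \<in> {i,j,k}) * of_bool (v \<in> {i,j,k})))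
      + G * (of_bool (u = j) * of_bool (v = k) + of_bool (u = k) * of_bool (v = j))))"
  have "(\<integral>z. (\<Sum>i\<in>I. \<Sum>j\<in>I. \<Sum>k\<in>I. of_bool (j \<noteq> k) * (w i j * w i k) * (h (z i) (z j) * h (z i) (z k)))\<^sup>2 \<partial>\<Omega>)
      = (\<integral>z. (\<Sum>p\<in>I \<times> I \<times> I. F p z)\<^sup>2 \<partial>\<Omega>)"
    by (simp only: sum_Times) (simp add: F_def)
  also have "\<dots> \<le> (\<Sum>p\<in>I \<times> I \<times> I. \<Sum>q\<in>I \<times> I \<times> I. K p q)"
  proof (rule integral_square_sum_le)
    fix p assume p: "p \<in> I \<times> I \<times> I"
    obtain i j k where ijk: "p = (i, j, k)" "i \<in> I" "j \<in> I" "k \<in> I" using p by auto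
    show "bounded_measurable (F p)" unfolding F_def ijk(1) prod.case by (intro bounded_measurable_rules ijk)
    fix q assume q: "q \<in> I \<times> I \<times> I"
    obtain l u v where luv: "q = (l, u, v)" "l \<in> I" "u \<in> I" "v \<in> I" using q by auto
    have \<beta>0: "0 \<le> \<beta>" using w[OF ijk(2,3)] by linarith
    let ?E' = "\<integral>z. (h (z i) (z j) * h (z i) (z k)) * (h (z l) (z u) * h (z l) (z v)) \<partial>\<Omega>"
    let ?c = "(of_bool (j \<noteq> k) * (w i j * w i k)) * (of_bool (u \<noteq> v) * (w l u * w l v))"
    have "(\<integral>z. F p z * F q z \<partial>\<Omega>) = (\<integral>z. ?c * ((h (z i) (z j) * h (z i) (z k)) * (h (z l) (z u) * h (z l) (z v))) \<partial>\<Omega>)"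
      unfolding F_def ijk(1) luv(1) prod.case
      by (intro Bochner_Integration.integral_cong refl) (simp add: mult_ac)
    then have E: "(\<integral>z. F p z * F q z \<partial>\<Omega>) = ?c * ?E'" by (simp only: integral_mult_right_zero)
    have K0: "0 \<le> K p q" unfolding K_def ijk(1) luv(1) prod.case
      by (intro mult_nonneg_nonneg add_nonneg_nonneg m4_nonneg G_nonneg zero_le_power \<beta>0) simp_all
    show "(\<integral>z. F p z * F q z \<partial>\<Omega>) \<le> K p q"
    proof (cases "j = k \<or> u = v \<or> i = j \<or> i = k \<or> l = u \<or> l = v")
      case True
      then have "?c = 0" using w0 by auto
      then show ?thesis using K0 unfolding E by (simp only: mult_zero_left)
    next
      case ne: False
      have cb: "\<bar>?c\<bar> \<le> \<beta>^4"
      proof -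
        have "\<bar>?c\<bar> = \<bar>w i j\<bar> * \<bar>w i k\<bar> * (\<bar>w l u\<bar> * \<bar>w l v\<bar>)" using ne by (simp add: abs_mult)
        also have "\<dots> \<le> \<beta> * \<beta> * (\<beta> * \<beta>)" by (intro mult_mono w ijk luv) (auto simp: \<beta>0)
        finally show ?thesis by (simp add: eval_nat_numeral mult_ac)
      qed
      have z0: "(\<integral>z. (h (z a) (z b) * h (z a) (z e)) * (h (z f) (z x) * h (z f) (z y)) \<partial>\<Omega>) = 0"
        if "a \<in> I" "b \<in> I" "e \<in> I" "f \<in> I" "x \<in> I" "y \<in> I" "b \<noteq> a" "b \<noteq> e" "b \<notin> {f, x, y}" for a b e f x y
      proof -
        have "(\<integral>z. h (z a) (z b) *\<^sub>R (h (z a) (z e) * (h (z f) (z x) * h (z f) (z y))) \<partial>\<Omega>) = 0"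
          using that by (intro integral_kernel_eq_0_right bounded_measurable_rules) auto
        then show ?thesis by (simp add: mult_ac)
      qed
      have fin: ?thesis if "?E' = 0" using that K0 unfolding E by simp
      \<comment> \<open>If the second centre \<open>l\<close> is new, the distinct ends
        \<open>j\<close> and \<open>k\<close> can recur only as \<open>u\<close> and
        \<open>v\<close>.\<close>
      consider "j \<notin> {l,u,v}" | "k \<notin> {l,u,v}" | "u \<notin> {i,j,k}" | "v \<notin> {i,j,k}"
        | "l \<in> {i,j,k}" "u \<in> {i,j,k}" "v \<in> {i,j,k}"
        | "l \<notin> {i,j,k}" "(u = j \<and> v = k) \<or> (u = k \<and> v = j)"
        using ne by auto
      then show ?thesis
      proof cases
        case 1
        then show ?thesis using z0[of i j k l u v] ijk luv ne by (intro fin) auto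
      next
        case 2
        then show ?thesis using z0[of i k j l u v] ijk luv ne by (intro fin) (auto simp: mult_ac)
      next
        case 3
        then show ?thesis using z0[of l u v i j k] ijk luv ne by (intro fin) (auto simp: mult_ac)
      next
        case 4
        then show ?thesis using z0[of l v u i j k] ijk luv ne by (intro fin) (auto simp: mult_ac)
      next
        case 5
        have "\<bar>?E'\<bar> \<le> m4"
          using integral_mult4_le[of i j i k l u l v] ne ijk luv by (simp add: mult_ac)
        then have "\<bar>?c\<bar> * \<bar>?E'\<bar> \<le> \<beta>^4 * m4" using cb by (intro mult_mono) (auto simp: \<beta>0)
        also have "\<dots> \<le> K p q" unfolding K_def ijk(1) luv(1) prod.case
          using 5 m4_nonneg G_nonneg \<beta>0 by (intro mult_left_mono) auto
        finally show ?thesis unfolding E by (simp add: abs_mult[symmetric])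
      next
        case 6
        have "?E' = G"
          using 6(2)
        proof
          assume "u = j \<and> v = k"
          then show ?thesis using integral_4_cycle[of i l j k] 6(1) ne ijk luv by auto
        next
          assume *: "u = k \<and> v = j"
          have "?E' = (\<integral>z. (h (z i) (z j) * h (z i) (z k)) * (h (z l) (z j) * h (z l) (z k)) \<partial>\<Omega>)"
            using * by (intro Bochner_Integration.integral_cong refl) (simp add: mult_ac)
          then show ?thesis using integral_4_cycle[of i l j k] 6(1) ne ijk luv by auto
        qed
        then have "\<bar>?c\<bar> * \<bar>?E'\<bar> \<le> \<beta>^4 * G" using cb G_nonneg by (intro mult_mono) (auto simp: \<beta>0)
        also have "\<dots> \<le> K p q" unfolding K_def ijk(1) luv(1) prod.case
        proof (rule mult_left_mono)
          have "G * 1 \<le> G * (of_bool (u = j) * of_bool (v = k) + of_bool (u = k) * of_bool (v = j))"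
            using 6(2) G_nonneg by (intro mult_left_mono) auto
          moreover have "0 \<le> m4 * (of_bool (l \<in> {i,j,k}) * (of_bool (u \<in> {i,j,k}) * of_bool (v \<in> {i,j,k})))"
            using m4_nonneg by (intro mult_nonneg_nonneg) simp_all
          ultimately show "G \<le> m4 * (of_bool (l \<in> {i,j,k}) * (of_bool (u \<in> {i,j,k}) * of_bool (v \<in> {i,j,k})))
            + G * (of_bool (u = j) * of_bool (v = k) + of_bool (u = k) * of_bool (v = j))" by linarith
        qed (simp add: \<beta>0)
        finally show ?thesis unfolding E by (simp add: abs_mult[symmetric])
      qed
    qed
  qed
  also have "\<dots> \<le> (\<Sum>p\<in>I \<times> I \<times> I. \<beta>^4 * (27 * m4 + 2 * real N * G))"
  proof (rule sum_mono)
    fix p assume p: "p \<in> I \<times> I \<times> I"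
    obtain i j k where ijk: "p = (i, j, k)" "i \<in> I" "j \<in> I" "k \<in> I" using p by auto
    let ?s = "\<Sum>l\<in>I. of_bool (l \<in> {i,j,k}) :: real"
    have s: "?s \<le> 3"
    proof -
      have "?s \<le> (\<Sum>l\<in>I. of_bool (l = i) + of_bool (l = j) + of_bool (l = k))"
        by (intro sum_mono) auto
      also have "\<dots> = 3" by (simp only: sum.distrib sum_of_bool[OF finite_I] ijk)
      finally show ?thesis .
    qed
    have s0: "0 \<le> ?s" by (intro sum_nonneg) simp
    have s2: "?s * ?s \<le> 3 * 3" by (intro mult_mono s s0) simp
    have s3: "?s * (?s * ?s) \<le> 3 * (3 * 3)" by (intro mult_mono s s2 s0 mult_nonneg_nonneg) simp
    have "(\<Sum>q\<in>I \<times> I \<times> I. K p q) = \<beta>^4 * (m4 * (?s * (?s * ?s)) + G * (\<Sum>l\<in>I. 1 + 1))"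
      unfolding ijk(1) K_def prod.case
      by (simp only: sum_Times prod.case sum.distrib sum_distrib_left[symmetric] sum_distrib_right[symmetric]
          sum_of_bool[OF finite_I ijk(3)] sum_of_bool[OF finite_I ijk(4)] mult_1_left mult_1_right)
    also have "\<dots> = \<beta>^4 * (m4 * (?s * (?s * ?s)) + 2 * real N * G)" by simp
    also have "\<dots> \<le> \<beta>^4 * (27 * m4 + 2 * real N * G)"
      using mult_left_mono[OF s3 m4_nonneg] by (intro mult_left_mono) simp_all
    finally show "(\<Sum>q\<in>I \<times> I \<times> I. K p q) \<le> \<beta>^4 * (27 * m4 + 2 * real N * G)" .
  qed
  also have "\<dots> = \<beta>^4 * (27 * real N ^ 3 * m4 + 2 * real N ^ 4 * G)"
    by (simp add: card_cartesian_product eval_nat_numeral algebra_simps)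
  finally show ?thesis .
qed

end

section \<open>The Stein equation of the quadratic form\<close>

text \<open>With \<open>w_norm\<close> equal to 2 the form \<open>S\<close>, half an ordered double
  sum, has variance \<open>m2\<close>, which is close to 1 in the application.\<close>

locale quadratic_form = degenerate_kernel +
  fixes w :: "nat \<Rightarrow> nat \<Rightarrow> real" and \<beta> :: real
  assumes w_sym: "\<And>i j. w i j = w j i" and w_diag: "\<And>i. w i i = 0"
    and w_bound: "\<And>i j. i \<in> I \<Longrightarrow> j \<in> I \<Longrightarrow> \<bar>w i j\<bar> \<le> \<beta>"
    and w_norm: "(\<Sum>i\<in>I. \<Sum>j\<in>I. (w i j)\<^sup>2) = 2"
begin

definition L :: "nat \<Rightarrow> (nat \<Rightarrow> 'a) \<Rightarrow> real" where
  "L i z = (\<Sum>j\<in>I. w i j * h (z i) (z j))"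

definition S :: "(nat \<Rightarrow> 'a) \<Rightarrow> real" where
  "S z = (\<Sum>i\<in>I. L i z) / 2"

text \<open>The coefficient produced by the first-order expansion. Its mean is \<open>m2\<close>,
  because the cross terms of \<open>(L i)\<^sup>2\<close> are centered and the squared weights sum
  to 2.\<close>

definition Q :: "(nat \<Rightarrow> 'a) \<Rightarrow> real" where
  "Q z = (\<Sum>i\<in>I. (L i z)\<^sup>2) / 2"

lemma bounded_measurable_L: "i \<in> I \<Longrightarrow> bounded_measurable (L i)"
  unfolding L_def[abs_def] by (intro bounded_measurable_rules)

lemma bounded_measurable_S: "bounded_measurable S" and bounded_measurable_Q: "bounded_measurable Q"
  unfolding S_def[abs_def] Q_def[abs_def] by (intro bounded_measurable_rules bounded_measurable_L; assumption)+

lemma leave_one_out: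
  assumes i: "i \<in> I"
  shows "(\<integral>z. L i z *\<^sub>R iexp (t * (S z - L i z)) \<partial>\<Omega>) = 0"
proof -
  \<comment> \<open>\<open>R\<close> deletes row and column \<open>i\<close> from the double sum. By
    symmetry each of the two contributes \<open>L i\<close>, and the half in \<open>S\<close> leaves
    \<open>S - L i\<close>.\<close>
  define R where "R z = (\<Sum>k\<in>I - {i}. \<Sum>l\<in>I - {i}. w k l * h (z k) (z l)) / 2" for z
  have R: "S z - L i z = R z" if z: "z \<in> space \<Omega>" for z
  proof -
    let ?f = "\<lambda>k l. w k l * h (z k) (z l)"
    have sym: "?f k l = ?f l k" if "k \<in> I" "l \<in> I" for k l
      using w_sym[of k l] h_sym[OF space_\<Omega>[OF z that(1)] space_\<Omega>[OF z that(2)]] by simp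
    have r: "(\<Sum>l\<in>I. ?f k l) = ?f k i + (\<Sum>l\<in>I - {i}. ?f k l)" for k
      using sum.remove[OF finite_I i] .
    have "(\<Sum>k\<in>I. \<Sum>l\<in>I. ?f k l) = (\<Sum>l\<in>I. ?f i l) + (\<Sum>k\<in>I - {i}. \<Sum>l\<in>I. ?f k l)"
      using sum.remove[OF finite_I i] .
    also have "(\<Sum>k\<in>I - {i}. \<Sum>l\<in>I. ?f k l) = (\<Sum>k\<in>I - {i}. ?f k i) + 2 * R z"
      by (simp only: r sum.distrib R_def)
    also have "(\<Sum>k\<in>I - {i}. ?f k i) = (\<Sum>k\<in>I - {i}. ?f i k)"
      using sym i by (intro sum.cong refl) auto
    also have "\<dots> = (\<Sum>k\<in>I. ?f i k)" using r[of i] by (simp add: w_diag)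
    finally show ?thesis unfolding S_def L_def by (simp add: field_simps)
  qed
  have bmR: "bounded_measurable (\<lambda>z. iexp (t * R z))"
    unfolding R_def by (intro bounded_measurable_iexp bounded_measurable_rules; simp)
  have int: "integrable \<Omega> (\<lambda>z. (w i j * h (z i) (z j)) *\<^sub>R iexp (t * R z))" if "j \<in> I" for j
    unfolding scaleR_conv_of_real by (intro bounded_measurable_integrable bounded_measurable_rules bmR i that)
  have "(\<integral>z. L i z *\<^sub>R iexp (t * (S z - L i z)) \<partial>\<Omega>)
      = (\<integral>z. (\<Sum>j\<in>I. (w i j * h (z i) (z j)) *\<^sub>R iexp (t * R z)) \<partial>\<Omega>)"
    using R by (intro Bochner_Integration.integral_cong refl) (simp add: L_def scaleR_sum_left)
  also have "\<dots> = (\<Sum>j\<in>I. (\<integral>z. (w i j * h (z i) (z j)) *\<^sub>R iexp (t * R z) \<partial>\<Omega>))"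
    by (rule Bochner_Integration.integral_sum) (rule int)
  also have "\<dots> = (\<Sum>j\<in>I. 0)"
  proof (rule sum.cong[OF refl])
    fix j assume j: "j \<in> I"
    show "(\<integral>z. (w i j * h (z i) (z j)) *\<^sub>R iexp (t * R z) \<partial>\<Omega>) = 0"
    proof (cases "i = j")
      case False
      have "(\<integral>z. h (z j) (z i) *\<^sub>R iexp (t * R z) \<partial>\<Omega>) = 0"
        using False by (intro integral_kernel_eq_0_right j i bmR) (auto simp: R_def intro!: sum.cong)
      moreover have "(\<integral>z. (w i j * h (z i) (z j)) *\<^sub>R iexp (t * R z) \<partial>\<Omega>)
          = (\<integral>z. w i j *\<^sub>R (h (z j) (z i) *\<^sub>R iexp (t * R z)) \<partial>\<Omega>)"
        using i j by (intro Bochner_Integration.integral_cong refl) (simp add: h_sym[OF space_\<Omega> space_\<Omega>])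
      ultimately show ?thesis by (simp only: integral_scaleR_right) simp
    qed (simp add: w_diag)
  qed
  finally show ?thesis by simp
qed

text \<open>Write \<open>iexp (t * (S - L i))\<close> as \<open>iexp (t * S)\<close> times
  \<open>1 - \<i> * t * L i\<close> plus a remainder of size
  \<open>t\<^sup>2 * (L i)\<^sup>2 / 2\<close>. Multiplied by \<open>L i\<close>, summed and halved,
  this is \<open>iexp (t * S) * (S - \<i> * t * Q)\<close> plus cubic terms. Its integral vanishes
  by \<open>leave_one_out\<close>, and replacing \<open>Q\<close> by 1 costs the first error
  term.\<close>

lemma stein_bound:
  "cmod ((\<integral>z. S z * iexp (t * S z) \<partial>\<Omega>) - \<i> * t * (\<integral>z. iexp (t * S z) \<partial>\<Omega>))
    \<le> \<bar>t\<bar> * (\<integral>z. \<bar>Q z - 1\<bar> \<partial>\<Omega>) + t\<^sup>2 * ((\<Sum>i\<in>I. (\<integral>z. \<bar>L i z\<bar>^3 \<partial>\<Omega>)) / 4)"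
proof -
  \<comment> \<open>The subtracted sum has integral zero and makes the difference small
    pointwise.\<close>
  define X where "X z = S z * iexp (t * S z) - \<i> * t * iexp (t * S z)
    - (\<Sum>i\<in>I. L i z *\<^sub>R iexp (t * (S z - L i z))) / 2" for z
  note b = bounded_measurable_integrable bounded_measurable_iexp bounded_measurable_rules bounded_measurable_S bounded_measurable_L bounded_measurable_Q
  have int: "integrable \<Omega> (\<lambda>z. L i z *\<^sub>R iexp (t * (S z - L i z)))" if "i \<in> I" for i
    unfolding scaleR_conv_of_real using that by (intro b)
  have bound: "cmod (X z) \<le> \<bar>t\<bar> * \<bar>Q z - 1\<bar> + t\<^sup>2 * ((\<Sum>i\<in>I. \<bar>L i z\<bar>^3) / 4)" for z
  proof -
    define r where "r i = iexp (- (t * L i z)) - (\<Sum>k\<le>1. (\<i> * - (t * L i z))^k / fact k)" for i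
    have rb: "cmod (r i) \<le> t\<^sup>2 * (L i z)\<^sup>2 / 2" for i
      using iexp_approx1[of "- (t * L i z)" 1] unfolding r_def
      by (simp add: abs_mult power_mult_distrib power2_eq_square[symmetric])
    have e: "iexp (t * (S z - L i z)) = iexp (t * S z) * (1 - \<i> * t * L i z + r i)" for i
    proof -
      have "iexp (t * (S z - L i z)) = iexp (t * S z) * iexp (- (t * L i z))"
        by (simp add: exp_add[symmetric] algebra_simps)
      then show ?thesis by (simp add: r_def)
    qed
    have "X z = iexp (t * S z) * (\<i> * t * of_real (Q z - 1) - (\<Sum>i\<in>I. L i z * r i) / 2)"
    proof -
      have "(\<Sum>i\<in>I. L i z *\<^sub>R iexp (t * (S z - L i z))) =
          iexp (t * S z) * (\<Sum>i\<in>I. L i z - \<i> * t * (L i z)\<^sup>2 + L i z * r i)"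
        unfolding e sum_distrib_left
        by (intro sum.cong refl) (simp add: scaleR_conv_of_real algebra_simps power2_eq_square)
      also have "(\<Sum>i\<in>I. L i z - \<i> * t * (L i z)\<^sup>2 + L i z * r i)
          = 2 * S z - \<i> * t * (2 * Q z) + (\<Sum>i\<in>I. L i z * r i)"
      proof -
        have "(\<Sum>i\<in>I. complex_of_real (L i z)) = 2 * S z" "(\<Sum>i\<in>I. (complex_of_real (L i z))\<^sup>2) = 2 * Q z"
          unfolding S_def Q_def by simp_all
        then show ?thesis by (simp only: sum.distrib sum_subtractf sum_distrib_left[symmetric] of_real_power)
      qed
      finally have s: "(\<Sum>i\<in>I. L i z *\<^sub>R iexp (t * (S z - L i z)))
          = iexp (t * S z) * (2 * S z - \<i> * t * (2 * Q z) + (\<Sum>i\<in>I. L i z * r i))" .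
      show ?thesis unfolding X_def s by (simp add: field_simps)
    qed
    then have "cmod (X z) = cmod (\<i> * t * of_real (Q z - 1) - (\<Sum>i\<in>I. L i z * r i) / 2)"
      by (simp add: norm_mult)
    also have "\<dots> \<le> cmod (\<i> * t * of_real (Q z - 1)) + cmod ((\<Sum>i\<in>I. L i z * r i) / 2)" by (rule norm_triangle_ineq4)
    also have "cmod (\<i> * t * of_real (Q z - 1)) = \<bar>t\<bar> * \<bar>Q z - 1\<bar>"
      by (simp only: norm_mult norm_of_real norm_ii mult_1_left)
    also have "cmod ((\<Sum>i\<in>I. L i z * r i) / 2) \<le> (\<Sum>i\<in>I. t\<^sup>2 * (\<bar>L i z\<bar>^3 / 2)) / 2"
    proof -
      have "cmod (\<Sum>i\<in>I. L i z * r i) \<le> (\<Sum>i\<in>I. t\<^sup>2 * (\<bar>L i z\<bar>^3 / 2))"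
      proof (rule sum_norm_le)
        fix i
        have "cmod (L i z * r i) \<le> \<bar>L i z\<bar> * (t\<^sup>2 * (L i z)\<^sup>2 / 2)"
          unfolding norm_mult norm_of_real by (intro mult_left_mono rb) simp
        also have "\<dots> = t\<^sup>2 * (\<bar>L i z\<bar>^3 / 2)"
          by (simp add: eval_nat_numeral abs_if)
        finally show "cmod (L i z * r i) \<le> t\<^sup>2 * (\<bar>L i z\<bar>^3 / 2)" .
      qed
      then show ?thesis by (simp add: norm_divide)
    qed
    also have "(\<Sum>i\<in>I. t\<^sup>2 * (\<bar>L i z\<bar>^3 / 2)) / 2 = t\<^sup>2 * ((\<Sum>i\<in>I. \<bar>L i z\<bar>^3) / 4)"
      by (simp add: sum_distrib_left[symmetric] sum_divide_distrib[symmetric])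
    finally show ?thesis by simp
  qed
  have bmX: "bounded_measurable X" unfolding X_def[abs_def] scaleR_conv_of_real by (intro b)
  have "(\<integral>z. X z \<partial>\<Omega>) = (\<integral>z. S z * iexp (t * S z) \<partial>\<Omega>) - \<i> * t * (\<integral>z. iexp (t * S z) \<partial>\<Omega>)
      - (\<Sum>i\<in>I. (\<integral>z. L i z *\<^sub>R iexp (t * (S z - L i z)) \<partial>\<Omega>)) / 2"
  proof -
    have 1: "integrable \<Omega> (\<lambda>z. S z * iexp (t * S z))" "integrable \<Omega> (\<lambda>z. \<i> * t * iexp (t * S z))"
      by (intro b)+
    have 2: "integrable \<Omega> (\<lambda>z. (\<Sum>i\<in>I. L i z *\<^sub>R iexp (t * (S z - L i z))) / 2)"
      by (intro integrable_divide Bochner_Integration.integrable_sum int)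
    show ?thesis unfolding X_def
      by (simp only: Bochner_Integration.integral_diff[OF Bochner_Integration.integrable_diff[OF 1] 2]
          Bochner_Integration.integral_diff[OF 1] integral_mult_right_zero integral_divide_zero
          Bochner_Integration.integral_sum[OF int])
  qed
  also have "(\<Sum>i\<in>I. (\<integral>z. L i z *\<^sub>R iexp (t * (S z - L i z)) \<partial>\<Omega>)) = 0"
    by (intro sum.neutral ballI leave_one_out)
  finally have "cmod ((\<integral>z. S z * iexp (t * S z) \<partial>\<Omega>) - \<i> * t * (\<integral>z. iexp (t * S z) \<partial>\<Omega>)) = cmod (\<integral>z. X z \<partial>\<Omega>)"
    by simp
  also have "\<dots> \<le> (\<integral>z. \<bar>t\<bar> * \<bar>Q z - 1\<bar> + t\<^sup>2 * ((\<Sum>i\<in>I. \<bar>L i z\<bar>^3) / 4) \<partial>\<Omega>)"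
    by (rule norm_integral_le) (use bound in \<open>auto intro!: b bmX\<close>)
  also have "\<dots> = \<bar>t\<bar> * (\<integral>z. \<bar>Q z - 1\<bar> \<partial>\<Omega>) + t\<^sup>2 * ((\<Sum>i\<in>I. (\<integral>z. \<bar>L i z\<bar>^3 \<partial>\<Omega>)) / 4)"
    by (subst Bochner_Integration.integral_add) (auto intro!: b simp: b)
  finally show ?thesis .
qed

text \<open>Expanding \<open>(L i)\<^sup>2\<close> splits \<open>Q - 1\<close> into the bias
  \<open>m2 - 1\<close>, the centered squares \<open>D\<close> and the cross terms \<open>B\<close>;
  the last two are bounded through their second moments.\<close>

lemma integral_Q_minus_1_le:
  "(\<integral>z. \<bar>Q z - 1\<bar> \<partial>\<Omega>) \<le> \<bar>m2 - 1\<bar> + sqrt (\<beta>^4 * real N ^ 3 * m4)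
    + sqrt (\<beta>^4 * (27 * real N ^ 3 * m4 + 2 * real N ^ 4 * G)) / 2"
proof -
  define D where "D z = (\<Sum>i\<in>I. \<Sum>j\<in>I. ((w i j)\<^sup>2 / 2) * ((h (z i) (z j))\<^sup>2 - m2))" for z
  define B where "B z = (\<Sum>i\<in>I. \<Sum>j\<in>I. \<Sum>k\<in>I. of_bool (j \<noteq> k) * (w i j * w i k) * (h (z i) (z j) * h (z i) (z k)))" for z
  have bmD: "bounded_measurable D" and bmB: "bounded_measurable B"
    unfolding D_def[abs_def] B_def[abs_def] by (intro bounded_measurable_rules; assumption)+
  have Q: "Q z - 1 = (m2 - 1) + D z + B z / 2" for z
  proof -
    have "(L i z)\<^sup>2 = (\<Sum>j\<in>I. (w i j)\<^sup>2 * (h (z i) (z j))\<^sup>2)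
        + (\<Sum>j\<in>I. \<Sum>k\<in>I. of_bool (j \<noteq> k) * (w i j * w i k) * (h (z i) (z j) * h (z i) (z k)))" for i
    proof -
      have "(L i z)\<^sup>2 = (\<Sum>j\<in>I. \<Sum>k\<in>I. (w i j * w i k) * (h (z i) (z j) * h (z i) (z k)))"
        by (simp add: L_def power2_eq_square sum_product mult_ac)
      also have "\<dots> = (\<Sum>j\<in>I. (\<Sum>k\<in>I. of_bool (k = j) * ((w i j)\<^sup>2 * (h (z i) (z j))\<^sup>2))
          + (\<Sum>k\<in>I. of_bool (j \<noteq> k) * (w i j * w i k) * (h (z i) (z j) * h (z i) (z k))))"
        unfolding sum.distrib[symmetric]
        by (intro sum.cong refl) (auto simp: power2_eq_square)
      also have "\<dots> = (\<Sum>j\<in>I. (w i j)\<^sup>2 * (h (z i) (z j))\<^sup>2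
          + (\<Sum>k\<in>I. of_bool (j \<noteq> k) * (w i j * w i k) * (h (z i) (z j) * h (z i) (z k))))"
        by (intro sum.cong refl arg_cong2[where f="(+)"])
          (simp only: sum_distrib_right[symmetric] sum_of_bool[OF finite_I] mult_1_left)
      finally show ?thesis by (simp only: sum.distrib)
    qed
    then have "2 * Q z = (\<Sum>i\<in>I. \<Sum>j\<in>I. (w i j)\<^sup>2 * (h (z i) (z j))\<^sup>2) + B z"
      unfolding Q_def B_def by (simp add: sum.distrib)
    moreover have "2 * D z = (\<Sum>i\<in>I. \<Sum>j\<in>I. (w i j)\<^sup>2 * (h (z i) (z j))\<^sup>2) - m2 * (\<Sum>i\<in>I. \<Sum>j\<in>I. (w i j)\<^sup>2)"
      unfolding D_def sum_distrib_left sum_subtractf[symmetric]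
      by (intro sum.cong refl) (simp add: algebra_simps)
    ultimately show ?thesis by (simp add: w_norm field_simps)
  qed
  note b = bounded_measurable_integrable bounded_measurable_rules bmD bmB
  have half: "\<bar>(w i j)\<^sup>2 / 2\<bar> \<le> \<beta>\<^sup>2 / 2" if "i \<in> I" "j \<in> I" for i j
    using power_mono[OF w_bound[OF that] abs_ge_zero, of 2] by simp
  have "(\<integral>z. (D z)\<^sup>2 \<partial>\<Omega>) \<le> 4 * (\<beta>\<^sup>2 / 2)\<^sup>2 * real N ^ 3 * m4"
    unfolding D_def by (rule integral_square_diagonal_le) (use half in \<open>simp_all add: w_diag\<close>)
  also have "\<dots> = \<beta>^4 * real N ^ 3 * m4" by (simp add: power_divide)
  finally have D1: "(\<integral>z. \<bar>D z\<bar> \<partial>\<Omega>) \<le> sqrt (\<beta>^4 * real N ^ 3 * m4)"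
    using bmD by (intro \<Omega>.integral_abs_le_sqrt) (auto simp: bounded_measurable_def intro!: b)
  have "(\<integral>z. (B z)\<^sup>2 \<partial>\<Omega>) \<le> \<beta>^4 * (27 * real N ^ 3 * m4 + 2 * real N ^ 4 * G)"
    unfolding B_def by (rule integral_square_offdiagonal_le) (auto simp: w_bound w_diag)
  then have B1: "(\<integral>z. \<bar>B z\<bar> \<partial>\<Omega>) \<le> sqrt (\<beta>^4 * (27 * real N ^ 3 * m4 + 2 * real N ^ 4 * G))"
    using bmB by (intro \<Omega>.integral_abs_le_sqrt) (auto simp: bounded_measurable_def intro!: b)
  have "(\<integral>z. \<bar>Q z - 1\<bar> \<partial>\<Omega>) \<le> (\<integral>z. \<bar>m2 - 1\<bar> + \<bar>D z\<bar> + \<bar>B z\<bar> / 2 \<partial>\<Omega>)"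
    by (intro integral_mono b bounded_measurable_Q) (simp add: Q)
  also have "\<dots> = \<bar>m2 - 1\<bar> + (\<integral>z. \<bar>D z\<bar> \<partial>\<Omega>) + (\<integral>z. \<bar>B z\<bar> \<partial>\<Omega>) / 2"
    by (simp add: b \<Omega>.prob_space)
  finally show ?thesis using D1 B1 by simp
qed

text \<open>The third absolute moment is interpolated between the second and the fourth by
  \<open>0 \<le> y\<^sup>2 * (\<eta> - \<bar>y\<bar>)\<^sup>2\<close>; the parameter
  \<open>\<eta>\<close> stays free so that the two terms can be balanced later.\<close>

lemma sum_integral_cube_le:
  assumes \<eta>: "0 < \<eta>"
  shows "(\<Sum>i\<in>I. (\<integral>z. \<bar>L i z\<bar>^3 \<partial>\<Omega>)) / 4
    \<le> (\<eta> * (\<beta>\<^sup>2 * real N ^ 2 * m2) + 3 * \<beta>^4 * real N ^ 3 * m4 / \<eta>) / 8"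
proof -
  note b = bounded_measurable_integrable bounded_measurable_rules bounded_measurable_L
  have one: "(\<integral>z. \<bar>L i z\<bar>^3 \<partial>\<Omega>) \<le> (\<eta> * (\<beta>\<^sup>2 * real N * m2) + 3 * \<beta>^4 * real N ^ 2 * m4 / \<eta>) / 2"
    if i: "i \<in> I" for i
  proof -
    have pw: "\<bar>y\<bar>^3 \<le> (\<eta> * y\<^sup>2 + y^4 / \<eta>) / 2" for y :: real
    proof -
      have "0 \<le> \<bar>y\<bar>\<^sup>2 * (\<eta> - \<bar>y\<bar>)\<^sup>2" by simp
      also have "\<dots> = \<eta>\<^sup>2 * y\<^sup>2 + y^4 - 2 * (\<eta> * \<bar>y\<bar>^3)"
        by (simp add: power2_diff eval_nat_numeral algebra_simps abs_if)
      finally show ?thesis using \<eta> by (simp add: field_simps power2_eq_square)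
    qed
    have "(\<integral>z. \<bar>L i z\<bar>^3 \<partial>\<Omega>) \<le> (\<integral>z. (\<eta> * (L i z)\<^sup>2 + (L i z)^4 / \<eta>) / 2 \<partial>\<Omega>)"
      by (intro integral_mono b i pw)
    also have "\<dots> = (\<eta> * (\<integral>z. (L i z)\<^sup>2 \<partial>\<Omega>) + (\<integral>z. (L i z)^4 \<partial>\<Omega>) / \<eta>) / 2"
      by (simp add: b i)
    also have "\<dots> \<le> (\<eta> * (\<beta>\<^sup>2 * real N * m2) + (3 * \<beta>^4 * real N ^ 2 * m4) / \<eta>) / 2"
      unfolding L_def using \<eta> i
      by (intro divide_right_mono add_mono mult_left_mono integral_square_linear_le integral_quartic_linear_le)
        (auto simp: w_bound w_diag)
    finally show ?thesis .
  qed
  have "(\<Sum>i\<in>I. (\<integral>z. \<bar>L i z\<bar>^3 \<partial>\<Omega>)) \<le> (\<Sum>i\<in>I. (\<eta> * (\<beta>\<^sup>2 * real N * m2) + 3 * \<beta>^4 * real N ^ 2 * m4 / \<eta>) / 2)"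
    by (intro sum_mono one)
  also have "\<dots> = real N * ((\<eta> * (\<beta>\<^sup>2 * real N * m2) + 3 * \<beta>^4 * real N ^ 2 * m4 / \<eta>) / 2)" by simp
  also have "\<dots> = (\<eta> * (\<beta>\<^sup>2 * real N ^ 2 * m2) + 3 * \<beta>^4 * real N ^ 3 * m4 / \<eta>) / 2"
    by (simp add: eval_nat_numeral algebra_simps add_divide_distrib)
  finally show ?thesis by simp
qed

text \<open>The exponents of \<open>\<epsilon>\<close> are those of the truncation level \<open>\<epsilon>\<^sup>2 \<surd>N\<close> chosen below.\<close>

lemma kolmogorov_S:
  assumes \<epsilon>: "0 < \<epsilon>" "\<epsilon> \<le> 1" and \<kappa>: "1 \<le> \<kappa>" "\<beta> = \<kappa> / real N" and N: "0 < N"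
    and m4: "m4 \<le> 256 * real N * \<epsilon>^10" and m2: "m2 \<le> 4" "\<bar>m2 - 1\<bar> \<le> 3 * \<epsilon>^3" and G: "G \<le> 22 * \<epsilon>^6"
  shows "\<bar>measure \<Omega> {z \<in> space \<Omega>. S z \<le> x} - cdf std_normal_distribution x\<bar> \<le> 640 * \<kappa>^4 * \<epsilon>\<^sup>2"
proof -
  have NN: "0 < real N" using N by simp
  have \<kappa>2: "1 \<le> \<kappa>\<^sup>2" "\<kappa>\<^sup>2 \<le> \<kappa>^4" "1 \<le> \<kappa>^4"
    using \<kappa> by (auto simp: power_increasing)
  have e: "\<epsilon>^5 \<le> \<epsilon>^3" "\<epsilon>^10 \<le> \<epsilon>^6" "\<epsilon>^3 \<le> \<epsilon>^2" using \<epsilon> by (auto intro!: power_decreasing)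
  have m4': "\<beta>^4 * real N ^ 3 * m4 \<le> 256 * \<kappa>^4 * \<epsilon>^10"
  proof -
    have "\<beta>^4 * real N ^ 3 * m4 \<le> \<beta>^4 * real N ^ 3 * (256 * real N * \<epsilon>^10)"
      using m4 by (intro mult_left_mono) auto
    also have "\<dots> = 256 * \<kappa>^4 * \<epsilon>^10" using NN by (simp add: \<kappa>(2) field_simps eval_nat_numeral)
    finally show ?thesis .
  qed
  have 1: "sqrt (\<beta>^4 * real N ^ 3 * m4) \<le> 16 * \<kappa>\<^sup>2 * \<epsilon>^3"
  proof -
    have "256 * \<kappa>^4 * \<epsilon>^10 \<le> 256 * \<kappa>^4 * \<epsilon>^6" using e by (intro mult_left_mono) auto
    also have "\<dots> = (16 * \<kappa>\<^sup>2 * \<epsilon>^3)\<^sup>2" by (simp add: power_mult_distrib flip: power_mult)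
    finally show ?thesis using m4' \<epsilon> by (intro real_le_lsqrt) auto
  qed
  have 2: "sqrt (\<beta>^4 * (27 * real N ^ 3 * m4 + 2 * real N ^ 4 * G)) \<le> 84 * \<kappa>\<^sup>2 * \<epsilon>^3"
  proof -
    have "\<beta>^4 * (27 * real N ^ 3 * m4 + 2 * real N ^ 4 * G) = 27 * (\<beta>^4 * real N ^ 3 * m4) + 2 * \<kappa>^4 * G"
      using NN by (simp add: \<kappa>(2) field_simps)
    also have "\<dots> \<le> 27 * (256 * \<kappa>^4 * \<epsilon>^6) + 2 * \<kappa>^4 * (22 * \<epsilon>^6)"
    proof (intro add_mono mult_left_mono G)
      have "256 * \<kappa>^4 * \<epsilon>^10 \<le> 256 * \<kappa>^4 * \<epsilon>^6" using e by (intro mult_left_mono) auto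
      then show "\<beta>^4 * real N ^ 3 * m4 \<le> 256 * \<kappa>^4 * \<epsilon>^6" using m4' by linarith
    qed auto
    \<comment> \<open>The constant 84 suffices because 27 * 256 + 44 = 6956, while its square is
      7056.\<close>
    also have "\<dots> \<le> (84 * \<kappa>\<^sup>2 * \<epsilon>^3)\<^sup>2"
      by (simp add: power_mult_distrib mult_right_mono flip: power_mult)
    finally show ?thesis using \<epsilon> by (intro real_le_lsqrt) auto
  qed
  define a where "a = (\<integral>z. \<bar>Q z - 1\<bar> \<partial>\<Omega>)"
  define b where "b = (\<Sum>i\<in>I. (\<integral>z. \<bar>L i z\<bar>^3 \<partial>\<Omega>)) / 4"
  have a0: "0 \<le> a" by (simp add: a_def)
  have b0: "0 \<le> b" by (auto simp: b_def intro!: sum_nonneg)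
  have a: "a \<le> 61 * \<kappa>\<^sup>2 * \<epsilon>^3"
  proof -
    \<comment> \<open>Bias, diagonal and cross terms contribute 3 + 16 + 84 / 2 = 61.\<close>
    have "a \<le> 3 * \<epsilon>^3 + 16 * \<kappa>\<^sup>2 * \<epsilon>^3 + 84 * \<kappa>\<^sup>2 * \<epsilon>^3 / 2"
      unfolding a_def by (rule order_trans[OF integral_Q_minus_1_le]) (intro add_mono divide_right_mono m2 1 2; simp)
    also have "3 * \<epsilon>^3 \<le> 3 * \<kappa>\<^sup>2 * \<epsilon>^3" using \<kappa>2 \<epsilon> by (intro mult_right_mono) auto
    finally show ?thesis by (simp add: mult_ac)
  qed
  have b: "b \<le> 97 * \<kappa>^4 * \<epsilon>^5"
  proof -
    \<comment> \<open>The interpolation parameter \<open>\<epsilon>^5\<close> puts both terms at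
      order \<open>\<epsilon>^5\<close>, with constant (4 + 3 * 256) / 8 = 193 / 2.\<close>
    have "b \<le> (\<epsilon>^5 * (\<beta>\<^sup>2 * real N ^ 2 * m2) + 3 * (\<beta>^4 * real N ^ 3 * m4) / \<epsilon>^5) / 8"
      unfolding b_def using sum_integral_cube_le[of "\<epsilon>^5"] \<epsilon> by (simp add: mult.assoc)
    also have "\<dots> \<le> (\<epsilon>^5 * (\<kappa>^4 * 4) + 3 * (256 * \<kappa>^4 * \<epsilon>^10) / \<epsilon>^5) / 8"
    proof (intro divide_right_mono add_mono mult_left_mono m4')
      have "\<beta>\<^sup>2 * real N ^ 2 = \<kappa>\<^sup>2" using NN by (simp add: \<kappa>(2) field_simps)
      then show "\<beta>\<^sup>2 * real N ^ 2 * m2 \<le> \<kappa>^4 * 4"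
        using \<kappa>2 m2 m2_nonneg by (simp add: mult_mono)
    qed (use \<epsilon> in auto)
    also have "\<dots> = (193 / 2) * \<kappa>^4 * \<epsilon>^5" using \<epsilon> by (simp add: field_simps eval_nat_numeral)
    also have "\<dots> \<le> 97 * \<kappa>^4 * \<epsilon>^5" using \<epsilon> by (intro mult_right_mono) auto
    finally show ?thesis .
  qed
  have S_meas[measurable]: "S \<in> borel_measurable \<Omega>" using bounded_measurable_S by (simp add: bounded_measurable_def)
  let ?\<mu> = "distr \<Omega> borel S"
  have rd: "real_distribution ?\<mu>" by (rule \<Omega>.real_distribution_distr) simp
  have "\<bar>cdf ?\<mu> x - cdf std_normal_distribution x\<bar> \<le> 6 * \<epsilon>\<^sup>2 + 4 * a / \<epsilon> + 4 * b / \<epsilon>\<^sup>2"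
  proof (rule kolmogorov_smoothing[OF rd \<epsilon> a0 b0])
    fix t
    show "cmod (char ?\<mu> t - of_real (exp (- t\<^sup>2 / 2))) \<le> (a + \<bar>t\<bar> * b) * (1 - exp (- t\<^sup>2 / 2))"
      by (rule \<Omega>.char_near_gaussian[OF S_meas _ a0 b0])
        (use stein_bound in \<open>auto simp: a_def b_def intro!: bounded_measurable_integrable bounded_measurable_rules bounded_measurable_S\<close>)
  qed
  \<comment> \<open>The three terms have constants 6, 244 and 388, with sum 638. The middle one
    shows the critical balance: \<open>\<epsilon>^3\<close> divided by
    \<open>\<epsilon>\<close>.\<close>
  also have "\<dots> \<le> 6 * \<epsilon>\<^sup>2 + 4 * (61 * \<kappa>\<^sup>2 * \<epsilon>^3) / \<epsilon> + 4 * (97 * \<kappa>^4 * \<epsilon>^5) / \<epsilon>\<^sup>2"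
    using \<epsilon> a b by (intro add_mono divide_right_mono mult_left_mono) auto
  also have "\<dots> = 6 * 1 * \<epsilon>\<^sup>2 + 244 * \<kappa>\<^sup>2 * \<epsilon>\<^sup>2 + 388 * \<kappa>^4 * \<epsilon>^3"
    using \<epsilon> by (simp add: field_simps eval_nat_numeral)
  also have "\<dots> \<le> 6 * \<kappa>^4 * \<epsilon>\<^sup>2 + 244 * \<kappa>^4 * \<epsilon>\<^sup>2 + 388 * \<kappa>^4 * \<epsilon>\<^sup>2"
    using \<kappa>2 e \<epsilon> by (intro add_mono mult_mono) auto
  also have "\<dots> \<le> 640 * \<kappa>^4 * \<epsilon>\<^sup>2" using \<kappa>2 by simp
  finally have "\<bar>cdf ?\<mu> x - cdf std_normal_distribution x\<bar> \<le> 640 * \<kappa>^4 * \<epsilon>\<^sup>2" .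
  moreover have "cdf ?\<mu> x = measure \<Omega> {z \<in> space \<Omega>. S z \<le> x}"
    unfolding cdf_def by (subst measure_distr) (auto intro!: arg_cong[where f="measure \<Omega>"])
  ultimately show ?thesis by simp
qed

end

subsection \<open>Square integrable kernels and their projections\<close>

lemma abs_mult_le_half_squares: "\<bar>u * v\<bar> \<le> (u\<^sup>2 + v\<^sup>2) / 2" for u v :: real
  using sum_squares_bound[of "\<bar>u\<bar>" "\<bar>v\<bar>"] by (simp add: abs_mult)

lemma abs_mult_le_squares: "\<bar>u * v\<bar> \<le> u\<^sup>2 + v\<^sup>2" for u v :: real
  by (rule order_trans[OF abs_mult_le_half_squares]) (simp add: field_simps)

lemma (in prob_space) integral_square_le:
  fixes u :: "'a \<Rightarrow> real"
  assumes "u \<in> borel_measurable M" "integrable M (\<lambda>x. (u x)\<^sup>2)"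
  shows "(\<integral>x. u x \<partial>M)\<^sup>2 \<le> (\<integral>x. (u x)\<^sup>2 \<partial>M)"
proof -
  have "integrable M u" using square_integrable_imp_integrable[OF assms] .
  then show ?thesis using variance_positive[of u] variance_eq[of u] assms(2) by simp
qed

lemma integrable_mult_l2:
  fixes u v :: "'a \<Rightarrow> real"
  assumes "u \<in> borel_measurable M" "v \<in> borel_measurable M"
    "integrable M (\<lambda>x. (u x)\<^sup>2)" "integrable M (\<lambda>x. (v x)\<^sup>2)"
  shows "integrable M (\<lambda>x. u x * v x)"
proof (rule Bochner_Integration.integrable_bound)
  show "integrable M (\<lambda>x. ((u x)\<^sup>2 + (v x)\<^sup>2) / 2)" using assms by simp
  show "AE x in M. norm (u x * v x) \<le> norm (((u x)\<^sup>2 + (v x)\<^sup>2) / 2)"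
    using abs_mult_le_half_squares by (auto intro!: order_trans[OF abs_mult_le_half_squares])
qed (use assms in measurable)

lemma square_integrable_add:
  fixes u v :: "'a \<Rightarrow> real"
  assumes "u \<in> borel_measurable M" "v \<in> borel_measurable M"
    "integrable M (\<lambda>x. (u x)\<^sup>2)" "integrable M (\<lambda>x. (v x)\<^sup>2)"
  shows "integrable M (\<lambda>x. (u x + v x)\<^sup>2)" "integrable M (\<lambda>x. (u x - v x)\<^sup>2)"
  using integrable_mult_l2[OF assms] assms
  by (auto simp: power2_sum power2_diff mult.assoc intro!: Bochner_Integration.integrable_add Bochner_Integration.integrable_diff)

lemma cauchy_schwarz_integral:
  fixes u v :: "'a \<Rightarrow> real"
  assumes "u \<in> borel_measurable M" "v \<in> borel_measurable M"
    "integrable M (\<lambda>x. (u x)\<^sup>2)" "integrable M (\<lambda>x. (v x)\<^sup>2)"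
  shows "(\<integral>x. u x * v x \<partial>M)\<^sup>2 \<le> (\<integral>x. (u x)\<^sup>2 \<partial>M) * (\<integral>x. (v x)\<^sup>2 \<partial>M)"
proof -
  let ?a = "\<integral>x. (u x)\<^sup>2 \<partial>M" and ?b = "\<integral>x. u x * v x \<partial>M" and ?c = "\<integral>x. (v x)\<^sup>2 \<partial>M"
  have q: "0 \<le> s\<^sup>2 * ?a + 2 * s * r * ?b + r\<^sup>2 * ?c" for s r :: real
  proof -
    have "0 \<le> (\<integral>x. (s * u x + r * v x)\<^sup>2 \<partial>M)" by simp
    also have "(\<lambda>x. (s * u x + r * v x)\<^sup>2) = (\<lambda>x. s\<^sup>2 * (u x)\<^sup>2 + 2 * s * r * (u x * v x) + r\<^sup>2 * (v x)\<^sup>2)"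
      by (auto simp: fun_eq_iff power2_sum power_mult_distrib algebra_simps)
    also have "(\<integral>x. s\<^sup>2 * (u x)\<^sup>2 + 2 * s * r * (u x * v x) + r\<^sup>2 * (v x)\<^sup>2 \<partial>M) = s\<^sup>2 * ?a + 2 * s * r * ?b + r\<^sup>2 * ?c"
      using assms integrable_mult_l2[OF assms] by simp
    finally show ?thesis .
  qed
  have a0: "0 \<le> ?a" and c0: "0 \<le> ?c" by simp_all
  show ?thesis
  proof (cases "?c = 0")
    case True
    have "?b = 0"
    proof (rule ccontr)
      assume b: "?b \<noteq> 0"
      \<comment> \<open>With \<open>?c = 0\<close> the form is affine in \<open>r\<close>, and this
        \<open>r\<close> would give it the value - 1.\<close>
      have "0 \<le> ?a + 2 * (- (?a + 1) / (2 * ?b)) * ?b"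
        using q[of 1 "- (?a + 1) / (2 * ?b)"] True by simp
      also have "\<dots> = - 1" using b by (simp add: field_simps)
      finally show False by simp
    qed
    then show ?thesis by simp
  next
    case False
    then have c: "0 < ?c" using c0 by linarith
    have "0 \<le> ?c\<^sup>2 * ?a + 2 * ?c * (- ?b) * ?b + (- ?b)\<^sup>2 * ?c" using q[of ?c "- ?b"] .
    also have "\<dots> = ?c * (?a * ?c - ?b\<^sup>2)" by (simp add: power2_eq_square algebra_simps)
    finally have "0 \<le> ?a * ?c - ?b\<^sup>2" using c by (simp add: zero_le_mult_iff)
    then show ?thesis by simp
  qed
qed

section \<open>Integrals over several independent points\<close>

locale prob_pair = prob_space Z for Z :: "'a measure"
begin

sublocale ZZ: pair_prob_space Z Z ..

abbreviation ZZ :: "('a \<times> 'a) measure" where "ZZ \<equiv> Z \<Otimes>\<^sub>M Z"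

lemma distr_fst: "distr ZZ Z fst = Z" by (rule distr_pair_fst)

lemma distr_snd: "distr ZZ Z snd = Z"
proof -
  have "distr ZZ Z snd = distr (distr ZZ ZZ (\<lambda>(x, y). (y, x))) Z fst"
    by (subst distr_distr) (auto simp: comp_def split_beta)
  also have "distr ZZ ZZ (\<lambda>(x, y). (y, x)) = ZZ" using ZZ.distr_pair_swap by simp
  finally show ?thesis by (simp add: distr_fst)
qed

lemma AE_fst: "AE x in Z. P x \<Longrightarrow> AE p in ZZ. P (fst p)"
  by (rule AE_distrD[of fst ZZ Z]) (simp, subst distr_fst)

lemma AE_snd: "AE x in Z. P x \<Longrightarrow> AE p in ZZ. P (snd p)"
  by (rule AE_distrD[of snd ZZ Z]) (simp, subst distr_snd)

lemma marginal:
  fixes u :: "'a \<Rightarrow> real"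
  assumes [measurable]: "u \<in> borel_measurable Z"
  shows "integrable ZZ (\<lambda>(x, y). u x) \<longleftrightarrow> integrable Z u"
    "integrable ZZ (\<lambda>(x, y). u y) \<longleftrightarrow> integrable Z u"
    "(\<integral>(x, y). u x \<partial>ZZ) = (\<integral>x. u x \<partial>Z)"
    "(\<integral>(x, y). u y \<partial>ZZ) = (\<integral>x. u x \<partial>Z)"
  using integrable_distr_eq[of fst ZZ Z u, unfolded distr_fst] integrable_distr_eq[of snd ZZ Z u, unfolded distr_snd]
    integral_distr[of fst ZZ Z u, unfolded distr_fst] integral_distr[of snd ZZ Z u, unfolded distr_snd] assms
  by (simp_all add: split_beta')

text \<open>The kernel of the adjoint of the integral operator of \<open>u\<close> followed after
  that of \<open>v\<close>; for symmetric kernels, their product.\<close>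

definition compose :: "('a \<Rightarrow> 'a \<Rightarrow> real) \<Rightarrow> ('a \<Rightarrow> 'a \<Rightarrow> real) \<Rightarrow> 'a \<Rightarrow> 'a \<Rightarrow> real" where
  "compose u v x y = (\<integral>z. u z x * v z y \<partial>Z)"

text \<open>Submultiplicativity of the Hilbert-Schmidt norm. Cauchy-Schwarz in the inner variable
  bounds the square by a product of column norms, whose integral factors. It applies at almost every
  pair only, as columns are square integrable only almost everywhere.\<close>

lemma compose_l2:
  assumes u[measurable]: "(\<lambda>(x, y). u x y) \<in> borel_measurable ZZ" and v[measurable]: "(\<lambda>(x, y). v x y) \<in> borel_measurable ZZ"
    and u2: "integrable ZZ (\<lambda>(x, y). (u x y)\<^sup>2)" and v2: "integrable ZZ (\<lambda>(x, y). (v x y)\<^sup>2)"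
  shows "(\<lambda>(x, y). compose u v x y) \<in> borel_measurable ZZ"
    and "AE p in ZZ. integrable Z (\<lambda>z. u z (fst p) * v z (snd p))"
    and "integrable ZZ (\<lambda>(x, y). (compose u v x y)\<^sup>2)"
    and "(\<integral>(x, y). (compose u v x y)\<^sup>2 \<partial>ZZ) \<le> (\<integral>(x, y). (u x y)\<^sup>2 \<partial>ZZ) * (\<integral>(x, y). (v x y)\<^sup>2 \<partial>ZZ)"
proof -
  have sec: "(\<lambda>z. k z x) \<in> borel_measurable Z"
    if "(\<lambda>(x, y). k x y) \<in> borel_measurable ZZ" "x \<in> space Z" for k :: "'a \<Rightarrow> 'a \<Rightarrow> real" and x
    using measurable_compose[OF _ that(1), of "\<lambda>z. (z, x)" Z] that(2) by simp
  show m[measurable]: "(\<lambda>(x, y). compose u v x y) \<in> borel_measurable ZZ"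
    unfolding compose_def by measurable
  define nu where "nu x = (\<integral>z. (u z x)\<^sup>2 \<partial>Z)" for x
  define nv where "nv x = (\<integral>z. (v z x)\<^sup>2 \<partial>Z)" for x
  have nm[measurable]: "nu \<in> borel_measurable Z" "nv \<in> borel_measurable Z"
    unfolding nu_def nv_def by measurable
  \<comment> \<open>Fubini is available for rows; columns are the rows of the swapped
    kernel.\<close>
  have swap: "AE x in Z. integrable Z (\<lambda>z. (k z x)\<^sup>2)" "integrable Z (\<lambda>x. \<integral>z. (k z x)\<^sup>2 \<partial>Z)"
      "(\<integral>x. (\<integral>z. (k z x)\<^sup>2 \<partial>Z) \<partial>Z) = (\<integral>(x, y). (k x y)\<^sup>2 \<partial>ZZ)"
    if k: "integrable ZZ (\<lambda>(x, y). (k x y)\<^sup>2)" for k :: "'a \<Rightarrow> 'a \<Rightarrow> real"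
  proof -
    have k': "integrable ZZ (\<lambda>(x, y). (k y x)\<^sup>2)" using ZZ.integrable_product_swap[OF k] by simp
    show "AE x in Z. integrable Z (\<lambda>z. (k z x)\<^sup>2)" "integrable Z (\<lambda>x. \<integral>z. (k z x)\<^sup>2 \<partial>Z)"
      using ZZ.AE_integrable_fst'[OF k'] ZZ.integrable_fst'[OF k'] by simp_all
    show "(\<integral>x. (\<integral>z. (k z x)\<^sup>2 \<partial>Z) \<partial>Z) = (\<integral>(x, y). (k x y)\<^sup>2 \<partial>ZZ)"
      using ZZ.integral_fst'[OF k'] ZZ.integral_product_swap[of "\<lambda>(x, y). (k x y)\<^sup>2"] k by (simp add: integrable_iff_bounded)
  qed
  have nn: "integrable ZZ (\<lambda>(x, y). nu x * nv y)" "(\<integral>(x, y). nu x * nv y \<partial>ZZ) = (\<integral>x. nu x \<partial>Z) * (\<integral>x. nv x \<partial>Z)"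
  proof -
    have i: "integrable Z nu" "integrable Z nv" using swap(2)[OF u2] swap(2)[OF v2] by (simp_all add: nu_def[abs_def] nv_def[abs_def])
    show ii: "integrable ZZ (\<lambda>(x, y). nu x * nv y)"
      using i ZZ.Fubini_integrable[of "\<lambda>(x, y). nu x * nv y"]
      by (auto simp: abs_mult split_beta intro!: integrable_mult_right)
    show "(\<integral>(x, y). nu x * nv y \<partial>ZZ) = (\<integral>x. nu x \<partial>Z) * (\<integral>x. nv x \<partial>Z)"
      using ZZ.integral_fst'[OF ii] i by simp
  qed
  have pw: "AE p in ZZ. integrable Z (\<lambda>z. u z (fst p) * v z (snd p)) \<and> (compose u v (fst p) (snd p))\<^sup>2 \<le> nu (fst p) * nv (snd p)"
    using AE_fst[OF swap(1)[OF u2]] AE_snd[OF swap(1)[OF v2]] AE_space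
  proof eventually_elim
    case (elim p)
    have "fst p \<in> space Z" "snd p \<in> space Z" using elim(3) by (auto simp: space_pair_measure)
    then have "(\<lambda>z. u z (fst p)) \<in> borel_measurable Z" "(\<lambda>z. v z (snd p)) \<in> borel_measurable Z"
      using sec u v by auto
    then show ?case
      using cauchy_schwarz_integral[of "\<lambda>z. u z (fst p)" Z "\<lambda>z. v z (snd p)"]
        integrable_mult_l2[of "\<lambda>z. u z (fst p)" Z "\<lambda>z. v z (snd p)"] elim
      by (simp add: compose_def nu_def nv_def)
  qed
  then show "AE p in ZZ. integrable Z (\<lambda>z. u z (fst p) * v z (snd p))" by auto
  show i2: "integrable ZZ (\<lambda>(x, y). (compose u v x y)\<^sup>2)"
    by (rule Bochner_Integration.integrable_bound[OF nn(1)]) (use pw in \<open>auto simp: split_beta\<close>)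
  have "(\<integral>(x, y). (compose u v x y)\<^sup>2 \<partial>ZZ) \<le> (\<integral>(x, y). nu x * nv y \<partial>ZZ)"
    by (rule integral_mono_AE[OF i2 nn(1)]) (use pw in \<open>auto simp: split_beta\<close>)
  then show "(\<integral>(x, y). (compose u v x y)\<^sup>2 \<partial>ZZ) \<le> (\<integral>(x, y). (u x y)\<^sup>2 \<partial>ZZ) * (\<integral>(x, y). (v x y)\<^sup>2 \<partial>ZZ)"
    using nn(2) swap(3)[OF u2] swap(3)[OF v2] by (simp add: nu_def nv_def)
qed

lemma product_integral:
  fixes u v :: "'a \<Rightarrow> real"
  assumes u: "integrable Z u" and v: "integrable Z v"
  shows "integrable ZZ (\<lambda>(x, y). u x * v y)" "(\<integral>(x, y). u x * v y \<partial>ZZ) = (\<integral>x. u x \<partial>Z) * (\<integral>x. v x \<partial>Z)"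
proof -
  show i: "integrable ZZ (\<lambda>(x, y). u x * v y)"
    using u v ZZ.Fubini_integrable[of "\<lambda>(x, y). u x * v y"]
    by (auto simp: abs_mult split_beta intro!: integrable_mult_right)
  show "(\<integral>(x, y). u x * v y \<partial>ZZ) = (\<integral>x. u x \<partial>Z) * (\<integral>x. v x \<partial>Z)"
    using ZZ.integral_fst'[OF i] u v by simp
qed

lemma nn_integral_ZZ:
  assumes "(\<lambda>(x, y). g x y) \<in> borel_measurable ZZ"
  shows "(\<integral>\<^sup>+p. (case p of (x, y) \<Rightarrow> g x y) \<partial>ZZ) = (\<integral>\<^sup>+x. (\<integral>\<^sup>+y. g x y \<partial>Z) \<partial>Z)"
  using nn_integral_fst[OF assms] by simp

lemma sigma_finite_ZZ: "sigma_finite_measure ZZ"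
  by (rule ZZ.sigma_finite_measure_axioms)

lemma nn_integral_ZZZ:
  assumes [measurable]: "(\<lambda>(x, y, z). g x y z) \<in> borel_measurable (Z \<Otimes>\<^sub>M ZZ)"
  shows "(\<integral>\<^sup>+p. (case p of (x, y, z) \<Rightarrow> g x y z) \<partial>(Z \<Otimes>\<^sub>M ZZ)) = (\<integral>\<^sup>+x. (\<integral>\<^sup>+y. (\<integral>\<^sup>+z. g x y z \<partial>Z) \<partial>Z) \<partial>Z)"
proof -
  have "(\<integral>\<^sup>+p. (case p of (x, y, z) \<Rightarrow> g x y z) \<partial>(Z \<Otimes>\<^sub>M ZZ))
      = (\<integral>\<^sup>+x. (\<integral>\<^sup>+q. (case q of (y, z) \<Rightarrow> g x y z) \<partial>ZZ) \<partial>Z)"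
    using sigma_finite_measure.nn_integral_fst[OF sigma_finite_ZZ assms] by simp
  also have "\<dots> = (\<integral>\<^sup>+x. (\<integral>\<^sup>+y. (\<integral>\<^sup>+z. g x y z \<partial>Z) \<partial>Z) \<partial>Z)"
    by (intro nn_integral_cong nn_integral_ZZ) measurable
  finally show ?thesis .
qed

lemma sigma_finite_ZZZ: "sigma_finite_measure (Z \<Otimes>\<^sub>M ZZ)"
proof -
  interpret T: pair_prob_space Z ZZ ..
  show ?thesis by (rule T.sigma_finite_measure_axioms)
qed

lemma nn_integral_ZZZZ:
  assumes [measurable]: "(\<lambda>(x, y, z, w). g x y z w) \<in> borel_measurable (Z \<Otimes>\<^sub>M (Z \<Otimes>\<^sub>M ZZ))"
  shows "(\<integral>\<^sup>+p. (case p of (x, y, z, w) \<Rightarrow> g x y z w) \<partial>(Z \<Otimes>\<^sub>M (Z \<Otimes>\<^sub>M ZZ)))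
      = (\<integral>\<^sup>+x. (\<integral>\<^sup>+y. (\<integral>\<^sup>+z. (\<integral>\<^sup>+w. g x y z w \<partial>Z) \<partial>Z) \<partial>Z) \<partial>Z)"
proof -
  have "(\<integral>\<^sup>+p. (case p of (x, y, z, w) \<Rightarrow> g x y z w) \<partial>(Z \<Otimes>\<^sub>M (Z \<Otimes>\<^sub>M ZZ)))
      = (\<integral>\<^sup>+x. (\<integral>\<^sup>+q. (case q of (y, z, w) \<Rightarrow> g x y z w) \<partial>(Z \<Otimes>\<^sub>M ZZ)) \<partial>Z)"
    using sigma_finite_measure.nn_integral_fst[OF sigma_finite_ZZZ assms] by simp
  also have "\<dots> = (\<integral>\<^sup>+x. (\<integral>\<^sup>+y. (\<integral>\<^sup>+z. (\<integral>\<^sup>+w. g x y z w \<partial>Z) \<partial>Z) \<partial>Z) \<partial>Z)"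
    by (intro nn_integral_cong nn_integral_ZZZ) measurable
  finally show ?thesis .
qed

lemma l2_nn:
  fixes d :: "'a \<Rightarrow> 'a \<Rightarrow> real"
  assumes [measurable]: "(\<lambda>(x, y). d x y) \<in> borel_measurable ZZ" and d2: "integrable ZZ (\<lambda>(x, y). (d x y)\<^sup>2)"
  shows "(\<integral>\<^sup>+x. (\<integral>\<^sup>+y. ennreal ((d x y)\<^sup>2) \<partial>Z) \<partial>Z) < \<infinity>"
proof -
  have "(\<integral>\<^sup>+x. (\<integral>\<^sup>+y. ennreal ((d x y)\<^sup>2) \<partial>Z) \<partial>Z) = (\<integral>\<^sup>+p. (case p of (x, y) \<Rightarrow> ennreal ((d x y)\<^sup>2)) \<partial>ZZ)"
    by (rule nn_integral_ZZ[symmetric]) measurable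
  also have "\<dots> = (\<integral>\<^sup>+p. ennreal (norm (case p of (x, y) \<Rightarrow> (d x y)\<^sup>2)) \<partial>ZZ)"
    by (intro nn_integral_cong) (auto split: prod.split)
  also have "\<dots> < \<infinity>" using d2 by (simp add: integrable_iff_bounded)
  finally show ?thesis .
qed

text \<open>Given the shared point the two factors are independent, so this is the second moment of
  the conditional mean. Joint integrability comes from
  \<open>\<bar>u * v\<bar> \<le> u\<^sup>2 + v\<^sup>2\<close>, which leaves double
  integrals.\<close>

lemma triple_integral:
  fixes d :: "'a \<Rightarrow> 'a \<Rightarrow> real"
  assumes d: "(\<lambda>(x, y). d x y) \<in> borel_measurable ZZ" and d2: "integrable ZZ (\<lambda>(x, y). (d x y)\<^sup>2)"
  shows "(\<integral>(x, y, z). d x y * d x z \<partial>(Z \<Otimes>\<^sub>M ZZ)) = (\<integral>x. (\<integral>y. d x y \<partial>Z)\<^sup>2 \<partial>Z)"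
proof -
  note d[measurable]
  have [measurable (raw)]: "(\<lambda>u. d (g u) (g' u)) \<in> borel_measurable M"
    if "g \<in> M \<rightarrow>\<^sub>M Z" "g' \<in> M \<rightarrow>\<^sub>M Z" for g g' and M :: "'m measure"
    using measurable_compose[OF measurable_Pair[OF that] d] by simp
  interpret T: pair_prob_space Z ZZ ..
  let ?I = "\<integral>\<^sup>+x. (\<integral>\<^sup>+y. ennreal ((d x y)\<^sup>2) \<partial>Z) \<partial>Z"
  have m: "(\<lambda>(x, y, z). d x y * d x z) \<in> borel_measurable (Z \<Otimes>\<^sub>M ZZ)" by measurable
  have i: "integrable (Z \<Otimes>\<^sub>M ZZ) (\<lambda>(x, y, z). d x y * d x z)"
  proof (rule integrableI_bounded[OF m])
    have "(\<integral>\<^sup>+p. ennreal (norm (case p of (x, y, z) \<Rightarrow> d x y * d x z)) \<partial>(Z \<Otimes>\<^sub>M ZZ))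
      \<le> (\<integral>\<^sup>+p. (case p of (x, y, z) \<Rightarrow> ennreal ((d x y)\<^sup>2) + ennreal ((d x z)\<^sup>2)) \<partial>(Z \<Otimes>\<^sub>M ZZ))"
    proof (intro nn_integral_mono)
      fix p :: "'a \<times> 'a \<times> 'a"
      obtain x y z where p: "p = (x, y, z)" by (cases p)
      have "\<bar>d x y * d x z\<bar> \<le> (d x y)\<^sup>2 + (d x z)\<^sup>2"
        by (rule abs_mult_le_squares)
      then show "ennreal (norm (case p of (x, y, z) \<Rightarrow> d x y * d x z))
          \<le> (case p of (x, y, z) \<Rightarrow> ennreal ((d x y)\<^sup>2) + ennreal ((d x z)\<^sup>2))"
        unfolding p by (simp flip: ennreal_plus add: ennreal_leI)
    qed
    also have "\<dots> = (\<integral>\<^sup>+x. (\<integral>\<^sup>+y. (\<integral>\<^sup>+z. ennreal ((d x y)\<^sup>2) + ennreal ((d x z)\<^sup>2) \<partial>Z) \<partial>Z) \<partial>Z)"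
      by (rule nn_integral_ZZZ) measurable
    also have "\<dots> = (\<integral>\<^sup>+x. (\<integral>\<^sup>+y. ennreal ((d x y)\<^sup>2) \<partial>Z) + (\<integral>\<^sup>+z. ennreal ((d x z)\<^sup>2) \<partial>Z) \<partial>Z)"
      by (intro nn_integral_cong) (simp add: nn_integral_add emeasure_space_1)
    also have "\<dots> = ?I + ?I" by (simp add: nn_integral_add)
    also have "\<dots> < \<infinity>" using l2_nn[OF d d2] by simp
    finally show "(\<integral>\<^sup>+p. ennreal (norm (case p of (x, y, z) \<Rightarrow> d x y * d x z)) \<partial>(Z \<Otimes>\<^sub>M ZZ)) < \<infinity>" .
  qed
  have d1: "integrable ZZ (\<lambda>(x, y). d x y)"
    using ZZ.square_integrable_imp_integrable[OF d] d2 by (simp add: split_beta')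
  have "(\<integral>(x, y, z). d x y * d x z \<partial>(Z \<Otimes>\<^sub>M ZZ)) = (\<integral>x. (\<integral>(y, z). d x y * d x z \<partial>ZZ) \<partial>Z)"
    using T.integral_fst'[OF i] by simp
  also have "\<dots> = (\<integral>x. (\<integral>y. d x y \<partial>Z)\<^sup>2 \<partial>Z)"
  proof (rule integral_cong_AE)
    show "AE x in Z. (\<integral>(y, z). d x y * d x z \<partial>ZZ) = (\<integral>y. d x y \<partial>Z)\<^sup>2"
      using ZZ.AE_integrable_fst'[OF d1]
      by eventually_elim (simp add: product_integral power2_eq_square)
  qed measurable
  finally show ?thesis .
qed

text \<open>Opposite edges of the 4-cycle share no vertex. Grouping the factors by opposite edges
  before applying \<open>\<bar>u * v\<bar> \<le> u\<^sup>2 + v\<^sup>2\<close> therefore gives a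
  majorant whose integrals factor, so square integrability of \<open>d\<close> suffices. The value
  arises by integrating out \<open>z1\<close> and \<open>z4\<close>, which are opposite
  vertices.\<close>

lemma cycle_integral:
  fixes d :: "'a \<Rightarrow> 'a \<Rightarrow> real"
  assumes d: "(\<lambda>(x, y). d x y) \<in> borel_measurable ZZ" and d2: "integrable ZZ (\<lambda>(x, y). (d x y)\<^sup>2)"
    and sym: "\<And>x y. x \<in> space Z \<Longrightarrow> y \<in> space Z \<Longrightarrow> d x y = d y x"
  shows "(\<integral>(z1, z2, z3, z4). d z1 z2 * d z1 z3 * d z2 z4 * d z3 z4 \<partial>(Z \<Otimes>\<^sub>M (Z \<Otimes>\<^sub>M ZZ)))
    = (\<integral>(x, y). (compose d d x y)\<^sup>2 \<partial>ZZ)"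
proof -
  note d[measurable]
  have [measurable (raw)]: "(\<lambda>u. d (g u) (g' u)) \<in> borel_measurable M"
    if "g \<in> M \<rightarrow>\<^sub>M Z" "g' \<in> M \<rightarrow>\<^sub>M Z" for g g' and M :: "'m measure"
    using measurable_compose[OF measurable_Pair[OF that] d] by simp
  interpret T: pair_prob_space Z ZZ ..
  interpret U: pair_prob_space Z "Z \<Otimes>\<^sub>M ZZ" ..
  let ?g = "\<lambda>(z1, z2, z3, z4). d z1 z2 * d z1 z3 * d z2 z4 * d z3 z4"
  let ?s = "\<lambda>x y. ennreal ((d x y)\<^sup>2)"
  let ?I = "\<integral>\<^sup>+x. (\<integral>\<^sup>+y. ?s x y \<partial>Z) \<partial>Z"
  have I: "?I < \<infinity>" by (rule l2_nn[OF d d2])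
  have m: "?g \<in> borel_measurable (Z \<Otimes>\<^sub>M (Z \<Otimes>\<^sub>M ZZ))" by measurable
  have gi: "integrable (Z \<Otimes>\<^sub>M (Z \<Otimes>\<^sub>M ZZ)) ?g"
  proof (rule integrableI_bounded[OF m])
    let ?b = "\<lambda>z1 z2 z3 z4. ?s z1 z2 * ?s z3 z4 + ?s z1 z3 * ?s z2 z4"
    have "(\<integral>\<^sup>+p. ennreal (norm (?g p)) \<partial>(Z \<Otimes>\<^sub>M (Z \<Otimes>\<^sub>M ZZ)))
      \<le> (\<integral>\<^sup>+p. (case p of (z1, z2, z3, z4) \<Rightarrow> ?b z1 z2 z3 z4) \<partial>(Z \<Otimes>\<^sub>M (Z \<Otimes>\<^sub>M ZZ)))"
    proof (intro nn_integral_mono)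
      fix p :: "'a \<times> 'a \<times> 'a \<times> 'a"
      obtain z1 z2 z3 z4 where p: "p = (z1, z2, z3, z4)" by (cases p)
      have "\<bar>(d z1 z2 * d z3 z4) * (d z1 z3 * d z2 z4)\<bar> \<le> (d z1 z2 * d z3 z4)\<^sup>2 + (d z1 z3 * d z2 z4)\<^sup>2"
        by (rule abs_mult_le_squares)
      then have "\<bar>d z1 z2 * d z1 z3 * d z2 z4 * d z3 z4\<bar> \<le> (d z1 z2)\<^sup>2 * (d z3 z4)\<^sup>2 + (d z1 z3)\<^sup>2 * (d z2 z4)\<^sup>2"
        by (simp add: power_mult_distrib mult_ac)
      then have "ennreal \<bar>d z1 z2 * d z1 z3 * d z2 z4 * d z3 z4\<bar> \<le> ennreal ((d z1 z2)\<^sup>2 * (d z3 z4)\<^sup>2 + (d z1 z3)\<^sup>2 * (d z2 z4)\<^sup>2)"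
        by (rule ennreal_leI)
      also have "\<dots> = ?b z1 z2 z3 z4" by (simp add: ennreal_plus ennreal_mult)
      finally show "ennreal (norm (?g p)) \<le> (case p of (z1, z2, z3, z4) \<Rightarrow> ?b z1 z2 z3 z4)"
        unfolding p by simp
    qed
    also have "\<dots> = (\<integral>\<^sup>+z1. (\<integral>\<^sup>+z2. (\<integral>\<^sup>+z3. (\<integral>\<^sup>+z4. ?b z1 z2 z3 z4 \<partial>Z) \<partial>Z) \<partial>Z) \<partial>Z)"
      by (rule nn_integral_ZZZZ) measurable
    also have "\<dots> = (\<integral>\<^sup>+z1. (\<integral>\<^sup>+z2. ?s z1 z2 * ?I + (\<integral>\<^sup>+z3. ?s z1 z3 \<partial>Z) * (\<integral>\<^sup>+z4. ?s z2 z4 \<partial>Z) \<partial>Z) \<partial>Z)"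
    proof (intro nn_integral_cong)
      fix z1 z2 assume z: "z1 \<in> space Z" "z2 \<in> space Z"
      have sec[measurable]: "(\<lambda>y. d x y) \<in> borel_measurable Z" if "x \<in> space Z" for x
        using measurable_compose[OF _ d, of "\<lambda>y. (x, y)" Z] that by simp
      have "(\<integral>\<^sup>+z3. (\<integral>\<^sup>+z4. ?b z1 z2 z3 z4 \<partial>Z) \<partial>Z)
          = (\<integral>\<^sup>+z3. ?s z1 z2 * (\<integral>\<^sup>+z4. ?s z3 z4 \<partial>Z) + ?s z1 z3 * (\<integral>\<^sup>+z4. ?s z2 z4 \<partial>Z) \<partial>Z)"
      proof (intro nn_integral_cong)
        fix z3 assume z3: "z3 \<in> space Z"
        have [measurable]: "d z2 \<in> borel_measurable Z" "d z3 \<in> borel_measurable Z" using sec z z3 by auto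
        show "(\<integral>\<^sup>+z4. ?b z1 z2 z3 z4 \<partial>Z) = ?s z1 z2 * (\<integral>\<^sup>+z4. ?s z3 z4 \<partial>Z) + ?s z1 z3 * (\<integral>\<^sup>+z4. ?s z2 z4 \<partial>Z)"
          by (subst nn_integral_add) (simp_all add: nn_integral_cmult)
      qed
      also have "\<dots> = ?s z1 z2 * ?I + (\<integral>\<^sup>+z3. ?s z1 z3 \<partial>Z) * (\<integral>\<^sup>+z4. ?s z2 z4 \<partial>Z)"
      proof -
        have [measurable]: "d z1 \<in> borel_measurable Z" using sec z by auto
        have im: "(\<lambda>z3. \<integral>\<^sup>+z4. ?s z3 z4 \<partial>Z) \<in> borel_measurable Z" by measurable
        show ?thesis by (subst nn_integral_add) (simp_all add: nn_integral_cmult nn_integral_multc im)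
      qed
      finally show "(\<integral>\<^sup>+z3. (\<integral>\<^sup>+z4. ?b z1 z2 z3 z4 \<partial>Z) \<partial>Z)
          = ?s z1 z2 * ?I + (\<integral>\<^sup>+z3. ?s z1 z3 \<partial>Z) * (\<integral>\<^sup>+z4. ?s z2 z4 \<partial>Z)" .
    qed
    also have "\<dots> = ?I * ?I + ?I * ?I"
    proof -
      have im: "(\<lambda>z3. \<integral>\<^sup>+z4. ?s z3 z4 \<partial>Z) \<in> borel_measurable Z" by measurable
      have "(\<integral>\<^sup>+z1. (\<integral>\<^sup>+z2. ?s z1 z2 * ?I + (\<integral>\<^sup>+z3. ?s z1 z3 \<partial>Z) * (\<integral>\<^sup>+z4. ?s z2 z4 \<partial>Z) \<partial>Z) \<partial>Z)
          = (\<integral>\<^sup>+z1. (\<integral>\<^sup>+z2. ?s z1 z2 \<partial>Z) * ?I + (\<integral>\<^sup>+z3. ?s z1 z3 \<partial>Z) * ?I \<partial>Z)"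
      proof (intro nn_integral_cong)
        fix z1 assume "z1 \<in> space Z"
        then have [measurable]: "d z1 \<in> borel_measurable Z"
          using measurable_compose[OF _ d, of "\<lambda>y. (z1, y)" Z] by simp
        show "(\<integral>\<^sup>+z2. ?s z1 z2 * ?I + (\<integral>\<^sup>+z3. ?s z1 z3 \<partial>Z) * (\<integral>\<^sup>+z4. ?s z2 z4 \<partial>Z) \<partial>Z)
          = (\<integral>\<^sup>+z2. ?s z1 z2 \<partial>Z) * ?I + (\<integral>\<^sup>+z3. ?s z1 z3 \<partial>Z) * ?I"
          by (subst nn_integral_add) (simp_all add: nn_integral_cmult nn_integral_multc im)
      qed
      also have "\<dots> = ?I * ?I + ?I * ?I"
        by (subst nn_integral_add) (simp_all add: nn_integral_multc im)
      finally show ?thesis .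
    qed
    also have "\<dots> < \<infinity>" using I by (simp add: ennreal_mult_less_top)
    finally show "(\<integral>\<^sup>+p. ennreal (norm (?g p)) \<partial>(Z \<Otimes>\<^sub>M (Z \<Otimes>\<^sub>M ZZ))) < \<infinity>" .
  qed
  let ?C = "compose d d"
  let ?g1 = "\<lambda>(z2, z3, z4). ?C z2 z3 * (d z2 z4 * d z3 z4)"
  have g1: "(\<integral>z1. ?g (z1, q) \<partial>Z) = ?g1 q" for q
  proof -
    obtain z2 z3 z4 where q: "q = (z2, z3, z4)" by (cases q)
    have "(\<integral>z1. ?g (z1, q) \<partial>Z) = (\<integral>z1. (d z1 z2 * d z1 z3) * (d z2 z4 * d z3 z4) \<partial>Z)"
      unfolding q by (intro Bochner_Integration.integral_cong refl) (simp add: mult.assoc)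
    then show ?thesis unfolding q compose_def by simp
  qed
  \<comment> \<open>Fubini integrates out the second component, so \<open>z1\<close> is moved
    there.\<close>
  have sw: "integrable ((Z \<Otimes>\<^sub>M ZZ) \<Otimes>\<^sub>M Z) (\<lambda>(q, z1). ?g (z1, q))"
    using U.integrable_product_swap[OF gi] by simp
  interpret W: pair_sigma_finite "Z \<Otimes>\<^sub>M ZZ" Z ..
  have g1i: "integrable (Z \<Otimes>\<^sub>M ZZ) ?g1"
    unfolding g1[symmetric] using W.integrable_fst'[OF sw] by simp
  have "(\<integral>p. ?g p \<partial>(Z \<Otimes>\<^sub>M (Z \<Otimes>\<^sub>M ZZ))) = (\<integral>p. (case p of (q, z1) \<Rightarrow> ?g (z1, q)) \<partial>((Z \<Otimes>\<^sub>M ZZ) \<Otimes>\<^sub>M Z))"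
    using U.integral_product_swap[OF m] by simp
  also have "\<dots> = (\<integral>q. ?g1 q \<partial>(Z \<Otimes>\<^sub>M ZZ))"
    unfolding g1[symmetric] using W.integral_fst'[OF sw] by simp
  also have "\<dots> = (\<integral>z2. (\<integral>q. ?g1 (z2, q) \<partial>ZZ) \<partial>Z)" using T.integral_fst'[OF g1i] by simp
  also have "\<dots> = (\<integral>z2. (\<integral>z3. (?C z2 z3)\<^sup>2 \<partial>Z) \<partial>Z)"
  proof (rule integral_cong_AE)
    have cm: "(\<lambda>(x, y). ?C x y) \<in> borel_measurable ZZ" by (rule compose_l2(1)[OF d d d2 d2])
    have [measurable (raw)]: "(\<lambda>u. ?C (g u) (g' u)) \<in> borel_measurable M"
      if "g \<in> M \<rightarrow>\<^sub>M Z" "g' \<in> M \<rightarrow>\<^sub>M Z" for g g' and M :: "'m measure"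
      using measurable_compose[OF measurable_Pair[OF that] cm] by simp
    show "(\<lambda>z2. \<integral>q. ?g1 (z2, q) \<partial>ZZ) \<in> borel_measurable Z" by measurable
    show "(\<lambda>z2. \<integral>z3. (?C z2 z3)\<^sup>2 \<partial>Z) \<in> borel_measurable Z" by measurable
    show "AE z2 in Z. (\<integral>q. ?g1 (z2, q) \<partial>ZZ) = (\<integral>z3. (?C z2 z3)\<^sup>2 \<partial>Z)"
      using T.AE_integrable_fst'[OF g1i] AE_space
    proof eventually_elim
      case (elim z2)
      have "(\<integral>q. ?g1 (z2, q) \<partial>ZZ) = (\<integral>z3. (\<integral>z4. ?C z2 z3 * (d z2 z4 * d z3 z4) \<partial>Z) \<partial>Z)"
        using ZZ.integral_fst'[OF elim(1)] by simp
      also have "\<dots> = (\<integral>z3. ?C z2 z3 * (\<integral>z4. d z2 z4 * d z3 z4 \<partial>Z) \<partial>Z)" by simp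
      also have "\<dots> = (\<integral>z3. (?C z2 z3)\<^sup>2 \<partial>Z)"
        using elim(2) sym by (intro Bochner_Integration.integral_cong refl)
          (auto simp: compose_def power2_eq_square intro!: Bochner_Integration.integral_cong)
      finally show ?case .
    qed
  qed
  also have "\<dots> = (\<integral>(x, y). (?C x y)\<^sup>2 \<partial>ZZ)"
    using ZZ.integral_fst'[OF compose_l2(3)[OF d d d2 d2]] by simp
  finally show ?thesis .
qed

end

section \<open>The degenerate projection and the population quantities\<close>

locale l2_kernel = prob_pair Z for Z :: "(nat \<Rightarrow> real) measure" +
  fixes f :: kern
  assumes meas: "(\<lambda>(x, y). f x y) \<in> borel_measurable ZZ"
    and sym: "\<And>x y. x \<in> space Z \<Longrightarrow> y \<in> space Z \<Longrightarrow> f x y = f y x"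
    and l2: "integrable ZZ (\<lambda>(x, y). (f x y)\<^sup>2)"
begin

definition a :: "(nat \<Rightarrow> real) \<Rightarrow> real" where "a x = (\<integral>z. f x z \<partial>Z)"

lemma meas'[measurable (raw)]:
  assumes "g \<in> M \<rightarrow>\<^sub>M Z" "g' \<in> M \<rightarrow>\<^sub>M Z"
  shows "(\<lambda>u. f (g u) (g' u)) \<in> borel_measurable M"
  using measurable_compose[OF measurable_Pair[OF assms] meas] by simp

lemma l1: "integrable ZZ (\<lambda>(x, y). f x y)"
  using ZZ.square_integrable_imp_integrable[OF meas] l2 by (simp add: split_beta')

lemma AE_section: "AE x in Z. integrable Z (\<lambda>y. f x y) \<and> integrable Z (\<lambda>y. (f x y)\<^sup>2)"
  using ZZ.AE_integrable_fst'[OF l1] ZZ.AE_integrable_fst'[OF l2] by simp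

lemma a_meas[measurable]: "a \<in> borel_measurable Z"
  unfolding a_def[abs_def] by measurable

lemma a_int: "integrable Z a" "(\<integral>x. a x \<partial>Z) = Ek f Z"
  using ZZ.integrable_fst'[OF l1] ZZ.integral_fst'[OF l1] by (simp_all add: a_def[abs_def] Ek_def)

lemma a_sq: "integrable Z (\<lambda>x. (a x)\<^sup>2)"
proof (rule Bochner_Integration.integrable_bound)
  show "integrable Z (\<lambda>x. \<integral>y. (f x y)\<^sup>2 \<partial>Z)" using ZZ.integrable_fst'[OF l2] by simp
  show "AE x in Z. norm ((a x)\<^sup>2) \<le> norm (\<integral>y. (f x y)\<^sup>2 \<partial>Z)"
    using AE_section AE_space
  proof eventually_elim
    case (elim x)
    then show ?case using integral_square_le[of "\<lambda>y. f x y"] by (simp add: a_def)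
  qed
qed measurable

lemma dk_eq: "x \<in> space Z \<Longrightarrow> y \<in> space Z \<Longrightarrow> dk f Z x y = f x y - a y - a x + Ek f Z"
  unfolding dk_def a_def by (simp add: sym cong: Bochner_Integration.integral_cong)

lemma dk_eq': "p \<in> space ZZ \<Longrightarrow> dk f Z (fst p) (snd p) = f (fst p) (snd p) - a (snd p) - a (fst p) + Ek f Z"
  by (auto simp: space_pair_measure dk_eq)

lemma dk_meas: "(\<lambda>(x, y). dk f Z x y) \<in> borel_measurable ZZ"
  unfolding dk_def by measurable

lemma dk_sym: "x \<in> space Z \<Longrightarrow> y \<in> space Z \<Longrightarrow> dk f Z x y = dk f Z y x"
  by (simp add: dk_eq sym)

lemma dk_degenerate_at:
  assumes x: "x \<in> space Z" and fx: "integrable Z (f x)"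
  shows "integrable Z (dk f Z x)" "(\<integral>y. dk f Z x y \<partial>Z) = 0"
proof -
  have e: "dk f Z x y = f x y - a y - a x + Ek f Z" if "y \<in> space Z" for y using dk_eq that x by simp
  have "integrable Z (\<lambda>y. f x y - a y - a x + Ek f Z)" using fx a_int by simp
  then show "integrable Z (dk f Z x)" by (subst Bochner_Integration.integrable_cong[OF refl e]) auto
  have "(\<integral>y. dk f Z x y \<partial>Z) = (\<integral>y. f x y - a y - a x + Ek f Z \<partial>Z)"
    by (rule Bochner_Integration.integral_cong[OF refl e])
  also have "\<dots> = 0"
  proof -
    have "(\<integral>y. f x y \<partial>Z) = a x" by (simp add: a_def)
    then show ?thesis using fx a_int by (simp add: prob_space)
  qed
  finally show "(\<integral>y. dk f Z x y \<partial>Z) = 0" .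
qed

text \<open>The centering argument works at the points whose section is integrable, which are almost
  all.\<close>

lemma dk_degenerate: "AE x in Z. (\<integral>y. dk f Z x y \<partial>Z) = 0"
  using AE_section AE_space by eventually_elim (use dk_degenerate_at(2) in auto)

lemma cross: "integrable ZZ (\<lambda>(x, y). f x y * a x)" "(\<integral>(x, y). f x y * a x \<partial>ZZ) = (\<integral>x. (a x)\<^sup>2 \<partial>Z)"
  "integrable ZZ (\<lambda>(x, y). f x y * a y)" "(\<integral>(x, y). f x y * a y \<partial>ZZ) = (\<integral>x. (a x)\<^sup>2 \<partial>Z)"
  "integrable ZZ (\<lambda>(x, y). a x * a y)" "(\<integral>(x, y). a x * a y \<partial>ZZ) = (Ek f Z)\<^sup>2"
proof -
  have f2: "integrable ZZ (\<lambda>p. (f (fst p) (snd p))\<^sup>2)" using l2 by (simp add: split_beta')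
  have a2: "integrable ZZ (\<lambda>p. (a (fst p))\<^sup>2)" "integrable ZZ (\<lambda>p. (a (snd p))\<^sup>2)"
    using marginal(1,2)[of "\<lambda>x. (a x)\<^sup>2"] a_sq by (simp_all add: split_beta')
  show 1: "integrable ZZ (\<lambda>(x, y). f x y * a x)"
    unfolding split_beta' by (rule integrable_mult_l2[OF _ _ f2 a2(1)]) measurable
  show 2: "integrable ZZ (\<lambda>(x, y). f x y * a y)"
    unfolding split_beta' by (rule integrable_mult_l2[OF _ _ f2 a2(2)]) measurable
  show 3: "integrable ZZ (\<lambda>(x, y). a x * a y)"
    unfolding split_beta' by (rule integrable_mult_l2[OF _ _ a2]) measurable
  have "(\<integral>(x, y). f x y * a x \<partial>ZZ) = (\<integral>x. (\<integral>y. f x y * a x \<partial>Z) \<partial>Z)"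
    using ZZ.integral_fst'[OF 1] by simp
  also have "\<dots> = (\<integral>x. (a x)\<^sup>2 \<partial>Z)" by (simp add: a_def power2_eq_square)
  finally show fa: "(\<integral>(x, y). f x y * a x \<partial>ZZ) = (\<integral>x. (a x)\<^sup>2 \<partial>Z)" .
  have "(\<integral>(x, y). f x y * a y \<partial>ZZ) = (\<integral>(x, y). f y x * a x \<partial>ZZ)"
    using ZZ.integral_product_swap[of "\<lambda>(x, y). f y x * a x"] by simp
  also have "\<dots> = (\<integral>(x, y). f x y * a x \<partial>ZZ)"
    by (rule Bochner_Integration.integral_cong) (auto simp: space_pair_measure sym)
  finally show "(\<integral>(x, y). f x y * a y \<partial>ZZ) = (\<integral>x. (a x)\<^sup>2 \<partial>Z)" using fa by simp
  show "(\<integral>(x, y). a x * a y \<partial>ZZ) = (Ek f Z)\<^sup>2"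
    using ZZ.integral_fst'[OF 3] by (simp add: a_int power2_eq_square)
qed

text \<open>The Hoeffding decomposition: \<open>dk\<close> removes the constant and both main
  effects, which are orthogonal to it. The expanded square is evaluated with \<open>cross\<close>,
  where both products of \<open>f\<close> with a main effect integrate to the second moment of
  \<open>a\<close>.\<close>

lemma dk_norm:
  "integrable ZZ (\<lambda>(x, y). (dk f Z x y)\<^sup>2)"
  "(\<integral>(x, y). (dk f Z x y)\<^sup>2 \<partial>ZZ) = (\<integral>(x, y). (f x y)\<^sup>2 \<partial>ZZ) - 2 * (\<integral>x. (a x)\<^sup>2 \<partial>Z) + (Ek f Z)\<^sup>2"
proof -
  let ?e = "Ek f Z"
  let ?g = "\<lambda>p. ((case p of (x, y) \<Rightarrow> (f x y)\<^sup>2) + (case p of (x, y) \<Rightarrow> (a y)\<^sup>2) + (case p of (x, y) \<Rightarrow> (a x)\<^sup>2) + ?e\<^sup>2)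
     + ((2 * ?e) * (case p of (x, y) \<Rightarrow> f x y) + 2 * (case p of (x, y) \<Rightarrow> a x * a y))
     - (2 * (case p of (x, y) \<Rightarrow> f x y * a y) + 2 * (case p of (x, y) \<Rightarrow> f x y * a x)
      + (2 * ?e) * (case p of (x, y) \<Rightarrow> a y) + (2 * ?e) * (case p of (x, y) \<Rightarrow> a x))"
  have eq: "(case p of (x, y) \<Rightarrow> (dk f Z x y)\<^sup>2) = ?g p" if "p \<in> space ZZ" for p
    unfolding split_beta dk_eq'[OF that] by (simp add: power2_eq_square algebra_simps)
  have a2m: "(\<lambda>x. (a x)\<^sup>2) \<in> borel_measurable Z" by measurable
  note i = l2 l1 cross(1,3,5) marginal(1,2)[OF a2m, THEN iffD2, OF a_sq] marginal(1,2)[OF a_meas, THEN iffD2, OF a_int(1)]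
  have gi: "integrable ZZ ?g"
    using i by (intro Bochner_Integration.integrable_add Bochner_Integration.integrable_diff integrable_mult_right) auto
  then show "integrable ZZ (\<lambda>(x, y). (dk f Z x y)\<^sup>2)"
    by (subst Bochner_Integration.integrable_cong[OF refl eq]) auto
  have "(\<integral>(x, y). (dk f Z x y)\<^sup>2 \<partial>ZZ) = (\<integral>p. ?g p \<partial>ZZ)"
    by (rule Bochner_Integration.integral_cong[OF refl eq])
  also have "\<dots> = (\<integral>(x, y). (f x y)\<^sup>2 \<partial>ZZ) - 2 * (\<integral>x. (a x)\<^sup>2 \<partial>Z) + ?e\<^sup>2"
  proof -
    have k: "integrable ZZ (\<lambda>p. ?e\<^sup>2)" by simp
    have e: "(\<integral>(x, y). f x y \<partial>ZZ) = ?e" by (simp add: Ek_def)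
    show ?thesis
      using i k by (simp add: cross(2,4,6) marginal(3,4) a_int(2) e ZZ.prob_space del: integral_mult_left_zero)
        (simp add: power2_eq_square)
  qed
  finally show "(\<integral>(x, y). (dk f Z x y)\<^sup>2 \<partial>ZZ) = (\<integral>(x, y). (f x y)\<^sup>2 \<partial>ZZ) - 2 * (\<integral>x. (a x)\<^sup>2 \<partial>Z) + (Ek f Z)\<^sup>2" .
qed

lemma dk_norm_le: "(\<integral>(x, y). (dk f Z x y)\<^sup>2 \<partial>ZZ) \<le> (\<integral>(x, y). (f x y)\<^sup>2 \<partial>ZZ)"
proof -
  have "(Ek f Z)\<^sup>2 \<le> (\<integral>x. (a x)\<^sup>2 \<partial>Z)" using integral_square_le[OF a_meas a_sq] a_int by simp
  moreover have "0 \<le> (\<integral>x. (a x)\<^sup>2 \<partial>Z)" by simp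
  ultimately show ?thesis unfolding dk_norm(2) by linarith
qed

lemma V2_eq: "V2 f Z = (\<integral>(x, y). (dk f Z x y)\<^sup>2 \<partial>ZZ)"
  unfolding V2_def dk_norm(2) using triple_integral[OF meas l2] by (simp add: a_def[abs_def])

text \<open>As a squared Hilbert-Schmidt norm, \<open>Eg\<close> is nonnegative and changes
  controllably under perturbation of the kernel, by \<open>compose_l2\<close>.\<close>

lemma Eg_eq: "Eg f Z = (\<integral>(x, y). (compose (dk f Z) (dk f Z) x y)\<^sup>2 \<partial>ZZ)"
  unfolding Eg_def gk_def by (rule cycle_integral[OF dk_meas dk_norm(1) dk_sym])

end

subsection \<open>The variance estimator as a quadratic form\<close>

lemma sum_offdiagonal:
  fixes F :: "'i \<Rightarrow> 'i \<Rightarrow> real"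
  assumes "finite I"
  shows "(\<Sum>s\<in>I. \<Sum>t\<in>I - {s}. F s t) = (\<Sum>s\<in>I. \<Sum>t\<in>I. F s t) - (\<Sum>s\<in>I. F s s)"
proof -
  have "(\<Sum>t\<in>I - {s}. F s t) = (\<Sum>t\<in>I. F s t) - F s s" if "s \<in> I" for s
    using sum.remove[OF assms that, of "F s"] by simp
  then show ?thesis by (simp add: sum_subtractf)
qed

text \<open>
  The diagonal is left out of all sums here, unlike in \<open>A_star\<close>. A constant diagonal \<open>a0\<close>
  shifts \<open>A_star\<close> by \<open>- a0 / (N - 1)\<close>, which is what the correction term of \<open>V_star\<close> removes.
\<close>

definition row_sum :: "'i set \<Rightarrow> ('i \<Rightarrow> 'i \<Rightarrow> real) \<Rightarrow> 'i \<Rightarrow> real" where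
  "row_sum I a s = (\<Sum>t\<in>I - {s}. a s t)"

definition total_sum :: "'i set \<Rightarrow> ('i \<Rightarrow> 'i \<Rightarrow> real) \<Rightarrow> real" where
  "total_sum I a = (\<Sum>s\<in>I. row_sum I a s)"

text \<open>U-centering, known from bias-corrected distance covariance: with the divisors
  \<open>N - 2\<close> and \<open>(N - 1) * (N - 2)\<close> the off-diagonal rows of a symmetric
  array sum to zero.\<close>

definition u_center :: "'i set \<Rightarrow> ('i \<Rightarrow> 'i \<Rightarrow> real) \<Rightarrow> 'i \<Rightarrow> 'i \<Rightarrow> real" where
  "u_center I a s t = a s t - row_sum I a s / (real (card I) - 2) - row_sum I a t / (real (card I) - 2)
     + total_sum I a / ((real (card I) - 1) * (real (card I) - 2))"

definition u_var :: "'i set \<Rightarrow> ('i \<Rightarrow> 'i \<Rightarrow> real) \<Rightarrow> real" where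
  "u_var I a = (\<Sum>s\<in>I. \<Sum>t\<in>I - {s}. (u_center I a s t)\<^sup>2) / (real (card I) * (real (card I) - 3))"

lemma u_center_sum:
  assumes I: "finite I" "4 \<le> card I"
  shows "(\<Sum>s\<in>I. \<Sum>t\<in>I - {s}. u_center I a s t) = 0"
proof -
  let ?N = "real (card I)" and ?T = "total_sum I a"
  have N: "4 \<le> ?N" using I by simp
  have "(\<Sum>s\<in>I. \<Sum>t\<in>I - {s}. u_center I a s t)
    = ?T - (\<Sum>s\<in>I. \<Sum>t\<in>I - {s}. row_sum I a s) / (?N - 2) - (\<Sum>s\<in>I. \<Sum>t\<in>I - {s}. row_sum I a t) / (?N - 2)
      + (\<Sum>s\<in>I. \<Sum>t\<in>I - {s}. ?T) / ((?N - 1) * (?N - 2))"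
    unfolding u_center_def
    by (simp add: sum.distrib sum_subtractf sum_divide_distrib[symmetric] total_sum_def row_sum_def)
  also have "(\<Sum>s\<in>I. \<Sum>t\<in>I - {s}. row_sum I a s) = (?N - 1) * ?T"
    unfolding sum_offdiagonal[OF I(1)] by (simp add: total_sum_def sum_distrib_left[symmetric] algebra_simps)
  also have "(\<Sum>s\<in>I. \<Sum>t\<in>I - {s}. row_sum I a t) = (?N - 1) * ?T"
    unfolding sum_offdiagonal[OF I(1)] by (simp add: total_sum_def algebra_simps)
  also have "(\<Sum>s\<in>I. \<Sum>t\<in>I - {s}. ?T) = ?N * (?N - 1) * ?T"
    unfolding sum_offdiagonal[OF I(1)] by (simp add: algebra_simps)
  also have "?T - (?N - 1) * ?T / (?N - 2) - (?N - 1) * ?T / (?N - 2) + ?N * (?N - 1) * ?T / ((?N - 1) * (?N - 2)) = 0"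
    using N by (simp add: divide_simps) (simp add: algebra_simps)
  finally show ?thesis .
qed

text \<open>On symmetric off-diagonal arrays, U-centering is the orthogonal projection onto those
  with vanishing row sums, so the squared norm of the image is the inner product of \<open>a\<close>
  with its image. The proof verifies this by expanding the square.\<close>

lemma u_center_square_sum:
  assumes I: "finite I" "4 \<le> card I" and sym: "\<And>s t. s \<in> I \<Longrightarrow> t \<in> I \<Longrightarrow> a s t = a t s"
  shows "(\<Sum>s\<in>I. \<Sum>t\<in>I - {s}. (u_center I a s t)\<^sup>2) = (\<Sum>s\<in>I. \<Sum>t\<in>I - {s}. (a s t)\<^sup>2)
    - 2 / (real (card I) - 2) * (\<Sum>s\<in>I. (row_sum I a s)\<^sup>2)
    + (total_sum I a)\<^sup>2 / ((real (card I) - 1) * (real (card I) - 2))"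
proof -
  let ?N = "real (card I)" and ?T = "total_sum I a"
  let ?r = "row_sum I a"
  define \<gamma> where "\<gamma> = 1 / ((?N - 1) * (?N - 2))"
  define \<alpha> where "\<alpha> = 1 / (?N - 2)"
  define R where "R = (\<Sum>s\<in>I. (?r s)\<^sup>2)"
  have N: "4 \<le> ?N" using I by simp
  have \<alpha>: "\<alpha> = \<gamma> * (?N - 1)" "\<alpha> * (?N - 2) = 1" using N by (auto simp: \<alpha>_def \<gamma>_def)
  have \<gamma>: "\<gamma> * (?N - 1) * (?N - 2) = 1" using N by (auto simp: \<gamma>_def)
  have eq: "(u_center I a s t)\<^sup>2 = (a s t)\<^sup>2 + (\<alpha>\<^sup>2 * (?r s)\<^sup>2 + (\<alpha>\<^sup>2 * (?r t)\<^sup>2 + (2 * \<alpha>\<^sup>2 * (?r s * ?r t) + (\<gamma>\<^sup>2 * ?T\<^sup>2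
      + (- (2 * \<alpha>) * (a s t * ?r s) + (- (2 * \<alpha>) * (a s t * ?r t) + (2 * \<gamma> * ?T * a s t
      + (- (2 * \<alpha> * \<gamma> * ?T) * ?r s + - (2 * \<alpha> * \<gamma> * ?T) * ?r t))))))))" for s t
    unfolding u_center_def \<alpha>_def \<gamma>_def by (simp add: power2_eq_square algebra_simps)
  have s1: "(\<Sum>s\<in>I. \<Sum>t\<in>I - {s}. (?r s)\<^sup>2) = (?N - 1) * R"
    unfolding sum_offdiagonal[OF I(1)] by (simp add: R_def sum_distrib_left[symmetric] algebra_simps)
  have s2: "(\<Sum>s\<in>I. \<Sum>t\<in>I - {s}. (?r t)\<^sup>2) = (?N - 1) * R"
    unfolding sum_offdiagonal[OF I(1)] by (simp add: R_def algebra_simps)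
  have "(\<Sum>s\<in>I. \<Sum>t\<in>I - {s}. ?r s * ?r t) = ?T\<^sup>2 - R"
    unfolding sum_offdiagonal[OF I(1)] R_def total_sum_def power2_eq_square sum_product by simp
  then have s3: "(\<Sum>s\<in>I. ?r s * sum ?r (I - {s})) = ?T\<^sup>2 - R" by (simp only: sum_distrib_left)
  have s4: "(\<Sum>s\<in>I. \<Sum>t\<in>I - {s}. ?T\<^sup>2) = ?N * (?N - 1) * ?T\<^sup>2"
    unfolding sum_offdiagonal[OF I(1)] by (simp add: algebra_simps)
  have s5: "(\<Sum>s\<in>I. \<Sum>t\<in>I - {s}. a s t * ?r s) = R"
    by (simp add: R_def row_sum_def sum_distrib_right[symmetric] power2_eq_square)
  have s6: "(\<Sum>s\<in>I. \<Sum>t\<in>I - {s}. a s t * ?r t) = R"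
  proof -
    have "(\<Sum>s\<in>I. \<Sum>t\<in>I - {s}. a s t * ?r t) = (\<Sum>s\<in>I. \<Sum>t\<in>I - {s}. a s t * ?r s)"
      unfolding sum_offdiagonal[OF I(1)]
      by (subst sum.swap) (auto intro!: sum.cong arg_cong2[where f="(-)"] simp: sym)
    then show ?thesis using s5 by simp
  qed
  have s7: "(\<Sum>s\<in>I. \<Sum>t\<in>I - {s}. a s t) = ?T" by (simp add: total_sum_def row_sum_def)
  have s8: "(\<Sum>s\<in>I. \<Sum>t\<in>I - {s}. ?r s) = (?N - 1) * ?T"
    unfolding sum_offdiagonal[OF I(1)] by (simp add: total_sum_def sum_distrib_left[symmetric] algebra_simps)
  have s9: "(\<Sum>s\<in>I. \<Sum>t\<in>I - {s}. ?r t) = (?N - 1) * ?T"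
    unfolding sum_offdiagonal[OF I(1)] by (simp add: total_sum_def algebra_simps)
  have "(\<Sum>s\<in>I. \<Sum>t\<in>I - {s}. (u_center I a s t)\<^sup>2) = (\<Sum>s\<in>I. \<Sum>t\<in>I - {s}. (a s t)\<^sup>2)
    + (\<alpha>\<^sup>2 * ((?N - 1) * R) + (\<alpha>\<^sup>2 * ((?N - 1) * R) + (2 * \<alpha>\<^sup>2 * (?T\<^sup>2 - R) + (\<gamma>\<^sup>2 * (?N * (?N - 1) * ?T\<^sup>2)
      + (- (2 * \<alpha>) * R + (- (2 * \<alpha>) * R + (2 * \<gamma> * ?T * ?T
      + (- (2 * \<alpha> * \<gamma> * ?T) * ((?N - 1) * ?T) + - (2 * \<alpha> * \<gamma> * ?T) * ((?N - 1) * ?T)))))))))"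
    unfolding eq sum.distrib sum_distrib_left[symmetric] s1 s2 s3 s4 s5 s6 s7 s8 s9 ..
  also have "\<dots> = (\<Sum>s\<in>I. \<Sum>t\<in>I - {s}. (a s t)\<^sup>2) - 2 * \<alpha> * R + \<gamma> * ?T\<^sup>2"
  proof -
    have "\<alpha>\<^sup>2 * ((?N - 1) * R) + \<alpha>\<^sup>2 * ((?N - 1) * R) - 2 * \<alpha>\<^sup>2 * R = 2 * \<alpha> * (\<alpha> * (?N - 2)) * R"
      by (simp add: power2_eq_square algebra_simps)
    then have c1: "\<alpha>\<^sup>2 * ((?N - 1) * R) + \<alpha>\<^sup>2 * ((?N - 1) * R) - 2 * \<alpha>\<^sup>2 * R = 2 * \<alpha> * R"
      unfolding \<alpha>(2) by simp
    have "2 * \<alpha>\<^sup>2 * ?T\<^sup>2 + ?N * (?N - 1) * (\<gamma>\<^sup>2 * ?T\<^sup>2) - 4 * \<alpha> * \<gamma> * ((?N - 1) * ?T\<^sup>2)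
        = - (\<gamma> * (\<gamma> * (?N - 1) * (?N - 2))) * ?T\<^sup>2"
      unfolding \<alpha>(1) by (simp add: power2_eq_square algebra_simps)
    then have c2: "2 * \<alpha>\<^sup>2 * ?T\<^sup>2 + ?N * (?N - 1) * (\<gamma>\<^sup>2 * ?T\<^sup>2) - 4 * \<alpha> * \<gamma> * ((?N - 1) * ?T\<^sup>2) = - \<gamma> * ?T\<^sup>2"
      unfolding \<gamma> by simp
    show ?thesis using c1 c2 by (simp add: power2_eq_square algebra_simps)
  qed
  finally show ?thesis by (simp add: \<alpha>_def \<gamma>_def R_def)
qed

text \<open>The off-diagonal row \<open>s\<close> of the array \<open>u s + u t\<close> sums to
  \<open>(N - 2) * u s + U\<close>; dividing by \<open>N - 2\<close> recovers \<open>u s\<close>,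
  and the total sum corrects the constant.\<close>

lemma u_center_shift:
  assumes I: "finite I" "4 \<le> card I"
    and ab: "\<And>s t. s \<in> I \<Longrightarrow> t \<in> I \<Longrightarrow> s \<noteq> t \<Longrightarrow> a s t = b s t + u s + u t"
    and st: "s \<in> I" "t \<in> I" "s \<noteq> t"
  shows "u_center I a s t = u_center I b s t"
proof -
  let ?N = "real (card I)"
  define U where "U = sum u I"
  have N: "4 \<le> ?N" using I by simp
  have r: "row_sum I a s = row_sum I b s + (?N - 2) * u s + U" if s: "s \<in> I" for s
  proof -
    have "row_sum I a s = (\<Sum>t\<in>I - {s}. b s t + u s + u t)"
      unfolding row_sum_def using s by (intro sum.cong refl ab) auto
    also have "\<dots> = row_sum I b s + (?N - 1) * u s + (U - u s)"
      using I s N by (simp add: sum.distrib row_sum_def U_def sum_diff1 of_nat_diff)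
    finally show ?thesis by (simp add: algebra_simps)
  qed
  have "total_sum I a = total_sum I b + (?N - 2) * U + ?N * U"
    unfolding total_sum_def using r by (simp add: sum.distrib U_def sum_distrib_left)
  then have T: "total_sum I a = total_sum I b + 2 * (?N - 1) * U" by (simp add: algebra_simps)
  show ?thesis
    unfolding u_center_def T r[OF st(1)] r[OF st(2)] ab[OF st]
    using N by (simp add: divide_simps) (simp add: algebra_simps)
qed

lemma u_var_shift:
  assumes "finite I" "4 \<le> card I"
    and "\<And>s t. s \<in> I \<Longrightarrow> t \<in> I \<Longrightarrow> s \<noteq> t \<Longrightarrow> a s t = b s t + u s + u t"
  shows "u_var I a = u_var I b"
  unfolding u_var_def
  by (intro arg_cong2[where f="(/)"] sum.cong refl arg_cong[where f="\<lambda>x. x\<^sup>2"] u_center_shift[OF assms]) auto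

lemma u_var_nonneg: "4 \<le> card I \<Longrightarrow> 0 \<le> u_var I a"
  unfolding u_var_def by (intro divide_nonneg_nonneg sum_nonneg mult_nonneg_nonneg) auto

lemma u_center_add: "u_center I (\<lambda>s t. a s t + b s t) s t = u_center I a s t + u_center I b s t"
  unfolding u_center_def total_sum_def row_sum_def
  by (simp add: sum.distrib add_divide_distrib algebra_simps)

lemma u_center_scale: "u_center I (\<lambda>s t. c * a s t) s t = c * u_center I a s t"
  unfolding u_center_def total_sum_def row_sum_def
  by (simp add: sum_distrib_left[symmetric] algebra_simps)

lemma u_var_scale: "u_var I (\<lambda>s t. c * a s t) = c\<^sup>2 * u_var I a"
  unfolding u_var_def u_center_scale by (simp add: power_mult_distrib sum_distrib_left[symmetric])

text \<open>The square root of \<open>u_var\<close> is a Euclidean seminorm of a linear image. The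
  tail of the kernel thus perturbs it by at most its own seminorm, for which second moments
  suffice.\<close>

lemma sqrt_u_var_triangle:
  assumes I: "finite I" "4 \<le> card I"
  shows "sqrt (u_var I (\<lambda>s t. a s t + b s t)) \<le> sqrt (u_var I a) + sqrt (u_var I b)"
proof -
  let ?P = "SIGMA s:I. I - {s}"
  let ?d = "real (card I) * (real (card I) - 3)"
  have v: "sqrt (u_var I x) = L2_set (\<lambda>(s, t). u_center I x s t) ?P / sqrt ?d" for x
    unfolding u_var_def L2_set_def using I
    by (simp add: sum.Sigma real_sqrt_divide split_beta)
  have "L2_set (\<lambda>(s, t). u_center I (\<lambda>s t. a s t + b s t) s t) ?P
      = L2_set (\<lambda>p. (case p of (s, t) \<Rightarrow> u_center I a s t) + (case p of (s, t) \<Rightarrow> u_center I b s t)) ?P"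
    by (simp add: u_center_add split_beta')
  also have "\<dots> \<le> L2_set (\<lambda>(s, t). u_center I a s t) ?P + L2_set (\<lambda>(s, t). u_center I b s t) ?P"
    by (rule L2_set_triangle_ineq)
  finally show ?thesis unfolding v add_divide_distrib[symmetric]
    using I by (intro divide_right_mono) auto
qed

lemma sqrt_u_var_diff:
  assumes I: "finite I" "4 \<le> card I"
  shows "\<bar>sqrt (u_var I a) - sqrt (u_var I b)\<bar> \<le> sqrt (u_var I (\<lambda>s t. a s t - b s t))"
proof -
  have "u_var I (\<lambda>s t. b s t - a s t) = u_var I (\<lambda>s t. a s t - b s t)"
    using u_var_scale[of I "-1" "\<lambda>s t. a s t - b s t"] by simp
  then show ?thesis
    using sqrt_u_var_triangle[OF I, of b "\<lambda>s t. a s t - b s t"] sqrt_u_var_triangle[OF I, of a "\<lambda>s t. b s t - a s t"]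
    by simp
qed

lemma total_sum_square_le: "finite I \<Longrightarrow> (total_sum I a)\<^sup>2 \<le> real (card I) * (\<Sum>s\<in>I. (row_sum I a s)\<^sup>2)"
  unfolding total_sum_def using sum_squared_le_sum_of_squares[of "row_sum I a" I] by (simp add: mult.commute)

text \<open>The row term has a favourable sign and is dropped; two uses of Cauchy-Schwarz bound the
  total-sum term by twice the sum of squares.\<close>

lemma u_var_le:
  assumes I: "finite I" "4 \<le> card I" and sym: "\<And>s t. s \<in> I \<Longrightarrow> t \<in> I \<Longrightarrow> a s t = a t s"
  shows "u_var I a \<le> 3 * (\<Sum>s\<in>I. \<Sum>t\<in>I - {s}. (a s t)\<^sup>2) / (real (card I) * (real (card I) - 3))"
proof -
  let ?N = "real (card I)" and ?A = "\<Sum>s\<in>I. \<Sum>t\<in>I - {s}. (a s t)\<^sup>2" and ?R = "\<Sum>s\<in>I. (row_sum I a s)\<^sup>2"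
  have N: "4 \<le> ?N" using I by simp
  have "?R \<le> (\<Sum>s\<in>I. (?N - 1) * (\<Sum>t\<in>I - {s}. (a s t)\<^sup>2))"
  proof (rule sum_mono)
    fix s assume "s \<in> I"
    then show "(row_sum I a s)\<^sup>2 \<le> (?N - 1) * (\<Sum>t\<in>I - {s}. (a s t)\<^sup>2)"
      using sum_squared_le_sum_of_squares[of "a s" "I - {s}"] I by (simp add: row_sum_def mult.commute of_nat_diff)
  qed
  then have R: "?R \<le> (?N - 1) * ?A" by (simp add: sum_distrib_left)
  have "(total_sum I a)\<^sup>2 / ((?N - 1) * (?N - 2)) \<le> ?N * ((?N - 1) * ?A) / ((?N - 1) * (?N - 2))"
    using total_sum_square_le[OF I(1), of a] R N
    by (intro divide_right_mono order_trans[OF total_sum_square_le[OF I(1)]] mult_left_mono) auto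
  also have "\<dots> = ?N / (?N - 2) * ?A"
  proof -
    have "x * ((x - 1) * y) / ((x - 1) * (x - 2)) = x / (x - 2) * y" if "4 \<le> x" for x y :: real
      using that by (simp add: divide_simps)
    then show ?thesis using N .
  qed
  also have "\<dots> \<le> 2 * ?A" using N by (intro mult_right_mono sum_nonneg) (auto simp: divide_le_eq)
  finally have T: "(total_sum I a)\<^sup>2 / ((?N - 1) * (?N - 2)) \<le> 2 * ?A" .
  have "0 \<le> 2 / (?N - 2) * ?R" using N by (intro mult_nonneg_nonneg sum_nonneg) auto
  then have "(\<Sum>s\<in>I. \<Sum>t\<in>I - {s}. (u_center I a s t)\<^sup>2) \<le> 3 * ?A"
    using u_center_square_sum[where a=a, OF I sym] T by linarith
  then show ?thesis unfolding u_var_def using N by (intro divide_right_mono) auto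
qed

text \<open>The entries of \<open>u_center\<close> sum to zero off the diagonal, so shifting them by
  \<open>- a0 / (N - 1)\<close> adds exactly \<open>N * (N - 1)\<close> squares of the shift and no
  cross term.\<close>

lemma A_star_square_sum:
  assumes N: "4 \<le> N" and sym: "\<And>s t. s \<in> {1..N} \<Longrightarrow> t \<in> {1..N} \<Longrightarrow> a s t = a t s"
    and diag: "\<And>s. s \<in> {1..N} \<Longrightarrow> a s s = a0"
  shows "1 / (real N * (real N - 3)) * (\<Sum>s=1..N. \<Sum>t\<in>{1..N} - {s}. (A_star N a s t)\<^sup>2)
    - a0\<^sup>2 / ((real N - 1) * (real N - 3)) = u_var {1..N} a"
proof -
  let ?I = "{1..N}"
  have N': "4 \<le> real N" using N by simp
  have fin: "finite ?I" "4 \<le> card ?I" using N by auto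
  have row: "(\<Sum>j=1..N. a s j) = row_sum ?I a s + a0" if "s \<in> ?I" for s
    unfolding row_sum_def using sum.remove[OF fin(1) that, of "a s"] diag[OF that] by simp
  have col: "(\<Sum>i=1..N. a i t) = row_sum ?I a t + a0" if t: "t \<in> ?I" for t
  proof -
    have "(\<Sum>i=1..N. a i t) = (\<Sum>i=1..N. a t i)" using sym t by (intro sum.cong refl) auto
    then show ?thesis using row[OF t] by simp
  qed
  have tot: "(\<Sum>i=1..N. \<Sum>j=1..N. a i j) = total_sum ?I a + real N * a0"
    using row by (simp add: total_sum_def sum.distrib)
  have A: "A_star N a s t = u_center ?I a s t - a0 / (real N - 1)" if "s \<in> ?I" "t \<in> ?I" for s t
    unfolding A_star_def u_center_def row[OF that(1)] col[OF that(2)] tot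
    using N' by (simp add: divide_simps) (simp add: algebra_simps)
  have "(\<Sum>s\<in>?I. \<Sum>t\<in>?I - {s}. (A_star N a s t)\<^sup>2)
      = (\<Sum>s\<in>?I. \<Sum>t\<in>?I - {s}. (u_center ?I a s t)\<^sup>2 + (- (2 * (a0 / (real N - 1))) * u_center ?I a s t + (a0 / (real N - 1))\<^sup>2))"
    by (intro sum.cong refl) (auto simp: A power2_diff)
  also have "\<dots> = (\<Sum>s\<in>?I. \<Sum>t\<in>?I - {s}. (u_center ?I a s t)\<^sup>2) + real N * (real N - 1) * (a0 / (real N - 1))\<^sup>2"
  proof -
    have "(\<Sum>s\<in>?I. \<Sum>t\<in>?I - {s}. (a0 / (real N - 1))\<^sup>2) = real N * (real N - 1) * (a0 / (real N - 1))\<^sup>2"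
      unfolding sum_offdiagonal[OF fin(1)] by (simp add: algebra_simps)
    then show ?thesis
      unfolding sum.distrib sum_distrib_left[symmetric] u_center_sum[OF fin] by simp
  qed
  finally have "(\<Sum>s=1..N. \<Sum>t\<in>?I - {s}. (A_star N a s t)\<^sup>2)
      = (\<Sum>s\<in>?I. \<Sum>t\<in>?I - {s}. (u_center ?I a s t)\<^sup>2) + real N * (real N - 1) * (a0 / (real N - 1))\<^sup>2" .
  moreover have "1 / (real N * (real N - 3)) * (real N * (real N - 1) * (a0 / (real N - 1))\<^sup>2) = a0\<^sup>2 / ((real N - 1) * (real N - 3))"
    using N' by (simp add: divide_simps) (simp add: power2_eq_square)
  ultimately show ?thesis by (simp add: u_var_def distrib_left)
qed

subsection \<open>The numerator as a weighted quadratic form\<close>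

text \<open>The coefficient of an unordered pair in \<open>E_stat\<close>, as
  \<open>1 / (n choose 2)\<close> is \<open>2 / (n * (n - 1))\<close>. The ordered double sum counts
  the pair twice, hence the half in \<open>E_stat_eq\<close>.\<close>

definition raw_weight :: "nat \<Rightarrow> nat \<Rightarrow> nat \<Rightarrow> nat \<Rightarrow> real" where
  "raw_weight n m s t =
     (if s = t then 0
      else if s \<le> n \<and> t \<le> n then - 2 / (real n * (real n - 1))
      else if n < s \<and> n < t then - 2 / (real m * (real m - 1))
      else 2 / (real n * real m))"

lemma sum_split_pooled:
  fixes f :: "nat \<Rightarrow> real"
  shows "(\<Sum>t=1..n + m. f t) = (\<Sum>t=1..n. f t) + (\<Sum>j=1..m. f (n + j))"
  using sum.ub_add_nat[of 1 n f m] sum.shift_bounds_cl_nat_ivl[of f 1 n m] by (simp add: add.commute)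

lemma sum_less_symmetric:
  fixes F :: "nat \<Rightarrow> nat \<Rightarrow> real"
  assumes "\<And>i j. i \<in> {1..n} \<Longrightarrow> j \<in> {1..n} \<Longrightarrow> F i j = F j i"
  shows "2 * (\<Sum>j=1..n. \<Sum>i=1..<j. F i j) = (\<Sum>i=1..n. \<Sum>j=1..n. of_bool (i \<noteq> j) * F i j)"
  using assms
proof (induction n)
  case (Suc n)
  have IH: "2 * (\<Sum>j=1..n. \<Sum>i=1..<j. F i j) = (\<Sum>i=1..n. \<Sum>j=1..n. of_bool (i \<noteq> j) * F i j)"
    by (rule Suc.IH) (use Suc.prems in auto)
  have 1: "(\<Sum>j=1..n. of_bool (Suc n \<noteq> j) * F (Suc n) j) = (\<Sum>i=1..n. F i (Suc n))"
    by (intro sum.cong refl) (use Suc.prems in auto)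
  have 2: "(\<Sum>i=1..n. of_bool (i \<noteq> Suc n) * F i (Suc n)) = (\<Sum>i=1..n. F i (Suc n))"
    by (intro sum.cong refl) auto
  have 3: "{1..<Suc n} = {1..n}" by auto
  have 4: "(\<Sum>j=1..Suc n. g j) = (\<Sum>j=1..n. g j) + g (Suc n)" for g :: "nat \<Rightarrow> real" by simp
  show ?case unfolding 4 sum.distrib 1 2 3 distrib_left IH by simp
qed simp

lemma E_stat_eq:
  assumes n: "2 \<le> n" and m: "2 \<le> m"
    and sym: "\<And>s t. s \<in> {1..n + m} \<Longrightarrow> t \<in> {1..n + m} \<Longrightarrow> k (pooled n X Y s) (pooled n X Y t) = k (pooled n X Y t) (pooled n X Y s)"
  shows "E_stat n m k X Y = (\<Sum>s=1..n + m. \<Sum>t=1..n + m. raw_weight n m s t * k (pooled n X Y s) (pooled n X Y t)) / 2"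
proof -
  let ?W = "pooled n X Y"
  let ?f = "\<lambda>s t. raw_weight n m s t * k (?W s) (?W t)"
  have n': "2 \<le> real n" and m': "2 \<le> real m" using n m by auto
  have XX: "(\<Sum>s=1..n. \<Sum>t=1..n. ?f s t) = - 2 / (real n * (real n - 1)) * (2 * (\<Sum>j=1..n. \<Sum>i=1..<j. k (X i) (X j)))"
  proof -
    have sX: "k (X i) (X j) = k (X j) (X i)" if "i \<in> {1..n}" "j \<in> {1..n}" for i j
      using sym[of i j] that by (auto simp: pooled_def)
    have eq: "2 * (\<Sum>j=1..n. \<Sum>i=1..<j. k (X i) (X j)) = (\<Sum>i=1..n. \<Sum>j=1..n. of_bool (i \<noteq> j) * k (X i) (X j))"
      by (rule sum_less_symmetric) (rule sX)
    show ?thesis unfolding eq unfolding sum_distrib_left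
      by (intro sum.cong refl) (auto simp: raw_weight_def pooled_def)
  qed
  have YY: "(\<Sum>s=1..m. \<Sum>t=1..m. ?f (n + s) (n + t)) = - 2 / (real m * (real m - 1)) * (2 * (\<Sum>j=1..m. \<Sum>i=1..<j. k (Y i) (Y j)))"
  proof -
    have sY: "k (Y i) (Y j) = k (Y j) (Y i)" if "i \<in> {1..m}" "j \<in> {1..m}" for i j
      using sym[of "n + i" "n + j"] that by (auto simp: pooled_def)
    have eq: "2 * (\<Sum>j=1..m. \<Sum>i=1..<j. k (Y i) (Y j)) = (\<Sum>i=1..m. \<Sum>j=1..m. of_bool (i \<noteq> j) * k (Y i) (Y j))"
      by (rule sum_less_symmetric) (rule sY)
    show ?thesis unfolding eq unfolding sum_distrib_left
      by (intro sum.cong refl) (auto simp: raw_weight_def pooled_def)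
  qed
  have XY: "(\<Sum>s=1..n. \<Sum>t=1..m. ?f s (n + t)) = 2 / (real n * real m) * (\<Sum>i=1..n. \<Sum>j=1..m. k (X i) (Y j))"
    unfolding sum_distrib_left by (intro sum.cong refl) (auto simp: raw_weight_def pooled_def)
  have YX: "(\<Sum>s=1..m. \<Sum>t=1..n. ?f (n + s) t) = 2 / (real n * real m) * (\<Sum>i=1..n. \<Sum>j=1..m. k (X i) (Y j))"
  proof -
    have "(\<Sum>s=1..m. \<Sum>t=1..n. ?f (n + s) t) = (\<Sum>s=1..m. \<Sum>t=1..n. 2 / (real n * real m) * k (X t) (Y s))"
    proof (intro sum.cong refl)
      fix s t assume st: "s \<in> {1..m}" "t \<in> {1..n}"
      show "?f (n + s) t = 2 / (real n * real m) * k (X t) (Y s)"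
        using st sym[of "n + s" t] by (auto simp: raw_weight_def pooled_def)
    qed
    also have "\<dots> = 2 / (real n * real m) * (\<Sum>i=1..n. \<Sum>j=1..m. k (X i) (Y j))"
      by (subst sum.swap) (simp add: sum_distrib_left)
    finally show ?thesis .
  qed
  have ch: "real (n choose 2) = real n * (real n - 1) / 2" "real (m choose 2) = real m * (real m - 1) / 2"
    using n m by (simp_all add: choose_two real_of_nat_div of_nat_diff)
  show ?thesis
    unfolding sum_split_pooled sum.distrib XX YY XY YX E_stat_def ch
    by (simp add: field_simps)
qed

text \<open>A row of the first sample has total weight \<open>- 2 / n\<close> within its own sample
  and \<open>2 / n\<close> across. The squared weights sum to \<open>2 * c_coef n m\<close>, so
  division by \<open>sqrt (c_coef n m)\<close> achieves the normalization 2.\<close>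

lemma raw_weight_props:
  assumes n: "2 \<le> n" and m: "2 \<le> m"
  shows "s \<in> {1..n + m} \<Longrightarrow> (\<Sum>t=1..n + m. raw_weight n m s t) = 0"
    and "(\<Sum>s=1..n + m. \<Sum>t=1..n + m. (raw_weight n m s t)\<^sup>2) = 2 * c_coef n m"
    and "raw_weight n m s t = raw_weight n m t s" "raw_weight n m s s = 0"
proof -
  have n': "2 \<le> real n" and m': "2 \<le> real m" using n m by auto
  show "raw_weight n m s t = raw_weight n m t s" "raw_weight n m s s = 0"
    by (auto simp: raw_weight_def)
  have ofs: "(\<Sum>t=1..j. of_bool (s \<noteq> t) * c) = (real j - 1) * c" if "s \<in> {1..j}" for s j and c :: real
  proof -
    have 1: "(\<Sum>t=1..j. of_bool (s \<noteq> t) * c) = of_bool (s \<noteq> s) * c + (\<Sum>t\<in>{1..j} - {s}. of_bool (s \<noteq> t) * c)"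
      by (rule sum.remove[OF _ that]) simp
    have 2: "(\<Sum>t\<in>{1..j} - {s}. of_bool (s \<noteq> t) * c) = (\<Sum>t\<in>{1..j} - {s}. c)"
      by (intro sum.cong refl) auto
    show ?thesis unfolding 1 2 using that by (simp add: of_nat_diff)
  qed
  \<comment> \<open>The general \<open>g\<close> serves both the row sums and the sums of
    squares.\<close>
  have rows: "(\<Sum>t=1..n + m. g (raw_weight n m s t)) =
      (if s \<le> n then (real n - 1) * g (- 2 / (real n * (real n - 1))) + real m * g (2 / (real n * real m))
       else real n * g (2 / (real n * real m)) + (real m - 1) * g (- 2 / (real m * (real m - 1))))"
    if s: "s \<in> {1..n + m}" and g0: "g 0 = 0" for s and g :: "real \<Rightarrow> real"
  proof (cases "s \<le> n")
    case True
    have "(\<Sum>t=1..n. g (raw_weight n m s t)) = (\<Sum>t=1..n. of_bool (s \<noteq> t) * g (- 2 / (real n * (real n - 1))))"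
      using True g0 by (intro sum.cong refl) (auto simp: raw_weight_def)
    also have "\<dots> = (real n - 1) * g (- 2 / (real n * (real n - 1)))" by (rule ofs) (use True s in auto)
    finally have "(\<Sum>t=1..n. g (raw_weight n m s t)) = (real n - 1) * g (- 2 / (real n * (real n - 1)))" .
    moreover have "(\<Sum>t=1..m. g (raw_weight n m s (n + t))) = (\<Sum>t=1..m. g (2 / (real n * real m)))"
      using True by (intro sum.cong refl arg_cong[where f=g]) (auto simp: raw_weight_def)
    ultimately show ?thesis using True unfolding sum_split_pooled by simp
  next
    case False
    have "(\<Sum>t=1..m. g (raw_weight n m s (n + t))) = (\<Sum>t=1..m. of_bool (s - n \<noteq> t) * g (- 2 / (real m * (real m - 1))))"
      using False g0 by (intro sum.cong refl) (auto simp: raw_weight_def)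
    also have "\<dots> = (real m - 1) * g (- 2 / (real m * (real m - 1)))" by (rule ofs) (use False s in auto)
    finally have "(\<Sum>t=1..m. g (raw_weight n m s (n + t))) = (real m - 1) * g (- 2 / (real m * (real m - 1)))" .
    moreover have "(\<Sum>t=1..n. g (raw_weight n m s t)) = (\<Sum>t=1..n. g (2 / (real n * real m)))"
      using False by (intro sum.cong refl arg_cong[where f=g]) (auto simp: raw_weight_def)
    ultimately show ?thesis using False unfolding sum_split_pooled by simp
  qed
  show "(\<Sum>t=1..n + m. raw_weight n m s t) = 0" if "s \<in> {1..n + m}"
    unfolding rows[OF that, of "\<lambda>x. x", OF refl] using n' m' by (auto simp: divide_simps)
  have "(\<Sum>s=1..n + m. \<Sum>t=1..n + m. (raw_weight n m s t)\<^sup>2)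
     = (\<Sum>s=1..n + m. (if s \<le> n then (real n - 1) * (- 2 / (real n * (real n - 1)))\<^sup>2 + real m * (2 / (real n * real m))\<^sup>2
       else real n * (2 / (real n * real m))\<^sup>2 + (real m - 1) * (- 2 / (real m * (real m - 1)))\<^sup>2))"
    by (intro sum.cong refl rows) auto
  also have "\<dots> = real n * ((real n - 1) * (- 2 / (real n * (real n - 1)))\<^sup>2 + real m * (2 / (real n * real m))\<^sup>2)
       + real m * (real n * (2 / (real n * real m))\<^sup>2 + (real m - 1) * (- 2 / (real m * (real m - 1)))\<^sup>2)"
    unfolding sum_split_pooled by simp
  also have "\<dots> = 2 * c_coef n m"
    unfolding c_coef_def using n' m' by (simp add: divide_simps) (simp add: power2_eq_square algebra_simps)
  finally show "(\<Sum>s=1..n + m. \<Sum>t=1..n + m. (raw_weight n m s t)\<^sup>2) = 2 * c_coef n m" .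
qed

subsection \<open>Perturbation of the limit law\<close>

lemma abs_sqrt_minus_1_le: "0 \<le> v \<Longrightarrow> \<bar>sqrt v - 1\<bar> \<le> \<bar>v - 1\<bar>"
proof -
  assume v: "0 \<le> v"
  have "\<bar>v - 1\<bar> = \<bar>sqrt v - 1\<bar> * (sqrt v + 1)"
  proof -
    have "v - 1 = (sqrt v - 1) * (sqrt v + 1)" using v by (simp add: algebra_simps)
    then show ?thesis using v by (simp add: abs_mult)
  qed
  moreover have "\<bar>sqrt v - 1\<bar> * 1 \<le> \<bar>sqrt v - 1\<bar> * (sqrt v + 1)"
    using v by (intro mult_left_mono) auto
  ultimately show ?thesis by simp
qed

text \<open>Off \<open>B\<close> the denominator is positive, as \<open>\<eta>\<close> is at most 1
  / 2, so the event compares \<open>S1 + S2\<close> with \<open>x * sqrt (V z)\<close>. It lies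
  between events for \<open>S1\<close> alone at thresholds
  \<open>x * (1 - sg * \<eta>) - \<delta>\<close> and
  \<open>x * (1 + sg * \<eta>) + \<delta>\<close>. The normal distribution function changes by at
  most \<open>\<delta> + 2 * \<eta>\<close> between \<open>x\<close> and either threshold.\<close>

lemma (in prob_space) studentized_cdf:
  fixes S1 S2 V :: "'a \<Rightarrow> real"
  assumes [measurable]: "S1 \<in> borel_measurable M" "S2 \<in> borel_measurable M" "V \<in> borel_measurable M" "B \<in> events"
    and good: "\<And>z. z \<in> space M \<Longrightarrow> z \<notin> B \<Longrightarrow> \<bar>S2 z\<bar> \<le> \<delta> \<and> \<bar>sqrt (V z) - 1\<bar> \<le> \<eta>"
    and \<delta>: "0 \<le> \<delta>" and \<eta>: "0 \<le> \<eta>" "\<eta> \<le> 1 / 2"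
    and D: "\<And>y. \<bar>prob {z \<in> space M. S1 z \<le> y} - cdf std_normal_distribution y\<bar> \<le> D"
  shows "\<bar>prob {z \<in> space M. (S1 z + S2 z) / sqrt (V z) \<le> x} - cdf std_normal_distribution x\<bar>
    \<le> D + prob B + \<delta> + 2 * \<eta>"
proof -
  let ?\<Phi> = "cdf std_normal_distribution"
  let ?T = "{z \<in> space M. (S1 z + S2 z) / sqrt (V z) \<le> x}"
  have pos: "0 < sqrt (V z)" if "z \<in> space M" "z \<notin> B" for z
    using good[OF that] \<eta> unfolding abs_le_iff by linarith
  have iff: "(S1 z + S2 z) / sqrt (V z) \<le> x \<longleftrightarrow> S1 z + S2 z \<le> x * sqrt (V z)" if "z \<in> space M" "z \<notin> B" for z
    using pos[OF that] by (simp add: divide_le_eq)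
  \<comment> \<open>With the sign of \<open>x\<close>, the factor \<open>1 + sg * \<eta>\<close>
    moves \<open>x\<close> upwards in either case.\<close>
  define sg where "sg = (if 0 \<le> x then 1 else - 1 :: real)"
  have xs: "x * sqrt (V z) \<le> x * (1 + sg * \<eta>)" "x * (1 - sg * \<eta>) \<le> x * sqrt (V z)" if "z \<in> space M" "z \<notin> B" for z
    using good[OF that] by (cases "0 \<le> x"; auto simp: sg_def abs_le_iff intro: mult_left_mono mult_left_mono_neg)+
  have sg: "\<bar>sg * \<eta>\<bar> = \<eta>" using \<eta> by (simp add: sg_def)
  have half: "1 / 2 \<le> 1 + sg * \<eta>" "1 / 2 \<le> 1 - sg * \<eta>" using sg \<eta> by (auto simp: abs_if split: if_splits)
  have upper: "prob ?T \<le> ?\<Phi> x + (D + prob B + \<delta> + 2 * \<eta>)"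
  proof -
    let ?y = "x * (1 + sg * \<eta>)"
    have "prob ?T \<le> prob ({z \<in> space M. S1 z \<le> ?y + \<delta>} \<union> B)"
    proof (rule finite_measure_mono)
      show "?T \<subseteq> {z \<in> space M. S1 z \<le> ?y + \<delta>} \<union> B"
      proof
        fix z assume z: "z \<in> ?T"
        show "z \<in> {z \<in> space M. S1 z \<le> ?y + \<delta>} \<union> B"
        proof (cases "z \<in> B")
          case False
          then have "S1 z + S2 z \<le> ?y" "\<bar>S2 z\<bar> \<le> \<delta>" using z iff[of z] xs[of z] good[of z] by auto
          then show ?thesis using z by auto
        qed simp
      qed
    qed measurable
    also have "\<dots> \<le> prob {z \<in> space M. S1 z \<le> ?y + \<delta>} + prob B" by (rule measure_subadditive) auto
    also have "prob {z \<in> space M. S1 z \<le> ?y + \<delta>} \<le> ?\<Phi> (?y + \<delta>) + D" using D[of "?y + \<delta>"] by (simp add: abs_le_iff)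
    also have "?\<Phi> (?y + \<delta>) \<le> ?\<Phi> ?y + \<delta>" using cdf_std_normal_lipschitz[of ?y "?y + \<delta>"] \<delta> by simp
    also have "?\<Phi> ?y \<le> ?\<Phi> x + 2 * \<eta>" using cdf_std_normal_scale[OF half(1), of x] sg by (simp add: abs_le_iff)
    finally show ?thesis by simp
  qed
  have lower: "?\<Phi> x - (D + prob B + \<delta> + 2 * \<eta>) \<le> prob ?T"
  proof -
    let ?y = "x * (1 - sg * \<eta>)"
    have "prob {z \<in> space M. S1 z \<le> ?y - \<delta>} \<le> prob (?T \<union> B)"
    proof (rule finite_measure_mono)
      show "{z \<in> space M. S1 z \<le> ?y - \<delta>} \<subseteq> ?T \<union> B"
      proof
        fix z assume z: "z \<in> {z \<in> space M. S1 z \<le> ?y - \<delta>}"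
        show "z \<in> ?T \<union> B"
        proof (cases "z \<in> B")
          case False
          then have "?y \<le> x * sqrt (V z)" "\<bar>S2 z\<bar> \<le> \<delta>" using z xs[of z] good[of z] by auto
          then show ?thesis using z iff[of z] False by auto
        qed simp
      qed
    qed measurable
    also have "\<dots> \<le> prob ?T + prob B" by (rule measure_subadditive) auto
    finally have "prob {z \<in> space M. S1 z \<le> ?y - \<delta>} \<le> prob ?T + prob B" .
    moreover have "?\<Phi> (?y - \<delta>) - D \<le> prob {z \<in> space M. S1 z \<le> ?y - \<delta>}" using D[of "?y - \<delta>"] by (simp add: abs_le_iff)
    moreover have "?\<Phi> ?y - \<delta> \<le> ?\<Phi> (?y - \<delta>)" using cdf_std_normal_lipschitz[of "?y - \<delta>" ?y] \<delta> by simp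
    moreover have "?\<Phi> x - 2 * \<eta> \<le> ?\<Phi> ?y" using cdf_std_normal_scale[OF half(2), of x] sg by (simp add: abs_le_iff)
    ultimately show ?thesis by linarith
  qed
  show ?thesis using upper lower by (simp add: abs_le_iff)
qed

lemma (in prob_space) markov_le:
  fixes u :: "'a \<Rightarrow> real"
  assumes "integrable M u" "\<And>x. x \<in> space M \<Longrightarrow> 0 \<le> u x" "(\<integral>x. u x \<partial>M) \<le> c * s" "0 < s"
  shows "prob {x \<in> space M. s < u x} \<le> c"
proof -
  have "prob {x \<in> space M. s < u x} \<le> prob {x \<in> space M. s \<le> u x}"
    using assms(1) by (intro finite_measure_mono) auto
  also have "\<dots> \<le> (\<integral>x. u x \<partial>M) / s"
    using integral_Markov_inequality_measure[of M u "{}" s] assms by (auto simp: AE_I2)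
  also have "\<dots> \<le> c" using assms by (simp add: divide_le_eq)
  finally show ?thesis .
qed

section \<open>Concentration of the variance estimator\<close>

context degenerate_kernel begin

text \<open>By \<open>u_center_square_sum\<close> the deviation consists of the centered squares
  \<open>D\<close>, the bias of \<open>m2\<close> with its finite-sample factor, and row-sum terms
  dominated by \<open>Q\<close>. The random parts are collected in \<open>R\<close>, bounded in
  mean, so that Markov can be applied later together with the other exceptional events.\<close>

lemma u_var_concentration:
  assumes \<epsilon>: "0 < \<epsilon>" "\<epsilon> \<le> 1" and N: "4 \<le> N" "1 / real N \<le> \<epsilon>^4"
    and m4: "m4 \<le> 256 * real N * \<epsilon>^10" and m2: "m2 \<le> 4" "\<bar>m2 - 1\<bar> \<le> 3 * \<epsilon>^3"
  obtains R where "integrable \<Omega> R" "\<And>z. 0 \<le> R z" "(\<integral>z. R z \<partial>\<Omega>) \<le> 256 * \<epsilon>^4"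
    "\<And>z. z \<in> space \<Omega> \<Longrightarrow> \<bar>u_var I (\<lambda>s t. h (z s) (z t)) - 1\<bar> \<le> 35 * \<epsilon>\<^sup>2 + R z"
proof -
  let ?N = "real N"
  have N4: "4 \<le> ?N" using N by simp
  define d where "d = ?N * (?N - 3)"
  \<comment> \<open>The second bound is attained at \<open>N = 4\<close>.\<close>
  have d: "0 < d" "?N\<^sup>2 \<le> 4 * d"
  proof -
    show "0 < d" using N4 by (simp add: d_def)
    have "?N * (4 * (?N - 3) - ?N) \<ge> 0" using N4 by (intro mult_nonneg_nonneg) auto
    then show "?N\<^sup>2 \<le> 4 * d" by (simp add: d_def power2_eq_square algebra_simps)
  qed
  define w :: "nat \<Rightarrow> nat \<Rightarrow> real" where "w s t = of_bool (s \<noteq> t)" for s t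
  define D where "D z = (\<Sum>s\<in>I. \<Sum>t\<in>I. w s t * ((h (z s) (z t))\<^sup>2 - m2))" for z
  define r where "r s z = (\<Sum>t\<in>I. w s t * h (z s) (z t))" for s z
  define Q where "Q z = (\<Sum>s\<in>I. (r s z)\<^sup>2)" for z
  have bmD: "bounded_measurable D" unfolding D_def[abs_def] by (intro bounded_measurable_rules)
  have bmr: "bounded_measurable (r s)" if "s \<in> I" for s unfolding r_def[abs_def] using that by (intro bounded_measurable_rules)
  have bmQ: "bounded_measurable Q" unfolding Q_def[abs_def] by (intro bounded_measurable_rules bmr)
  have off: "(\<Sum>t\<in>I - {s}. F t) = (\<Sum>t\<in>I. w s t * F t)" if "s \<in> I" for s and F :: "nat \<Rightarrow> real"
    using that finite_I by (subst sum.remove[OF finite_I that]) (auto simp: w_def intro!: sum.cong)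
  define R where "R z = \<bar>D z\<bar> / d + 4 / (?N - 2) * Q z / d" for z
  have ED: "(\<integral>z. \<bar>D z\<bar> \<partial>\<Omega>) \<le> 32 * ?N\<^sup>2 * \<epsilon>^5"
  proof -
    have "(\<integral>z. (D z)\<^sup>2 \<partial>\<Omega>) \<le> 4 * 1\<^sup>2 * ?N ^ 3 * m4"
      unfolding D_def by (rule integral_square_diagonal_le) (auto simp: w_def)
    also have "\<dots> \<le> 4 * 1\<^sup>2 * ?N ^ 3 * (256 * ?N * \<epsilon>^10)" using m4 by (intro mult_left_mono) auto
    also have "\<dots> = (32 * ?N\<^sup>2 * \<epsilon>^5)\<^sup>2" by (simp add: power_mult_distrib eval_nat_numeral)
    finally have "(\<integral>z. \<bar>D z\<bar> \<partial>\<Omega>) \<le> sqrt ((32 * ?N\<^sup>2 * \<epsilon>^5)\<^sup>2)"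
      using bmD by (intro \<Omega>.integral_abs_le_sqrt) (auto simp: bounded_measurable_def intro!: bounded_measurable_integrable bounded_measurable_rules bmD)
    then show ?thesis using \<epsilon> by simp
  qed
  have EQ: "(\<integral>z. Q z \<partial>\<Omega>) \<le> 4 * ?N\<^sup>2"
  proof -
    have "(\<integral>z. Q z \<partial>\<Omega>) = (\<Sum>s\<in>I. (\<integral>z. (r s z)\<^sup>2 \<partial>\<Omega>))"
      unfolding Q_def by (intro Bochner_Integration.integral_sum bounded_measurable_integrable bounded_measurable_rules bmr)
    also have "\<dots> \<le> (\<Sum>s\<in>I. 1\<^sup>2 * ?N * m2)"
      unfolding r_def by (intro sum_mono integral_square_linear_le) (auto simp: w_def)
    also have "\<dots> = ?N\<^sup>2 * m2" by (simp add: power2_eq_square)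
    also have "\<dots> \<le> ?N\<^sup>2 * 4" using m2 by (intro mult_left_mono) auto
    finally show ?thesis by simp
  qed
  have bmR: "bounded_measurable R" unfolding R_def[abs_def] by (intro bounded_measurable_rules bmD bmQ)
  show thesis
  proof (rule that[of R])
    show "integrable \<Omega> R" by (rule bounded_measurable_integrable[OF bmR])
    show "0 \<le> R z" for z using N4 d by (auto simp: R_def Q_def intro!: add_nonneg_nonneg mult_nonneg_nonneg divide_nonneg_nonneg sum_nonneg)
    have "(\<integral>z. R z \<partial>\<Omega>) = (\<integral>z. \<bar>D z\<bar> \<partial>\<Omega>) / d + 4 / (?N - 2) * (\<integral>z. Q z \<partial>\<Omega>) / d"
      unfolding R_def by (simp add: bounded_measurable_integrable bounded_measurable_rules bmD bmQ)
    also have "\<dots> \<le> 32 * ?N\<^sup>2 * \<epsilon>^5 / d + 4 / (?N - 2) * (4 * ?N\<^sup>2) / d"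
      using ED EQ d N4 by (intro add_mono divide_right_mono mult_left_mono) auto
    also have "\<dots> \<le> 128 * \<epsilon>^4 + 128 * \<epsilon>^4"
    proof (rule add_mono)
      have "32 * ?N\<^sup>2 * \<epsilon>^5 \<le> 32 * (4 * d) * \<epsilon>^4"
        using d \<epsilon> by (intro mult_mono power_decreasing) auto
      then show "32 * ?N\<^sup>2 * \<epsilon>^5 / d \<le> 128 * \<epsilon>^4" using d by (simp add: divide_le_eq)
      have "4 / (?N - 2) * (4 * ?N\<^sup>2) \<le> 4 / (?N - 2) * (4 * (4 * d))"
        using d N4 by (intro mult_left_mono) auto
      then have "4 / (?N - 2) * (4 * ?N\<^sup>2) / d \<le> 64 / (?N - 2)" using d N4 by (simp add: field_simps)
      also have "\<dots> \<le> 128 * (1 / ?N)" using N4 by (simp add: field_simps)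
      also have "\<dots> \<le> 128 * \<epsilon>^4" using N by simp
      finally show "4 / (?N - 2) * (4 * ?N\<^sup>2) / d \<le> 128 * \<epsilon>^4" .
    qed
    finally show "(\<integral>z. R z \<partial>\<Omega>) \<le> 256 * \<epsilon>^4" by simp
    fix z assume z: "z \<in> space \<Omega>"
    let ?a = "\<lambda>s t. h (z s) (z t)"
    have row: "row_sum I ?a s = r s z" if "s \<in> I" for s
      unfolding row_sum_def r_def using off[OF that] by simp
    have QR: "(\<Sum>s\<in>I. (row_sum I ?a s)\<^sup>2) = Q z" unfolding Q_def using row by simp
    have Q0: "0 \<le> Q z" unfolding Q_def by (simp add: sum_nonneg)
    define T where "T = (total_sum I ?a)\<^sup>2 / ((?N - 1) * (?N - 2))"
    have T: "0 \<le> T" "T \<le> 2 / (?N - 2) * Q z"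
    proof -
      show "0 \<le> T" using N4 by (simp add: T_def)
      have "T \<le> ?N * Q z / ((?N - 1) * (?N - 2))"
        unfolding T_def using total_sum_square_le[OF finite_I, of ?a] QR N4 by (intro divide_right_mono) auto
      also have "\<dots> = ?N / (?N - 1) * (Q z / (?N - 2))" by simp
      also have "\<dots> \<le> 2 * (Q z / (?N - 2))"
        using N4 Q0 by (intro mult_right_mono) (auto simp: divide_le_eq)
      finally show "T \<le> 2 / (?N - 2) * Q z" by simp
    qed
    have sq: "(\<Sum>s\<in>I. \<Sum>t\<in>I - {s}. (?a s t)\<^sup>2) = D z + ?N * (?N - 1) * m2"
    proof -
      have "(\<Sum>s\<in>I. \<Sum>t\<in>I - {s}. (?a s t)\<^sup>2) = (\<Sum>s\<in>I. \<Sum>t\<in>I - {s}. ((?a s t)\<^sup>2 - m2) + m2)" by simp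
      also have "\<dots> = (\<Sum>s\<in>I. \<Sum>t\<in>I - {s}. ((?a s t)\<^sup>2 - m2)) + (\<Sum>s\<in>I. \<Sum>t\<in>I - {s}. m2)"
        by (simp only: sum.distrib)
      also have "(\<Sum>s\<in>I. \<Sum>t\<in>I - {s}. ((?a s t)\<^sup>2 - m2)) = D z" unfolding D_def using off by simp
      also have "(\<Sum>s\<in>I. \<Sum>t\<in>I - {s}. m2) = ?N * (?N - 1) * m2"
        unfolding sum_offdiagonal[OF finite_I] by (simp add: algebra_simps)
      finally show ?thesis .
    qed
    have "u_var I ?a = (D z + ?N * (?N - 1) * m2 - 2 / (?N - 2) * Q z + T) / d"
      unfolding u_var_def d_def[symmetric] T_def QR[symmetric] sq[symmetric]
      by (subst u_center_square_sum[OF finite_I N(1)]) (auto simp: h_sym[OF space_\<Omega>[OF z] space_\<Omega>[OF z]])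
    also have "\<dots> = D z / d + (?N - 1) / (?N - 3) * m2 + (T - 2 / (?N - 2) * Q z) / d"
    proof -
      have "?N * (?N - 1) * m2 / d = (?N - 1) / (?N - 3) * m2" using N4 by (simp add: d_def)
      then show ?thesis by (simp only: add_divide_distrib diff_divide_distrib)
    qed
    finally have u: "u_var I ?a - 1 = D z / d + ((?N - 1) / (?N - 3) * m2 - 1) + (T - 2 / (?N - 2) * Q z) / d" by simp
    \<comment> \<open>The factor \<open>(N - 1) / (N - 3)\<close> exceeds 1 by
      \<open>2 / (N - 3)\<close>, at most \<open>8 / N\<close>. With \<open>m2\<close> at most 4
      this adds 32 to the 3 from the bias.\<close>
    have c1: "\<bar>(?N - 1) / (?N - 3) * m2 - 1\<bar> \<le> 35 * \<epsilon>\<^sup>2"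
    proof -
      have "(?N - 1) / (?N - 3) * m2 - 1 = (m2 - 1) + 2 * m2 / (?N - 3)" using N4 by (simp add: field_simps)
      moreover have "2 * m2 / (?N - 3) \<le> 32 * \<epsilon>^2"
      proof -
        have "2 * m2 / (?N - 3) \<le> 8 / (?N - 3)" using m2 N4 by (intro divide_right_mono) auto
        also have "\<dots> \<le> 32 * (1 / ?N)" using N4 by (simp add: field_simps)
        also have "\<dots> \<le> 32 * \<epsilon>^4" using N by simp
        also have "\<dots> \<le> 32 * \<epsilon>^2" using \<epsilon> by (simp add: power_decreasing)
        finally show ?thesis .
      qed
      moreover have "0 \<le> 2 * m2 / (?N - 3)" using m2_nonneg N4 by simp
      moreover have "\<epsilon>^3 \<le> \<epsilon>^2" using \<epsilon> by (intro power_decreasing) auto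
      moreover have "0 \<le> \<epsilon>\<^sup>2" by simp
      ultimately show ?thesis using m2(2) unfolding abs_le_iff by linarith
    qed
    have c2: "\<bar>T - 2 / (?N - 2) * Q z\<bar> \<le> 4 / (?N - 2) * Q z"
    proof -
      have "4 / (?N - 2) * Q z = 2 * (2 / (?N - 2) * Q z)" by simp
      then show ?thesis using T unfolding abs_le_iff by linarith
    qed
    have "\<bar>u_var I ?a - 1\<bar> \<le> \<bar>D z / d\<bar> + \<bar>(?N - 1) / (?N - 3) * m2 - 1\<bar> + \<bar>(T - 2 / (?N - 2) * Q z) / d\<bar>"
      unfolding u by (rule order_trans[OF abs_triangle_ineq add_right_mono[OF abs_triangle_ineq]])
    also have "\<dots> \<le> \<bar>D z\<bar> / d + 35 * \<epsilon>\<^sup>2 + 4 / (?N - 2) * Q z / d"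
    proof (intro add_mono)
      show "\<bar>D z / d\<bar> \<le> \<bar>D z\<bar> / d" using d by simp
      show "\<bar>(T - 2 / (?N - 2) * Q z) / d\<bar> \<le> 4 / (?N - 2) * Q z / d"
        unfolding abs_divide abs_of_pos[OF d(1)] using d by (intro divide_right_mono c2) simp
    qed (rule c1)
    finally show "\<bar>u_var I ?a - 1\<bar> \<le> 35 * \<epsilon>\<^sup>2 + R z" by (simp add: R_def)
  qed
qed

end

subsection \<open>The remainder of the truncation\<close>

definition qform :: "nat set \<Rightarrow> (nat \<Rightarrow> nat \<Rightarrow> real) \<Rightarrow> ('a \<Rightarrow> 'a \<Rightarrow> real) \<Rightarrow> (nat \<Rightarrow> 'a) \<Rightarrow> real" where
  "qform I w f z = (\<Sum>i\<in>I. \<Sum>j\<in>I. w i j * f (z i) (z j)) / 2"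

lemma qform_shift:
  assumes I: "finite I" and w0: "\<And>i. i \<in> I \<Longrightarrow> (\<Sum>j\<in>I. w i j) = 0" and sym: "\<And>i j. w i j = w j i"
    and fg: "\<And>i j. i \<in> I \<Longrightarrow> j \<in> I \<Longrightarrow> f (z i) (z j) = g (z i) (z j) + u (z i) + v (z j)"
  shows "qform I w f z = qform I w g z"
proof -
  have "(\<Sum>i\<in>I. \<Sum>j\<in>I. w i j * f (z i) (z j)) = (\<Sum>i\<in>I. \<Sum>j\<in>I. w i j * g (z i) (z j) + (w i j * u (z i) + w i j * v (z j)))"
    by (intro sum.cong refl) (simp add: fg algebra_simps)
  also have "\<dots> = (\<Sum>i\<in>I. \<Sum>j\<in>I. w i j * g (z i) (z j)) + ((\<Sum>i\<in>I. \<Sum>j\<in>I. w i j * u (z i)) + (\<Sum>i\<in>I. \<Sum>j\<in>I. w i j * v (z j)))"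
    by (simp only: sum.distrib)
  also have "(\<Sum>i\<in>I. \<Sum>j\<in>I. w i j * u (z i)) = 0"
    by (simp only: sum_distrib_right[symmetric] w0 cong: sum.cong) simp
  also have "(\<Sum>i\<in>I. \<Sum>j\<in>I. w i j * v (z j)) = (\<Sum>j\<in>I. \<Sum>i\<in>I. w j i * v (z j))"
    by (subst sum.swap) (simp add: sym)
  also have "\<dots> = 0"
    by (simp only: sum_distrib_right[symmetric] w0 cong: sum.cong) simp
  finally show ?thesis by (simp add: qform_def)
qed

context sample begin

text \<open>Distinct unordered pairs are uncorrelated, and each pair is counted in two orders, so
  the second moment is that of \<open>k\<close> times half the sum of squared weights. Here
  \<open>k\<close> is only square integrable and degenerate almost everywhere, as for the tail of
  the truncation.\<close>

lemma qform_l2_le: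
  fixes k :: "'a \<Rightarrow> 'a \<Rightarrow> real"
  assumes k: "(\<lambda>(x, y). k x y) \<in> borel_measurable (Z \<Otimes>\<^sub>M Z)" and k2: "integrable (Z \<Otimes>\<^sub>M Z) (\<lambda>(x, y). (k x y)\<^sup>2)"
    and sym: "\<And>x y. x \<in> space Z \<Longrightarrow> y \<in> space Z \<Longrightarrow> k x y = k y x"
    and degen: "AE x in Z. (\<integral>y. k x y \<partial>Z) = 0"
    and w: "\<And>i j. w i j = w j i" "\<And>i. w i i = 0" "(\<Sum>i\<in>I. \<Sum>j\<in>I. (w i j)\<^sup>2) = 2"
  shows "integrable \<Omega> (\<lambda>z. (qform I w k z)\<^sup>2)"
    and "(\<integral>z. (qform I w k z)\<^sup>2 \<partial>\<Omega>) \<le> (\<integral>(x, y). (k x y)\<^sup>2 \<partial>(Z \<Otimes>\<^sub>M Z))"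
proof -
  note k[measurable]
  have k_meas[measurable (raw)]: "(\<lambda>u. k (g u) (g' u)) \<in> borel_measurable M"
    if "g \<in> M \<rightarrow>\<^sub>M Z" "g' \<in> M \<rightarrow>\<^sub>M Z" for g g' and M :: "'m measure"
    using measurable_compose[OF measurable_Pair[OF that] k] by simp
  let ?K = "\<integral>(x, y). (k x y)\<^sup>2 \<partial>(Z \<Otimes>\<^sub>M Z)"
  have K0: "0 \<le> ?K" by (auto intro!: integral_nonneg_AE)
  have km: "(\<lambda>z. k (z i) (z j)) \<in> borel_measurable \<Omega>" if "i \<in> I" "j \<in> I" for i j
    using that by measurable
  have sq: "integrable \<Omega> (\<lambda>z. (k (z i) (z j))\<^sup>2)" "(\<integral>z. (k (z i) (z j))\<^sup>2 \<partial>\<Omega>) = ?K"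
    if "i \<in> I" "j \<in> I" "i \<noteq> j" for i j
    using integral_pair[OF that, of "\<lambda>x y. (k x y)\<^sup>2"] k2 by auto
  have prod_i: "integrable \<Omega> (\<lambda>z. k (z i) (z j) * k (z u) (z v))"
    if "i \<in> I" "j \<in> I" "i \<noteq> j" "u \<in> I" "v \<in> I" "u \<noteq> v" for i j u v
    using that by (intro integrable_mult_l2 km sq)
  have integral_kernel_eq_0_right: "(\<integral>z. k (z i) (z j) * k (z u) (z v) \<partial>\<Omega>) = 0"
    if ij: "i \<in> I" "j \<in> I" "i \<noteq> j" and uv: "u \<in> I" "v \<in> I" "u \<noteq> v" and j: "j \<notin> {u, v}" for i j u v
  proof -
    have "(\<integral>z. k (z i) (z j) * k (z u) (z v) \<partial>\<Omega>)
        = (\<integral>z. (\<integral>x. k ((z(j := x)) i) ((z(j := x)) j) * k ((z(j := x)) u) ((z(j := x)) v) \<partial>Z) \<partial>\<Omega>)"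
      by (intro integral_resample prod_i ij uv)
    also have "\<dots> = (\<integral>z. (\<integral>x. k (z i) x \<partial>Z) * k (z u) (z v) \<partial>\<Omega>)"
      using ij j by (intro Bochner_Integration.integral_cong refl) auto
    also have "\<dots> = (\<integral>z. 0 \<partial>\<Omega>)"
    proof (rule integral_cong_AE)
      show "AE z in \<Omega>. (\<integral>x. k (z i) x \<partial>Z) * k (z u) (z v) = 0"
        using AE_coord[OF ij(1) degen] by eventually_elim simp
      have "(\<lambda>x. \<integral>y. k x y \<partial>Z) \<in> borel_measurable Z" by measurable
      then have "(\<lambda>z. \<integral>x. k (z i) x \<partial>Z) \<in> borel_measurable \<Omega>"
        using ij by measurable
      then show "(\<lambda>z. (\<integral>x. k (z i) x \<partial>Z) * k (z u) (z v)) \<in> borel_measurable \<Omega>"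
        using km[OF uv(1,2)] by measurable
    qed simp
    finally show ?thesis by simp
  qed
  have integral_kernel_eq_0_left: "(\<integral>z. k (z i) (z j) * k (z u) (z v) \<partial>\<Omega>) = 0"
    if ij: "i \<in> I" "j \<in> I" "i \<noteq> j" and uv: "u \<in> I" "v \<in> I" "u \<noteq> v" and i: "i \<notin> {u, v}" for i j u v
  proof -
    have "(\<integral>z. k (z i) (z j) * k (z u) (z v) \<partial>\<Omega>) = (\<integral>z. k (z j) (z i) * k (z u) (z v) \<partial>\<Omega>)"
      using ij by (intro Bochner_Integration.integral_cong) (auto simp: sym[OF space_\<Omega> space_\<Omega>])
    then show ?thesis using integral_kernel_eq_0_right[of j i u v] that by auto
  qed
  let ?F = "\<lambda>p z. w (fst p) (snd p) * k (z (fst p)) (z (snd p)) / 2"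
  let ?b = "\<lambda>p q. (w (fst p) (snd p))\<^sup>2 / 4 * ?K * (of_bool (fst q = fst p) * of_bool (snd q = snd p)
      + of_bool (fst q = snd p) * of_bool (snd q = fst p)) :: real"
  have F: "qform I w k z = (\<Sum>p\<in>I \<times> I. ?F p z)" for z
    by (simp add: qform_def sum_Times sum_divide_distrib)
  have FF: "integrable \<Omega> (\<lambda>z. ?F p z * ?F q z) \<and> (\<integral>z. ?F p z * ?F q z \<partial>\<Omega>) \<le> ?b p q"
    if p: "p \<in> I \<times> I" and q: "q \<in> I \<times> I" for p q
  proof -
    obtain i j where ij: "p = (i, j)" "i \<in> I" "j \<in> I" using p by auto
    obtain u v where uv: "q = (u, v)" "u \<in> I" "v \<in> I" using q by auto
    have b0: "0 \<le> ?b p q" using K0 by (intro mult_nonneg_nonneg add_nonneg_nonneg) auto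
    have eq: "(\<lambda>z. ?F p z * ?F q z) = (\<lambda>z. (w i j * w u v / 4) * (k (z i) (z j) * k (z u) (z v)))"
      unfolding ij uv by (auto simp: fun_eq_iff)
    show ?thesis
    proof (cases "i = j \<or> u = v")
      case True
      then have "w i j * w u v / 4 = 0" using w(2) by auto
      then show ?thesis using b0 unfolding eq by (simp only: mult_zero_left) simp
    next
      case False
      then have ne: "i \<noteq> j" "u \<noteq> v" by auto
      have int: "integrable \<Omega> (\<lambda>z. ?F p z * ?F q z)"
        unfolding eq using ij uv ne by (intro integrable_mult_right prod_i)
      have val: "(\<integral>z. ?F p z * ?F q z \<partial>\<Omega>) = (w i j * w u v / 4) * (\<integral>z. k (z i) (z j) * k (z u) (z v) \<partial>\<Omega>)"
        unfolding eq by (rule integral_mult_right_zero)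
      consider "j \<notin> {u, v}" | "i \<notin> {u, v}" | "u = i" "v = j" | "u = j" "v = i" using ne by auto
      then have "(\<integral>z. ?F p z * ?F q z \<partial>\<Omega>) \<le> ?b p q"
      proof cases
        case 1
        then show ?thesis unfolding val using integral_kernel_eq_0_right[OF ij(2,3) ne(1) uv(2,3) ne(2)] b0 by simp
      next
        case 2
        then show ?thesis unfolding val using integral_kernel_eq_0_left[OF ij(2,3) ne(1) uv(2,3) ne(2)] b0 by simp
      next
        case 3
        then show ?thesis unfolding val using sq(2)[OF ij(2,3) ne(1)] ne by (simp add: ij uv power2_eq_square)
      next
        case 4
        have "(\<integral>z. k (z i) (z j) * k (z j) (z i) \<partial>\<Omega>) = (\<integral>z. (k (z i) (z j))\<^sup>2 \<partial>\<Omega>)"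
          using ij by (intro Bochner_Integration.integral_cong) (auto simp: sym[OF space_\<Omega> space_\<Omega>] power2_eq_square)
        then show ?thesis unfolding val using 4 sq(2)[OF ij(2,3) ne(1)] ne w(1)[of j i] by (simp add: ij uv power2_eq_square)
      qed
      then show ?thesis using int by blast
    qed
  qed
  have sqF: "(qform I w k z)\<^sup>2 = (\<Sum>p\<in>I \<times> I. \<Sum>q\<in>I \<times> I. ?F p z * ?F q z)" for z
    unfolding F power2_eq_square sum_product ..
  show "integrable \<Omega> (\<lambda>z. (qform I w k z)\<^sup>2)"
    unfolding sqF using FF by (intro Bochner_Integration.integrable_sum) blast
  have "(\<integral>z. (qform I w k z)\<^sup>2 \<partial>\<Omega>) = (\<Sum>p\<in>I \<times> I. \<Sum>q\<in>I \<times> I. (\<integral>z. ?F p z * ?F q z \<partial>\<Omega>))"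
  proof -
    have "(\<integral>z. (\<Sum>p\<in>I \<times> I. \<Sum>q\<in>I \<times> I. ?F p z * ?F q z) \<partial>\<Omega>)
        = (\<Sum>p\<in>I \<times> I. (\<integral>z. (\<Sum>q\<in>I \<times> I. ?F p z * ?F q z) \<partial>\<Omega>))"
      using FF by (intro Bochner_Integration.integral_sum Bochner_Integration.integrable_sum) blast
    also have "\<dots> = (\<Sum>p\<in>I \<times> I. \<Sum>q\<in>I \<times> I. (\<integral>z. ?F p z * ?F q z \<partial>\<Omega>))"
      using FF by (intro sum.cong refl Bochner_Integration.integral_sum) blast
    finally show ?thesis unfolding sqF .
  qed
  also have "\<dots> \<le> (\<Sum>p\<in>I \<times> I. \<Sum>q\<in>I \<times> I. ?b p q)" using FF by (intro sum_mono) blast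
  also have "\<dots> = (\<Sum>p\<in>I \<times> I. (w (fst p) (snd p))\<^sup>2 / 4 * ?K * 2)"
  proof (rule sum.cong[OF refl])
    fix p assume p: "p \<in> I \<times> I"
    have "(\<Sum>q\<in>I \<times> I. of_bool (fst q = fst p) * of_bool (snd q = snd p)
      + of_bool (fst q = snd p) * of_bool (snd q = fst p)) = (2 :: real)"
      using p by (auto simp only: mem_Sigma_iff sum_Times fst_conv snd_conv sum.distrib sum_distrib_left[symmetric]
          sum_of_bool[OF finite_I] mult_1_right) 
    then show "(\<Sum>q\<in>I \<times> I. ?b p q) = (w (fst p) (snd p))\<^sup>2 / 4 * ?K * 2"
      by (simp only: sum_distrib_left[symmetric])
  qed
  also have "\<dots> = (\<Sum>i\<in>I. \<Sum>j\<in>I. (w i j)\<^sup>2) * (?K / 2)"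
    unfolding sum_Times fst_conv snd_conv sum_distrib_right by (intro sum.cong refl) simp
  also have "\<dots> = ?K" by (simp add: w(3))
  finally show "(\<integral>z. (qform I w k z)\<^sup>2 \<partial>\<Omega>) \<le> ?K" .
qed

end

lemma power4_sum_le: "(a - b - c + d) ^ 4 \<le> 64 * (a^4 + b^4 + c^4 + d^4)" for a b c d :: real
proof -
  have two: "(x + y)^4 \<le> 8 * (x^4 + y^4)" for x y :: real
  proof -
    have "(x + y)\<^sup>2 \<le> 2 * (x\<^sup>2 + y\<^sup>2)" using sum_squares_bound[of x y] by (simp add: power2_sum)
    then have "((x + y)\<^sup>2)\<^sup>2 \<le> (2 * (x\<^sup>2 + y\<^sup>2))\<^sup>2" by (intro power_mono) auto
    also have "\<dots> = 4 * (x\<^sup>2 + y\<^sup>2)\<^sup>2" by (simp only: power_mult_distrib) simp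
    also have "(x\<^sup>2 + y\<^sup>2)\<^sup>2 \<le> 2 * (x^4 + y^4)" using sum_squares_bound[of "x\<^sup>2" "y\<^sup>2"] by (simp add: power2_sum flip: power_mult)
    finally show ?thesis by (simp flip: power_mult)
  qed
  have "(a - b - c + d)^4 = ((a + - b) + (- c + d))^4"
    by (rule arg_cong[where f="\<lambda>x. x^4"]) simp
  also have "\<dots> \<le> 8 * ((a + - b)^4 + (- c + d)^4)" by (rule two)
  also have "\<dots> \<le> 8 * (8 * (a^4 + (- b)^4) + 8 * ((- c)^4 + d^4))" by (intro mult_left_mono add_mono two) simp
  finally show ?thesis by simp
qed

text \<open>Jensen bounds the fourth moments of the conditional means and of the mean by that of
  \<open>f\<close>, so each of the four terms contributes 64. Boundedness supplies
  integrability.\<close>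

lemma (in l2_kernel) dk_fourth_moment_le:
  assumes b: "\<And>x y. \<bar>f x y\<bar> \<le> b"
  shows "(\<integral>(x, y). dk f Z x y ^ 4 \<partial>ZZ) \<le> 256 * (\<integral>(x, y). f x y ^ 4 \<partial>ZZ)"
proof -
  have b0: "0 \<le> b" using b[of undefined undefined] by linarith
  have fx: "integrable Z (\<lambda>y. f x y ^ n)" if "x \<in> space Z" for x n
    using that b by (intro integrable_const_bound[where B="b ^ n"]) (auto simp: power_abs intro!: power_mono)
  have ab: "\<bar>a x\<bar> \<le> b" if "x \<in> space Z" for x
  proof -
    have "norm (a x) \<le> (\<integral>y. b \<partial>Z)" unfolding a_def
      by (rule norm_integral_le) (use fx[OF that, of 1] b in auto)
    then show ?thesis by (simp add: prob_space)
  qed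
  have ai: "integrable Z (\<lambda>x. a x ^ n)" for n
    using ab b0 by (intro integrable_const_bound[where B="b ^ n"]) (auto simp: power_abs intro!: power_mono AE_I2)
  have p4: "f x y ^ 4 \<le> b ^ 4" for x y
    using power_mono[OF b[of x y] abs_ge_zero, of 4] by simp
  have f4: "integrable ZZ (\<lambda>(x, y). f x y ^ 4)"
    by (intro ZZ.integrable_const_bound[where B="b ^ 4"]) (auto simp: split_beta p4)
  have a4: "a x ^ 4 \<le> (\<integral>y. f x y ^ 4 \<partial>Z)" if x: "x \<in> space Z" for x
  proof -
    have "(a x)\<^sup>2 \<le> (\<integral>y. (f x y)\<^sup>2 \<partial>Z)" unfolding a_def by (rule integral_square_le) (use x fx[OF x] in auto)
    then have "((a x)\<^sup>2)\<^sup>2 \<le> (\<integral>y. (f x y)\<^sup>2 \<partial>Z)\<^sup>2" by (intro power_mono) auto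
    also have "\<dots> \<le> (\<integral>y. ((f x y)\<^sup>2)\<^sup>2 \<partial>Z)" by (rule integral_square_le) (use x fx[OF x, of 4] in \<open>auto simp flip: power_mult\<close>)
    finally show ?thesis by (simp flip: power_mult)
  qed
  let ?m = "\<integral>(x, y). f x y ^ 4 \<partial>ZZ"
  have A: "(\<integral>x. a x ^ 4 \<partial>Z) \<le> ?m"
  proof -
    have "(\<integral>x. a x ^ 4 \<partial>Z) \<le> (\<integral>x. (\<integral>y. f x y ^ 4 \<partial>Z) \<partial>Z)"
      using ZZ.integrable_fst'[OF f4] by (intro integral_mono ai a4) auto
    then show ?thesis using ZZ.integral_fst'[OF f4] by simp
  qed
  have E: "Ek f Z ^ 4 \<le> ?m"
  proof -
    have "(Ek f Z)\<^sup>2 \<le> (\<integral>x. (a x)\<^sup>2 \<partial>Z)" unfolding a_int(2)[symmetric] by (rule integral_square_le) (use a_sq in auto)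
    then have "((Ek f Z)\<^sup>2)\<^sup>2 \<le> (\<integral>x. (a x)\<^sup>2 \<partial>Z)\<^sup>2" by (intro power_mono) auto
    also have "\<dots> \<le> (\<integral>x. ((a x)\<^sup>2)\<^sup>2 \<partial>Z)" by (rule integral_square_le) (use ai[of 4] in \<open>auto simp flip: power_mult\<close>)
    finally show ?thesis using A by (simp flip: power_mult)
  qed
  have a4m: "(\<lambda>x. a x ^ 4) \<in> borel_measurable Z" by measurable
  let ?g = "\<lambda>p. 64 * ((case p of (x, y) \<Rightarrow> f x y ^ 4) + (case p of (x, y) \<Rightarrow> a y ^ 4) + (case p of (x, y) \<Rightarrow> a x ^ 4) + Ek f Z ^ 4)"
  note i = f4 marginal(1,2)[OF a4m, THEN iffD2, OF ai[of 4]]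
  have gi: "integrable ZZ ?g"
    by (intro integrable_mult_right Bochner_Integration.integrable_add i) simp
  have pw: "(case p of (x, y) \<Rightarrow> dk f Z x y ^ 4) \<le> ?g p" if "p \<in> space ZZ" for p
    using power4_sum_le[of "f (fst p) (snd p)" "a (snd p)" "a (fst p)" "Ek f Z"] dk_eq'[OF that]
    by (simp add: split_beta)
  have dm: "(\<lambda>(x, y). dk f Z x y ^ 4) \<in> borel_measurable ZZ"
    using dk_meas by (simp add: split_beta')
  have di: "integrable ZZ (\<lambda>(x, y). dk f Z x y ^ 4)"
  proof (rule Bochner_Integration.integrable_bound[OF gi dm], rule AE_I2)
    fix p assume "p \<in> space ZZ"
    from pw[OF this] show "norm (case p of (x, y) \<Rightarrow> dk f Z x y ^ 4) \<le> norm (?g p)" by (auto simp: split_beta)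
  qed
  have "(\<integral>(x, y). dk f Z x y ^ 4 \<partial>ZZ) \<le> (\<integral>p. ?g p \<partial>ZZ)"
    by (rule integral_mono[OF di gi pw])
  also have "\<dots> = 64 * (?m + (\<integral>x. a x ^ 4 \<partial>Z) + (\<integral>x. a x ^ 4 \<partial>Z) + Ek f Z ^ 4)"
    using i by (simp add: marginal(3,4)[OF a4m] ZZ.prob_space)
  also have "\<dots> \<le> 256 * ?m" using A E by simp
  finally show ?thesis .
qed

subsection \<open>The studentized statistic\<close>

definition clip :: "real \<Rightarrow> ('a \<Rightarrow> 'a \<Rightarrow> real) \<Rightarrow> 'a \<Rightarrow> 'a \<Rightarrow> real" where
  "clip c f x y = max (- c) (min c (f x y))"

text \<open>The clipped part \<open>t\<close> of \<open>f\<close>, projected to \<open>h\<close>,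
  carries the limit law; the tail \<open>g\<close>, projected to \<open>k\<close>, is a perturbation
  of numerator and denominator. The powers of \<open>\<epsilon>\<close> in the hypotheses are those
  delivered by the truncation level.\<close>

lemma (in l2_kernel) studentized_core:
  fixes I :: "nat set" and w :: "nat \<Rightarrow> nat \<Rightarrow> real" and \<kappa> \<epsilon> c x :: real
  defines "\<Omega> \<equiv> PiM I (\<lambda>_. Z)"
  assumes I: "finite I" "4 \<le> card I" and \<epsilon>: "0 < \<epsilon>" "\<epsilon> \<le> 1" and N: "1 / real (card I) \<le> \<epsilon>^4"
    and w_sym: "\<And>i j. w i j = w j i" and w_diag: "\<And>i. w i i = 0" and w_row: "\<And>i. i \<in> I \<Longrightarrow> (\<Sum>j\<in>I. w i j) = 0"
    and w_norm: "(\<Sum>i\<in>I. \<Sum>j\<in>I. (w i j)\<^sup>2) = 2"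
    and w_bound: "\<And>i j. i \<in> I \<Longrightarrow> j \<in> I \<Longrightarrow> \<bar>w i j\<bar> \<le> \<kappa> / real (card I)" and \<kappa>: "1 \<le> \<kappa>"
    and norm1: "(\<integral>(x, y). (dk f Z x y)\<^sup>2 \<partial>ZZ) = 1" and g4: "Eg f Z \<le> \<epsilon>^8" and c: "0 \<le> c"
    and tail: "(\<integral>(x, y). (f x y - clip c f x y)\<^sup>2 \<partial>ZZ) \<le> \<epsilon>^6"
    and fourth: "(\<integral>(x, y). clip c f x y ^ 4 \<partial>ZZ) \<le> real (card I) * \<epsilon>^10"
  shows "\<bar>measure \<Omega> {z \<in> space \<Omega>. qform I w f z / sqrt (u_var I (\<lambda>s t. f (z s) (z t))) \<le> x}
      - cdf std_normal_distribution x\<bar> \<le> 1000 * \<kappa>^4 * \<epsilon>\<^sup>2"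
proof -
  interpret S: sample Z I by unfold_locales (rule I(1))
  have \<Omega>: "\<Omega> = S.\<Omega>" by (simp add: \<Omega>_def)
  interpret N: real_distribution std_normal_distribution by (rule real_dist_normal_dist)
  have \<kappa>4: "1 \<le> \<kappa>^4" using \<kappa> by simp
  define t where "t = clip c f"
  define g where "g x y = f x y - t x y" for x y
  have tb: "\<bar>t x y\<bar> \<le> c" for x y using c by (auto simp: t_def clip_def abs_le_iff)
  have t_meas: "(\<lambda>(x, y). t x y) \<in> borel_measurable ZZ" unfolding t_def clip_def by measurable
  have t2: "integrable ZZ (\<lambda>(x, y). (t x y)\<^sup>2)"
  proof (rule ZZ.integrable_const_bound[where B="c\<^sup>2"])
    show "AE p in ZZ. norm (case p of (x, y) \<Rightarrow> (t x y)\<^sup>2) \<le> c\<^sup>2"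
      using power_mono[OF tb abs_ge_zero, where n=2] by (auto simp: split_beta)
  qed (use t_meas in \<open>simp add: split_beta'\<close>)
  interpret T: l2_kernel Z t
    by unfold_locales (use t_meas t2 sym in \<open>auto simp: t_def clip_def\<close>)
  have g_meas: "(\<lambda>(x, y). g x y) \<in> borel_measurable ZZ"
    unfolding g_def using meas T.meas by (simp add: split_beta')
  have g2: "integrable ZZ (\<lambda>(x, y). (g x y)\<^sup>2)"
    using square_integrable_add(2)[of "\<lambda>(x, y). f x y" ZZ "\<lambda>(x, y). t x y"] meas l2 T.meas T.l2
    by (simp add: g_def split_beta')
  interpret R: l2_kernel Z g
    by unfold_locales (use g_meas g2 sym T.sym in \<open>auto simp: g_def\<close>)
  define d where "d = dk f Z"
  define h where "h = dk t Z"
  define k where "k = dk g Z"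
  have ftg: "f x y = t x y + g x y" for x y by (simp add: g_def)
  have Ek: "Ek f Z = Ek t Z + Ek g Z"
    unfolding Ek_def ftg using T.l1 R.l1 by (simp add: split_beta')
  \<comment> \<open>Conditional means add only where the sections are integrable, so
    \<open>d = h + k\<close> becomes an almost-everywhere identity.\<close>
  have good: "AE x in Z. x \<in> space Z \<and> a x = T.a x + R.a x"
    using T.AE_section R.AE_section AE_space
    by eventually_elim (simp add: a_def T.a_def R.a_def ftg)
  have dhk: "d x y = h x y + k x y"
    if "x \<in> space Z \<and> a x = T.a x + R.a x" "y \<in> space Z \<and> a y = T.a y + R.a y" for x y
    using that unfolding d_def h_def k_def by (simp add: dk_eq T.dk_eq R.dk_eq ftg Ek)
  have AEd: "AE p in ZZ. d (fst p) (snd p) = h (fst p) (snd p) + k (fst p) (snd p)"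
    using AE_fst[OF good] AE_snd[OF good] by eventually_elim (rule dhk)
  note dm = dk_meas[folded d_def] and hm = T.dk_meas[folded h_def] and km = R.dk_meas[folded k_def]
  note d2 = dk_norm(1)[folded d_def] and h2 = T.dk_norm(1)[folded h_def] and k2 = R.dk_norm(1)[folded k_def]
  have g2v: "(\<integral>(x, y). (g x y)\<^sup>2 \<partial>ZZ) \<le> \<epsilon>^6" using tail by (simp add: g_def t_def)
  have k2v: "(\<integral>(x, y). (k x y)\<^sup>2 \<partial>ZZ) \<le> \<epsilon>^6" using R.dk_norm_le g2v by (simp add: k_def)
  have d2v: "(\<integral>(x, y). (d x y)\<^sup>2 \<partial>ZZ) = 1" using norm1 by (simp add: d_def)
  have e36: "\<epsilon>^6 \<le> \<epsilon>^3" "\<epsilon>^3 \<le> 1" using \<epsilon> by (auto intro: power_decreasing power_le_one)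
  \<comment> \<open>As \<open>h = d - k\<close>, the squared norm of \<open>h\<close> is 1 minus
    twice the inner product of \<open>d\<close> and \<open>k\<close> plus the squared norm of
    \<open>k\<close>. By Cauchy-Schwarz the inner product is at most
    \<open>\<epsilon>^3\<close>.\<close>
  have h2v: "\<bar>(\<integral>(x, y). (h x y)\<^sup>2 \<partial>ZZ) - 1\<bar> \<le> 3 * \<epsilon>^3"
  proof -
    let ?d = "\<lambda>p. d (fst p) (snd p)" and ?k = "\<lambda>p. k (fst p) (snd p)"
    have m: "?d \<in> borel_measurable ZZ" "?k \<in> borel_measurable ZZ" using dm km by (simp_all add: split_beta')
    have i: "integrable ZZ (\<lambda>p. (?d p)\<^sup>2)" "integrable ZZ (\<lambda>p. (?k p)\<^sup>2)" using d2 k2 by (simp_all add: split_beta')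
    have dki: "integrable ZZ (\<lambda>p. ?d p * ?k p)" by (rule integrable_mult_l2[OF m i])
    have hm': "(\<lambda>p. (h (fst p) (snd p))\<^sup>2) \<in> borel_measurable ZZ" using hm by (simp add: split_beta')
    have "(\<integral>(x, y). (h x y)\<^sup>2 \<partial>ZZ) = (\<integral>p. (?d p)\<^sup>2 - 2 * (?d p * ?k p) + (?k p)\<^sup>2 \<partial>ZZ)"
      unfolding split_beta'
    proof (rule integral_cong_AE)
      show "AE p in ZZ. (h (fst p) (snd p))\<^sup>2 = (?d p)\<^sup>2 - 2 * (?d p * ?k p) + (?k p)\<^sup>2"
        using AEd by eventually_elim (simp add: power2_eq_square algebra_simps)
    qed (use m hm' in measurable)
    also have "\<dots> = 1 - 2 * (\<integral>p. ?d p * ?k p \<partial>ZZ) + (\<integral>p. (?k p)\<^sup>2 \<partial>ZZ)"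
      using i dki d2v by (simp add: split_beta')
    finally have eq: "(\<integral>(x, y). (h x y)\<^sup>2 \<partial>ZZ) - 1 = (\<integral>p. (?k p)\<^sup>2 \<partial>ZZ) - 2 * (\<integral>p. ?d p * ?k p \<partial>ZZ)" by simp
    have "(\<integral>p. ?d p * ?k p \<partial>ZZ)\<^sup>2 \<le> 1 * \<epsilon>^6"
      using cauchy_schwarz_integral[OF m i] d2v k2v by (simp add: split_beta')
    moreover have "1 * \<epsilon>^6 = (\<epsilon>^3)\<^sup>2" by (simp flip: power_mult)
    ultimately have "\<bar>\<integral>p. ?d p * ?k p \<partial>ZZ\<bar> \<le> \<bar>\<epsilon>^3\<bar>" by (simp only: abs_le_square_iff)
    then have "\<bar>\<integral>p. ?d p * ?k p \<partial>ZZ\<bar> \<le> \<epsilon>^3" using \<epsilon> by simp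
    moreover have "0 \<le> (\<integral>p. (?k p)\<^sup>2 \<partial>ZZ)" by simp
    moreover have "(\<integral>p. (?k p)\<^sup>2 \<partial>ZZ) \<le> \<epsilon>^6" using k2v by (simp add: split_beta')
    ultimately show ?thesis using e36 unfolding eq abs_le_iff by linarith
  qed
  have tx: "integrable Z (t x)" if "x \<in> space Z" for x
    using that tb by (intro integrable_const_bound[where B=c]) auto
  \<comment> \<open>A non-integrable function has integral 0 by convention, so the bound on
    \<open>h\<close> holds at all arguments, as \<open>h_bound\<close> demands.\<close>
  have aT: "\<bar>\<integral>z. u z \<partial>Z\<bar> \<le> c" if "\<And>z. \<bar>u z\<bar> \<le> c" for u :: "(nat \<Rightarrow> real) \<Rightarrow> real"
  proof (cases "integrable Z u")
    case True
    have "norm (\<integral>z. u z \<partial>Z) \<le> (\<integral>z. c \<partial>Z)" by (rule norm_integral_le[OF True]) (use that in auto)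
    then show ?thesis by (simp add: prob_space)
  qed (simp add: not_integrable_integral_eq c)
  have hb: "\<bar>h x y\<bar> \<le> 4 * c" for x y
  proof -
    have "norm (\<integral>(x, y). t x y \<partial>ZZ) \<le> (\<integral>p. c \<partial>ZZ)"
      by (rule norm_integral_le[OF T.l1]) (use tb in auto)
    then have "\<bar>Ek t Z\<bar> \<le> c" by (simp add: Ek_def ZZ.prob_space)
    moreover have "\<bar>\<integral>z. t z y \<partial>Z\<bar> \<le> c" "\<bar>\<integral>z. t x z \<partial>Z\<bar> \<le> c" by (intro aT tb)+
    ultimately show ?thesis using tb[of x y] unfolding h_def dk_def by (simp add: abs_le_iff)
  qed
  interpret D: quadratic_form Z I h "4 * c" w "\<kappa> / real (card I)"
    by unfold_locales
      (use hm hb T.dk_sym T.dk_degenerate_at(2) tx w_sym w_diag w_bound w_norm in \<open>auto simp: h_def\<close>)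
  have m2: "D.m2 = (\<integral>(x, y). (h x y)\<^sup>2 \<partial>ZZ)" by (simp add: D.m2_def)
  have m2b: "D.m2 \<le> 4" "\<bar>D.m2 - 1\<bar> \<le> 3 * \<epsilon>^3" using h2v e36 unfolding m2 by (auto simp: abs_le_iff)
  have m4b: "D.m4 \<le> 256 * real (card I) * \<epsilon>^10"
  proof -
    have "D.m4 \<le> 256 * (\<integral>(x, y). t x y ^ 4 \<partial>ZZ)"
      unfolding D.m4_def unfolding h_def by (rule T.dk_fourth_moment_le[OF tb])
    also have "\<dots> \<le> 256 * (real (card I) * \<epsilon>^10)" using fourth unfolding t_def by (intro mult_left_mono) simp_all
    finally show ?thesis by simp
  qed
  \<comment> \<open>As products of operators, \<open>h h = d d - d k - k h\<close>. The squared norm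
    of \<open>d d\<close> is \<open>Eg\<close>, the other two are bounded by products of squared
    norms, and 22 = 2 + 4 + 4 * 4.\<close>
  have Gb: "D.G \<le> 22 * \<epsilon>^6"
  proof -
    let ?hh = "\<lambda>p. compose h h (fst p) (snd p)" and ?dd = "\<lambda>p. compose d d (fst p) (snd p)"
    let ?dk = "\<lambda>p. compose d k (fst p) (snd p)" and ?kh = "\<lambda>p. compose k h (fst p) (snd p)"
    note cdd = compose_l2[OF dm dm d2 d2] and cdk = compose_l2[OF dm km d2 k2]
      and ckh = compose_l2[OF km hm k2 h2] and chh = compose_l2[OF hm hm h2 h2]
    have pw: "AE p in ZZ. (?hh p)\<^sup>2 \<le> 2 * (?dd p)\<^sup>2 + 4 * (?dk p)\<^sup>2 + 4 * (?kh p)\<^sup>2"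
      using cdd(2) cdk(2) ckh(2) AE_fst[OF good] AE_snd[OF good]
    proof eventually_elim
      case (elim p)
      let ?x = "fst p" and ?y = "snd p"
      have "?hh p = (\<integral>z. d z ?x * d z ?y - d z ?x * k z ?y - k z ?x * h z ?y \<partial>Z)"
        unfolding compose_def
      proof (rule integral_cong_AE)
        show "AE z in Z. h z ?x * h z ?y = d z ?x * d z ?y - d z ?x * k z ?y - k z ?x * h z ?y"
          using good
        proof eventually_elim
          case (elim z)
          have "d z ?x = h z ?x + k z ?x" "d z ?y = h z ?y + k z ?y"
            using dhk elim \<open>?x \<in> space Z \<and> a ?x = T.a ?x + R.a ?x\<close> \<open>?y \<in> space Z \<and> a ?y = T.a ?y + R.a ?y\<close> by auto
          then show ?case by (simp add: algebra_simps)
        qed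
        have sec: "(\<lambda>z. u z v) \<in> borel_measurable Z"
          if "(\<lambda>(x, y). u x y) \<in> borel_measurable ZZ" "v \<in> space Z" for u :: "(nat \<Rightarrow> real) \<Rightarrow> _ \<Rightarrow> real" and v
          using measurable_compose[OF _ that(1), of "\<lambda>z. (z, v)" Z] that(2) by simp
        have xy: "?x \<in> space Z" "?y \<in> space Z" using elim by auto
        note s = sec[OF dm xy(1)] sec[OF dm xy(2)] sec[OF km xy(1)] sec[OF km xy(2)] sec[OF hm xy(1)] sec[OF hm xy(2)]
        show "(\<lambda>z. h z ?x * h z ?y) \<in> borel_measurable Z"
          "(\<lambda>z. d z ?x * d z ?y - d z ?x * k z ?y - k z ?x * h z ?y) \<in> borel_measurable Z"
          by (intro borel_measurable_times borel_measurable_diff s)+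
      qed
      also have "\<dots> = ?dd p - ?dk p - ?kh p" using elim by (simp add: compose_def)
      finally have eq: "?hh p = ?dd p - ?dk p - ?kh p" .
      have "(u - v - v')\<^sup>2 \<le> 2 * u\<^sup>2 + 4 * v\<^sup>2 + 4 * v'\<^sup>2" for u v v' :: real
      proof -
        have "0 \<le> (u + v + v')\<^sup>2 + 2 * (v - v')\<^sup>2" by simp
        then show ?thesis by (simp add: power2_eq_square algebra_simps)
      qed
      then show ?case unfolding eq .
    qed
    have i: "integrable ZZ (\<lambda>p. (?dd p)\<^sup>2)" "integrable ZZ (\<lambda>p. (?dk p)\<^sup>2)" "integrable ZZ (\<lambda>p. (?kh p)\<^sup>2)" "integrable ZZ (\<lambda>p. (?hh p)\<^sup>2)"
      using cdd(3) cdk(3) ckh(3) chh(3) by (simp_all add: split_beta')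
    have "D.G = (\<integral>p. (?hh p)\<^sup>2 \<partial>ZZ)" unfolding D.G_def D.H_def compose_def by (simp add: split_beta')
    also have "\<dots> \<le> (\<integral>p. 2 * (?dd p)\<^sup>2 + 4 * (?dk p)\<^sup>2 + 4 * (?kh p)\<^sup>2 \<partial>ZZ)"
      using i by (intro integral_mono_AE pw) auto
    also have "\<dots> = 2 * (\<integral>p. (?dd p)\<^sup>2 \<partial>ZZ) + 4 * (\<integral>p. (?dk p)\<^sup>2 \<partial>ZZ) + 4 * (\<integral>p. (?kh p)\<^sup>2 \<partial>ZZ)"
      using i by simp
    also have "(\<integral>p. (?dd p)\<^sup>2 \<partial>ZZ) = Eg f Z" unfolding Eg_eq d_def by (simp add: split_beta')
    also have "(\<integral>p. (?dk p)\<^sup>2 \<partial>ZZ) \<le> \<epsilon>^6"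
      using cdk(4) k2v unfolding d2v by (simp add: split_beta')
    also have "(\<integral>p. (?kh p)\<^sup>2 \<partial>ZZ) \<le> \<epsilon>^6 * 4"
    proof -
      have "(\<integral>p. (?kh p)\<^sup>2 \<partial>ZZ) \<le> (\<integral>(x, y). (k x y)\<^sup>2 \<partial>ZZ) * (\<integral>(x, y). (h x y)\<^sup>2 \<partial>ZZ)"
        using ckh(4) by (simp add: split_beta')
      also have "\<dots> \<le> \<epsilon>^6 * 4"
        using m2b(1) \<epsilon> unfolding m2 by (intro mult_mono k2v) (auto intro!: integral_nonneg_AE)
      finally show ?thesis .
    qed
    also have "Eg f Z \<le> \<epsilon>^6" using g4 \<epsilon> power_decreasing[of 6 8 \<epsilon>] by simp
    finally show ?thesis by simp
  qed
  let ?S1 = "qform I w h" and ?S2 = "qform I w k"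
  let ?V = "\<lambda>z. u_var I (\<lambda>s t. f (z s) (z t))"
  have kolm: "\<bar>S.\<Omega>.prob {z \<in> space S.\<Omega>. ?S1 z \<le> y} - cdf std_normal_distribution y\<bar> \<le> 640 * \<kappa>^4 * \<epsilon>\<^sup>2" for y
  proof -
    have "?S1 z = D.S z" for z by (simp add: qform_def D.S_def D.L_def)
    then show ?thesis
      using D.kolmogorov_S[OF \<epsilon> \<kappa> refl _ m4b m2b Gb, of y] I by simp
  qed
  obtain Rm where Rm: "integrable S.\<Omega> Rm" "\<And>z. 0 \<le> Rm z" "(\<integral>z. Rm z \<partial>S.\<Omega>) \<le> 256 * \<epsilon>^4"
    "\<And>z. z \<in> space S.\<Omega> \<Longrightarrow> \<bar>u_var I (\<lambda>s t. h (z s) (z t)) - 1\<bar> \<le> 35 * \<epsilon>\<^sup>2 + Rm z"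
    using D.u_var_concentration[OF \<epsilon> I(2) N m4b m2b] by blast
  \<comment> \<open>\<open>U\<close> is the majorant of \<open>u_var\<close> for the tail given by
    \<open>u_var_le\<close>. Its mean has the constant 9 because
    \<open>3 * (N - 1) / (N - 3)\<close> is at most 9 for \<open>N \<ge> 4\<close>.\<close>
  define U where "U z = 3 * (\<Sum>s\<in>I. \<Sum>t\<in>I - {s}. (g (z s) (z t))\<^sup>2) / (real (card I) * (real (card I) - 3))" for z
  have N4: "4 \<le> real (card I)" using I by simp
  have g2i: "integrable S.\<Omega> (\<lambda>z. (g (z s) (z t))\<^sup>2)" "(\<integral>z. (g (z s) (z t))\<^sup>2 \<partial>S.\<Omega>) = (\<integral>(x, y). (g x y)\<^sup>2 \<partial>ZZ)"
    if "s \<in> I" "t \<in> I - {s}" for s t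
    using S.integral_pair[of s t "\<lambda>x y. (g x y)\<^sup>2"] that g2 by auto
  have Ui: "integrable S.\<Omega> U" unfolding U_def[abs_def]
    using g2i(1) by (intro integrable_divide integrable_mult_right Bochner_Integration.integrable_sum)
  have U0: "0 \<le> U z" for z unfolding U_def using N4
    by (intro divide_nonneg_nonneg mult_nonneg_nonneg sum_nonneg) auto
  have UE: "(\<integral>z. U z \<partial>S.\<Omega>) \<le> 9 * \<epsilon>^6"
  proof -
    let ?v = "\<integral>(x, y). (g x y)\<^sup>2 \<partial>ZZ"
    have "(\<integral>z. U z \<partial>S.\<Omega>) = 3 * (\<Sum>s\<in>I. \<Sum>t\<in>I - {s}. (\<integral>z. (g (z s) (z t))\<^sup>2 \<partial>S.\<Omega>)) / (real (card I) * (real (card I) - 3))"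
    proof -
      have "(\<integral>z. (\<Sum>s\<in>I. \<Sum>t\<in>I - {s}. (g (z s) (z t))\<^sup>2) \<partial>S.\<Omega>) = (\<Sum>s\<in>I. (\<integral>z. (\<Sum>t\<in>I - {s}. (g (z s) (z t))\<^sup>2) \<partial>S.\<Omega>))"
        by (intro Bochner_Integration.integral_sum Bochner_Integration.integrable_sum g2i(1))
      also have "\<dots> = (\<Sum>s\<in>I. \<Sum>t\<in>I - {s}. (\<integral>z. (g (z s) (z t))\<^sup>2 \<partial>S.\<Omega>))"
        by (intro sum.cong refl Bochner_Integration.integral_sum g2i(1))
      finally show ?thesis unfolding U_def by simp
    qed
    also have "(\<Sum>s\<in>I. \<Sum>t\<in>I - {s}. (\<integral>z. (g (z s) (z t))\<^sup>2 \<partial>S.\<Omega>)) = (\<Sum>s\<in>I. \<Sum>t\<in>I - {s}. ?v)"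
      by (intro sum.cong refl g2i(2))
    also have "\<dots> = real (card I) * (real (card I) - 1) * ?v"
      unfolding sum_offdiagonal[OF I(1)] by (simp add: algebra_simps)
    also have "3 * (real (card I) * (real (card I) - 1) * ?v) / (real (card I) * (real (card I) - 3))
        = (3 * (real (card I) - 1) / (real (card I) - 3)) * ?v" using N4 by simp
    also have "\<dots> \<le> 9 * \<epsilon>^6"
      using N4 g2v by (intro mult_mono) (auto simp: divide_le_eq intro!: integral_nonneg_AE)
    finally show ?thesis .
  qed
  have S2: "integrable S.\<Omega> (\<lambda>z. (?S2 z)\<^sup>2)" "(\<integral>z. (?S2 z)\<^sup>2 \<partial>S.\<Omega>) \<le> \<epsilon>^6"
    using S.qform_l2_le[OF km k2 R.dk_sym[folded k_def] R.dk_degenerate[folded k_def] w_sym w_diag w_norm] k2v by auto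
  have qm: "qform I w u \<in> borel_measurable S.\<Omega>" if "(\<lambda>(x, y). u x y) \<in> borel_measurable ZZ" for u :: kern
  proof -
    have "(\<lambda>z. u (z i) (z j)) \<in> borel_measurable S.\<Omega>" if "i \<in> I" "j \<in> I" for i j
      using measurable_compose[OF S.measurable_pair_coord[OF that] \<open>(\<lambda>(x, y). u x y) \<in> borel_measurable ZZ\<close>] by simp
    then show ?thesis unfolding qform_def[abs_def] by measurable
  qed
  have Vm: "?V \<in> borel_measurable S.\<Omega>"
  proof -
    have [measurable]: "(\<lambda>z. f (z i) (z j)) \<in> borel_measurable S.\<Omega>" if "i \<in> I" "j \<in> I" for i j
      using measurable_compose[OF S.measurable_pair_coord[OF that] meas] by simp
    show ?thesis unfolding u_var_def u_center_def total_sum_def row_sum_def by measurable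
  qed
  have Rmm[measurable]: "Rm \<in> borel_measurable S.\<Omega>" and Um[measurable]: "U \<in> borel_measurable S.\<Omega>"
    using Rm(1) Ui by auto
  note qk[measurable] = qm[OF km]
  \<comment> \<open>The thresholds make \<open>S2\<close>, the root of \<open>U\<close> and
    \<open>Rm\<close> all at most \<open>\<epsilon>\<^sup>2\<close> off the exceptional set. Markov
    gives probabilities with constants 1, 9 and 256.\<close>
  let ?B1 = "{z \<in> space S.\<Omega>. \<epsilon>^4 < (?S2 z)\<^sup>2}" and ?B2 = "{z \<in> space S.\<Omega>. \<epsilon>^4 < U z}" and ?B3 = "{z \<in> space S.\<Omega>. \<epsilon>\<^sup>2 < Rm z}"
  let ?B = "?B1 \<union> ?B2 \<union> ?B3"
  have PB: "S.\<Omega>.prob ?B \<le> 266 * \<epsilon>\<^sup>2"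
  proof -
    have e: "\<epsilon>^6 = \<epsilon>\<^sup>2 * \<epsilon>^4" "\<epsilon>^4 = \<epsilon>\<^sup>2 * \<epsilon>\<^sup>2" "0 < \<epsilon>^4" "0 < \<epsilon>\<^sup>2" using \<epsilon> by (simp_all add: eval_nat_numeral)
    have b: "(\<integral>z. (?S2 z)\<^sup>2 \<partial>S.\<Omega>) \<le> \<epsilon>\<^sup>2 * \<epsilon>^4" "(\<integral>z. U z \<partial>S.\<Omega>) \<le> 9 * \<epsilon>\<^sup>2 * \<epsilon>^4" "(\<integral>z. Rm z \<partial>S.\<Omega>) \<le> 256 * \<epsilon>\<^sup>2 * \<epsilon>\<^sup>2"
      using S2(2) UE Rm(3) unfolding e(1) by (simp_all add: eval_nat_numeral)
    have "S.\<Omega>.prob ?B1 \<le> \<epsilon>\<^sup>2" by (rule S.\<Omega>.markov_le[OF S2(1) _ b(1) e(3)]) simp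
    moreover have "S.\<Omega>.prob ?B2 \<le> 9 * \<epsilon>\<^sup>2" by (rule S.\<Omega>.markov_le[OF Ui U0 b(2) e(3)])
    moreover have "S.\<Omega>.prob ?B3 \<le> 256 * \<epsilon>\<^sup>2" by (rule S.\<Omega>.markov_le[OF Rm(1,2) b(3) e(4)])
    moreover have "S.\<Omega>.prob ?B \<le> S.\<Omega>.prob ?B1 + S.\<Omega>.prob ?B2 + S.\<Omega>.prob ?B3"
      by (intro order_trans[OF measure_subadditive add_right_mono[OF measure_subadditive]]) auto
    ultimately show ?thesis by linarith
  qed
  have good: "\<bar>?S2 z\<bar> \<le> \<epsilon>\<^sup>2 \<and> \<bar>sqrt (?V z) - 1\<bar> \<le> 37 * \<epsilon>\<^sup>2" if z: "z \<in> space S.\<Omega>" and zB: "z \<notin> ?B" for z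
  proof -
    have b: "(?S2 z)\<^sup>2 \<le> \<epsilon>^4" "U z \<le> \<epsilon>^4" "Rm z \<le> \<epsilon>\<^sup>2" using z zB by auto
    have "\<epsilon>^4 = (\<epsilon>\<^sup>2)\<^sup>2" by (simp flip: power_mult)
    then have "\<bar>?S2 z\<bar> \<le> \<bar>\<epsilon>\<^sup>2\<bar>" using b(1) by (simp only: abs_le_square_iff)
    then have s: "\<bar>?S2 z\<bar> \<le> \<epsilon>\<^sup>2" by simp
    note sp = S.space_\<Omega>[OF z]
    have "\<bar>sqrt (?V z) - sqrt (u_var I (\<lambda>s u. t (z s) (z u)))\<bar> \<le> sqrt (u_var I (\<lambda>s u. g (z s) (z u)))"
      unfolding g_def by (rule sqrt_u_var_diff[OF I])
    also have "\<dots> \<le> sqrt (\<epsilon>^4)"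
    proof (rule real_sqrt_le_mono)
      have "u_var I (\<lambda>s u. g (z s) (z u)) \<le> U z"
        unfolding U_def by (rule u_var_le[OF I]) (rule R.sym[OF sp sp])
      then show "u_var I (\<lambda>s u. g (z s) (z u)) \<le> \<epsilon>^4" using b(2) by simp
    qed
    also have "\<dots> = \<epsilon>\<^sup>2" by (rule real_sqrt_unique) (simp_all flip: power_mult)
    finally have 1: "\<bar>sqrt (?V z) - sqrt (u_var I (\<lambda>s u. t (z s) (z u)))\<bar> \<le> \<epsilon>\<^sup>2" .
    \<comment> \<open>The constant \<open>Ek t Z\<close> is shared equally between the two
      arguments, since the shift uses one function for both.\<close>
    have "u_var I (\<lambda>s u. t (z s) (z u)) = u_var I (\<lambda>s u. h (z s) (z u))"
      by (rule u_var_shift[OF I, where u="\<lambda>s. T.a (z s) - Ek t Z / 2"]) (simp add: h_def T.dk_eq[OF sp sp])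
    then have "\<bar>sqrt (u_var I (\<lambda>s u. t (z s) (z u))) - 1\<bar> \<le> \<bar>u_var I (\<lambda>s u. h (z s) (z u)) - 1\<bar>"
      using abs_sqrt_minus_1_le[OF u_var_nonneg[OF I(2)]] by simp
    also have "\<dots> \<le> 36 * \<epsilon>\<^sup>2" using Rm(4)[OF z] b(3) by simp
    finally show ?thesis using 1 s by (auto simp: abs_le_iff)
  qed
  have sum: "qform I w f z = ?S1 z + ?S2 z" if z: "z \<in> space S.\<Omega>" for z
  proof -
    note sp = S.space_\<Omega>[OF z]
    have "qform I w f z = qform I w t z + qform I w g z"
      unfolding qform_def ftg by (simp add: distrib_left sum.distrib add_divide_distrib)
    also have "qform I w t z = ?S1 z"
      by (rule qform_shift[OF I(1) w_row w_sym, where u="\<lambda>x. T.a x - Ek t Z" and v=T.a]) (simp_all add: h_def T.dk_eq[OF sp sp])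
    also have "qform I w g z = ?S2 z"
      by (rule qform_shift[OF I(1) w_row w_sym, where u="\<lambda>x. R.a x - Ek g Z" and v=R.a]) (simp_all add: k_def R.dk_eq[OF sp sp])
    finally show ?thesis .
  qed
  let ?P = "S.\<Omega>.prob {z \<in> space S.\<Omega>. qform I w f z / sqrt (?V z) \<le> x}"
  show ?thesis unfolding \<Omega>
  \<comment> \<open>If \<open>37 * \<epsilon>\<^sup>2\<close> exceeds 1 / 2, the claimed bound
    exceeds 1. Otherwise the additional constant is 266 + 1 + 74 = 341.\<close>
  proof (cases "37 * \<epsilon>\<^sup>2 \<le> 1 / 2")
    case True
    have set: "{z \<in> space S.\<Omega>. qform I w f z / sqrt (?V z) \<le> x} = {z \<in> space S.\<Omega>. (?S1 z + ?S2 z) / sqrt (?V z) \<le> x}"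
      using sum by auto
    have "\<bar>?P - cdf std_normal_distribution x\<bar> \<le> 640 * \<kappa>^4 * \<epsilon>\<^sup>2 + S.\<Omega>.prob ?B + \<epsilon>\<^sup>2 + 2 * (37 * \<epsilon>\<^sup>2)"
      unfolding set
      by (rule S.\<Omega>.studentized_cdf[OF qm[OF hm] qm[OF km] Vm _ good]) (use True kolm in auto)
    also have "\<dots> \<le> 640 * \<kappa>^4 * \<epsilon>\<^sup>2 + 341 * (1 * \<epsilon>\<^sup>2)" using PB by simp
    also have "\<dots> \<le> 640 * \<kappa>^4 * \<epsilon>\<^sup>2 + 341 * (\<kappa>^4 * \<epsilon>\<^sup>2)" using \<kappa>4 by (intro add_left_mono mult_left_mono mult_right_mono) auto
    also have "\<dots> \<le> 1000 * \<kappa>^4 * \<epsilon>\<^sup>2" by simp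
    finally show "\<bar>?P - cdf std_normal_distribution x\<bar> \<le> 1000 * \<kappa>^4 * \<epsilon>\<^sup>2" .
  next
    case False
    have "\<bar>?P - cdf std_normal_distribution x\<bar> \<le> 1"
      using N.cdf_bounded_prob[of x] N.cdf_nonneg[of x] S.\<Omega>.prob_le_1[of "{z \<in> space S.\<Omega>. qform I w f z / sqrt (?V z) \<le> x}"]
        measure_nonneg[of S.\<Omega> "{z \<in> space S.\<Omega>. qform I w f z / sqrt (?V z) \<le> x}"]
      unfolding abs_le_iff by linarith
    also have "\<dots> \<le> 1000 * (1 * \<epsilon>\<^sup>2)" using False by simp
    also have "\<dots> \<le> 1000 * (\<kappa>^4 * \<epsilon>\<^sup>2)" using \<kappa>4 by (intro mult_left_mono mult_right_mono) auto
    finally show "\<bar>?P - cdf std_normal_distribution x\<bar> \<le> 1000 * \<kappa>^4 * \<epsilon>\<^sup>2" by simp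
  qed
qed

subsection \<open>Choice of the truncation level\<close>

text \<open>The difference vanishes up to level \<open>c\<close>, and beyond it
  \<open>\<bar>y\<bar> powr (- (2 * \<tau>))\<close> is at most its value at
  \<open>c\<close>.\<close>

lemma square_minus_clip_le:
  fixes y c \<tau> :: real
  assumes c: "0 < c" and \<tau>: "0 < \<tau>"
  shows "(y - max (- c) (min c y))\<^sup>2 \<le> \<bar>y\<bar> powr (2 + 2 * \<tau>) * c powr (- (2 * \<tau>))"
proof (cases "\<bar>y\<bar> \<le> c")
  case True
  then have "max (- c) (min c y) = y" by (auto simp: abs_le_iff)
  then show ?thesis by simp
next
  case False
  then have y: "c < \<bar>y\<bar>" "0 < \<bar>y\<bar>" using c by auto
  have "\<bar>y - max (- c) (min c y)\<bar> \<le> \<bar>y\<bar>" using c by (auto simp: abs_if max_def min_def)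
  then have "(y - max (- c) (min c y))\<^sup>2 \<le> \<bar>y\<bar>\<^sup>2" by (simp add: abs_le_square_iff)
  also have "\<dots> = \<bar>y\<bar> powr (2 + 2 * \<tau>) * \<bar>y\<bar> powr (- (2 * \<tau>))"
    using y by (simp flip: powr_add)
  also have "\<dots> \<le> \<bar>y\<bar> powr (2 + 2 * \<tau>) * c powr (- (2 * \<tau>))"
    using y c \<tau> by (intro mult_left_mono powr_mono2') auto
  finally show ?thesis .
qed

text \<open>Of the four powers, \<open>2 + 2 * \<tau>\<close> are bounded by
  \<open>\<bar>y\<bar>\<close> and the remaining \<open>2 - 2 * \<tau>\<close> by \<open>c\<close>;
  this is where \<open>\<tau> \<le> 1\<close> enters.\<close>

lemma clip_power4_le:
  fixes y c \<tau> :: real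
  assumes c: "0 < c" and \<tau>: "0 < \<tau>" "\<tau> \<le> 1"
  shows "(max (- c) (min c y)) ^ 4 \<le> \<bar>y\<bar> powr (2 + 2 * \<tau>) * c powr (2 - 2 * \<tau>)"
proof -
  define s where "s = \<bar>max (- c) (min c y)\<bar>"
  have s: "s \<le> c" "s \<le> \<bar>y\<bar>" "0 \<le> s" using c by (auto simp: s_def abs_if max_def min_def)
  have "(max (- c) (min c y)) ^ 4 = s ^ 4" by (simp add: s_def)
  also have "\<dots> \<le> \<bar>y\<bar> powr (2 + 2 * \<tau>) * c powr (2 - 2 * \<tau>)"
  proof (cases "s = 0")
    case False
    then have "s ^ 4 = s powr (2 + 2 * \<tau>) * s powr (2 - 2 * \<tau>)"
      using s by (simp flip: powr_add)
    also have "\<dots> \<le> \<bar>y\<bar> powr (2 + 2 * \<tau>) * c powr (2 - 2 * \<tau>)"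
      using s \<tau> by (intro mult_mono powr_mono2) auto
    finally show ?thesis .
  qed simp
  finally show ?thesis .
qed

text \<open>The tangent of the convex power function at \<open>u = 1\<close>, obtained from Young's
  inequality with second factor 1.\<close>

lemma powr_ge_linear:
  fixes u p :: real
  assumes "0 \<le> u" "1 < p"
  shows "p * u - (p - 1) \<le> u powr p"
proof -
  have "u * 1 \<le> u powr p / p + 1 powr (p / (p - 1)) / (p / (p - 1))"
    using assms by (intro Youngs_inequality) (auto simp: field_simps)
  then have "p * u \<le> p * (u powr p / p + (p - 1) / p)" using assms by (intro mult_left_mono) auto
  then show ?thesis using assms by (simp add: distrib_left)
qed

text \<open>
  Hence the bracket of the theorem is at least \<open>N powr (- \<tau>)\<close>; for the finitely many small sample
  sizes the bound is then trivial with a suitable constant.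
\<close>

lemma (in l2_kernel) moment_ge_1:
  assumes norm1: "(\<integral>(x, y). (dk f Z x y)\<^sup>2 \<partial>ZZ) = 1" and \<tau>: "0 < \<tau>"
    and fq: "integrable ZZ (\<lambda>(x, y). \<bar>f x y\<bar> powr (2 + 2 * \<tau>))"
  shows "1 \<le> (\<integral>(x, y). \<bar>f x y\<bar> powr (2 + 2 * \<tau>) \<partial>ZZ)"
proof -
  have f2: "1 \<le> (\<integral>(x, y). (f x y)\<^sup>2 \<partial>ZZ)" using dk_norm_le norm1 by simp
  \<comment> \<open>The tangent bound at \<open>(f x y)\<^sup>2\<close> plays the part of Jensen's
    inequality.\<close>
  have pw: "(1 + \<tau>) * (f x y)\<^sup>2 - \<tau> \<le> \<bar>f x y\<bar> powr (2 + 2 * \<tau>)" for x y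
  proof -
    have "(1 + \<tau>) * (f x y)\<^sup>2 - (1 + \<tau> - 1) \<le> (f x y)\<^sup>2 powr (1 + \<tau>)"
      using \<tau> by (intro powr_ge_linear) auto
    also have "(f x y)\<^sup>2 powr (1 + \<tau>) = \<bar>f x y\<bar> powr (2 + 2 * \<tau>)"
    proof -
      have "(f x y)\<^sup>2 = \<bar>f x y\<bar> powr 2" by simp
      then show ?thesis by (simp only: powr_powr) (simp add: algebra_simps)
    qed
    finally show ?thesis by simp
  qed
  have "1 \<le> (1 + \<tau>) * (\<integral>(x, y). (f x y)\<^sup>2 \<partial>ZZ) - \<tau>"
  proof -
    have "(1 + \<tau>) * 1 \<le> (1 + \<tau>) * (\<integral>(x, y). (f x y)\<^sup>2 \<partial>ZZ)"
      using f2 \<tau> by (intro mult_left_mono) auto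
    then show ?thesis by simp
  qed
  also have "\<dots> = (\<integral>p. (1 + \<tau>) * (case p of (x, y) \<Rightarrow> (f x y)\<^sup>2) - \<tau> \<partial>ZZ)"
    using l2 by (simp add: ZZ.prob_space)
  also have "\<dots> \<le> (\<integral>(x, y). \<bar>f x y\<bar> powr (2 + 2 * \<tau>) \<partial>ZZ)"
    using fq pw Bochner_Integration.integrable_diff[OF integrable_mult_right[OF l2, of "1 + \<tau>"] ZZ.integrable_const[of "\<tau>"]]
    by (intro integral_mono) (auto simp: split_beta)
  finally show ?thesis .
qed

lemma (in l2_kernel) Eg_nonneg: "0 \<le> Eg f Z"
  unfolding Eg_eq by (auto intro!: integral_nonneg_AE)

text \<open>With \<open>\<delta> powr (3 + 2 * \<tau>) = B\<close> each hypothesis of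
  \<open>studentized_core\<close> becomes a comparison of exponents. For \<open>\<delta> > 1\<close>
  the bound is trivial, so exponents may be lowered to integers independent of
  \<open>\<tau>\<close>.\<close>

lemma (in l2_kernel) studentized_rate:
  fixes I :: "nat set" and w :: "nat \<Rightarrow> nat \<Rightarrow> real" and \<kappa> \<tau> x B :: real
  defines "\<Omega> \<equiv> PiM I (\<lambda>_. Z)"
  assumes I: "finite I" "4 \<le> card I" and \<tau>: "0 < \<tau>" "\<tau> \<le> 1"
    and w: "\<And>i j. w i j = w j i" "\<And>i. w i i = 0" "\<And>i. i \<in> I \<Longrightarrow> (\<Sum>j\<in>I. w i j) = 0" "(\<Sum>i\<in>I. \<Sum>j\<in>I. (w i j)\<^sup>2) = 2"
      "\<And>i j. i \<in> I \<Longrightarrow> j \<in> I \<Longrightarrow> \<bar>w i j\<bar> \<le> \<kappa> / real (card I)" and \<kappa>: "1 \<le> \<kappa>"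
    and norm1: "(\<integral>(x, y). (dk f Z x y)\<^sup>2 \<partial>ZZ) = 1"
    and fq: "integrable ZZ (\<lambda>(x, y). \<bar>f x y\<bar> powr (2 + 2 * \<tau>))"
    and B: "B = real (card I) powr (- \<tau>) * (\<integral>(x, y). \<bar>f x y\<bar> powr (2 + 2 * \<tau>) \<partial>ZZ) + Eg f Z powr ((1 + \<tau>) / 2)"
  shows "\<bar>measure \<Omega> {z \<in> space \<Omega>. qform I w f z / sqrt (u_var I (\<lambda>s t. f (z s) (z t))) \<le> x}
      - cdf std_normal_distribution x\<bar> \<le> 1000 * \<kappa>^4 * B powr (1 / (3 + 2 * \<tau>))"
proof -
  let ?N = "real (card I)"
  define M where "M = (\<integral>(x, y). \<bar>f x y\<bar> powr (2 + 2 * \<tau>) \<partial>ZZ)"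
  have M1: "1 \<le> M" unfolding M_def by (rule moment_ge_1[OF norm1 \<tau>(1) fq])
  have N0: "0 < ?N" using I by simp
  have B1: "?N powr (- \<tau>) * M \<le> B" "Eg f Z powr ((1 + \<tau>) / 2) \<le> B"
    unfolding B M_def[symmetric] using M1 by auto
  have B0: "0 < B" using B1(1) M1 N0 by (smt (verit) mult_pos_pos powr_gt_zero)
  have NB: "?N powr (- \<tau>) \<le> B" using B1(1) mult_left_mono[OF M1, of "?N powr (- \<tau>)"] by simp
  define \<delta> where "\<delta> = B powr (1 / (3 + 2 * \<tau>))"
  have \<delta>0: "0 < \<delta>" using B0 by (simp add: \<delta>_def)
  have \<delta>B: "\<delta> powr (3 + 2 * \<tau>) = B" using B0 \<tau> by (simp add: \<delta>_def powr_powr)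
  have \<kappa>4: "1 \<le> \<kappa>^4" using \<kappa> by simp
  interpret S: sample Z I by unfold_locales (rule I(1))
  interpret N: real_distribution std_normal_distribution by (rule real_dist_normal_dist)
  let ?A = "{z \<in> space \<Omega>. qform I w f z / sqrt (u_var I (\<lambda>s t. f (z s) (z t))) \<le> x}"
  show ?thesis
  proof (cases "\<delta> \<le> 1")
    case False
    have "\<bar>measure \<Omega> ?A - cdf std_normal_distribution x\<bar> \<le> 1"
      using N.cdf_bounded_prob[of x] N.cdf_nonneg[of x] S.\<Omega>.prob_le_1[of ?A] measure_nonneg[of \<Omega> ?A]
      unfolding abs_le_iff \<Omega>_def by linarith
    also have "\<dots> \<le> 1000 * (1 * \<delta>)" using False by simp
    also have "\<dots> \<le> 1000 * (\<kappa>^4 * \<delta>)" using \<kappa>4 \<delta>0 by (intro mult_left_mono mult_right_mono) auto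
    finally show ?thesis unfolding \<delta>_def by simp
  next
    case True
    define \<epsilon> where "\<epsilon> = sqrt \<delta>"
    have \<epsilon>: "0 < \<epsilon>" "\<epsilon> \<le> 1" "\<epsilon>\<^sup>2 = \<delta>" using \<delta>0 True by (auto simp: \<epsilon>_def)
    have e: "\<epsilon>^4 = \<delta> powr 2" "\<epsilon>^6 = \<delta> powr 3" "\<epsilon>^8 = \<delta> powr 4" "\<epsilon>^10 = \<delta> powr 5"
    proof -
      have "\<epsilon> ^ (2 * n) = \<delta> ^ n" for n unfolding power_mult \<epsilon>(3) ..
      from this[of 2] this[of 3] this[of 4] this[of 5]
      show "\<epsilon>^4 = \<delta> powr 2" "\<epsilon>^6 = \<delta> powr 3" "\<epsilon>^8 = \<delta> powr 4" "\<epsilon>^10 = \<delta> powr 5"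
        using \<delta>0 by (simp_all add: powr_numeral)
    qed
    have \<delta>mono: "\<delta> powr u \<le> \<delta> powr v" if "v \<le> u" for u v
      using powr_mono'[OF that] \<delta>0 True by simp
    define c where "c = \<delta> * sqrt ?N"
    have c0: "0 < c" using \<delta>0 N0 by (simp add: c_def)
    have cp: "c powr r = \<delta> powr r * ?N powr (r / 2)" for r
      using \<delta>0 N0 by (simp add: c_def powr_mult powr_half_sqrt[symmetric] powr_powr)
    have Mle: "M \<le> ?N powr \<tau> * \<delta> powr (3 + 2 * \<tau>)"
    proof -
      have "?N powr \<tau> * (?N powr (- \<tau>) * M) \<le> ?N powr \<tau> * B" by (intro mult_left_mono B1) simp
      then show ?thesis using N0 by (simp add: \<delta>B mult.assoc[symmetric] flip: powr_add)
    qed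
    have cm: "(\<lambda>(x, y). clip c f x y) \<in> borel_measurable ZZ" unfolding clip_def by measurable
    have tail: "(\<integral>(x, y). (f x y - clip c f x y)\<^sup>2 \<partial>ZZ) \<le> \<epsilon>^6"
    proof -
      have "(\<integral>(x, y). (f x y - clip c f x y)\<^sup>2 \<partial>ZZ) \<le> (\<integral>p. (case p of (x, y) \<Rightarrow> \<bar>f x y\<bar> powr (2 + 2 * \<tau>)) * c powr (- (2 * \<tau>)) \<partial>ZZ)"
        using square_minus_clip_le[OF c0 \<tau>(1)]
        by (intro integral_mono' integrable_mult_left fq) (auto simp: split_beta clip_def)
      also have "\<dots> = M * c powr (- (2 * \<tau>))" using fq by (simp add: M_def)
      also have "\<dots> \<le> ?N powr \<tau> * \<delta> powr (3 + 2 * \<tau>) * c powr (- (2 * \<tau>))" by (intro mult_right_mono Mle) simp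
      also have "\<dots> = (?N powr \<tau> * ?N powr (- \<tau>)) * (\<delta> powr (3 + 2 * \<tau>) * \<delta> powr (- (2 * \<tau>)))"
        by (simp add: cp mult_ac)
      also have "\<dots> = \<delta> powr 3" using N0 \<delta>0 by (simp flip: powr_add)
      finally show ?thesis unfolding e .
    qed
    have fourth: "(\<integral>(x, y). clip c f x y ^ 4 \<partial>ZZ) \<le> ?N * \<epsilon>^10"
    proof -
      have "(\<integral>(x, y). clip c f x y ^ 4 \<partial>ZZ) \<le> (\<integral>p. (case p of (x, y) \<Rightarrow> \<bar>f x y\<bar> powr (2 + 2 * \<tau>)) * c powr (2 - 2 * \<tau>) \<partial>ZZ)"
        using clip_power4_le[OF c0 \<tau>]
        by (intro integral_mono' integrable_mult_left fq) (auto simp: split_beta clip_def)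
      also have "\<dots> = M * c powr (2 - 2 * \<tau>)" using fq by (simp add: M_def)
      also have "\<dots> \<le> ?N powr \<tau> * \<delta> powr (3 + 2 * \<tau>) * c powr (2 - 2 * \<tau>)" by (intro mult_right_mono Mle) simp
      also have "\<dots> = (?N powr \<tau> * ?N powr ((2 - 2 * \<tau>) / 2)) * (\<delta> powr (3 + 2 * \<tau>) * \<delta> powr (2 - 2 * \<tau>))"
        by (simp add: cp mult_ac)
      also have "\<dots> = ?N powr 1 * \<delta> powr 5"
        unfolding powr_add[symmetric] by (intro arg_cong2[where f="(*)"] arg_cong2[where f="(powr)"]) (auto simp: field_simps)
      also have "\<dots> = ?N * \<delta> powr 5" using N0 by simp
      finally show ?thesis unfolding e .
    qed
    \<comment> \<open>\<open>B\<close> dominates \<open>N powr (- \<tau>)\<close>, hence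
      \<open>1 / N\<close> is at most \<open>\<delta> powr ((3 + 2 * \<tau>) / \<tau>)\<close>, and
      that exponent is at least 2.\<close>
    have Nle: "1 / ?N \<le> \<epsilon>^4"
    proof -
      have "(?N powr (- \<tau>)) powr (1 / \<tau>) \<le> (\<delta> powr (3 + 2 * \<tau>)) powr (1 / \<tau>)"
        using NB \<tau> unfolding \<delta>B by (intro powr_mono2) auto
      then have "?N powr (- 1) \<le> \<delta> powr ((3 + 2 * \<tau>) / \<tau>)" using \<tau> by (simp add: powr_powr)
      also have "\<dots> \<le> \<delta> powr 2" using \<tau> by (intro \<delta>mono) (simp add: field_simps)
      finally show ?thesis using N0 by (simp add: e powr_minus_divide)
    qed
    \<comment> \<open>The exponent here is
      \<open>2 * (3 + 2 * \<tau>) / (1 + \<tau>) = 4 + 2 / (1 + \<tau>)\<close>.\<close>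
    have g4: "Eg f Z \<le> \<epsilon>^8"
    proof -
      have "(Eg f Z powr ((1 + \<tau>) / 2)) powr (2 / (1 + \<tau>)) \<le> (\<delta> powr (3 + 2 * \<tau>)) powr (2 / (1 + \<tau>))"
        using B1(2) \<tau> unfolding \<delta>B by (intro powr_mono2) auto
      moreover have "(1 + \<tau>) / 2 * (2 / (1 + \<tau>)) = 1" using \<tau> by simp
      ultimately have "Eg f Z \<le> \<delta> powr ((3 + 2 * \<tau>) * (2 / (1 + \<tau>)))"
        using Eg_nonneg by (simp only: powr_powr powr_one)
      also have "\<dots> \<le> \<delta> powr 4" using \<tau> by (intro \<delta>mono) (simp add: field_simps)
      finally show ?thesis unfolding e .
    qed
    have "\<bar>measure \<Omega> ?A - cdf std_normal_distribution x\<bar> \<le> 1000 * \<kappa>^4 * \<epsilon>\<^sup>2"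
      unfolding \<Omega>_def
      by (rule studentized_core[OF I \<epsilon>(1,2) Nle w \<kappa> norm1 g4 less_imp_le[OF c0] tail fourth])
    then show ?thesis by (simp add: \<epsilon>(3) \<delta>_def)
  qed
qed

subsection \<open>Centering and scaling\<close>

text \<open>The projection ignores constants and is homogeneous, so \<open>V2\<close> scales with
  the square and \<open>Eg\<close>, a product of four factors, with the fourth power. Both are
  compared through their norm representations, because the two projections agree only almost
  everywhere.\<close>

lemma (in l2_kernel) affine:
  fixes u v :: real
  defines "f' \<equiv> \<lambda>x y. (f x y - u) * v"
  shows "l2_kernel Z f'"
    and "(\<integral>(x, y). (dk f' Z x y)\<^sup>2 \<partial>ZZ) = v\<^sup>2 * V2 f Z"
    and "Eg f' Z = v^4 * Eg f Z"
proof -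
  have m': "(\<lambda>(x, y). f' x y) \<in> borel_measurable ZZ" unfolding f'_def by measurable
  have i': "integrable ZZ (\<lambda>(x, y). (f' x y)\<^sup>2)"
  proof -
    have "integrable ZZ (\<lambda>p. ((case p of (x, y) \<Rightarrow> f x y) - u)\<^sup>2)"
      using square_integrable_add(2)[of "\<lambda>(x, y). f x y" ZZ "\<lambda>p. u"] meas l2 by (simp add: split_beta')
    then have "integrable ZZ (\<lambda>p. v\<^sup>2 * ((case p of (x, y) \<Rightarrow> f x y) - u)\<^sup>2)" by simp
    then show ?thesis by (simp add: f'_def split_beta' power_mult_distrib mult.commute)
  qed
  show l2': "l2_kernel Z f'"
    by unfold_locales (use m' i' sym in \<open>auto simp: f'_def\<close>)
  interpret F: l2_kernel Z f' by (rule l2')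
  have good: "AE x in Z. x \<in> space Z \<and> F.a x = (a x - u) * v"
    using AE_section AE_space
  proof eventually_elim
    case (elim x)
    then have "(\<integral>y. (f x y - u) * v \<partial>Z) = ((\<integral>y. f x y \<partial>Z) - u) * v" by (simp add: prob_space)
    then show ?case using elim unfolding F.a_def a_def unfolding f'_def by simp
  qed
  have Ek': "Ek f' Z = (Ek f Z - u) * v"
    unfolding Ek_def f'_def using l1 by (simp add: split_beta' ZZ.prob_space)
  have eq: "dk f' Z x y = v * dk f Z x y"
    if "x \<in> space Z \<and> F.a x = (a x - u) * v" "y \<in> space Z \<and> F.a y = (a y - u) * v" for x y
    using that by (simp add: dk_eq F.dk_eq Ek') (simp add: f'_def algebra_simps)
  have dm: "(\<lambda>p. dk f Z (fst p) (snd p)) \<in> borel_measurable ZZ" "(\<lambda>p. dk f' Z (fst p) (snd p)) \<in> borel_measurable ZZ"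
    using dk_meas F.dk_meas by (simp_all add: split_beta')
  have "(\<integral>(x, y). (dk f' Z x y)\<^sup>2 \<partial>ZZ) = (\<integral>p. v\<^sup>2 * (dk f Z (fst p) (snd p))\<^sup>2 \<partial>ZZ)"
    unfolding split_beta'
  proof (rule integral_cong_AE)
    show "AE p in ZZ. (dk f' Z (fst p) (snd p))\<^sup>2 = v\<^sup>2 * (dk f Z (fst p) (snd p))\<^sup>2"
      using AE_fst[OF good] AE_snd[OF good] by eventually_elim (simp add: eq power_mult_distrib)
  qed (use dm in measurable)
  then show "(\<integral>(x, y). (dk f' Z x y)\<^sup>2 \<partial>ZZ) = v\<^sup>2 * V2 f Z" unfolding V2_eq by (simp add: split_beta')
  have cm: "(\<lambda>p. compose (dk f Z) (dk f Z) (fst p) (snd p)) \<in> borel_measurable ZZ"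
    "(\<lambda>p. compose (dk f' Z) (dk f' Z) (fst p) (snd p)) \<in> borel_measurable ZZ"
    using compose_l2(1)[OF dk_meas dk_meas dk_norm(1) dk_norm(1)] compose_l2(1)[OF F.dk_meas F.dk_meas F.dk_norm(1) F.dk_norm(1)]
    by (simp_all add: split_beta')
  have "Eg f' Z = (\<integral>p. v^4 * (compose (dk f Z) (dk f Z) (fst p) (snd p))\<^sup>2 \<partial>ZZ)"
    unfolding F.Eg_eq split_beta'
  proof (rule integral_cong_AE)
    show "AE p in ZZ. (compose (dk f' Z) (dk f' Z) (fst p) (snd p))\<^sup>2 = v^4 * (compose (dk f Z) (dk f Z) (fst p) (snd p))\<^sup>2"
      using AE_fst[OF good] AE_snd[OF good]
    proof eventually_elim
      case (elim p)
      have sec: "(\<lambda>z. d z y) \<in> borel_measurable Z"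
        if "(\<lambda>(x, y). d x y) \<in> borel_measurable ZZ" "y \<in> space Z" for d :: kern and y
        using measurable_compose[OF _ that(1), of "\<lambda>z. (z, y)" Z] that(2) by simp
      have "compose (dk f' Z) (dk f' Z) (fst p) (snd p) = (\<integral>z. v\<^sup>2 * (dk f Z z (fst p) * dk f Z z (snd p)) \<partial>Z)"
        unfolding compose_def
      proof (rule integral_cong_AE)
        show "AE z in Z. dk f' Z z (fst p) * dk f' Z z (snd p) = v\<^sup>2 * (dk f Z z (fst p) * dk f Z z (snd p))"
          using good by eventually_elim (use elim in \<open>simp add: eq power2_eq_square\<close>)
        show "(\<lambda>z. dk f' Z z (fst p) * dk f' Z z (snd p)) \<in> borel_measurable Z"
          "(\<lambda>z. v\<^sup>2 * (dk f Z z (fst p) * dk f Z z (snd p))) \<in> borel_measurable Z"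
          using elim by (intro borel_measurable_times borel_measurable_const sec dk_meas F.dk_meas; simp)+
      qed
      then show ?case by (simp add: compose_def power_mult_distrib flip: power_mult)
    qed
  qed (use cm in measurable)
  then show "Eg f' Z = v^4 * Eg f Z" unfolding Eg_eq by (simp add: split_beta')
qed

subsection \<open>Pooling the two samples\<close>

lemma mixture_same: "prob_space P \<Longrightarrow> mixture \<rho> P P = P"
  unfolding mixture_def
  by (simp add: bind_const' measure_pmf.prob_space_axioms prob_space_imp_subprob_space)

lemma prod_split_pooled:
  fixes f :: "nat \<Rightarrow> 'a::comm_monoid_mult"
  shows "(\<Prod>t=1..n + m. f t) = (\<Prod>t=1..n. f t) * (\<Prod>j=1..m. f (n + j))"
  using prod.ub_add_nat[of 1 n f m] prod.shift_bounds_cl_nat_ivl[of f 1 n m] by (simp add: add.commute)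

text \<open>The restriction puts the pooled sample into the product space, whose elements are
  \<open>undefined\<close> off the index set.\<close>

definition pool :: "nat \<Rightarrow> nat \<Rightarrow> (nat \<Rightarrow> 'a) \<times> (nat \<Rightarrow> 'a) \<Rightarrow> nat \<Rightarrow> 'a" where
  "pool n m XY = restrict (pooled n (fst XY) (snd XY)) {1..n + m}"

lemma pool_measurable:
  "pool n m \<in> PiM {1..n} (\<lambda>_. P) \<Otimes>\<^sub>M PiM {1..m} (\<lambda>_. P) \<rightarrow>\<^sub>M PiM {1..n + m} (\<lambda>_. P)"
  unfolding pool_def
proof (rule measurable_restrict)
  fix s assume s: "s \<in> {1..n + m}"
  show "(\<lambda>XY. pooled n (fst XY) (snd XY) s) \<in> PiM {1..n} (\<lambda>_. P) \<Otimes>\<^sub>M PiM {1..m} (\<lambda>_. P) \<rightarrow>\<^sub>M P"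
  proof (cases "s \<le> n")
    case True
    then show ?thesis
      using s measurable_compose[OF measurable_fst measurable_component_singleton[of s "{1..n}" "\<lambda>_. P"]]
      by (simp add: pooled_def)
  next
    case False
    then have "s - n \<in> {1..m}" using s by auto
    then show ?thesis
      using False measurable_compose[OF measurable_snd measurable_component_singleton[of "s - n" "{1..m}" "\<lambda>_. P"]]
      by (simp add: pooled_def)
  qed
qed

lemma (in prob_space) distr_pool:
  "distr (PiM {1..n} (\<lambda>_. M) \<Otimes>\<^sub>M PiM {1..m} (\<lambda>_. M)) (PiM {1..n + m} (\<lambda>_. M)) (pool n m)
     = PiM {1..n + m} (\<lambda>_. M)"
proof -
  interpret product_sigma_finite "\<lambda>_ :: nat. M" by unfold_locales
  interpret X: prob_space "PiM {1..n} (\<lambda>_. M)" by (intro prob_space_PiM prob_space_axioms)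
  interpret Y: prob_space "PiM {1..m} (\<lambda>_. M)" by (intro prob_space_PiM prob_space_axioms)
  let ?XY = "PiM {1..n} (\<lambda>_. M) \<Otimes>\<^sub>M PiM {1..m} (\<lambda>_. M)"
  show ?thesis
  proof (rule PiM_eqI)
    fix A assume A: "\<And>i. i \<in> {1..n + m} \<Longrightarrow> A i \<in> sets M"
    have box: "pool n m -` PiE {1..n + m} A \<inter> space ?XY = PiE {1..n} A \<times> PiE {1..m} (\<lambda>j. A (n + j))"
      (is "?l = ?r")
    proof (intro set_eqI iffI)
      fix XY assume XY: "XY \<in> ?l"
      have "fst XY i \<in> A i" if "i \<in> {1..n}" for i
        using XY that by (auto simp: pool_def pooled_def PiE_iff dest!: bspec[where x=i])
      moreover have "snd XY j \<in> A (n + j)" if "j \<in> {1..m}" for j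
        using XY that by (auto simp: pool_def pooled_def PiE_iff dest!: bspec[where x="n + j"])
      ultimately show "XY \<in> ?r"
        using XY by (cases XY) (auto simp: space_pair_measure space_PiM PiE_iff)
    next
      fix XY assume XY: "XY \<in> ?r"
      have "pooled n (fst XY) (snd XY) s \<in> A s" if s: "s \<in> {1..n + m}" for s
      proof (cases "s \<le> n")
        case False
        then have "s - n \<in> {1..m}" "n + (s - n) = s" using s by auto
        then show ?thesis using XY False by (auto simp: pooled_def PiE_iff dest!: bspec[where x="s - n"])
      qed (use XY s in \<open>auto simp: pooled_def\<close>)
      moreover have "XY \<in> space ?XY"
      proof -
        have "A i \<subseteq> space M" if "i \<in> {1..n + m}" for i using A[OF that] by (rule sets.sets_into_space)
        then have "PiE {1..n} A \<subseteq> space (PiM {1..n} (\<lambda>_. M))"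
          "PiE {1..m} (\<lambda>j. A (n + j)) \<subseteq> space (PiM {1..m} (\<lambda>_. M))"
          unfolding space_PiM by (intro PiE_mono; simp)+
        then show ?thesis using XY unfolding space_pair_measure by blast
      qed
      ultimately show "XY \<in> ?l" by (auto simp: pool_def)
    qed
    have "emeasure (distr ?XY (PiM {1..n + m} (\<lambda>_. M)) (pool n m)) (PiE {1..n + m} A)
        = emeasure ?XY (PiE {1..n} A \<times> PiE {1..m} (\<lambda>j. A (n + j)))"
      unfolding box[symmetric] using A by (intro emeasure_distr pool_measurable sets_PiM_I_finite) auto
    also have "\<dots> = (\<Prod>i=1..n. emeasure M (A i)) * (\<Prod>j=1..m. emeasure M (A (n + j)))"
    proof -
      have "emeasure ?XY (PiE {1..n} A \<times> PiE {1..m} (\<lambda>j. A (n + j)))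
          = emeasure (PiM {1..n} (\<lambda>_. M)) (PiE {1..n} A) * emeasure (PiM {1..m} (\<lambda>_. M)) (PiE {1..m} (\<lambda>j. A (n + j)))"
        using A by (intro Y.emeasure_pair_measure_Times sets_PiM_I_finite) auto
      moreover have "emeasure (PiM {1..n} (\<lambda>_. M)) (PiE {1..n} A) = (\<Prod>i=1..n. emeasure M (A i))"
        using A by (intro emeasure_PiM) auto
      moreover have "emeasure (PiM {1..m} (\<lambda>_. M)) (PiE {1..m} (\<lambda>j. A (n + j))) = (\<Prod>j=1..m. emeasure M (A (n + j)))"
        using A by (intro emeasure_PiM) auto
      ultimately show ?thesis by simp
    qed
    also have "\<dots> = (\<Prod>i=1..n + m. emeasure M (A i))" by (rule prod_split_pooled[symmetric])
    finally show "emeasure (distr ?XY (PiM {1..n + m} (\<lambda>_. M)) (pool n m)) (PiE {1..n + m} A)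
        = (\<Prod>i\<in>{1..n + m}. emeasure M (A i))" .
  qed auto
qed

subsection \<open>The statistic as a studentized quadratic form\<close>

lemma c_coef_ge: "2 \<le> n \<Longrightarrow> 2 \<le> m \<Longrightarrow> 16 / (real (n + m))\<^sup>2 \<le> c_coef n m"
proof -
  assume n: "2 \<le> n" and m: "2 \<le> m"
  have nm: "2 \<le> real n" "2 \<le> real m" using n m by auto
  have "4 * (real n * real m) \<le> (real n + real m)\<^sup>2"
    using zero_le_power2[of "real n - real m"] by (simp add: power2_eq_square algebra_simps)
  then have "16 / (real (n + m))\<^sup>2 \<le> 16 / (4 * (real n * real m))" using nm by (intro divide_left_mono) auto
  also have "\<dots> = 0 + 4 / (real n * real m) + 0" by simp
  also have "\<dots> \<le> c_coef n m" unfolding c_coef_def using nm by (intro add_mono) auto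
  finally show ?thesis .
qed

text \<open>As \<open>n - 1\<close> is at least \<open>n / 2\<close>, all raw weights are at most
  \<open>4 / (\<eta> * N)\<^sup>2\<close>, while \<open>sqrt (c_coef n m)\<close> is at least
  \<open>4 / N\<close>. This produces \<open>\<kappa> = 1 / \<eta>\<^sup>2\<close>.\<close>

lemma raw_weight_le:
  assumes n: "2 \<le> n" and m: "2 \<le> m" and \<eta>: "0 < \<eta>" "\<eta> * real (n + m) \<le> real n" "\<eta> * real (n + m) \<le> real m"
  shows "\<bar>raw_weight n m s t\<bar> / sqrt (c_coef n m) \<le> 1 / \<eta>\<^sup>2 / real (n + m)"
proof -
  let ?N = "real (n + m)"
  have N: "0 < ?N" and eN: "0 < \<eta> * ?N" using n \<eta> by auto
  have nm: "2 \<le> real n" "2 \<le> real m" using n m by auto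
  have le: "2 / (x * y) \<le> 4 / (\<eta> * ?N)\<^sup>2" if "\<eta> * ?N \<le> x" "\<eta> * ?N / 2 \<le> y" for x y
  proof -
    have "(\<eta> * ?N) * (\<eta> * ?N / 2) \<le> x * y" using that eN by (intro mult_mono) auto
    moreover have "0 < (\<eta> * ?N) * (\<eta> * ?N / 2)" using eN by simp
    ultimately have "2 / (x * y) \<le> 2 / ((\<eta> * ?N) * (\<eta> * ?N / 2))"
      by (intro frac_le) auto
    then show ?thesis by (simp add: power2_eq_square)
  qed
  have "\<bar>raw_weight n m s t\<bar> \<le> 4 / (\<eta> * ?N)\<^sup>2"
    using le[of "real n" "real n - 1"] le[of "real m" "real m - 1"] le[of "real n" "real m"] \<eta> nm
    by (auto simp: raw_weight_def)
  moreover have "4 / ?N \<le> sqrt (c_coef n m)"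
    using c_coef_ge[OF n m] N by (intro real_le_rsqrt) (simp add: power_divide)
  ultimately have "\<bar>raw_weight n m s t\<bar> / sqrt (c_coef n m) \<le> (4 / (\<eta> * ?N)\<^sup>2) / (4 / ?N)"
    using N by (intro frac_le) auto
  also have "\<dots> = 1 / \<eta>\<^sup>2 / ?N"
  proof -
    have "(4 / (\<eta> * x)\<^sup>2) / (4 / x) = 1 / \<eta>\<^sup>2 / x" if "0 < x" for x :: real
      using that \<eta>(1) by (simp add: field_simps power2_eq_square)
    then show ?thesis using N by blast
  qed
  finally show ?thesis .
qed

text \<open>With \<open>k = \<sigma> * f + e\<close>, the constant \<open>e\<close> drops out of the
  numerator by the vanishing row sums and out of the denominator by \<open>u_var_shift\<close>, and
  \<open>\<sigma>\<close> cancels in the quotient. \<open>W\<close> has to agree with the pooled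
  sample only on the index range, so that the restricted sample \<open>pool\<close>
  qualifies.\<close>

lemma T_stat_eq:
  fixes n m :: nat and W :: "nat \<Rightarrow> nat \<Rightarrow> real" and e \<sigma> :: real
  defines "N \<equiv> n + m"
  assumes n: "2 \<le> n" and m: "2 \<le> m" and \<sigma>: "0 < \<sigma>"
    and sym: "\<And>s t. s \<in> {1..N} \<Longrightarrow> t \<in> {1..N} \<Longrightarrow> k (pooled n X Y s) (pooled n X Y t) = k (pooled n X Y t) (pooled n X Y s)"
    and diag: "\<And>s. s \<in> {1..N} \<Longrightarrow> k (pooled n X Y s) (pooled n X Y s) = a0"
    and W: "\<And>s. s \<in> {1..N} \<Longrightarrow> W s = pooled n X Y s"
  defines "f \<equiv> \<lambda>x y. (k x y - e) * (1 / \<sigma>)"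
  shows "T_stat n m k a0 X Y =
    qform {1..N} (\<lambda>s t. raw_weight n m s t / sqrt (c_coef n m)) f W / sqrt (u_var {1..N} (\<lambda>s t. f (W s) (W t)))"
proof -
  let ?I = "{1..N}" and ?c = "sqrt (c_coef n m)" and ?w = "raw_weight n m"
  have N: "4 \<le> N" using n m by (simp add: N_def)
  have c0: "0 < c_coef n m"
    by (rule less_le_trans[OF _ c_coef_ge[OF n m]]) (use n in simp)
  have symW: "k (W s) (W t) = k (W t) (W s)" if "s \<in> ?I" "t \<in> ?I" for s t using sym that W by simp
  have kf: "k x y = \<sigma> * f x y + e" for x y using \<sigma> by (simp add: f_def)
  have row: "(\<Sum>t\<in>?I. ?w s t * k (W s) (W t)) = (\<Sum>t\<in>?I. ?w s t * (\<sigma> * f (W s) (W t)))" if "s \<in> ?I" for s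
    using raw_weight_props(1)[OF n m, of s] that
    by (simp add: kf distrib_left sum.distrib N_def flip: sum_distrib_right)
  have "E_stat n m k X Y = (\<Sum>s\<in>?I. \<Sum>t\<in>?I. ?w s t * k (W s) (W t)) / 2"
    unfolding N_def using sym W
    by (subst E_stat_eq[OF n m]) (auto simp: N_def intro!: sum.cong)
  also have "\<dots> = (\<Sum>s\<in>?I. \<Sum>t\<in>?I. ?w s t * (\<sigma> * f (W s) (W t))) / 2"
    by (intro arg_cong2[where f="(/)"] sum.cong refl row) auto
  also have "\<dots> = ?c * \<sigma> * qform ?I (\<lambda>s t. ?w s t / ?c) f W"
    using c0 by (simp add: qform_def sum_distrib_left mult_ac)
  finally have E: "E_stat n m k X Y = ?c * \<sigma> * qform ?I (\<lambda>s t. ?w s t / ?c) f W" .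
  have "V_star n m k a0 X Y = u_var ?I (\<lambda>s t. k (pooled n X Y s) (pooled n X Y t))"
    unfolding V_star_def Let_def N_def[symmetric]
    by (rule A_star_square_sum[OF N]) (use sym diag in auto)
  also have "\<dots> = u_var ?I (\<lambda>s t. \<sigma> * f (W s) (W t))"
    by (rule u_var_shift[where u="\<lambda>_. e / 2"]) (use N W in \<open>auto simp: kf\<close>)
  also have "\<dots> = \<sigma>\<^sup>2 * u_var ?I (\<lambda>s t. f (W s) (W t))" by (rule u_var_scale)
  finally have V: "V_star n m k a0 X Y = \<sigma>\<^sup>2 * u_var ?I (\<lambda>s t. f (W s) (W t))" .
  show ?thesis unfolding T_stat_def E V using c0 \<sigma> by (simp add: real_sqrt_mult)
qed

subsection \<open>The rate for a fixed sample size\<close>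

lemma abs_powr_le_power4: "\<bar>y\<bar> powr q \<le> 1 + y ^ 4" if "0 \<le> q" "q \<le> 4" for y q :: real
proof (cases "\<bar>y\<bar> \<le> 1")
  case True
  have "\<bar>y\<bar> powr q \<le> 1 powr q" using True that by (intro powr_mono2) auto
  then show ?thesis by (simp add: add_increasing2)
next
  case False
  have "\<bar>y\<bar> powr q \<le> \<bar>y\<bar> powr 4" using False that by (intro powr_mono) auto
  also have "\<dots> = y ^ 4" using False by (simp add: powr_numeral)
  finally show ?thesis by simp
qed

text \<open>The lower bound on \<open>B\<close> is a separate conclusion, free of conditions on the
  ratio of the sample sizes, because it serves the sizes for which that ratio is not under
  control.\<close>

lemma T_stat_rate:
  fixes P :: "(nat \<Rightarrow> real) measure" and n m p :: nat and k :: kern and \<eta> \<tau> :: real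
  defines "N \<equiv> n + m"
  defines "B \<equiv> Ektilde_powr k P (2 + 2 * \<tau>) / (real N powr \<tau> * V2 k P powr (1 + \<tau>))
      + Eg k P powr ((1 + \<tau>) / 2) / V2 k P powr (1 + \<tau>)"
  assumes n: "2 \<le> n" and m: "2 \<le> m" and \<tau>: "0 < \<tau>" "\<tau> \<le> 1"
    and k: "mmd_kernel p k" and diag: "\<And>x. x \<in> space (euclid p) \<Longrightarrow> k x x = a0"
    and P: "borel_prob p P" and k4: "integrable (P \<Otimes>\<^sub>M P) (\<lambda>(x, y). k x y ^ 4)" and V: "V2 k P \<noteq> 0"
  shows "real N powr (- \<tau>) \<le> B"
    and "0 < \<eta> \<Longrightarrow> \<eta> \<le> 1 \<Longrightarrow> \<eta> * real N \<le> real n \<Longrightarrow> \<eta> * real N \<le> real m \<Longrightarrow>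
      \<bar>measure (sample_law n m P P) {(X, Y) \<in> space (sample_law n m P P). T_stat n m k a0 X Y \<le> x}
        - cdf std_normal_distribution x\<bar> \<le> 1000 * (1 / \<eta>\<^sup>2) ^ 4 * B powr (1 / (3 + 2 * \<tau>))"
proof -
  interpret prob_pair P using P by (simp add: borel_prob_def prob_pair_def)
  have setsP: "sets P = sets (euclid p)" and spP: "space P = space (euclid p)"
    using P sets_eq_imp_space_eq by (auto simp: borel_prob_def)
  have km: "(\<lambda>(x, y). k x y) \<in> borel_measurable ZZ"
    using k setsP by (simp add: mmd_kernel_def cong: measurable_cong_sets sets_pair_measure_cong)
  have ksym: "k x y = k y x" if "x \<in> space P" "y \<in> space P" for x y
    using k that by (simp add: mmd_kernel_def spP)
  have k2: "integrable ZZ (\<lambda>(x, y). (k x y)\<^sup>2)"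
  proof (rule Bochner_Integration.integrable_bound)
    show "integrable ZZ (\<lambda>z. 1 + (case z of (x, y) \<Rightarrow> k x y ^ 4))" using k4 by simp
    show "AE z in ZZ. norm (case z of (x, y) \<Rightarrow> (k x y)\<^sup>2) \<le> norm (1 + (case z of (x, y) \<Rightarrow> k x y ^ 4))"
    proof (rule AE_I2)
      fix z
      have "(k (fst z) (snd z))\<^sup>2 \<le> 1 + k (fst z) (snd z) ^ 4"
        using abs_powr_le_power4[of 2 "k (fst z) (snd z)"] by simp
      then show "norm (case z of (x, y) \<Rightarrow> (k x y)\<^sup>2) \<le> norm (1 + (case z of (x, y) \<Rightarrow> k x y ^ 4))"
        by (simp add: split_beta)
    qed
    have "(\<lambda>z. (case z of (x, y) \<Rightarrow> k x y)\<^sup>2) \<in> borel_measurable ZZ" using km by measurable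
    then show "(\<lambda>(x, y). (k x y)\<^sup>2) \<in> borel_measurable ZZ" by (simp add: split_beta')
  qed
  interpret K: l2_kernel P k by unfold_locales (use km ksym k2 in auto)
  define e where "e = Ek k P"
  \<comment> \<open>\<open>V2\<close> is a squared norm, so being nonzero makes it positive and
    \<open>\<sigma>\<close> a proper scale.\<close>
  define \<sigma> where "\<sigma> = sqrt (V2 k P)"
  have V0: "0 < V2 k P"
  proof -
    have "0 \<le> V2 k P" unfolding K.V2_eq by (auto intro!: integral_nonneg_AE)
    then show ?thesis using V by simp
  qed
  have \<sigma>0: "0 < \<sigma>" and \<sigma>2: "\<sigma>\<^sup>2 = V2 k P" using V0 by (auto simp: \<sigma>_def)
  define f where "f = (\<lambda>x y. (k x y - e) * (1 / \<sigma>))"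
  interpret F: l2_kernel P f unfolding f_def by (rule K.affine(1))
  have norm1: "(\<integral>(x, y). (dk f P x y)\<^sup>2 \<partial>ZZ) = 1"
    unfolding f_def K.affine(2) using V0 by (simp add: power_divide \<sigma>2)
  have Egf: "Eg f P = Eg k P / (V2 k P)\<^sup>2"
    unfolding f_def K.affine(3) by (simp add: power_divide flip: \<sigma>2 power_mult)
  have fpw: "\<bar>f x y\<bar> powr (2 + 2 * \<tau>) = \<bar>k_tilde k P x y\<bar> powr (2 + 2 * \<tau>) / V2 k P powr (1 + \<tau>)" for x y
  proof -
    have "\<sigma> powr (2 + 2 * \<tau>) = V2 k P powr (1 + \<tau>)"
    proof -
      have e: "1 / 2 * (2 + 2 * \<tau>) = 1 + \<tau>" by simp
      have s: "\<sigma> = V2 k P powr (1 / 2)" using V0 by (simp add: \<sigma>_def powr_half_sqrt)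
      show ?thesis unfolding s powr_powr e ..
    qed
    moreover have "\<bar>f x y\<bar> = \<bar>k_tilde k P x y\<bar> / \<sigma>" using \<sigma>0 by (simp add: f_def k_tilde_def e_def abs_mult)
    ultimately show ?thesis using \<sigma>0 by (simp add: powr_divide)
  qed
  have ktq: "integrable ZZ (\<lambda>(x, y). \<bar>k_tilde k P x y\<bar> powr (2 + 2 * \<tau>))"
  proof (rule Bochner_Integration.integrable_bound)
    show "integrable ZZ (\<lambda>z. 1 + 8 * ((case z of (x, y) \<Rightarrow> k x y ^ 4) + e ^ 4))" using k4 by simp
    show "AE z in ZZ. norm (case z of (x, y) \<Rightarrow> \<bar>k_tilde k P x y\<bar> powr (2 + 2 * \<tau>))
        \<le> norm (1 + 8 * ((case z of (x, y) \<Rightarrow> k x y ^ 4) + e ^ 4))"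
    proof (rule AE_I2)
      fix z
      let ?a = "k (fst z) (snd z)"
      have "\<bar>?a - e\<bar> powr (2 + 2 * \<tau>) \<le> 1 + (?a - e) ^ 4" using \<tau> by (intro abs_powr_le_power4) auto
      also have "(?a - e) ^ 4 \<le> 8 * (?a ^ 4 + e ^ 4)"
      proof -
        have "(?a - e)\<^sup>2 \<le> 2 * (?a\<^sup>2 + e\<^sup>2)"
          using zero_le_power2[of "?a + e"] by (simp add: power2_eq_square algebra_simps)
        then have "((?a - e)\<^sup>2)\<^sup>2 \<le> (2 * (?a\<^sup>2 + e\<^sup>2))\<^sup>2" by (rule power_mono) simp
        also have "\<dots> \<le> 8 * (?a ^ 4 + e ^ 4)"
          using zero_le_power2[of "?a\<^sup>2 - e\<^sup>2"] by (simp add: power2_eq_square power4_eq_xxxx algebra_simps)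
        finally show ?thesis by simp
      qed
      finally have "\<bar>?a - e\<bar> powr (2 + 2 * \<tau>) \<le> 1 + 8 * (?a ^ 4 + e ^ 4)" by simp
      then show "norm (case z of (x, y) \<Rightarrow> \<bar>k_tilde k P x y\<bar> powr (2 + 2 * \<tau>))
        \<le> norm (1 + 8 * ((case z of (x, y) \<Rightarrow> k x y ^ 4) + e ^ 4))"
        by (simp add: split_beta k_tilde_def e_def)
    qed
    have "(\<lambda>z. \<bar>(case z of (x, y) \<Rightarrow> k x y) - e\<bar> powr (2 + 2 * \<tau>)) \<in> borel_measurable ZZ" using km by measurable
    then show "(\<lambda>(x, y). \<bar>k_tilde k P x y\<bar> powr (2 + 2 * \<tau>)) \<in> borel_measurable ZZ"
      by (simp add: split_beta' k_tilde_def e_def)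
  qed
  have fq: "integrable ZZ (\<lambda>(x, y). \<bar>f x y\<bar> powr (2 + 2 * \<tau>))"
    using integrable_divide[OF ktq, of "V2 k P powr (1 + \<tau>)"] by (simp add: fpw split_beta')
  have Mf: "(\<integral>(x, y). \<bar>f x y\<bar> powr (2 + 2 * \<tau>) \<partial>ZZ) = Ektilde_powr k P (2 + 2 * \<tau>) / V2 k P powr (1 + \<tau>)"
    unfolding Ektilde_powr_def fpw by (simp add: split_beta')
  have gf: "Eg f P powr ((1 + \<tau>) / 2) = Eg k P powr ((1 + \<tau>) / 2) / V2 k P powr (1 + \<tau>)"
  proof -
    have "((V2 k P)\<^sup>2) powr ((1 + \<tau>) / 2) = (V2 k P powr 2) powr ((1 + \<tau>) / 2)" using V0 by simp
    also have "\<dots> = V2 k P powr (1 + \<tau>)" unfolding powr_powr by (rule arg_cong[where f="(powr) _"]) simp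
    finally show ?thesis unfolding Egf using K.Eg_nonneg V0 by (simp add: powr_divide)
  qed
  have N0: "0 < real N" using n by (simp add: N_def)
  have B: "B = real (card {1..N}) powr (- \<tau>) * (\<integral>(x, y). \<bar>f x y\<bar> powr (2 + 2 * \<tau>) \<partial>ZZ) + Eg f P powr ((1 + \<tau>) / 2)"
    unfolding B_def Mf gf by (simp add: powr_minus field_simps)
  have "real N powr (- \<tau>) * 1 \<le> real N powr (- \<tau>) * (\<integral>(x, y). \<bar>f x y\<bar> powr (2 + 2 * \<tau>) \<partial>ZZ)"
    by (intro mult_left_mono F.moment_ge_1 norm1 fq \<tau>) auto
  then show "real N powr (- \<tau>) \<le> B" unfolding B by (simp add: add_increasing2)

  assume \<eta>: "0 < \<eta>" "\<eta> \<le> 1" "\<eta> * real N \<le> real n" "\<eta> * real N \<le> real m"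
  let ?\<Omega> = "PiM {1..N} (\<lambda>_. P)" and ?w = "\<lambda>s t. raw_weight n m s t / sqrt (c_coef n m)"
  let ?A = "{z \<in> space ?\<Omega>. qform {1..N} ?w f z / sqrt (u_var {1..N} (\<lambda>s t. f (z s) (z t))) \<le> x}"
  have c0: "0 < c_coef n m"
    by (rule less_le_trans[OF _ c_coef_ge[OF n m]]) (use n in simp)
  have rate: "\<bar>measure ?\<Omega> ?A - cdf std_normal_distribution x\<bar> \<le> 1000 * (1 / \<eta>\<^sup>2) ^ 4 * B powr (1 / (3 + 2 * \<tau>))"
  proof (rule F.studentized_rate)
    show "?w i j = ?w j i" "?w i i = 0" for i j
      using raw_weight_props(3)[OF n m, of i j] raw_weight_props(4)[OF n m] by auto
    show "(\<Sum>j\<in>{1..N}. ?w i j) = 0" if "i \<in> {1..N}" for i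
      using raw_weight_props(1)[OF n m, of i] that by (simp add: N_def flip: sum_divide_distrib)
    show "(\<Sum>i\<in>{1..N}. \<Sum>j\<in>{1..N}. (?w i j)\<^sup>2) = 2"
      using raw_weight_props(2)[OF n m] c0 by (simp add: N_def power_divide flip: sum_divide_distrib)
    show "\<bar>?w i j\<bar> \<le> 1 / \<eta>\<^sup>2 / real (card {1..N})" for i j
      using raw_weight_le[OF n m \<eta>(1), of i j] \<eta>(3,4) c0 by (simp add: N_def)
    show "1 \<le> 1 / \<eta>\<^sup>2" using \<eta> by (simp add: power_le_one)
  qed (use n m \<tau> norm1 fq B in \<open>auto simp: N_def\<close>)
  \<comment> \<open>The event is the preimage under \<open>pool\<close> of an event for one i.i.d.
    sample, and \<open>pool\<close> transports the law.\<close>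
  have "measure (sample_law n m P P) {(X, Y) \<in> space (sample_law n m P P). T_stat n m k a0 X Y \<le> x} = measure ?\<Omega> ?A"
  proof -
    interpret S: sample P "{1..N}" by unfold_locales simp
    have fm: "(\<lambda>z. f (z s) (z t)) \<in> borel_measurable ?\<Omega>" if "s \<in> {1..N}" "t \<in> {1..N}" for s t
      using that by (intro F.meas' measurable_component_singleton)
    have mA: "?A \<in> sets ?\<Omega>"
    proof -
      have q: "(\<lambda>z. qform {1..N} ?w f z) \<in> borel_measurable ?\<Omega>" unfolding qform_def
        by (intro borel_measurable_sum borel_measurable_times borel_measurable_const borel_measurable_divide fm)
      have u: "(\<lambda>z. u_var {1..N} (\<lambda>s t. f (z s) (z t))) \<in> borel_measurable ?\<Omega>"
        unfolding u_var_def u_center_def row_sum_def total_sum_def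
        by (intro borel_measurable_sum borel_measurable_times borel_measurable_const borel_measurable_divide
            borel_measurable_add borel_measurable_diff borel_measurable_power fm) auto
      show ?thesis using q u by measurable
    qed
    have sp: "pool n m XY \<in> space ?\<Omega>" if "XY \<in> space (sample_law n m P P)" for XY
      using measurable_space[OF pool_measurable] that by (simp add: sample_law_def N_def)
    have T: "T_stat n m k a0 (fst XY) (snd XY)
        = qform {1..N} ?w f (pool n m XY) / sqrt (u_var {1..N} (\<lambda>s t. f (pool n m XY s) (pool n m XY t)))"
      if XY: "XY \<in> space (sample_law n m P P)" for XY
    proof -
      have pl: "pool n m XY s = pooled n (fst XY) (snd XY) s" if "s \<in> {1..N}" for s
        using that by (simp add: pool_def N_def)
      have sp': "pooled n (fst XY) (snd XY) s \<in> space P" if "s \<in> {1..N}" for s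
        using S.space_\<Omega>[OF sp[OF XY] that] pl[OF that] by simp
      show ?thesis unfolding N_def f_def
        by (rule T_stat_eq[OF n m \<sigma>0]) (use sp' pl ksym diag in \<open>auto simp: N_def spP\<close>)
    qed
    have "{(X, Y) \<in> space (sample_law n m P P). T_stat n m k a0 X Y \<le> x}
        = pool n m -` ?A \<inter> space (sample_law n m P P)"
      using T sp by auto
    then show ?thesis
      using measure_distr[OF pool_measurable[of n m P, folded N_def] mA] distr_pool[of n m]
      by (simp add: sample_law_def N_def)
  qed
  then show "\<bar>measure (sample_law n m P P) {(X, Y) \<in> space (sample_law n m P P). T_stat n m k a0 X Y \<le> x}
        - cdf std_normal_distribution x\<bar> \<le> 1000 * (1 / \<eta>\<^sup>2) ^ 4 * B powr (1 / (3 + 2 * \<tau>))"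
    using rate by simp
qed

text \<open>The ratio of the sample sizes is controlled only in the limit, which explains the two
  constants: \<open>C\<close> is fixed before the sequences and serves all indices from some
  \<open>L\<close> on, while \<open>C'\<close> covers the finitely many earlier indices and may
  depend on the sequences.\<close>

theorem theorem17:
  fixes \<rho> \<tau> :: real
  assumes "0 < \<rho>" "\<rho> < 1" "0 < \<tau>" "\<tau> \<le> 1"
  shows "\<exists>C>0. \<forall>n m :: nat \<Rightarrow> nat.
    filterlim n at_top sequentially \<and> filterlim m at_top sequentially \<and>
    (\<lambda>l. real (n l) / real (n l + m l)) \<longlonglongrightarrow> \<rho> \<longrightarrow>
    (\<exists>L. \<exists>C'>0. \<forall>l p k a0 P Q.
       2 \<le> n l \<and> 2 \<le> m l \<and> 1 \<le> p \<and>
       mmd_kernel p k \<and> (\<forall>x\<in>space (euclid p). k x x = a0) \<and>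
       borel_prob p P \<and> borel_prob p Q \<and>
       integrable (mixture \<rho> P Q \<Otimes>\<^sub>M mixture \<rho> P Q) (\<lambda>(z1, z2). k z1 z2 ^ 4) \<and>
       V2 k (mixture \<rho> P Q) \<noteq> 0 \<and>
       P = Q \<longrightarrow>
       (SUP x. \<bar>measure (sample_law (n l) (m l) P Q)
                   {(X, Y) \<in> space (sample_law (n l) (m l) P Q). T_stat (n l) (m l) k a0 X Y \<le> x}
                 - cdf std_normal_distribution x\<bar>)
       \<le> (if L \<le> l then C else C') *
          (Ektilde_powr k (mixture \<rho> P Q) (2 + 2 * \<tau>)
             / (real (n l + m l) powr \<tau> * V2 k (mixture \<rho> P Q) powr (1 + \<tau>))
           + Eg k (mixture \<rho> P Q) powr ((1 + \<tau>) / 2)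
             / V2 k (mixture \<rho> P Q) powr (1 + \<tau>)) powr (1 / (3 + 2 * \<tau>)))"
proof -
  \<comment> \<open>Half the distance of \<open>\<rho>\<close> from the endpoints leaves room for
    the ratio to be eventually between \<open>\<eta>\<close> and \<open>1 - \<eta>\<close>.\<close>
  define \<eta> where "\<eta> = min \<rho> (1 - \<rho>) / 2"
  have \<eta>: "0 < \<eta>" "\<eta> \<le> 1" "\<eta> < \<rho>" "\<rho> < 1 - \<eta>" using assms by (auto simp: \<eta>_def min_def field_simps)
  show ?thesis
  proof (intro exI[of _ "1000 * (1 / \<eta>\<^sup>2) ^ 4"] conjI allI impI, goal_cases)
    case 1
    show ?case using \<eta> by simp
  next
    case (2 n m)
    let ?N = "\<lambda>l. real (n l + m l)" and ?r = "1 / (3 + 2 * \<tau>)"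
    have "eventually (\<lambda>l. \<eta> < real (n l) / ?N l \<and> real (n l) / ?N l < 1 - \<eta>) sequentially"
      using 2 \<eta> by (intro eventually_conj order_tendstoD[of _ \<rho>]) auto
    then obtain L where L: "\<And>l. L \<le> l \<Longrightarrow> \<eta> < real (n l) / ?N l \<and> real (n l) / ?N l < 1 - \<eta>"
      unfolding eventually_sequentially by blast
    \<comment> \<open>The sum dominates each of the finitely many terms with \<open>l < L\<close>;
      the summand 1 keeps \<open>C'\<close> positive when \<open>L = 0\<close>.\<close>
    define C' where "C' = 1 + (\<Sum>l<L. (?N l powr \<tau>) powr ?r)"
    have C'0: "0 < C'" unfolding C'_def by (intro add_pos_nonneg sum_nonneg) auto
    show ?case
    proof (intro exI[of _ L] exI[of _ C'] conjI allI impI C'0 cSUP_least; (elim conjE)?)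
      fix l p k a0 P Q x
      assume n: "2 \<le> n l" and m: "2 \<le> m l" and k: "mmd_kernel p k" "\<forall>x\<in>space (euclid p). k x x = a0"
        and P: "borel_prob p P" and PQ: "P = Q"
        and k4: "integrable (mixture \<rho> P Q \<Otimes>\<^sub>M mixture \<rho> P Q) (\<lambda>(z1, z2). k z1 z2 ^ 4)"
        and V: "V2 k (mixture \<rho> P Q) \<noteq> 0"
      have mix: "mixture \<rho> P P = P" using P by (simp add: mixture_same borel_prob_def)
      define B where "B = Ektilde_powr k P (2 + 2 * \<tau>) / (?N l powr \<tau> * V2 k P powr (1 + \<tau>))
        + Eg k P powr ((1 + \<tau>) / 2) / V2 k P powr (1 + \<tau>)"
      let ?S = "sample_law (n l) (m l) P P"
      let ?D = "\<bar>measure ?S {(X, Y) \<in> space ?S. T_stat (n l) (m l) k a0 X Y \<le> x} - cdf std_normal_distribution x\<bar>"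
      note R = T_stat_rate[OF n m assms(3,4) k(1) bspec[OF k(2)] P 
        k4[folded PQ, unfolded mix] V[folded PQ, unfolded mix], folded B_def]
      have "?D \<le> (if L \<le> l then 1000 * (1 / \<eta>\<^sup>2) ^ 4 else C') * B powr ?r"
      proof (cases "L \<le> l")
        case True
        have N0: "0 < ?N l" using n by simp
        have "\<eta> * ?N l \<le> real (n l)" "real (n l) \<le> (1 - \<eta>) * ?N l"
          using L[OF True] N0 by (auto simp: field_simps)
        then have "?D \<le> 1000 * (1 / \<eta>\<^sup>2) ^ 4 * B powr ?r"
          using \<eta> by (intro R(2)) (auto simp: algebra_simps)
        then show ?thesis using True by simp
      next
        case False
        have N0: "0 < ?N l" using n by simp
        interpret N: real_distribution std_normal_distribution by (rule real_dist_normal_dist)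
        interpret P: prob_space P using P by (simp add: borel_prob_def)
        interpret S: prob_space ?S
          unfolding sample_law_def by (intro prob_space_pair prob_space_PiM P.prob_space_axioms)
        let ?A = "{(X, Y) \<in> space ?S. T_stat (n l) (m l) k a0 X Y \<le> x}"
        have "?D \<le> 1"
          using N.cdf_bounded_prob[of x] N.cdf_nonneg[of x] S.prob_le_1[of ?A] measure_nonneg[of ?S ?A]
          unfolding abs_le_iff by linarith
        \<comment> \<open>The trivial bound 1 is split so that the second factor is absorbed by
          \<open>N powr (- \<tau>) \<le> B\<close> and the first by \<open>C'\<close>.\<close>
        also have "1 = (?N l powr \<tau>) powr ?r * (?N l powr (- \<tau>)) powr ?r"
          using N0 by (simp add: powr_powr flip: powr_add)
        also have "\<dots> \<le> C' * B powr ?r"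
        proof (intro mult_mono)
          have "(?N l powr \<tau>) powr ?r \<le> (\<Sum>l<L. (?N l powr \<tau>) powr ?r)"
            using False by (intro member_le_sum) auto
          then show "(?N l powr \<tau>) powr ?r \<le> C'" by (simp add: C'_def)
          show "(?N l powr (- \<tau>)) powr ?r \<le> B powr ?r"
            using R(1) assms by (intro powr_mono2) auto
        qed (use C'0 in auto)
        finally show ?thesis using False by simp
      qed
      then show "\<bar>measure (sample_law (n l) (m l) P Q)
                   {(X, Y) \<in> space (sample_law (n l) (m l) P Q). T_stat (n l) (m l) k a0 X Y \<le> x}
                 - cdf std_normal_distribution x\<bar>
       \<le> (if L \<le> l then 1000 * (1 / \<eta>\<^sup>2) ^ 4 else C') *
          (Ektilde_powr k (mixture \<rho> P Q) (2 + 2 * \<tau>)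
             / (real (n l + m l) powr \<tau> * V2 k (mixture \<rho> P Q) powr (1 + \<tau>))
           + Eg k (mixture \<rho> P Q) powr ((1 + \<tau>) / 2)
             / V2 k (mixture \<rho> P Q) powr (1 + \<tau>)) powr (1 / (3 + 2 * \<tau>))"
        unfolding B_def PQ[symmetric] mix .
    qed auto
  qed
qed

end
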